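(* Let $G$ be a non-trivial finite solvable group, $k$ an arbitrary field, and $F/k$ a Galois field extension of group $G$. Then there exist $t_0 \in k$ and a Galois field extension $E/k(T)$ of group $G$ with $E \not\subseteq \overline{k}(T)$ such that the specialization $E_{t_0}/k$ of $E/k(T)$ at $t_0$ equals $F/k$.
   Context: $T$ is an indeterminate; $\overline{k}$ is an algebraic closure of $k$, taken inside an algebraic closure of $k(T)$ containing $E$. Let $E/k(T)$ be a finite Galois field extension, $B$ the integral closure of $k[T]$ in $E$, and $t_0 \in k$. The specialization $E_{t_0}/k$ of $E/k(T)$ at $t_0$ is the extension of $k$ given by the residue field $E_{t_0}=B/\mathfrak{P}$, where $\mathfrak{P}$ is any maximal ideal of $B$ lying over $\langle T-t_0\rangle$. It is a finite normal extension of $k$, independent of the choice of $\mathfrak{P}$ up to $k$-isomorphism; equality of extensions of $k$ is understood accordingly (e.g. inside a fixed algebraic closure of $k$). *)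

theory Defs
  imports "HOL-Algebra.Algebra" "HOL-Algebra.Algebraic_Closure_Type"
begin

text \<open>
  All fields occurring here are subfields of one fixed field \<open>R\<close>, namely an algebraic closure of
  $k(T)$.  For a subfield \<open>K\<close> of \<open>R\<close> and \<open>T\<close> in \<open>R\<close>, the subring $K[T]$ is the library's
  \<open>simple_extension K T\<close>.
\<close>

context field
begin

definition adjoin :: "'a set \<Rightarrow> 'a \<Rightarrow> 'a set"
  where "adjoin K x = generate_field R (insert x K)"

definition alg_closure_in :: "'a set \<Rightarrow> 'a set"
  where "alg_closure_in K = {x \<in> carrier R. (algebraic over K) x}"

definition normal_extension :: "'a set \<Rightarrow> 'a set \<Rightarrow> bool"
  where "normal_extension K E \<longleftrightarrow>
    (\<forall>x\<in>E. (algebraic over K) x) \<and>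
    (\<forall>p\<in>carrier (K[X]). pirreducible K p \<and> (\<exists>x\<in>E. is_root p x) \<longrightarrow>
       ring.splitted (R\<lparr>carrier := E\<rparr>) p)"

text \<open>
  Multiplicities of roots are taken in \<open>R\<close>, so the following is separability only when \<open>R\<close> is
  algebraically closed (or at least \<open>E\<close> is normal over \<open>K\<close>).
\<close>

definition separable_extension :: "'a set \<Rightarrow> 'a set \<Rightarrow> bool"
  where "separable_extension K E \<longleftrightarrow>
    (\<forall>x\<in>E. (algebraic over K) x) \<and>
    (\<forall>p\<in>carrier (K[X]). pirreducible K p \<and> (\<exists>x\<in>E. is_root p x) \<longrightarrow>
       (\<forall>a\<in>carrier R. alg_mult p a \<le> 1))"

definition finite_galois_extension :: "'a set \<Rightarrow> 'a set \<Rightarrow> bool"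
  where "finite_galois_extension K E \<longleftrightarrow>
    subfield K R \<and> subfield E R \<and> K \<subseteq> E \<and> finite_dimension K E \<and>
    normal_extension K E \<and> separable_extension K E"

definition galois_group :: "'a set \<Rightarrow> 'a set \<Rightarrow> ('a \<Rightarrow> 'a) monoid"
  where "galois_group K E = (BijGroup E)
    \<lparr>carrier := {\<sigma> \<in> Bij E. \<sigma> \<in> ring_hom (R\<lparr>carrier := E\<rparr>) (R\<lparr>carrier := E\<rparr>) \<and> (\<forall>x\<in>K. \<sigma> x = x)}\<rparr>"

definition galois_extension_of_group :: "'a set \<Rightarrow> 'a set \<Rightarrow> ('g, 'm) monoid_scheme \<Rightarrow> bool"
  where "galois_extension_of_group K E G \<longleftrightarrow>
    finite_galois_extension K E \<and> galois_group K E \<cong> G"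

definition integral_closure :: "'a set \<Rightarrow> 'a set \<Rightarrow> 'a set"
  where "integral_closure A E =
    {x \<in> E. \<exists>p\<in>carrier (A[X]). p \<noteq> [] \<and> Polynomials.lead_coeff p = \<one> \<and> eval p x = \<zero>}"

text \<open>
  For $B$ the integral closure of $K[T]$ in \<open>E\<close>: \<open>P\<close> is a maximal ideal of $B$ whose intersection
  with $K[T]$ is the ideal of $K[T]$ generated by $T - t_0$.
\<close>

definition maximal_ideal_over :: "'a set \<Rightarrow> 'a \<Rightarrow> 'a set \<Rightarrow> 'a \<Rightarrow> 'a set \<Rightarrow> bool"
  where "maximal_ideal_over K T E t0 P \<longleftrightarrow>
    maximalideal P (R\<lparr>carrier := integral_closure (simple_extension K T) E\<rparr>) \<and>
    P \<inter> simple_extension K T = PIdl\<^bsub>R\<lparr>carrier := simple_extension K T\<rparr>\<^esub> (T \<ominus> t0)"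

definition residue_field :: "'a set \<Rightarrow> 'a \<Rightarrow> 'a set \<Rightarrow> 'a set \<Rightarrow> 'a set ring"
  where "residue_field K T E P = R\<lparr>carrier := integral_closure (simple_extension K T) E\<rparr> Quot P"

text \<open>
  Equality of extensions of \<open>K\<close> is isomorphism over \<open>K\<close>, where \<open>K\<close> maps to the residue field
  by sending $c$ to its coset modulo \<open>P\<close>.  The specialization does not depend on the maximal ideal,
  and the condition is imposed for all of them; that there is one is stated as well, to exclude
  vacuous truth.
\<close>

definition specialization_equals :: "'a set \<Rightarrow> 'a \<Rightarrow> 'a set \<Rightarrow> 'a \<Rightarrow> 'a set \<Rightarrow> bool"
  where "specialization_equals K T E t0 F \<longleftrightarrow>
    (\<exists>P. maximal_ideal_over K T E t0 P) \<and>
    (\<forall>P. maximal_ideal_over K T E t0 P \<longrightarrow>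
      (\<exists>h\<in>ring_iso (residue_field K T E P) (R\<lparr>carrier := F\<rparr>).
        \<forall>c\<in>K. h (P +>\<^bsub>R\<lparr>carrier := integral_closure (simple_extension K T) E\<rparr>\<^esub> c) = c))"

end

text \<open>The whole type \<open>'a\<close> as a field in the sense of HOL-Algebra.\<close>

abbreviation ambient :: "'a::field ring" (\<open>\<Omega>\<close>)
  where "\<Omega> \<equiv> ring_of_type_algebra"

end

theory Submission
  imports Defs "HOL-Computational_Algebra.Computational_Algebra" "Jordan_Normal_Form.Char_Poly" "HOL-Number_Theory.Residues"
begin

text \<open>
  Put $t_0 = 0$ and work with Laurent series in $X$, which plays the role of $T$.  Let $A$ be a
  non-trivial elementary abelian normal $p$-subgroup of $\mathrm{Gal}(F/k)$, which exists by
  solvability.  Let $M = F(\zeta)$, where $\zeta$ is a primitive $p$-th root of unity, or $1$ in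
  characteristic $p$, and let $\tilde A$ be the group of all elements of $\mathrm{Gal}(M/k)$ that
  restrict to elements of $A$ and fix $\zeta$; it is again non-trivial, normal and elementary abelian.

  Given $a \in \tilde A$ and a power series $v$ with $v^p = 1 + cX$, $v(0) = 1$ (or, in
  characteristic $p$, $v^p - v = cX$, $v(0) = 0$), map $z$ to $Q_z(v)$, where $Q_z$ is the polynomial of
  degree less than $p$ taking the value $a^i(z)$ at $\zeta^i$ (respectively at $i$).  This twist by the cyclic
  extension generated by $v$ is additive and does not change the lowest coefficient of $z$.  It is not
  multiplicative, but it maps suitable rings onto rings, since $Q_z Q_{z'}$ and $Q_{zz'}$ agree at the nodes.
  Let $c$ run through the conjugates of an element of $M$ with stabilizer $\tilde A$, twist each time by
  the corresponding conjugate of one fixed $a$, and compose.  The resulting operator commutes with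
  $\mathrm{Gal}(M/k)$, and the image $E$ of $F(X)$ is a field, because its invariants under
  $\mathrm{Gal}(F/k)$ are $k(X)$; hence $E/k(X)$ is Galois with the same group as $F/k$.  The image of a
  constant $z \in F$ is integral over $k[X]$ and has value $z$ at $X = 0$, so the residue field at $0$ is $F$.

  Finally $E$ is not contained in $\overline{k}(X)$: an eigenvector $x$ of $\tilde A$ for a character
  $\chi$ with $\chi(a) = 1$ is mapped to $x \prod_c v_c^{m_c}$ with an exponent equal to $1$ (respectively to
  $x + \sum_c \chi_c v_c$), which is not a rational function.
\<close>

section \<open>Subrings, homomorphisms and polynomials with coefficients in a subset\<close>

text \<open>The model is a split embedding problem. The series v generate an abelian extension of
  M(X), and Gal(M/k) permutes them along with the c. Sending the generator for c to the conjugate of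
  a attached to c defines a map from the semidirect product back to Gal(M/k); the fixed field of its
  kernel is an extension with the old group. At X = 0 the series become constants, the abelian part
  disappears, and F/k is recovered. The twist describes this fixed field without constructing the
  large extension: moving v to the next conjugate changes Q_z exactly as a does. For this the nodes
  must be fixed by a, which is why zeta is adjoined and fixed by the twisting group. The obstacle is
  that the twist is not multiplicative. The error in a product is a multiple of the value of the
  nodal polynomial at v, an invariant monomial in X, so it can be moved inside the twist; inverses
  are then obtained from norms. In characteristic p the weighted sum of the conjugates c may vanish,
  and the result could be rational. Some weighted power sum does not vanish, so the series are taken
  with c^j X in place of cX for a suitable j.\<close>

definition subring_of :: "'a::field set \<Rightarrow> bool"
  where "subring_of S \<longleftrightarrow> 1 \<in> S \<and> (\<forall>x\<in>S. \<forall>y\<in>S. x - y \<in> S \<and> x * y \<in> S)"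

text \<open>Fields are handled as subsets of a \<open>field\<close> type, which gives access to the
  polynomial type and to Laurent series; \<open>Om_subfield_iff\<close> links this to the
  record-based notion of the statement.\<close>

definition subfield_of :: "'a::field set \<Rightarrow> bool"
  where "subfield_of S \<longleftrightarrow> subring_of S \<and> (\<forall>x\<in>S. inverse x \<in> S)"

text \<open>The values outside \<open>S\<close> are free, so one function can be a homomorphism on
  several rings; the target may be another type, as for \<open>fls_const\<close>.\<close>

definition hom_on :: "'a::field set \<Rightarrow> ('a \<Rightarrow> 'b::field) \<Rightarrow> bool"
  where "hom_on S f \<longleftrightarrow> f 1 = 1 \<and> (\<forall>x\<in>S. \<forall>y\<in>S. f (x + y) = f x + f y \<and> f (x * y) = f x * f y)"

definition polys :: "'a::field set \<Rightarrow> 'a poly set"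
  where "polys S = {p. \<forall>i. poly.coeff p i \<in> S}"

lemma subring_of_UNIV [simp]: "subring_of UNIV"
  by (simp add: subring_of_def)

context
  fixes S :: "'a::field set"
  assumes S: "subring_of S"
begin

lemma subring_1: "1 \<in> S" and subring_diff: "x \<in> S \<Longrightarrow> y \<in> S \<Longrightarrow> x - y \<in> S"
  and subring_mult: "x \<in> S \<Longrightarrow> y \<in> S \<Longrightarrow> x * y \<in> S"
  using S by (auto simp: subring_of_def)

lemma subring_0: "0 \<in> S"
  using subring_diff[OF subring_1 subring_1] by simp

lemma subring_uminus: "x \<in> S \<Longrightarrow> - x \<in> S"
  using subring_diff[OF subring_0] by fastforce

lemma subring_add: "x \<in> S \<Longrightarrow> y \<in> S \<Longrightarrow> x + y \<in> S"
  using subring_diff[OF _ subring_uminus, of x y] by simp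

lemma subring_sum: "(\<And>i. i \<in> I \<Longrightarrow> f i \<in> S) \<Longrightarrow> sum f I \<in> S"
  by (induction I rule: infinite_finite_induct) (auto intro: subring_0 subring_add)

lemma subring_prod: "(\<And>i. i \<in> I \<Longrightarrow> f i \<in> S) \<Longrightarrow> prod f I \<in> S"
  by (induction I rule: infinite_finite_induct) (auto intro: subring_1 subring_mult)

lemma subring_power: "x \<in> S \<Longrightarrow> x ^ n \<in> S"
  by (induction n) (auto intro: subring_1 subring_mult)

lemma subring_of_nat: "of_nat n \<in> S"
  by (induction n) (auto intro: subring_0 subring_1 subring_add)

lemmas subring_simps = subring_1 subring_0 subring_diff subring_mult subring_uminus subring_add
  subring_sum subring_prod subring_power subring_of_nat

lemma polys_0: "0 \<in> polys S"
  by (simp add: polys_def subring_simps)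

lemma polys_pCons_iff: "pCons a p \<in> polys S \<longleftrightarrow> a \<in> S \<and> p \<in> polys S"
proof
  assume *: "pCons a p \<in> polys S"
  then have "poly.coeff (pCons a p) 0 \<in> S" "\<And>i. poly.coeff (pCons a p) (Suc i) \<in> S"
    unfolding polys_def by blast+
  then show "a \<in> S \<and> p \<in> polys S" by (simp add: polys_def)
next
  assume *: "a \<in> S \<and> p \<in> polys S"
  then show "pCons a p \<in> polys S"
    by (auto simp: polys_def coeff_pCons split: nat.split)
qed

lemma polys_1: "1 \<in> polys S"
  by (simp add: one_pCons polys_pCons_iff subring_simps polys_0)

lemma polys_add: "p \<in> polys S \<Longrightarrow> q \<in> polys S \<Longrightarrow> p + q \<in> polys S"
  by (simp add: polys_def subring_simps)

lemma polys_diff: "p \<in> polys S \<Longrightarrow> q \<in> polys S \<Longrightarrow> p - q \<in> polys S"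
  by (simp add: polys_def subring_simps)

lemma polys_uminus: "p \<in> polys S \<Longrightarrow> - p \<in> polys S"
  by (simp add: polys_def subring_simps)

lemma polys_smult: "c \<in> S \<Longrightarrow> q \<in> polys S \<Longrightarrow> Polynomial.smult c q \<in> polys S"
  by (simp add: polys_def subring_simps)

lemma polys_monom: "c \<in> S \<Longrightarrow> Polynomial.monom c n \<in> polys S"
  by (auto simp: polys_def subring_simps)

lemma polys_mult: "p \<in> polys S \<Longrightarrow> q \<in> polys S \<Longrightarrow> p * q \<in> polys S"
  by (auto simp: polys_def coeff_mult subring_simps)

lemma polys_sum: "(\<And>i. i \<in> I \<Longrightarrow> f i \<in> polys S) \<Longrightarrow> sum f I \<in> polys S"
  by (induction I rule: infinite_finite_induct) (auto intro: polys_0 polys_add)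

lemma polys_prod: "(\<And>i. i \<in> I \<Longrightarrow> f i \<in> polys S) \<Longrightarrow> prod f I \<in> polys S"
  by (induction I rule: infinite_finite_induct) (auto intro: polys_1 polys_mult)

lemma polys_power: "p \<in> polys S \<Longrightarrow> p ^ n \<in> polys S"
  by (induction n) (auto intro: polys_1 polys_mult)

lemma polys_pcompose: "p \<in> polys S \<Longrightarrow> q \<in> polys S \<Longrightarrow> pcompose p q \<in> polys S"
  by (induction p) (auto simp: pcompose_pCons polys_pCons_iff intro!: polys_add polys_mult polys_0)

lemmas polys_simps = polys_0 polys_1 polys_add polys_diff polys_uminus polys_smult polys_monom
  polys_mult polys_sum polys_prod polys_power polys_pcompose

lemma poly_in: "p \<in> polys S \<Longrightarrow> x \<in> S \<Longrightarrow> poly p x \<in> S"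
  by (induction p) (auto simp: polys_pCons_iff subring_simps)

text \<open>A monic divisor requires no inverses of coefficients. The version over a mere ring is
  the one applied in \<open>twist_mult\<close>, where the coefficient ring is the image of earlier
  twists.\<close>

lemma monic_division:
  assumes f: "f \<in> polys S" "monic f" and p: "p \<in> polys S"
  shows "\<exists>q\<in>polys S. \<exists>r\<in>polys S. p = f * q + r \<and> (r = 0 \<or> degree r < degree f)"
  using p
proof (induction "degree p" arbitrary: p rule: less_induct)
  case less
  show ?case
  proof (cases "p = 0 \<or> degree p < degree f")
    case True
    then show ?thesis using less.prems polys_0 by (intro bexI[of _ 0] bexI[of _ p]) auto
  next
    case False
    define m where "m = Polynomial.monom (lead_coeff p) (degree p - degree f)"
    have m: "m \<in> polys S" using less.prems by (auto simp: m_def polys_def intro: polys_simps subring_0)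
    define p' where "p' = p - f * m"
    have p': "p' \<in> polys S" unfolding p'_def using less.prems f m by (intro polys_diff polys_mult)
    have lc: "lead_coeff p \<noteq> 0" using False by simp
    have m0: "m \<noteq> 0" "degree m = degree p - degree f" using lc by (auto simp: m_def degree_monom_eq)
    have f0: "f \<noteq> 0" using f(2) by auto
    have dm: "degree (f * m) = degree p" using False m0 f0 by (simp add: degree_mult_eq)
    have lm: "lead_coeff (f * m) = lead_coeff p" using f(2) lc m0
      by (simp add: lead_coeff_mult m_def)
    \<comment> \<open>In degree 0 the degree cannot drop; there \<open>f\<close> and
      \<open>p\<close> are constant and the difference vanishes.\<close>
    have sm: "p' = 0 \<or> degree p' < degree p"
    proof (cases "degree p = 0")
      case True
      then have "degree p' = 0" using dm degree_diff_le[of p 0 "f*m"] by (simp add: p'_def)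
      moreover have "poly.coeff p' 0 = 0" using lm dm True by (simp add: p'_def)
      ultimately show ?thesis by (metis leading_coeff_0_iff)
    next
      case False
      have "degree p' \<le> degree p" unfolding p'_def using dm by (simp add: degree_diff_le)
      moreover have "poly.coeff p' (degree p) = 0" using lm dm by (simp add: p'_def)
      ultimately show ?thesis by (metis leading_coeff_0_iff nat_less_le)
    qed
    have "\<exists>q\<in>polys S. \<exists>r\<in>polys S. p' = f * q + r \<and> (r = 0 \<or> degree r < degree f)"
      using sm less.hyps p' polys_0 by (metis add_0 mult_zero_right)
    then obtain q r where "q \<in> polys S" "r \<in> polys S" "p' = f * q + r" "r = 0 \<or> degree r < degree f" by blast
    moreover have "p = f * (q + m) + r" using \<open>p' = f * q + r\<close> by (simp add: p'_def algebra_simps)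
    ultimately show ?thesis using m polys_add by blast
  qed
qed

end

lemma subfield_ring: "subfield_of K \<Longrightarrow> subring_of K"
  by (simp add: subfield_of_def)

lemma subfield_inverse: "subfield_of K \<Longrightarrow> x \<in> K \<Longrightarrow> inverse x \<in> K"
  by (simp add: subfield_of_def)

lemma subfield_divide: "subfield_of K \<Longrightarrow> x \<in> K \<Longrightarrow> y \<in> K \<Longrightarrow> x / y \<in> K"
  by (simp add: divide_inverse subfield_inverse subring_mult subfield_ring)

lemma polys_mono: "S \<subseteq> S' \<Longrightarrow> polys S \<subseteq> polys S'"
  by (auto simp: polys_def)

context
  fixes S :: "'a::field set" and f :: "'a \<Rightarrow> 'b::field"
  assumes S: "subring_of S" and f: "hom_on S f"
begin

lemma hom_1: "f 1 = 1"
  and hom_add: "x \<in> S \<Longrightarrow> y \<in> S \<Longrightarrow> f (x + y) = f x + f y"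
  and hom_mult: "x \<in> S \<Longrightarrow> y \<in> S \<Longrightarrow> f (x * y) = f x * f y"
  using f by (auto simp: hom_on_def)

lemma hom_0: "f 0 = 0"
  using hom_add[OF subring_0[OF S] subring_0[OF S]] by (metis add_0 add_cancel_right_right)

lemma hom_uminus: "x \<in> S \<Longrightarrow> f (- x) = - f x"
  using hom_add[of x "-x"] hom_0 subring_uminus[OF S] by (simp add: eq_neg_iff_add_eq_0 add.commute)

lemma hom_diff: "x \<in> S \<Longrightarrow> y \<in> S \<Longrightarrow> f (x - y) = f x - f y"
  using hom_add[of x "-y"] hom_uminus subring_uminus[OF S] by simp

lemma hom_sum: "(\<And>i. i \<in> I \<Longrightarrow> g i \<in> S) \<Longrightarrow> f (sum g I) = (\<Sum>i\<in>I. f (g i))"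
  by (induction I rule: infinite_finite_induct) (auto simp: hom_0 hom_add subring_sum[OF S])

lemma hom_prod: "(\<And>i. i \<in> I \<Longrightarrow> g i \<in> S) \<Longrightarrow> f (prod g I) = (\<Prod>i\<in>I. f (g i))"
  by (induction I rule: infinite_finite_induct) (auto simp: hom_1 hom_mult subring_prod[OF S])

lemma hom_power: "x \<in> S \<Longrightarrow> f (x ^ n) = f x ^ n"
  by (induction n) (auto simp: hom_1 hom_mult subring_power[OF S])

lemma hom_of_nat: "f (of_nat n) = of_nat n"
  by (induction n) (auto simp: hom_0 hom_1 hom_add subring_of_nat[OF S] subring_1[OF S])

lemma hom_inverse: "x \<in> S \<Longrightarrow> inverse x \<in> S \<Longrightarrow> f (inverse x) = inverse (f x)"
  by (metis hom_0 hom_1 hom_mult inverse_unique inverse_zero right_inverse)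

lemma hom_nonzero: "x \<in> S \<Longrightarrow> inverse x \<in> S \<Longrightarrow> x \<noteq> 0 \<Longrightarrow> f x \<noteq> 0"
  by (metis hom_1 hom_mult mult_zero_left one_neq_zero right_inverse)

lemma hom_divide: "x \<in> S \<Longrightarrow> y \<in> S \<Longrightarrow> inverse y \<in> S \<Longrightarrow> f (x / y) = f x / f y"
  by (simp add: divide_inverse hom_mult hom_inverse)

lemma coeff_hom_poly: "poly.coeff (map_poly f p) i = f (poly.coeff p i)"
  by (simp add: coeff_map_poly hom_0)

lemma hom_poly_add: "p \<in> polys S \<Longrightarrow> q \<in> polys S \<Longrightarrow> map_poly f (p + q) = map_poly f p + map_poly f q"
  by (intro poly_eqI) (simp add: coeff_hom_poly hom_add polys_def)

lemma hom_poly_diff: "p \<in> polys S \<Longrightarrow> q \<in> polys S \<Longrightarrow> map_poly f (p - q) = map_poly f p - map_poly f q"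
  by (intro poly_eqI) (simp add: coeff_hom_poly hom_diff polys_def)

lemma hom_poly_smult: "c \<in> S \<Longrightarrow> q \<in> polys S \<Longrightarrow> map_poly f (Polynomial.smult c q) = Polynomial.smult (f c) (map_poly f q)"
  by (intro poly_eqI) (simp add: coeff_hom_poly hom_mult polys_def)

lemma hom_poly_pCons: "map_poly f (pCons a p) = pCons (f a) (map_poly f p)"
  by (intro poly_eqI) (simp add: coeff_hom_poly coeff_pCons split: nat.split)

lemma hom_poly_0: "map_poly f 0 = 0" and hom_poly_1: "map_poly f 1 = 1"
  by (simp_all add: hom_0 hom_1 one_pCons hom_poly_pCons)

lemma hom_poly_mult: "p \<in> polys S \<Longrightarrow> q \<in> polys S \<Longrightarrow> map_poly f (p * q) = map_poly f p * map_poly f q"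
  by (intro poly_eqI) (simp add: coeff_hom_poly coeff_mult polys_def hom_sum hom_mult subring_mult[OF S])

lemma hom_poly_prod: "(\<And>i. i \<in> I \<Longrightarrow> g i \<in> polys S) \<Longrightarrow> map_poly f (prod g I) = (\<Prod>i\<in>I. map_poly f (g i))"
  by (induction I rule: infinite_finite_induct) (auto simp: hom_poly_1 hom_poly_mult polys_prod[OF S])

lemma hom_poly_sum: "(\<And>i. i \<in> I \<Longrightarrow> g i \<in> polys S) \<Longrightarrow> map_poly f (sum g I) = (\<Sum>i\<in>I. map_poly f (g i))"
  by (induction I rule: infinite_finite_induct) (auto simp: hom_poly_0 hom_poly_add polys_sum[OF S])

lemma poly_hom: "p \<in> polys S \<Longrightarrow> x \<in> S \<Longrightarrow> f (poly p x) = poly (map_poly f p) (f x)"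
  by (induction p)
    (auto simp: hom_poly_pCons polys_pCons_iff[OF S] hom_0 hom_add hom_mult poly_in[OF S] subring_mult[OF S])

lemma hom_poly_pcompose:
  "p \<in> polys S \<Longrightarrow> q \<in> polys S \<Longrightarrow> map_poly f (pcompose p q) = pcompose (map_poly f p) (map_poly f q)"
  by (induction p)
    (auto simp: hom_poly_pCons polys_pCons_iff[OF S] hom_0 pcompose_pCons hom_poly_add hom_poly_mult
      polys_mult[OF S] polys_pcompose[OF S] polys_0[OF S])

lemma map_poly_in: "p \<in> polys S \<Longrightarrow> f ` S \<subseteq> S' \<Longrightarrow> map_poly f p \<in> polys S'"
  by (auto simp: polys_def coeff_hom_poly)

end

lemma hom_on_subset: "hom_on S f \<Longrightarrow> S' \<subseteq> S \<Longrightarrow> hom_on S' f"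
  by (auto simp: hom_on_def)

lemma hom_inj:
  assumes K: "subfield_of K" and f: "hom_on K f"
  shows "inj_on f K"
proof (rule inj_onI)
  fix x y assume *: "x \<in> K" "y \<in> K" "f x = f y"
  note R = subfield_ring[OF K]
  have "f (x - y) = 0" using hom_diff[OF R f] * by simp
  then show "x = y" using hom_nonzero[OF R f, of "x - y"] * subring_diff[OF R] subfield_inverse[OF K] by auto
qed

lemma hom_image_subfield:
  assumes K: "subfield_of K" and f: "hom_on K f"
  shows "subfield_of (f ` K)"
proof -
  note R = subfield_ring[OF K]
  have "1 \<in> f ` K" using hom_1[OF R f] subring_1[OF R] by force
  moreover have "f x - f y \<in> f ` K" "f x * f y \<in> f ` K" if "x \<in> K" "y \<in> K" for x y
    using that by (simp_all add: hom_diff[OF R f, symmetric] hom_mult[OF R f, symmetric] subring_simps[OF R])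
  moreover have "inverse (f x) \<in> f ` K" if "x \<in> K" for x
    using that by (simp add: hom_inverse[OF R f, symmetric] subfield_inverse[OF K])
  ultimately show ?thesis by (auto simp: subfield_of_def subring_of_def)
qed

lemma hom_on_the_inv:
  assumes K: "subfield_of K" and f: "hom_on K f"
  shows "hom_on (f ` K) (the_inv_into K f)"
proof -
  note R = subfield_ring[OF K]
  note inj = hom_inj[OF K f]
  have *: "the_inv_into K f (f x) = x" if "x \<in> K" for x using the_inv_into_f_f[OF inj that] .
  have "the_inv_into K f 1 = 1" using *[OF subring_1[OF R]] hom_1[OF R f] by simp
  moreover have "the_inv_into K f (f x + f y) = x + y" "the_inv_into K f (f x * f y) = x * y"
    if "x \<in> K" "y \<in> K" for x y
    using that *[of "x + y"] *[of "x * y"] by (simp_all add: hom_add[OF R f] hom_mult[OF R f] subring_simps[OF R])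
  ultimately show ?thesis by (auto simp: hom_on_def *)
qed

section \<open>Simple extensions and extension of homomorphisms\<close>

definition alg_over :: "'a::field set \<Rightarrow> 'a \<Rightarrow> bool"
  where "alg_over K x \<longleftrightarrow> (\<exists>p\<in>polys K. p \<noteq> 0 \<and> poly p x = 0)"

definition simple_ext :: "'a::field set \<Rightarrow> 'a \<Rightarrow> 'a set"
  where "simple_ext K x = (\<lambda>p. poly p x) ` polys K"

text \<open>Minimality is encoded as divisibility over \<open>K\<close>, the property that makes the
  extension of homomorphisms well defined.\<close>

definition is_minpoly :: "'a::field set \<Rightarrow> 'a \<Rightarrow> 'a poly \<Rightarrow> bool"
  where "is_minpoly K x f \<longleftrightarrow> f \<in> polys K \<and> monic f \<and> poly f x = 0 \<and>
    (\<forall>p\<in>polys K. poly p x = 0 \<longrightarrow> (\<exists>q\<in>polys K. p = f * q))"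

lemma minpoly_exists:
  assumes K: "subfield_of K" and x: "alg_over K x"
  obtains f where "is_minpoly K x f"
proof -
  note R = subfield_ring[OF K]
  define P where "P p \<longleftrightarrow> p \<in> polys K \<and> p \<noteq> 0 \<and> poly p x = 0" for p
  have "\<exists>p. P p" using x unfolding alg_over_def P_def by blast
  then obtain g where g: "P g" "\<And>p. P p \<Longrightarrow> degree g \<le> degree p"
    using ex_has_least_nat[of P _ degree] by blast
  define f where "f = Polynomial.smult (inverse (lead_coeff g)) g"
  have lg: "lead_coeff g \<noteq> 0" "lead_coeff g \<in> K" using g(1) by (auto simp: P_def polys_def)
  have f: "f \<in> polys K" "monic f" "poly f x = 0" "degree f = degree g"
    using g(1) lg by (auto simp: f_def P_def intro!: polys_smult[OF R] subfield_inverse[OF K])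
  have "\<exists>q\<in>polys K. p = f * q" if p: "p \<in> polys K" "poly p x = 0" for p
  proof -
    obtain q r where q: "q \<in> polys K" "r \<in> polys K" "p = f * q + r" "r = 0 \<or> degree r < degree f"
      using monic_division[OF R f(1,2) p(1)] by blast
    have "poly r x = 0" using q(3) p f(3) by simp
    then have "r = 0" using g(2)[of r] q f(4) unfolding P_def by force
    then show ?thesis using q by auto
  qed
  then show ?thesis using that f unfolding is_minpoly_def by blast
qed

lemma minpoly_degree_le:
  assumes "is_minpoly K x f" "p \<in> polys K" "p \<noteq> 0" "poly p x = 0"
  shows "degree f \<le> degree p"
proof -
  obtain q where "p = f * q" using assms unfolding is_minpoly_def by blast
  then show ?thesis using assms(3) by (auto simp: degree_mult_eq)
qed

lemma simple_ext_subring: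
  assumes R: "subring_of K" shows "subring_of (simple_ext K x)"
  unfolding subring_of_def simple_ext_def
proof safe
  show "1 \<in> (\<lambda>p. poly p x) ` polys K" using polys_1[OF R] by force
  fix p q assume "p \<in> polys K" "q \<in> polys K"
  then show "poly p x - poly q x \<in> (\<lambda>p. poly p x) ` polys K" "poly p x * poly q x \<in> (\<lambda>p. poly p x) ` polys K"
    by (metis image_eqI poly_diff polys_diff[OF R], metis image_eqI poly_mult polys_mult[OF R])
qed

lemma simple_ext_base: "subring_of K \<Longrightarrow> K \<subseteq> simple_ext K x"
  unfolding simple_ext_def
proof
  fix c assume "subring_of K" "c \<in> K"
  then have "[:c:] \<in> polys K" by (simp add: polys_pCons_iff polys_0)
  moreover have "c = poly [:c:] x" by simp
  ultimately show "c \<in> (\<lambda>p. poly p x) ` polys K" by blast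
qed

lemma simple_ext_gen: "subring_of K \<Longrightarrow> x \<in> simple_ext K x"
  unfolding simple_ext_def
  by (rule image_eqI[of _ _ "[:0,1:]"]) (simp_all add: polys_pCons_iff polys_0 subring_simps)

lemma simple_ext_subset: "subring_of L \<Longrightarrow> K \<subseteq> L \<Longrightarrow> x \<in> L \<Longrightarrow> simple_ext K x \<subseteq> L"
  unfolding simple_ext_def using poly_in polys_mono by blast

text \<open>A Euclidean descent at the point \<open>x\<close>: dividing \<open>f\<close> by
  \<open>p\<close> expresses \<open>poly r x\<close> as a multiple of \<open>poly p x\<close>, so an
  inverse for the smaller remainder gives one for \<open>p\<close>. If the remainder vanishes at
  \<open>x\<close> it is 0, and then the cofactor has the degree of \<open>f\<close>, so
  \<open>p\<close> is constant.\<close>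

lemma minpoly_bezout:
  assumes K: "subfield_of K" and f: "is_minpoly K x f"
    and p: "p \<in> polys K" "poly p x \<noteq> 0"
  shows "\<exists>q\<in>polys K. poly p x * poly q x = 1"
proof -
  note R = subfield_ring[OF K]
  have ff: "f \<in> polys K" "monic f" "poly f x = 0" using f by (auto simp: is_minpoly_def)
  have main: "\<exists>q\<in>polys K. poly p x * poly q x = 1" if "p \<in> polys K" "poly p x \<noteq> 0" "degree p < degree f" for p
    using that
  proof (induction "degree p" arbitrary: p rule: less_induct)
    case less
    define c where "c = inverse (lead_coeff p)"
    have p0: "p \<noteq> 0" using less.prems by auto
    have c: "c \<in> K" "c \<noteq> 0" using less.prems(1) p0 unfolding c_def polys_def by (auto intro: subfield_inverse[OF K])
    have cp: "Polynomial.smult c p \<in> polys K" "monic (Polynomial.smult c p)" "degree (Polynomial.smult c p) = degree p"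
      using polys_smult[OF R c(1) less.prems(1)] c p0 by (auto simp: c_def)
    obtain q r where q: "q \<in> polys K" "r \<in> polys K" "f = Polynomial.smult c p * q + r" "r = 0 \<or> degree r < degree p"
      using monic_division[OF R cp(1,2) ff(1)] cp(3) by auto
    show ?case
    proof (cases "poly r x = 0")
      case False
      then have "r \<noteq> 0" by auto
      then obtain s where s: "s \<in> polys K" "poly r x * poly s x = 1"
        using less.hyps[of r] q(2,4) False less.prems(3) by auto
      have "poly r x = - (c * poly p x * poly q x)" using q(3) ff(3)
        by (metis add_eq_0_iff minus_minus poly_add poly_mult poly_smult)
      then have "poly p x * poly (Polynomial.smult (- c) (q * s)) x = 1" using s(2) by (simp add: algebra_simps)
      moreover have "Polynomial.smult (- c) (q * s) \<in> polys K"
        using q s c by (intro polys_simps[OF R] subring_simps[OF R])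
      ultimately show ?thesis by blast
    next
      case True
      then have r0: "r = 0" using minpoly_degree_le[OF f q(2)] q(4) less.prems(3) by force
      have "poly q x = 0" using q(3) r0 ff(3) less.prems(2) c by simp
      moreover have "q \<noteq> 0" using q(3) r0 ff(2) by auto
      ultimately have "degree f \<le> degree q" using minpoly_degree_le[OF f q(1)] by blast
      moreover have "degree f = degree p + degree q" using q(3) r0 \<open>q \<noteq> 0\<close> p0 c by (simp add: degree_mult_eq)
      ultimately have "degree p = 0" by simp
      then obtain a where a: "p = [:a:]" by (metis degree_eq_zeroE)
      then have "a \<in> K" "a \<noteq> 0" using less.prems polys_pCons_iff[OF R] by auto
      then have "[:inverse a:] \<in> polys K" by (simp add: polys_pCons_iff[OF R] polys_0[OF R] subfield_inverse[OF K])
      moreover have "poly p x * poly [:inverse a:] x = 1" using a \<open>a \<noteq> 0\<close> by simp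
      ultimately show ?thesis by blast
    qed
  qed
  obtain q r where q: "q \<in> polys K" "r \<in> polys K" "p = f * q + r" "r = 0 \<or> degree r < degree f"
    using monic_division[OF R ff(1,2) p(1)] by blast
  have "poly r x = poly p x" using q(3) ff(3) by simp
  then show ?thesis using main[of r] q p by auto
qed

lemma simple_ext_subfield:
  assumes K: "subfield_of K" and x: "alg_over K x"
  shows "subfield_of (simple_ext K x)"
proof -
  obtain f where f: "is_minpoly K x f" using minpoly_exists[OF K x] .
  have "inverse (poly p x) \<in> simple_ext K x" if "p \<in> polys K" for p
  proof (cases "poly p x = 0")
    case True
    then show ?thesis using subring_0[OF simple_ext_subring[OF subfield_ring[OF K]]] by simp
  next
    case False
    then show ?thesis using minpoly_bezout[OF K f that] unfolding simple_ext_def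
      by (metis image_eqI inverse_unique)
  qed
  then show ?thesis using simple_ext_subring[OF subfield_ring[OF K]]
    by (auto simp: subfield_of_def simple_ext_def)
qed

text \<open>The field generated by \<open>x\<close> is the quotient of the polynomials by
  \<open>f\<close>: two polynomials with equal value at \<open>x\<close> differ by a multiple of
  \<open>f\<close>, and the image of \<open>f\<close> vanishes at \<open>z\<close>.\<close>

lemma extend_hom:
  assumes K: "subfield_of K" and f: "is_minpoly K x f" and h: "hom_on K h"
    and z: "poly (map_poly h f) z = 0"
  obtains h' where "hom_on (simple_ext K x) h'" "h' x = z" "\<And>c. c \<in> K \<Longrightarrow> h' c = h c"
    "\<And>p. p \<in> polys K \<Longrightarrow> h' (poly p x) = poly (map_poly h p) z"
proof -
  note R = subfield_ring[OF K]
  have ff: "f \<in> polys K" "monic f" "poly f x = 0" using f by (auto simp: is_minpoly_def)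
  have wd: "poly (map_poly h p) z = poly (map_poly h q) z"
    if "p \<in> polys K" "q \<in> polys K" "poly p x = poly q x" for p q
  proof -
    have "p - q \<in> polys K" "poly (p - q) x = 0" using that by (auto intro: polys_simps[OF R])
    then obtain r where r: "r \<in> polys K" "p - q = f * r" using f unfolding is_minpoly_def by blast
    have "map_poly h p - map_poly h q = map_poly h f * map_poly h r"
      using hom_poly_diff[OF R h that(1,2)] hom_poly_mult[OF R h ff(1) r(1)] r(2) by simp
    then show ?thesis using z by (metis eq_iff_diff_eq_0 mult_zero_left poly_diff poly_mult)
  qed
  define h' where "h' y = poly (map_poly h (SOME p. p \<in> polys K \<and> poly p x = y)) z" for y
  have h': "h' (poly p x) = poly (map_poly h p) z" if "p \<in> polys K" for p
  proof -
    have "(SOME q. q \<in> polys K \<and> poly q x = poly p x) \<in> polys K \<and>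
      poly (SOME q. q \<in> polys K \<and> poly q x = poly p x) x = poly p x"
      by (rule someI[of _ p]) (use that in auto)
    then show ?thesis unfolding h'_def using wd[OF _ that] by blast
  qed
  have c: "h' c = h c" if "c \<in> K" for c
  proof -
    have "[:c:] \<in> polys K" using that by (simp add: polys_pCons_iff[OF R] polys_0[OF R])
    from h'[OF this] show ?thesis by (simp add: hom_poly_pCons[OF R h] hom_poly_0[OF R h])
  qed
  have "h' x = z"
  proof -
    have "[:0,1:] \<in> polys K" by (simp add: polys_pCons_iff[OF R] polys_0[OF R] subring_simps[OF R])
    from h'[OF this] show ?thesis by (simp add: hom_poly_pCons[OF R h] hom_poly_0[OF R h] hom_0[OF R h] hom_1[OF R h])
  qed
  moreover have "hom_on (simple_ext K x) h'"
    unfolding hom_on_def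
  proof (intro conjI ballI)
    show "h' 1 = 1" using c[OF subring_1[OF R]] hom_1[OF R h] by simp
    fix u v assume "u \<in> simple_ext K x" "v \<in> simple_ext K x"
    then obtain p q where pq: "p \<in> polys K" "q \<in> polys K" "u = poly p x" "v = poly q x"
      by (auto simp: simple_ext_def)
    show "h' (u + v) = h' u + h' v"
      using h'[OF polys_add[OF R pq(1,2)]] h'[OF pq(1)] h'[OF pq(2)] hom_poly_add[OF R h pq(1,2)] pq by simp
    show "h' (u * v) = h' u * h' v"
      using h'[OF polys_mult[OF R pq(1,2)]] h'[OF pq(1)] h'[OF pq(2)] hom_poly_mult[OF R h pq(1,2)] pq by simp
  qed
  ultimately show ?thesis using that c h' by blast
qed

section \<open>The whole type as a HOL-Algebra field, and its subfields\<close>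

lemma ring_of_type_algebra_sel [simp]:
  "carrier \<Omega> = UNIV" "monoid.mult \<Omega> = (\<lambda>x y. x * y)"
  "one \<Omega> = 1" "ring.zero \<Omega> = 0" "add \<Omega> = (+)"
  by (simp_all add: ring_of_type_algebra_def fun_eq_iff)

lemma Om_field: "field (\<Omega> :: 'a::field ring)"
  by (rule field_from_type_algebra)

interpretation Om: domain "\<Omega> :: 'a::field ring"
  by (rule field.axioms(1)[OF Om_field])

lemma Om_a_inv [simp]: "a_inv (\<Omega> :: 'a::field ring) x = - x"
  by (rule Om.minus_equality) auto

lemma Om_minus [simp]: "a_minus (\<Omega> :: 'a::field ring) x y = x - y"
  by (simp add: a_minus_def)

lemma Om_inv: "(x :: 'a::field) \<noteq> 0 \<Longrightarrow> m_inv \<Omega> x = inverse x"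
  by (rule Om.comm_inv_char) auto

lemma Om_subring_iff: "subring K \<Omega> \<longleftrightarrow> subring_of (K :: 'a::field set)"
proof
  assume "subring K \<Omega>"
  from subringE[OF this] have *: "1 \<in> K" "\<And>x. x \<in> K \<Longrightarrow> - x \<in> K"
    "\<And>x y. x \<in> K \<Longrightarrow> y \<in> K \<Longrightarrow> x * y \<in> K" "\<And>x y. x \<in> K \<Longrightarrow> y \<in> K \<Longrightarrow> x + y \<in> K"
    by simp_all
  have "x - y \<in> K" if "x \<in> K" "y \<in> K" for x y
    using *(4)[OF that(1) *(2)[OF that(2)]] by simp
  with * show "subring_of K" by (auto simp: subring_of_def)
next
  assume "subring_of K"
  then show "subring K \<Omega>"
    by (intro Om.subringI) (auto simp: subring_simps)
qed

lemma Om_subfield_iff: "subfield K \<Omega> \<longleftrightarrow> subfield_of (K :: 'a::field set)"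
proof
  assume *: "subfield K \<Omega>"
  then have K: "subring_of K" using subfieldE(1) Om_subring_iff by blast
  have "inverse x \<in> K" if "x \<in> K" for x
  proof (cases "x = 0")
    case False
    then have "m_inv \<Omega> x \<in> K"
      using Om.subfield_m_inv(1)[OF *, of x] that by auto
    then show ?thesis using Om_inv[OF False] by simp
  qed (use that in simp)
  with K show "subfield_of K" by (auto simp: subfield_of_def)
next
  assume "subfield_of K"
  then show "subfield K \<Omega>"
    by (intro field.subfieldI'[OF Om_field]) (auto simp: subfield_of_def Om_subring_iff Om_inv)
qed

lemma finite_subfield_generator:
  fixes K :: "'a::field set"
  assumes K: "subfield_of K" and fin: "finite K"
  obtains a where "a \<in> K" "\<And>x. x \<in> K \<Longrightarrow> x \<noteq> 0 \<Longrightarrow> \<exists>n. x = a ^ n"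
proof -
  let ?R = "(\<Omega> :: 'a ring)\<lparr>carrier := K\<rparr>"
  interpret F: field ?R
    using Om.subfield_iff(2) K Om_subfield_iff by blast
  obtain a where a: "a \<in> carrier (mult_of ?R)" "carrier (mult_of ?R) = {a [^]\<^bsub>?R\<^esub> i | i::nat. i \<in> UNIV}"
    using F.finite_field_mult_group_has_gen fin by auto
  have pow: "a [^]\<^bsub>?R\<^esub> n = a ^ n" for n :: nat
    by (induction n) (auto simp: mult.commute)
  show ?thesis
    by (rule that[of a]) (use a pow in auto)
qed

section \<open>Finite groups of automorphisms\<close>

lemma finite_polys_bounded_degree:
  assumes "finite K" shows "finite {p \<in> polys K. degree p \<le> n}"
proof (rule finite_surj[of "{xs. set xs \<subseteq> K \<and> length xs \<le> Suc n}" _ Poly])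
  show "finite {xs. set xs \<subseteq> K \<and> length xs \<le> Suc n}" using assms by (rule finite_lists_length_le)
  show "{p \<in> polys K. degree p \<le> n} \<subseteq> Poly ` {xs. set xs \<subseteq> K \<and> length xs \<le> Suc n}"
  proof
    fix p assume p: "p \<in> {p \<in> polys K. degree p \<le> n}"
    have "set (coeffs p) \<subseteq> K"
    proof
      fix c assume "c \<in> set (coeffs p)"
      then have "c \<in> range (poly.coeff p)" by (auto simp: coeffs_def split: if_splits)
      then show "c \<in> K" using p by (auto simp: polys_def)
    qed
    moreover have "length (coeffs p) \<le> Suc n" using p by (cases "p = 0") (auto simp: length_coeffs)
    moreover have "p = Poly (coeffs p)" by simp
    ultimately show "p \<in> Poly ` {xs. set xs \<subseteq> K \<and> length xs \<le> Suc n}" by blast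
  qed
qed

text \<open>If \<open>u\<close> avoids all \<open>W i\<close> except \<open>W i0\<close> and
  \<open>w\<close> lies outside \<open>W i0\<close>, the infinite line of points
  \<open>w + c * u\<close> misses \<open>W i0\<close>; two of its points share another
  \<open>W j\<close>, and their difference puts \<open>u\<close> there.\<close>

lemma subspace_avoidance:
  fixes K :: "'a::field set"
  assumes K: "subring_of K" "infinite K" and I: "finite I" and V0: "V \<noteq> {}"
    and V: "\<And>x y. x \<in> V \<Longrightarrow> y \<in> V \<Longrightarrow> x + y \<in> V" "\<And>c x. c \<in> K \<Longrightarrow> x \<in> V \<Longrightarrow> c * x \<in> V"
    and W: "\<And>i x y. i \<in> I \<Longrightarrow> x \<in> W i \<Longrightarrow> y \<in> W i \<Longrightarrow> x - y \<in> W i"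
      "\<And>i c x. i \<in> I \<Longrightarrow> c \<in> K \<Longrightarrow> x \<in> W i \<Longrightarrow> c * x \<in> W i"
      "\<And>i c x. i \<in> I \<Longrightarrow> c \<in> K \<Longrightarrow> c \<noteq> 0 \<Longrightarrow> c * x \<in> W i \<Longrightarrow> x \<in> W i"
    and cover: "V \<subseteq> (\<Union>i\<in>I. W i)"
  shows "\<exists>i\<in>I. V \<subseteq> W i"
  using I W cover
proof (induction I rule: finite_induct)
  case empty
  then show ?case using V0 by auto
next
  case (insert i0 I)
  show ?case
  proof (cases "V \<subseteq> (\<Union>i\<in>I. W i) \<or> V \<subseteq> W i0")
    case True
    then show ?thesis using insert.IH insert.prems by blast
  next
    case False
    then obtain u w where u: "u \<in> V" "\<And>i. i \<in> I \<Longrightarrow> u \<notin> W i" and w: "w \<in> V" "w \<notin> W i0" by blast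
    have u0: "u \<in> W i0" using u insert.prems(4) by blast
    have mem: "w + c * u \<in> V" if "c \<in> K" for c using V u w that by blast
    have n0: "w + c * u \<notin> W i0" if "c \<in> K" for c
    proof
      assume "w + c * u \<in> W i0"
      then have "w + c * u - c * u \<in> W i0" using insert.prems(1,2) u0 that by blast
      then show False using w by simp
    qed
    have "\<exists>i\<in>I. w + c * u \<in> W i" if "c \<in> K" for c using mem n0 insert.prems(4) that by blast
    then obtain j where j: "\<And>c. c \<in> K \<Longrightarrow> j c \<in> I \<and> w + c * u \<in> W (j c)" by metis
    have "\<not> inj_on j K"
    proof
      assume "inj_on j K"
      moreover have "finite (j ` K)" using j by (intro finite_subset[OF _ insert.hyps(1)]) auto
      ultimately show False using K(2) finite_imageD by blast
    qed
    then obtain c d where cd: "c \<in> K" "d \<in> K" "c \<noteq> d" "j c = j d" by (auto simp: inj_on_def)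
    have "(w + c * u) - (w + d * u) \<in> W (j c)"
      by (rule insert.prems(1)) (use j[OF cd(1)] j[OF cd(2)] cd in auto)
    then have "(c - d) * u \<in> W (j c)" by (simp add: algebra_simps)
    moreover have "c - d \<in> K" "c - d \<noteq> 0" using cd subring_diff[OF K(1)] by auto
    ultimately have "u \<in> W (j c)" using insert.prems(3)[of "j c" "c - d" u] j[OF cd(1)] by blast
    then show ?thesis using u(2) j[OF cd(1)] by blast
  qed
qed

text \<open>\<open>S\<close> is only a ring, because the twisted ring \<open>E\<close> carries the
  action before it is known to be a field.\<close>

locale ring_action = group G for G :: "('i, 'm) monoid_scheme" (structure) +
  fixes S :: "'b::field set" and act :: "'i \<Rightarrow> 'b \<Rightarrow> 'b"
  assumes S: "subring_of S" and fin: "finite (carrier G)"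
    and hom: "g \<in> carrier G \<Longrightarrow> hom_on S (act g)"
    and act_in: "g \<in> carrier G \<Longrightarrow> x \<in> S \<Longrightarrow> act g x \<in> S"
    and act_mult: "g \<in> carrier G \<Longrightarrow> h \<in> carrier G \<Longrightarrow> x \<in> S \<Longrightarrow> act (g \<otimes> h) x = act g (act h x)"
    and act_one: "x \<in> S \<Longrightarrow> act \<one> x = x"
begin

definition fixed :: "'b set"
  where "fixed = {x \<in> S. \<forall>g\<in>carrier G. act g x = x}"

lemma fixedD: "x \<in> fixed \<Longrightarrow> x \<in> S" "x \<in> fixed \<Longrightarrow> g \<in> carrier G \<Longrightarrow> act g x = x"
  by (auto simp: fixed_def)

lemma act_inv: "g \<in> carrier G \<Longrightarrow> x \<in> S \<Longrightarrow> act (inv g) (act g x) = x"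
  by (metis act_mult act_one inv_closed l_inv)

lemma act_inj: "g \<in> carrier G \<Longrightarrow> inj_on (act g) S"
  by (metis act_inv inj_onI)

lemma bij_translate: "g \<in> carrier G \<Longrightarrow> bij_betw (\<lambda>h. g \<otimes> h) (carrier G) (carrier G)"
  by (rule bij_betw_byWitness[where f' = "\<lambda>h. inv g \<otimes> h"]) (auto simp: m_assoc[symmetric])

lemma fixed_subring: "subring_of fixed"
  using hom_1[OF S hom] hom_diff[OF S hom] hom_mult[OF S hom] subring_simps[OF S]
  by (auto simp: subring_of_def fixed_def)

lemma polys_act: "g \<in> carrier G \<Longrightarrow> q \<in> polys S \<Longrightarrow> map_poly (act g) q \<in> polys S"
  using map_poly_in[OF S hom] act_in by blast

lemma norm_poly:
  assumes q: "q \<in> polys S" shows "(\<Prod>g\<in>carrier G. map_poly (act g) q) \<in> polys fixed"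
proof -
  let ?P = "\<Prod>g\<in>carrier G. map_poly (act g) q"
  have P: "?P \<in> polys S" by (rule polys_prod[OF S]) (rule polys_act[OF _ q])
  have "map_poly (act h) ?P = ?P" if h: "h \<in> carrier G" for h
  proof -
    have "map_poly (act h) ?P = (\<Prod>g\<in>carrier G. map_poly (act h) (map_poly (act g) q))"
      by (rule hom_poly_prod[OF S hom[OF h]]) (rule polys_act[OF _ q])
    also have "\<dots> = (\<Prod>g\<in>carrier G. map_poly (act (h \<otimes> g)) q)"
    proof (rule prod.cong[OF refl], rule poly_eqI)
      fix g i assume g: "g \<in> carrier G"
      show "poly.coeff (map_poly (act h) (map_poly (act g) q)) i = poly.coeff (map_poly (act (h \<otimes> g)) q) i"
        using act_mult[OF h g] q h g by (simp add: coeff_hom_poly[OF S hom] polys_def)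
    qed
    also have "\<dots> = ?P" by (rule prod.reindex_bij_betw[OF bij_translate[OF h]])
    finally show ?thesis .
  qed
  then have "act h (poly.coeff ?P i) = poly.coeff ?P i" if "h \<in> carrier G" for h i
    using coeff_hom_poly[OF S hom[OF that], of ?P i] that by simp
  with P show ?thesis by (auto simp: polys_def fixed_def)
qed

definition orbit_poly :: "'b \<Rightarrow> 'b poly"
  where "orbit_poly x = (\<Prod>g\<in>carrier G. [:- act g x, 1:])"

lemma orbit_poly:
  assumes x: "x \<in> S"
  shows "orbit_poly x \<in> polys fixed" "monic (orbit_poly x)" "poly (orbit_poly x) y = (\<Prod>g\<in>carrier G. y - act g x)"
    "degree (orbit_poly x) = card (carrier G)" "poly (orbit_poly x) x = 0"
proof -
  have "map_poly (act g) [:- x, 1:] = [:- act g x, 1:]" if "g \<in> carrier G" for g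
    using hom_uminus[OF S hom[OF that] x] by (simp add: hom_poly_pCons[OF S hom[OF that]] hom_1[OF S hom[OF that]] hom_poly_0[OF S hom[OF that]])
  then have "orbit_poly x = (\<Prod>g\<in>carrier G. map_poly (act g) [:- x, 1:])"
    unfolding orbit_poly_def by (intro prod.cong) auto
  moreover have "[:- x, 1:] \<in> polys S" using x by (auto simp: polys_pCons_iff[OF S] polys_0[OF S] subring_simps[OF S])
  ultimately show "orbit_poly x \<in> polys fixed" using norm_poly by metis
  show "monic (orbit_poly x)" unfolding orbit_poly_def by (rule monic_prod) auto
  show *: "poly (orbit_poly x) y = (\<Prod>g\<in>carrier G. y - act g x)" for y by (simp add: orbit_poly_def poly_prod)
  show "degree (orbit_poly x) = card (carrier G)" unfolding orbit_poly_def by (simp add: degree_prod_eq_sum_degree)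
  show "poly (orbit_poly x) x = 0" unfolding * using act_one[OF x] fin by (intro prod_zero) (auto intro!: bexI[of _ \<one>])
qed

lemma prod_fixed: "x \<in> S \<Longrightarrow> (\<Prod>g\<in>carrier G. act g x) \<in> fixed"
proof -
  assume x: "x \<in> S"
  have "act h (\<Prod>g\<in>carrier G. act g x) = (\<Prod>g\<in>carrier G. act g x)" if h: "h \<in> carrier G" for h
  proof -
    have "act h (\<Prod>g\<in>carrier G. act g x) = (\<Prod>g\<in>carrier G. act h (act g x))"
      by (rule hom_prod[OF S hom[OF h]]) (use x act_in in auto)
    also have "\<dots> = (\<Prod>g\<in>carrier G. act (h \<otimes> g) x)" by (intro prod.cong) (auto simp: act_mult h x)
    also have "\<dots> = (\<Prod>g\<in>carrier G. act g x)" by (rule prod.reindex_bij_betw[OF bij_translate[OF h]])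
    finally show ?thesis .
  qed
  then show "(\<Prod>g\<in>carrier G. act g x) \<in> fixed" using x by (auto simp: fixed_def intro!: subring_prod[OF S] act_in)
qed

text \<open>The inverse of \<open>x\<close> is the product of its other conjugates divided by its norm.\<close>

lemma subfield_if_fixed_subfield:
  assumes F: "subfield_of fixed" shows "subfield_of S"
proof -
  have "inverse x \<in> S" if x: "x \<in> S" "x \<noteq> 0" for x
  proof -
    let ?N = "\<Prod>g\<in>carrier G. act g x" and ?M = "\<Prod>g\<in>carrier G - {\<one>}. act g x"
    have "?N = act \<one> x * ?M" using fin by (intro prod.remove) auto
    then have N: "?N = x * ?M" using act_one x by simp
    have "act g x \<noteq> 0" if "g \<in> carrier G" for g
      using act_inv[OF that x(1)] hom_0[OF S hom[OF inv_closed[OF that]]] x by auto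
    then have "?N \<noteq> 0" using fin by simp
    then have "inverse x = ?M * inverse ?N" using N x by (simp add: field_simps)
    moreover have "?M \<in> S" by (rule subring_prod[OF S]) (use act_in x in auto)
    moreover have "inverse ?N \<in> S" using subfield_inverse[OF F prod_fixed[OF x(1)]] fixedD by blast
    ultimately show ?thesis using subring_mult[OF S] by simp
  qed
  then show ?thesis using S subring_0[OF S] by (metis inverse_zero subfield_of_def)
qed

lemma fixed_subfield:
  assumes "subfield_of S" shows "subfield_of fixed"
  using fixed_subring hom_inverse[OF S hom] subfield_inverse[OF assms]
  by (auto simp: subfield_of_def fixed_def)

section \<open>Lagrange interpolation at the conjugates of an element\<close>

definition lagrange :: "'b \<Rightarrow> 'i \<Rightarrow> 'b poly"
  where "lagrange \<theta> g = (\<Prod>h\<in>carrier G - {g}. Polynomial.smult (inverse (act g \<theta> - act h \<theta>)) [:- act h \<theta>, 1:])"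

context
  fixes \<theta> :: 'b
  assumes sf: "subfield_of S" and \<theta>: "\<theta> \<in> S" "inj_on (\<lambda>g. act g \<theta>) (carrier G)"
begin

lemma lagrange_in: "g \<in> carrier G \<Longrightarrow> lagrange \<theta> g \<in> polys S"
  unfolding lagrange_def
  by (intro polys_prod[OF S] polys_smult[OF S] subfield_inverse[OF sf])
     (auto simp: polys_pCons_iff[OF S] polys_0[OF S] subring_simps[OF S] act_in \<theta>)

lemma lagrange_degree:
  assumes "g \<in> carrier G" shows "degree (lagrange \<theta> g) < card (carrier G)"
proof -
  have "degree (lagrange \<theta> g) \<le> (\<Sum>h\<in>carrier G - {g}. degree (Polynomial.smult (inverse (act g \<theta> - act h \<theta>)) [:- act h \<theta>, 1:]))"
    unfolding lagrange_def by (rule degree_prod_sum_le[unfolded comp_def]) (use fin in auto)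
  also have "\<dots> \<le> (\<Sum>h\<in>carrier G - {g}. 1)" by (rule sum_mono) simp
  also have "\<dots> < card (carrier G)"
  proof -
    have "card (carrier G) > 0" using fin one_closed card_gt_0_iff by blast
    then show ?thesis using assms fin by simp
  qed
  finally show ?thesis .
qed

lemma lagrange_eval:
  assumes "g \<in> carrier G" "h \<in> carrier G"
  shows "poly (lagrange \<theta> g) (act h \<theta>) = (if g = h then 1 else 0)"
proof (cases "g = h")
  case True
  have "poly (Polynomial.smult (inverse (act h \<theta> - act k \<theta>)) [:- act k \<theta>, 1:]) (act h \<theta>) = 1"
    if "k \<in> carrier G - {h}" for k
  proof -
    have "act h \<theta> - act k \<theta> \<noteq> 0" using \<theta>(2) assms that by (auto simp: inj_on_def)
    moreover have "poly (Polynomial.smult (inverse (act h \<theta> - act k \<theta>)) [:- act k \<theta>, 1:]) (act h \<theta>) =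
      inverse (act h \<theta> - act k \<theta>) * (act h \<theta> - act k \<theta>)" by (simp add: algebra_simps)
    ultimately show ?thesis by (metis left_inverse)
  qed
  then show ?thesis using True unfolding lagrange_def poly_prod by (simp add: prod.neutral)
next
  case False
  then show ?thesis using assms fin unfolding lagrange_def poly_prod by (auto intro!: prod_zero bexI[of _ h])
qed

lemma lagrange_act:
  assumes k: "k \<in> carrier G" and g: "g \<in> carrier G"
  shows "map_poly (act k) (lagrange \<theta> g) = lagrange \<theta> (k \<otimes> g)"
proof -
  note hk = hom[OF k]
  have "map_poly (act k) (lagrange \<theta> g) =
    (\<Prod>h\<in>carrier G - {g}. map_poly (act k) (Polynomial.smult (inverse (act g \<theta> - act h \<theta>)) [:- act h \<theta>, 1:]))"
    unfolding lagrange_def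
    by (rule hom_poly_prod[OF S hk], intro polys_smult[OF S] subfield_inverse[OF sf])
       (auto simp: polys_pCons_iff[OF S] polys_0[OF S] subring_simps[OF S] act_in \<theta> g)
  also have "\<dots> = (\<Prod>h\<in>carrier G - {g}. Polynomial.smult (inverse (act (k \<otimes> g) \<theta> - act (k \<otimes> h) \<theta>)) [:- act (k \<otimes> h) \<theta>, 1:])"
  proof (rule prod.cong[OF refl])
    fix h assume h: "h \<in> carrier G - {g}"
    have "act g \<theta> - act h \<theta> \<in> S" using h g \<theta> by (auto intro: subring_diff[OF S] act_in)
    then show "map_poly (act k) (Polynomial.smult (inverse (act g \<theta> - act h \<theta>)) [:- act h \<theta>, 1:]) =
      Polynomial.smult (inverse (act (k \<otimes> g) \<theta> - act (k \<otimes> h) \<theta>)) [:- act (k \<otimes> h) \<theta>, 1:]"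
      using h g k \<theta> by (subst hom_poly_smult[OF S hk])
        (auto simp: polys_pCons_iff[OF S] polys_0[OF S] subring_simps[OF S] act_in subfield_inverse[OF sf]
          hom_inverse[OF S hk] hom_poly_pCons[OF S hk] hom_0[OF S hk] hom_1[OF S hk] hom_uminus[OF S hk] hom_diff[OF S hk] act_mult)
  qed
  also have "\<dots> = lagrange \<theta> (k \<otimes> g)"
    unfolding lagrange_def
  proof (rule prod.reindex_bij_betw[where h = "\<lambda>h. k \<otimes> h"])
    show "bij_betw (\<lambda>h. k \<otimes> h) (carrier G - {g}) (carrier G - {k \<otimes> g})"
      using k g by (intro bij_betw_byWitness[where f' = "\<lambda>h. inv k \<otimes> h"]) (auto simp: m_assoc[symmetric])
  qed
  finally show ?thesis .
qed

text \<open>The polynomial interpolating \<open>act g x\<close> at \<open>act g \<theta>\<close> has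
  invariant coefficients, since the group permutes nodes and values in the same way; its value at
  \<open>\<theta>\<close> is \<open>x\<close>.\<close>

lemma primitive_span:
  assumes x: "x \<in> S" shows "\<exists>p\<in>polys fixed. poly p \<theta> = x"
proof -
  define p where "p = (\<Sum>g\<in>carrier G. Polynomial.smult (act g x) (lagrange \<theta> g))"
  have pS: "p \<in> polys S" unfolding p_def by (intro polys_sum[OF S] polys_smult[OF S] act_in x lagrange_in)
  have "map_poly (act k) p = p" if k: "k \<in> carrier G" for k
  proof -
    have "map_poly (act k) p = (\<Sum>g\<in>carrier G. map_poly (act k) (Polynomial.smult (act g x) (lagrange \<theta> g)))"
      unfolding p_def by (rule hom_poly_sum[OF S hom[OF k]]) (intro polys_smult[OF S] act_in x lagrange_in)
    also have "\<dots> = (\<Sum>g\<in>carrier G. Polynomial.smult (act (k \<otimes> g) x) (lagrange \<theta> (k \<otimes> g)))"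
      by (rule sum.cong[OF refl]) (simp add: hom_poly_smult[OF S hom[OF k]] act_in x lagrange_in lagrange_act k act_mult)
    also have "\<dots> = p" unfolding p_def by (rule sum.reindex_bij_betw[OF bij_translate[OF k]])
    finally show ?thesis .
  qed
  then have "p \<in> polys fixed" using pS unfolding polys_def fixed_def
    by (auto simp: coeff_hom_poly[OF S hom, symmetric])
  moreover have "poly p \<theta> = x"
  proof -
    have "poly p (act \<one> \<theta>) = (\<Sum>g\<in>carrier G. act g x * (if g = \<one> then 1 else 0))"
      unfolding p_def poly_sum by (rule sum.cong[OF refl]) (simp add: lagrange_eval)
    also have "\<dots> = (\<Sum>g\<in>carrier G. if g = \<one> then act g x else 0)" by (intro sum.cong) auto
    also have "\<dots> = x" using fin act_one x by simp
    finally show ?thesis using act_one \<theta> by simp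
  qed
  ultimately show ?thesis by blast
qed

text \<open>The Lagrange basis sums to 1, and its values at 0 are conjugate to each other by
  \<open>lagrange_act\<close>, so the one belonging to the identity has trace 1.\<close>

lemma trace_one: "\<exists>t\<in>S. (\<Sum>g\<in>carrier G. act g t) = 1"
proof -
  let ?p = "\<Sum>g\<in>carrier G. lagrange \<theta> g"
  have "?p - 1 = 0"
  proof (rule ccontr)
    assume nz: "?p - 1 \<noteq> 0"
    have c: "card (carrier G) > 0" using fin one_closed card_gt_0_iff by blast
    have "degree ?p < card (carrier G)"
      by (rule degree_sum_less) (use lagrange_degree c in auto)
    then have d: "degree (?p - 1) < card (carrier G)"
    proof -
      have "degree (?p - 1) \<le> card (carrier G) - 1"
        using \<open>degree ?p < card (carrier G)\<close> by (intro degree_diff_le) auto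
      then show ?thesis using c by linarith
    qed
    have "(\<lambda>g. act g \<theta>) ` carrier G \<subseteq> {y. poly (?p - 1) y = 0}"
    proof
      fix y assume "y \<in> (\<lambda>g. act g \<theta>) ` carrier G"
      then obtain h where h: "h \<in> carrier G" "y = act h \<theta>" by auto
      have "poly ?p y = (\<Sum>g\<in>carrier G. if g = h then 1 else 0)"
        unfolding poly_sum h(2) by (rule sum.cong[OF refl]) (simp add: lagrange_eval h)
      then show "y \<in> {y. poly (?p - 1) y = 0}" using fin h by simp
    qed
    then have "card (carrier G) \<le> card {y. poly (?p - 1) y = 0}"
      by (metis \<theta>(2) card_image card_mono nz poly_roots_finite)
    also have "\<dots> \<le> degree (?p - 1)" by (rule poly_roots_degree[OF nz])
    finally show False using d by simp
  qed
  then have "1 = poly ?p 0" by simp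
  also have "\<dots> = (\<Sum>g\<in>carrier G. act g (poly (lagrange \<theta> \<one>) 0))"
    unfolding poly_sum
  proof (rule sum.cong[OF refl])
    fix g assume g: "g \<in> carrier G"
    have "act g (poly (lagrange \<theta> \<one>) 0) = poly (map_poly (act g) (lagrange \<theta> \<one>)) (act g 0)"
      by (rule poly_hom[OF S hom[OF g]]) (auto intro: lagrange_in subring_0[OF S])
    also have "\<dots> = poly (lagrange \<theta> g) 0" using lagrange_act[OF g, of \<one>] g hom_0[OF S hom[OF g]] by simp
    finally show "poly (lagrange \<theta> g) 0 = act g (poly (lagrange \<theta> \<one>) 0)" ..
  qed
  finally show ?thesis using poly_in[OF S lagrange_in subring_0[OF S], of \<one>] by (metis one_closed)
qed

end

text \<open>Primitivity is phrased through stabilizers, so that it yields both elements with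
  distinct conjugates (\<open>V = S\<close>) and elements whose stabilizer is a given subgroup
  (\<open>V\<close> its fixed field).\<close>

lemma primitive_element:
  assumes sf: "subfield_of S" and V: "subfield_of V" "V \<subseteq> S" "fixed \<subseteq> V"
  shows "\<exists>\<theta>\<in>V. \<forall>g\<in>carrier G. act g \<theta> = \<theta> \<longrightarrow> (\<forall>x\<in>V. act g x = x)"
proof (cases "finite fixed")
  case True
  \<comment> \<open>Over a finite fixed field there are finitely many candidates for
    \<open>orbit_poly\<close>, so \<open>S\<close> is finite and a generator of the multiplicative
    group of \<open>V\<close> is primitive.\<close>
  have "S \<subseteq> (\<Union>p\<in>{p \<in> polys fixed. degree p \<le> card (carrier G)} - {0}. {y. poly p y = 0})"
  proof
    fix x assume "x \<in> S"
    note * = orbit_poly[OF this]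
    have "orbit_poly x \<noteq> 0" using *(2) by auto
    with * show "x \<in> (\<Union>p\<in>{p \<in> polys fixed. degree p \<le> card (carrier G)} - {0}. {y. poly p y = 0})"
      by (intro UN_I[of "orbit_poly x"]) auto
  qed
  moreover have "finite (\<Union>p\<in>{p \<in> polys fixed. degree p \<le> card (carrier G)} - {0}. {y. poly p y = 0})"
    using finite_polys_bounded_degree[OF True] by (intro finite_UN_I) (auto simp: poly_roots_finite)
  ultimately have "finite S" by (rule finite_subset)
  then have "finite V" by (rule finite_subset[OF V(2)])
  then obtain a where a: "a \<in> V" "\<And>x. x \<in> V \<Longrightarrow> x \<noteq> 0 \<Longrightarrow> \<exists>n. x = a ^ n"
    using finite_subfield_generator[OF V(1)] by blast
  have "act g x = x" if g: "g \<in> carrier G" "act g a = a" and x: "x \<in> V" for g x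
  proof (cases "x = 0")
    case False
    then obtain n where "x = a ^ n" using a x by blast
    then show ?thesis using hom_power[OF S hom[OF g(1)], of a n] g a V by auto
  qed (use hom_0[OF S hom[OF g(1)]] in simp)
  then show ?thesis using a by blast
next
  case False
  note RV = subfield_ring[OF V(1)]
  define I where "I = {g \<in> carrier G. \<not> (\<forall>x\<in>V. act g x = x)}"
  define W where "W g = {x \<in> V. act g x = x}" for g
  show ?thesis
  proof (rule ccontr)
    assume "\<not> ?thesis"
    \<comment> \<open>If no element is primitive, \<open>V\<close> is covered by the fixed spaces of
      those \<open>g\<close> that move something in \<open>V\<close>.\<close>
    then have cover: "V \<subseteq> (\<Union>g\<in>I. W g)" unfolding I_def W_def by blast
    have "\<exists>g\<in>I. V \<subseteq> W g"
    proof (rule subspace_avoidance[OF fixed_subring False _ _ _ _ _ _ _ cover])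
      show "finite I" using fin by (simp add: I_def)
      show "V \<noteq> {}" using subring_1[OF RV] by auto
      show "\<And>x y. x \<in> V \<Longrightarrow> y \<in> V \<Longrightarrow> x + y \<in> V" by (rule subring_add[OF RV])
      show "\<And>c x. c \<in> fixed \<Longrightarrow> x \<in> V \<Longrightarrow> c * x \<in> V" using V(3) subring_mult[OF RV] by blast
      fix g assume "g \<in> I"
      then have g: "g \<in> carrier G" by (simp add: I_def)
      note h = hom[OF g]
      show "x - y \<in> W g" if "x \<in> W g" "y \<in> W g" for x y
      proof -
        have "x \<in> S" "y \<in> S" using that V(2) by (auto simp: W_def)
        then show ?thesis using that subring_diff[OF RV] hom_diff[OF S h] unfolding W_def by simp
      qed
      show *: "c * x \<in> W g" if "c \<in> fixed" "x \<in> W g" for c x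
      proof -
        have "c \<in> S" "c \<in> V" "x \<in> S" "x \<in> V" "act g c = c" "act g x = x"
          using that V fixedD(1) fixedD(2)[OF _ g] unfolding W_def by auto
        then show ?thesis using subring_mult[OF RV] hom_mult[OF S h] unfolding W_def by simp
      qed
      show "x \<in> W g" if "c \<in> fixed" "c \<noteq> 0" "c * x \<in> W g" for c x
        using *[of "inverse c" "c * x"] that subfield_inverse[OF fixed_subfield[OF sf]]
        by (simp add: mult.assoc[symmetric])
    qed
    then show False unfolding I_def W_def by blast
  qed
qed

lemma primitive_inj:
  assumes "\<theta> \<in> S" "\<And>g. g \<in> carrier G \<Longrightarrow> act g \<theta> = \<theta> \<Longrightarrow> g = \<one>"
  shows "inj_on (\<lambda>g. act g \<theta>) (carrier G)"
proof (rule inj_onI)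
  fix g h assume *: "g \<in> carrier G" "h \<in> carrier G" "act g \<theta> = act h \<theta>"
  have "act (inv h \<otimes> g) \<theta> = \<theta>" using * act_mult act_inv assms(1) by simp
  then have "inv h \<otimes> g = \<one>" using assms(2) * by simp
  then show "g = h" using * by (metis inv_equality inv_inv inv_closed)
qed

end

section \<open>Integral elements\<close>

definition integral_over :: "'a::field set \<Rightarrow> 'a \<Rightarrow> bool"
  where "integral_over A x \<longleftrightarrow> (\<exists>p\<in>polys A. monic p \<and> poly p x = 0)"

definition span_over :: "'a::field set \<Rightarrow> 'a set \<Rightarrow> 'a set"
  where "span_over A T = {\<Sum>t\<in>T. c t * t | c. \<forall>t\<in>T. c t \<in> A}"

lemma char_poly_in_polys:
  assumes R: "subring_of A" and M: "M \<in> carrier_mat n n" "\<And>i j. i < n \<Longrightarrow> j < n \<Longrightarrow> M $$ (i, j) \<in> A"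
  shows "char_poly M \<in> polys A"
proof -
  have C: "char_poly_matrix M \<in> carrier_mat n n" using M by simp
  have e: "char_poly_matrix M $$ (i, j) \<in> polys A" if "i < n" "j < n" for i j
    using that M by (auto simp: char_poly_matrix_def polys_pCons_iff[OF R] polys_0[OF R] polys_1[OF R] subring_simps[OF R])
  have "signof p * (\<Prod>i = 0..<n. char_poly_matrix M $$ (i, p i)) \<in> polys A" if "p permutes {0..<n}" for p
  proof -
    have "(\<Prod>i = 0..<n. char_poly_matrix M $$ (i, p i)) \<in> polys A"
      by (rule polys_prod[OF R], rule e) (use that permutes_in_image in fastforce)+
    then show ?thesis by (cases p rule: sign_cases) (auto intro: polys_uminus[OF R])
  qed
  then show ?thesis unfolding char_poly_def det_def'[OF C] by (intro polys_sum[OF R]) simp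
qed

text \<open>The determinant trick: listing \<open>T\<close> as a vector makes \<open>z\<close> an
  eigenvalue of its multiplication matrix over \<open>A\<close>, hence a root of the characteristic
  polynomial. The element \<open>t0\<close> keeps the eigenvector from being zero.\<close>

lemma integral_if_finite_module:
  assumes R: "subring_of A" and T: "finite T" "t0 \<in> T" "t0 \<noteq> 0"
    and z: "\<And>t. t \<in> T \<Longrightarrow> z * t \<in> span_over A T"
  shows "integral_over A z"
proof -
  define n where "n = card T"
  obtain s where s: "bij_betw s {0..<n} T" using T(1) ex_bij_betw_nat_finite n_def by blast
  have "\<exists>c. (\<forall>u\<in>T. c u \<in> A) \<and> z * t = (\<Sum>u\<in>T. c u * u)" if "t \<in> T" for t
    using z[OF that] unfolding span_over_def by blast
  then obtain c where c: "\<And>t. t \<in> T \<Longrightarrow> (\<forall>u\<in>T. c t u \<in> A) \<and> z * t = (\<Sum>u\<in>T. c t u * u)" by metis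
  define M where "M = mat n n (\<lambda>(i, j). c (s i) (s j))"
  have M: "M \<in> carrier_mat n n" by (simp add: M_def)
  have sT: "s i \<in> T" if "i < n" for i using s that by (auto simp: bij_betw_def)
  have "eigenvector M (vec n s) z"
    unfolding eigenvector_def
  proof (intro conjI)
    show "vec n s \<in> carrier_vec (dim_row M)" by (simp add: M_def)
    obtain i where "i < n" "s i = t0" using s T(2) by (auto simp: bij_betw_def)
    then have "vec n s $ i \<noteq> 0\<^sub>v n $ i" using T(3) by simp
    then show "vec n s \<noteq> 0\<^sub>v (dim_row M)" by (auto simp: M_def)
    show "M *\<^sub>v vec n s = z \<cdot>\<^sub>v vec n s"
    proof (rule eq_vecI)
      fix i assume "i < dim_vec (z \<cdot>\<^sub>v vec n s)"
      then have i: "i < n" by simp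
      have "(M *\<^sub>v vec n s) $ i = (\<Sum>j = 0..<n. c (s i) (s j) * s j)"
        using i by (simp add: M_def scalar_prod_def)
      also have "\<dots> = (\<Sum>u\<in>T. c (s i) u * u)" by (rule sum.reindex_bij_betw[OF s])
      also have "\<dots> = z * s i" using c[OF sT[OF i]] by simp
      finally show "(M *\<^sub>v vec n s) $ i = (z \<cdot>\<^sub>v vec n s) $ i" using i by simp
    qed (simp add: M_def)
  qed
  then have "poly (char_poly M) z = 0" using eigenvalue_root_char_poly[OF M] by (auto simp: eigenvalue_def)
  moreover have "char_poly M \<in> polys A"
    by (rule char_poly_in_polys[OF R M]) (use c sT in \<open>simp add: M_def\<close>)
  moreover have "monic (char_poly M)" using degree_monic_char_poly[OF M] by simp
  ultimately show ?thesis unfolding integral_over_def by blast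
qed

lemma span_over_add: "subring_of A \<Longrightarrow> x \<in> span_over A T \<Longrightarrow> y \<in> span_over A T \<Longrightarrow> x + y \<in> span_over A T"
proof -
  assume R: "subring_of A" and "x \<in> span_over A T" "y \<in> span_over A T"
  then obtain c d where "\<forall>t\<in>T. c t \<in> A" "\<forall>t\<in>T. d t \<in> A" "x = (\<Sum>t\<in>T. c t * t)" "y = (\<Sum>t\<in>T. d t * t)"
    unfolding span_over_def by blast
  then show ?thesis unfolding span_over_def
    by (intro CollectI exI[of _ "\<lambda>t. c t + d t"]) (auto simp: sum.distrib algebra_simps subring_add[OF R])
qed

lemma span_over_smult: "subring_of A \<Longrightarrow> a \<in> A \<Longrightarrow> x \<in> span_over A T \<Longrightarrow> a * x \<in> span_over A T"
proof -
  assume R: "subring_of A" and a: "a \<in> A" and "x \<in> span_over A T"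
  then obtain c where "\<forall>t\<in>T. c t \<in> A" "x = (\<Sum>t\<in>T. c t * t)" unfolding span_over_def by blast
  then show ?thesis unfolding span_over_def using a
    by (intro CollectI exI[of _ "\<lambda>t. a * c t"]) (auto simp: sum_distrib_left algebra_simps subring_mult[OF R])
qed

lemma span_over_0: "subring_of A \<Longrightarrow> 0 \<in> span_over A T"
  unfolding span_over_def by (intro CollectI exI[of _ "\<lambda>_. 0"]) (auto simp: subring_0)

lemma span_over_sum: "subring_of A \<Longrightarrow> (\<And>i. i \<in> I \<Longrightarrow> f i \<in> span_over A T) \<Longrightarrow> sum f I \<in> span_over A T"
  by (induction I rule: infinite_finite_induct) (auto intro: span_over_0 span_over_add)

lemma span_over_base: "subring_of A \<Longrightarrow> finite T \<Longrightarrow> t \<in> T \<Longrightarrow> t \<in> span_over A T"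
  unfolding span_over_def
  by (intro CollectI exI[of _ "\<lambda>u. if u = t then 1 else 0"]) (auto simp: subring_simps if_distrib[of "\<lambda>c. c * _"] cong: if_cong)

text \<open>The monomials \<open>x ^ i * y ^ j\<close> below the two degrees span an
  \<open>A\<close>-module stable under \<open>x\<close> and \<open>y\<close>.\<close>

lemma integral_closed:
  assumes R: "subring_of A" and x: "integral_over A x" and y: "integral_over A y"
  shows "integral_over A (x + y)" "integral_over A (x * y)"
proof -
  obtain p q where p: "p \<in> polys A" "monic p" "poly p x = 0" and q: "q \<in> polys A" "monic q" "poly q y = 0"
    using x y unfolding integral_over_def by blast
  define m n where "m = degree p" and "n = degree q"
  have "m \<noteq> 0"
  proof
    assume "m = 0"
    then obtain a where "p = [:a:]" using degree_eq_zeroE m_def by metis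
    then show False using p by auto
  qed
  have "n \<noteq> 0"
  proof
    assume "n = 0"
    then obtain a where "q = [:a:]" using degree_eq_zeroE n_def by metis
    then show False using q by auto
  qed
  define T where "T = (\<lambda>(i, j). x ^ i * y ^ j) ` ({..<m} \<times> {..<n})"
  have T: "finite T" "1 \<in> T" unfolding T_def using \<open>m \<noteq> 0\<close> \<open>n \<noteq> 0\<close>
    by (auto intro!: image_eqI[of _ _ "(0, 0)"])
  have tT: "x ^ i * y ^ j \<in> span_over A T" if "i < m" "j < n" for i j
    by (rule span_over_base[OF R T(1)]) (use that in \<open>auto simp: T_def\<close>)
  have top: "u ^ degree f = (\<Sum>k<degree f. - poly.coeff f k * u ^ k)" if "monic f" "poly f u = 0" for f and u :: 'a
  proof -
    have "(\<Sum>k\<le>degree f. poly.coeff f k * u ^ k) = 0" using that by (simp add: poly_altdef)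
    then have "(\<Sum>k<degree f. poly.coeff f k * u ^ k) + u ^ degree f = 0"
      using that(1) by (simp add: lessThan_Suc_atMost[symmetric])
    then show ?thesis by (simp add: sum_negf eq_neg_iff_add_eq_0 add.commute)
  qed
  have cA: "- poly.coeff p k \<in> A" "- poly.coeff q k \<in> A" for k
    using p q by (auto simp: polys_def subring_uminus[OF R])
  have xm: "x * (x ^ i * y ^ j) \<in> span_over A T" if "i < m" "j < n" for i j
  proof (cases "Suc i < m")
    case True
    then show ?thesis using tT[of "Suc i" j] that by (simp add: mult.assoc)
  next
    case False
    then have "Suc i = m" using that by simp
    then have "x * (x ^ i * y ^ j) = x ^ m * y ^ j" by (metis mult.assoc power_Suc)
    also have "\<dots> = (\<Sum>k<m. - poly.coeff p k * (x ^ k * y ^ j))"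
      unfolding m_def top[OF p(2,3)] by (simp add: sum_distrib_right mult.assoc)
    also have "\<dots> \<in> span_over A T" using that by (intro span_over_sum[OF R] span_over_smult[OF R] tT cA) auto
    finally show ?thesis .
  qed
  have ym: "y * (x ^ i * y ^ j) \<in> span_over A T" if "i < m" "j < n" for i j
  proof (cases "Suc j < n")
    case True
    then show ?thesis using tT[of i "Suc j"] that by (simp add: mult.left_commute)
  next
    case False
    then have "Suc j = n" using that by simp
    then have "y * (x ^ i * y ^ j) = y ^ n * x ^ i" by (metis mult.assoc mult.commute power_Suc)
    also have "\<dots> = (\<Sum>k<n. - poly.coeff q k * (x ^ i * y ^ k))"
      unfolding n_def top[OF q(2,3)] sum_distrib_right by (simp add: mult_ac)
    also have "\<dots> \<in> span_over A T" using that by (intro span_over_sum[OF R] span_over_smult[OF R] tT cA) auto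
    finally show ?thesis .
  qed
  have xT: "x * t \<in> span_over A T" "y * t \<in> span_over A T" if "t \<in> T" for t
    using that xm ym by (auto simp: T_def)
  show "integral_over A (x + y)"
    by (rule integral_if_finite_module[OF R T(1,2)])
       (auto simp: distrib_right intro!: span_over_add[OF R] xT)
  have span_x: "x * u \<in> span_over A T" if u: "u \<in> span_over A T" for u
  proof -
    obtain c where c: "\<forall>t\<in>T. c t \<in> A" "u = (\<Sum>t\<in>T. c t * t)" using u unfolding span_over_def by blast
    have "x * u = (\<Sum>t\<in>T. c t * (x * t))" using c by (simp add: sum_distrib_left mult_ac)
    also have "\<dots> \<in> span_over A T" using c by (intro span_over_sum[OF R] span_over_smult[OF R] xT) auto
    finally show ?thesis .
  qed
  show "integral_over A (x * y)"
    by (rule integral_if_finite_module[OF R T(1,2)]) (simp_all add: mult.assoc span_x xT)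
qed

lemma integral_base: "subring_of A \<Longrightarrow> a \<in> A \<Longrightarrow> integral_over A a"
  unfolding integral_over_def
  by (rule bexI[of _ "[:- a, 1:]"]) (simp_all add: polys_pCons_iff polys_0 subring_uminus subring_1)

lemma integral_subring:
  assumes R: "subring_of A" shows "subring_of {x. integral_over A x}"
proof -
  have "integral_over A (x - y)" if "integral_over A x" "integral_over A y" for x y
  proof -
    have "integral_over A (- 1 * y)"
      by (rule integral_closed(2)[OF R integral_base[OF R]]) (use that R in \<open>simp_all add: subring_uminus subring_1\<close>)
    then show ?thesis using integral_closed(1)[OF R that(1), of "- 1 * y"] by simp
  qed
  then show ?thesis using integral_closed(2)[OF R] integral_base[OF R subring_1[OF R]]
    by (auto simp: subring_of_def)
qed

text \<open>A monic equation for \<open>poly q y\<close> composed with the monic \<open>q\<close>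
  stays monic. The use is for the series \<open>v c\<close>, which satisfy a polynomial equation
  with simple right side.\<close>

lemma integral_if_poly_integral:
  assumes R: "subring_of A" and q: "q \<in> polys A" "monic q" "degree q > 0" and y: "integral_over A (poly q y)"
  shows "integral_over A y"
proof -
  obtain f where f: "f \<in> polys A" "monic f" "poly f (poly q y) = 0" using y unfolding integral_over_def by blast
  have "lead_coeff (pcompose f q) = 1" using f q lead_coeff_comp[of q f] by simp
  then show ?thesis unfolding integral_over_def
    by (intro bexI[of _ "pcompose f q"]) (use f q R in \<open>auto simp: poly_pcompose intro: polys_pcompose\<close>)
qed

no_notation index_mat (infixl "$$" 100)
no_notation vec_index (infixl "$" 100)
unbundle Formal_Laurent_Series.fps_syntax

section \<open>Laurent series with coefficients in a subfield\<close>

definition ser :: "'a::field set \<Rightarrow> 'a fls set"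
  where "ser K = {f. \<forall>n. f $$ n \<in> K}"

definition ser_map :: "('a \<Rightarrow> 'a) \<Rightarrow> 'a::field fls \<Rightarrow> 'a fls"
  where "ser_map \<sigma> f = Abs_fls (\<lambda>n. \<sigma> (f $$ n))"

definition fls_of_poly :: "'a::field poly \<Rightarrow> 'a fls"
  where "fls_of_poly p = fps_to_fls (fps_of_poly p)"

text \<open>When \<open>F\<close> is algebraic over \<open>K\<close> this is all of $F(X)$, with
  denominators cleared to lie over \<open>K\<close>. Over the fixed field these denominators are
  invariant, so a group acts on numerators alone.\<close>

definition ratx :: "'a::field set \<Rightarrow> 'a set \<Rightarrow> 'a fls set"
  where "ratx F K = {fls_of_poly p / fls_of_poly q | p q. p \<in> polys F \<and> q \<in> polys K \<and> q \<noteq> 0}"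

lemma ser_map_nth: "\<sigma> 0 = 0 \<Longrightarrow> ser_map \<sigma> f $$ n = \<sigma> (f $$ n)"
  unfolding ser_map_def by (rule nth_Abs_fls_lower_bound[of "fls_subdegree f"]) simp

lemma ser_nth: "f \<in> ser K \<Longrightarrow> f $$ n \<in> K"
  by (simp add: ser_def)

lemma ser_subring:
  assumes K: "subring_of K" shows "subring_of (ser K)"
  by (auto simp: subring_of_def ser_def fls_times_nth(2) intro!: subring_simps[OF K])

text \<open>The coefficients of an inverse satisfy a recursion in which only the lowest coefficient
  of the given series is inverted.\<close>

lemma ser_subfield:
  assumes K: "subfield_of K" shows "subfield_of (ser K)"
proof -
  note R = subfield_ring[OF K]
  have "inverse f \<in> ser K" if f: "f \<in> ser K" for f
  proof (cases "f = 0")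
    case False
    define d where "d = fls_subdegree f"
    define g where "g = inverse f"
    have dg: "fls_subdegree g = - d" unfolding g_def d_def by simp
    have fg: "g * f = 1" using False by (simp add: g_def)
    have "g $$ (int n - d) \<in> K" for n
    proof (induction n rule: less_induct)
      case (less n)
      let ?m = "int n - d"
      have "(g * f) $$ (int n) = (\<Sum>i = -d..?m. g $$ i * f $$ (int n - i))"
        using fls_times_nth(2)[of g f "int n"] dg d_def by simp
      also have "{-d..?m} = insert ?m {-d..<?m}" by auto
      also have "(\<Sum>i\<in>insert ?m {-d..<?m}. g $$ i * f $$ (int n - i)) = g $$ ?m * f $$ d + (\<Sum>i\<in>{-d..<?m}. g $$ i * f $$ (int n - i))"
        by (subst sum.insert) auto
      finally have "g $$ ?m * f $$ d = (1::'a fls) $$ int n - (\<Sum>i\<in>{-d..<?m}. g $$ i * f $$ (int n - i))"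
        using fg by simp
      moreover have "(\<Sum>i\<in>{-d..<?m}. g $$ i * f $$ (int n - i)) \<in> K"
      proof (rule subring_sum[OF R])
        fix i assume i: "i \<in> {-d..<?m}"
        then have "g $$ (int (nat (i + d)) - d) \<in> K" by (intro less.IH) auto
        then show "g $$ i * f $$ (int n - i) \<in> K" using i f by (intro subring_mult[OF R]) (auto simp: ser_def)
      qed
      moreover have "(1::'a fls) $$ int n \<in> K" using subring_1[OF R] subring_0[OF R] by simp
      ultimately have "g $$ ?m * f $$ d \<in> K" using subring_diff[OF R] by simp
      moreover have "f $$ d \<noteq> 0" using False by (simp add: d_def)
      moreover have "f $$ d \<in> K" using f by (simp add: ser_def)
      ultimately have "g $$ ?m * f $$ d / f $$ d \<in> K" by (intro subfield_divide[OF K])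
      with \<open>f $$ d \<noteq> 0\<close> show ?case by simp
    qed
    moreover have "g $$ n = 0" if "n < - d" for n using that dg by simp
    ultimately have "g $$ n \<in> K" for n
    proof (cases "n < - d")
      case False
      then have "n = int (nat (n + d)) - d" by simp
      then show ?thesis using \<open>\<And>n. g $$ (int n - d) \<in> K\<close> by metis
    qed (simp add: \<open>\<And>n. n < - d \<Longrightarrow> g $$ n = 0\<close> subring_0[OF R])
    then show ?thesis by (simp add: ser_def g_def)
  next
    case True
    then show ?thesis using f by simp
  qed
  then show ?thesis using ser_subring[OF R] by (simp add: subfield_of_def)
qed

lemma ser_mono: "K \<subseteq> L \<Longrightarrow> ser K \<subseteq> ser L"
  by (auto simp: ser_def)

lemma ser_const: "0 \<in> K \<Longrightarrow> fls_const c \<in> ser K \<longleftrightarrow> c \<in> K"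
  by (auto simp: ser_def)

lemma fls_of_poly_nth: "fls_of_poly p $$ n = (if n < 0 then 0 else poly.coeff p (nat n))"
  by (simp add: fls_of_poly_def)

lemma fls_of_poly_inj: "fls_of_poly p = fls_of_poly q \<longleftrightarrow> p = q"
  by (simp add: fls_of_poly_def fps_of_poly_eq_iff)

lemma fls_of_poly_hom:
  "fls_of_poly 0 = 0" "fls_of_poly 1 = 1" "fls_of_poly (p + q) = fls_of_poly p + fls_of_poly q"
  "fls_of_poly (p - q) = fls_of_poly p - fls_of_poly q" "fls_of_poly (p * q) = fls_of_poly p * fls_of_poly q"
  "fls_of_poly (- p) = - fls_of_poly p" "fls_of_poly (p ^ n) = fls_of_poly p ^ n"
  "fls_of_poly [:c:] = fls_const c" "fls_of_poly [:0, 1:] = fls_X"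
  by (simp_all add: fls_of_poly_def fps_of_poly_add fps_of_poly_diff fps_of_poly_mult fls_times_fps_to_fls
      fps_of_poly_uminus fps_of_poly_power fps_to_fls_power fps_of_poly_const)

lemma fls_of_poly_eq_0_iff [simp]: "fls_of_poly p = 0 \<longleftrightarrow> p = 0"
  using fls_of_poly_inj[of p 0] by (simp add: fls_of_poly_hom)

lemma fls_of_poly_ser: "subring_of K \<Longrightarrow> fls_of_poly p \<in> ser K \<longleftrightarrow> p \<in> polys K"
proof
  assume "fls_of_poly p \<in> ser K"
  then have "fls_of_poly p $$ int n \<in> K" for n by (simp add: ser_def)
  then show "p \<in> polys K" by (simp add: polys_def fls_of_poly_nth)
qed (auto simp: ser_def polys_def fls_of_poly_nth subring_0)

lemma ratxI: "p \<in> polys F \<Longrightarrow> q \<in> polys K \<Longrightarrow> q \<noteq> 0 \<Longrightarrow> fls_of_poly p / fls_of_poly q \<in> ratx F K"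
  unfolding ratx_def by blast

lemma ratxE:
  assumes "z \<in> ratx F K"
  obtains p q where "p \<in> polys F" "q \<in> polys K" "q \<noteq> 0" "z = fls_of_poly p / fls_of_poly q"
  using assms unfolding ratx_def by blast

lemma ratx_mono: "F \<subseteq> F' \<Longrightarrow> K \<subseteq> K' \<Longrightarrow> ratx F K \<subseteq> ratx F' K'"
  unfolding ratx_def using polys_mono by blast

lemma ratx_subring:
  assumes F: "subring_of F" and K: "subring_of K" "K \<subseteq> F"
  shows "subring_of (ratx F K)"
  unfolding subring_of_def
proof (intro conjI ballI)
  have "fls_of_poly 1 / fls_of_poly 1 \<in> ratx F K" by (intro ratxI polys_1 F K) simp
  then show "1 \<in> ratx F K" by (simp add: fls_of_poly_hom)
  fix x y assume "x \<in> ratx F K" "y \<in> ratx F K"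
  then obtain p q p' q' where *: "p \<in> polys F" "q \<in> polys K" "q \<noteq> 0" "x = fls_of_poly p / fls_of_poly q"
    "p' \<in> polys F" "q' \<in> polys K" "q' \<noteq> 0" "y = fls_of_poly p' / fls_of_poly q'"
    by (metis ratxE)
  have qF: "q \<in> polys F" "q' \<in> polys F" using * polys_mono[OF K(2)] by auto
  have "fls_of_poly (p * q' - p' * q) / fls_of_poly (q * q') \<in> ratx F K"
    using * qF by (intro ratxI polys_diff polys_mult F K) auto
  moreover have "fls_of_poly (p * q' - p' * q) / fls_of_poly (q * q') = x - y"
    unfolding *(4) *(8) using *(3,7) by (simp add: fls_of_poly_hom diff_divide_distrib)
  ultimately show "x - y \<in> ratx F K" by simp
  have "fls_of_poly (p * p') / fls_of_poly (q * q') \<in> ratx F K"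
    using * by (intro ratxI polys_mult F K) auto
  then show "x * y \<in> ratx F K" using * by (simp add: fls_of_poly_hom)
qed

lemma ratx_subfield:
  assumes K: "subring_of K" shows "subfield_of (ratx K K)"
proof -
  have "inverse x \<in> ratx K K" if x: "x \<in> ratx K K" for x
  proof (cases "x = 0")
    case False
    obtain p q where *: "p \<in> polys K" "q \<in> polys K" "q \<noteq> 0" "x = fls_of_poly p / fls_of_poly q"
      using x by (rule ratxE)
    then have "fls_of_poly q / fls_of_poly p \<in> ratx K K" using False by (intro ratxI) (auto simp: fls_of_poly_hom)
    then show ?thesis using * by simp
  qed (use x in simp)
  then show ?thesis using ratx_subring[OF K K] by (simp add: subfield_of_def)
qed

lemma ratx_poly: "subring_of K \<Longrightarrow> p \<in> polys F \<Longrightarrow> fls_of_poly p \<in> ratx F K"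
  using ratxI[of p F 1 K] by (simp add: polys_1 fls_of_poly_hom)

lemma ratx_const: "subring_of K \<Longrightarrow> subring_of F \<Longrightarrow> c \<in> F \<Longrightarrow> fls_const c \<in> ratx F K"
  using ratx_poly[of K "[:c:]" F] by (simp add: polys_pCons_iff polys_0 fls_of_poly_hom)

lemma ratx_X: "subring_of K \<Longrightarrow> subring_of F \<Longrightarrow> fls_X \<in> ratx F K"
  using ratx_poly[of K "[:0,1:]" F] by (simp add: polys_pCons_iff polys_0 subring_0 subring_1 fls_of_poly_hom)

lemma ratx_ser: "subfield_of F \<Longrightarrow> K \<subseteq> F \<Longrightarrow> ratx F K \<subseteq> ser F"
proof
  fix z assume F: "subfield_of F" "K \<subseteq> F" and "z \<in> ratx F K"
  note R = subfield_ring[OF F(1)]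
  from \<open>z \<in> ratx F K\<close> obtain p q where "p \<in> polys F" "q \<in> polys K" "z = fls_of_poly p / fls_of_poly q" by (metis ratxE)
  then show "z \<in> ser F" using polys_mono[OF F(2)]
    by (auto intro!: subfield_divide[OF ser_subfield[OF F(1)]] simp: fls_of_poly_ser[OF R])
qed

context
  fixes K :: "'a::field set" and \<sigma> :: "'a \<Rightarrow> 'a"
  assumes K: "subfield_of K" and \<sigma>: "hom_on K \<sigma>"
begin

lemma ser_map_nth': "ser_map \<sigma> f $$ n = \<sigma> (f $$ n)"
  by (rule ser_map_nth[of \<sigma>, OF hom_0[OF subfield_ring[OF K] \<sigma>]])

text \<open>The coefficient formula \<open>fls_times_nth\<close> for products sums over a range
  given by the subdegrees, so these must be preserved before multiplicativity can be compared
  termwise.\<close>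

lemma ser_map_subdegree:
  assumes f: "f \<in> ser K" shows "fls_subdegree (ser_map \<sigma> f) = fls_subdegree f"
proof (cases "f = 0")
  case True
  then have "ser_map \<sigma> f = 0" by (intro fls_eqI) (simp add: ser_map_nth' hom_0[OF subfield_ring[OF K] \<sigma>])
  with True show ?thesis by simp
next
  case False
  show ?thesis
  proof (rule fls_subdegree_eqI)
    have "f $$ fls_subdegree f \<in> K" "f $$ fls_subdegree f \<noteq> 0" using f False by (auto simp: ser_def)
    then show "ser_map \<sigma> f $$ fls_subdegree f \<noteq> 0"
      using hom_nonzero[OF subfield_ring[OF K] \<sigma> _ subfield_inverse[OF K]] by (simp add: ser_map_nth')
    show "ser_map \<sigma> f $$ n = 0" if "n < fls_subdegree f" for n
      using that by (simp add: ser_map_nth' hom_0[OF subfield_ring[OF K] \<sigma>])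
  qed
qed

lemma ser_map_hom: "hom_on (ser K) (ser_map \<sigma>)"
  unfolding hom_on_def
proof (intro conjI ballI)
  note R = subfield_ring[OF K]
  show "ser_map \<sigma> 1 = 1"
    by (rule fls_eqI) (simp add: ser_map_nth' hom_0[OF R \<sigma>] hom_1[OF R \<sigma>])
  fix f g assume f: "f \<in> ser K" and g: "g \<in> ser K"
  show "ser_map \<sigma> (f + g) = ser_map \<sigma> f + ser_map \<sigma> g"
    by (rule fls_eqI) (simp add: ser_map_nth' hom_add[OF R \<sigma>] ser_nth f g)
  show "ser_map \<sigma> (f * g) = ser_map \<sigma> f * ser_map \<sigma> g"
  proof (rule fls_eqI)
    fix n
    have "ser_map \<sigma> (f * g) $$ n = (\<Sum>i=fls_subdegree f..n - fls_subdegree g. \<sigma> (f $$ i * g $$ (n - i)))"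
      unfolding ser_map_nth' fls_times_nth(2)
      by (rule hom_sum[OF R \<sigma>]) (simp add: subring_mult[OF R] ser_nth[OF f] ser_nth[OF g])
    also have "\<dots> = (ser_map \<sigma> f * ser_map \<sigma> g) $$ n"
      unfolding fls_times_nth(2) ser_map_subdegree[OF f] ser_map_subdegree[OF g]
      by (intro sum.cong) (simp_all add: ser_map_nth' hom_mult[OF R \<sigma>] ser_nth[OF f] ser_nth[OF g])
    finally show "ser_map \<sigma> (f * g) $$ n = (ser_map \<sigma> f * ser_map \<sigma> g) $$ n" .
  qed
qed

lemma ser_map_const: "ser_map \<sigma> (fls_const c) = fls_const (\<sigma> c)"
  by (rule fls_eqI) (simp add: ser_map_nth' hom_0[OF subfield_ring[OF K] \<sigma>])

lemma ser_map_poly: "ser_map \<sigma> (fls_of_poly p) = fls_of_poly (map_poly \<sigma> p)"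
  by (rule fls_eqI) (simp add: ser_map_nth' fls_of_poly_nth coeff_hom_poly[OF subfield_ring[OF K] \<sigma>] hom_0[OF subfield_ring[OF K] \<sigma>])

lemma ser_map_ratx:
  assumes "p \<in> polys K" "q \<in> polys K"
  shows "ser_map \<sigma> (fls_of_poly p / fls_of_poly q) = fls_of_poly (map_poly \<sigma> p) / fls_of_poly (map_poly \<sigma> q)"
  using hom_divide[OF ser_subring[OF subfield_ring[OF K]] ser_map_hom, of "fls_of_poly p" "fls_of_poly q"] assms
    subfield_inverse[OF ser_subfield[OF K]]
  by (simp add: fls_of_poly_ser[OF subfield_ring[OF K]] ser_map_poly)

lemma ser_map_in: "\<sigma> ` K \<subseteq> L \<Longrightarrow> f \<in> ser K \<Longrightarrow> ser_map \<sigma> f \<in> ser L"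
  by (auto simp: ser_def ser_map_nth')

end

lemma ser_action:
  assumes "ring_action G M act" and M: "subfield_of M"
  shows "ring_action G (ser M) (\<lambda>g. ser_map (act g))"
proof -
  interpret A: ring_action G M act by fact
  show ?thesis
  proof unfold_locales
    show "subring_of (ser M)" by (rule ser_subring[OF A.S])
    show "finite (carrier G)" by (rule A.fin)
    fix g assume g: "g \<in> carrier G"
    show "hom_on (ser M) (ser_map (act g))" by (rule ser_map_hom[OF M A.hom[OF g]])
    fix x assume x: "x \<in> ser M"
    show "ser_map (act g) x \<in> ser M" by (rule ser_map_in[OF M A.hom[OF g] _ x]) (use A.act_in g in auto)
    fix h assume h: "h \<in> carrier G"
    show "ser_map (act (g \<otimes>\<^bsub>G\<^esub> h)) x = ser_map (act g) (ser_map (act h) x)"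
      using x by (intro fls_eqI) (simp add: ser_map_nth'[OF M A.hom] g h A.act_mult ser_nth)
  next
    fix x assume x: "x \<in> ser M"
    show "ser_map (act \<one>\<^bsub>G\<^esub>) x = x"
      using x by (intro fls_eqI) (simp add: ser_map_nth'[OF M A.hom] A.act_one ser_nth)
  qed
qed

section \<open>Twisting by one automorphism of prime order\<close>

definition lagr :: "nat \<Rightarrow> (nat \<Rightarrow> 'b::field) \<Rightarrow> nat \<Rightarrow> 'b poly"
  where "lagr p pt i = (\<Prod>j\<in>{..<p} - {i}. Polynomial.smult (inverse (pt i - pt j)) [:- pt j, 1:])"

definition interp :: "nat \<Rightarrow> (nat \<Rightarrow> 'b::field) \<Rightarrow> ('b \<Rightarrow> 'b) \<Rightarrow> 'b \<Rightarrow> 'b poly"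
  where "interp p pt a z = (\<Sum>i<p. Polynomial.smult ((a ^^ i) z) (lagr p pt i))"

text \<open>At \<open>v = pt i\<close> the value is the conjugate \<open>(a ^^ i) z\<close>; a general \<open>v\<close> deforms these values.\<close>

definition twist :: "nat \<Rightarrow> (nat \<Rightarrow> 'b::field) \<Rightarrow> ('b \<Rightarrow> 'b) \<Rightarrow> 'b \<Rightarrow> 'b \<Rightarrow> 'b"
  where "twist p pt a v z = poly (interp p pt a z) v"

text \<open>This becomes \<open>X^p - 1\<close> for the powers of \<open>\<zeta>\<close> and
  \<open>X^p - X\<close> for the residues modulo \<open>p\<close>.\<close>

definition nodal :: "nat \<Rightarrow> (nat \<Rightarrow> 'b::field) \<Rightarrow> 'b poly"
  where "nodal p pt = (\<Prod>i<p. [:- pt i, 1:])"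

lemma lagr_eval:
  assumes "inj_on pt {..<p}" "i < p" "j < p"
  shows "poly (lagr p pt i) (pt j) = (if i = j then 1 else 0)"
proof (cases "i = j")
  case True
  have "poly (Polynomial.smult (inverse (pt i - pt k)) [:- pt k, 1:]) (pt i) = 1" if "k \<in> {..<p} - {i}" for k
  proof -
    have "pt i - pt k \<noteq> 0" using assms that by (auto simp: inj_on_def)
    moreover have "poly (Polynomial.smult (inverse (pt i - pt k)) [:- pt k, 1:]) (pt i) = inverse (pt i - pt k) * (pt i - pt k)"
      by (simp add: algebra_simps)
    ultimately show ?thesis by (metis left_inverse)
  qed
  then show ?thesis using True unfolding lagr_def poly_prod by (simp add: prod.neutral)
next
  case False
  then show ?thesis using assms unfolding lagr_def poly_prod by (auto intro!: prod_zero bexI[of _ j])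
qed

lemma lagr_degree: "i < p \<Longrightarrow> degree (lagr p pt i) < p"
proof -
  assume i: "i < p"
  have "degree (lagr p pt i) \<le> (\<Sum>j\<in>{..<p} - {i}. degree (Polynomial.smult (inverse (pt i - pt j)) [:- pt j, 1:]))"
    unfolding lagr_def by (rule degree_prod_sum_le[unfolded comp_def]) auto
  also have "\<dots> \<le> (\<Sum>j\<in>{..<p} - {i}. 1)" by (rule sum_mono) simp
  also have "\<dots> < p" using i by simp
  finally show ?thesis .
qed

lemma interp_eval:
  assumes "inj_on pt {..<p}" "j < p" shows "poly (interp p pt a z) (pt j) = (a ^^ j) z"
proof -
  have "poly (interp p pt a z) (pt j) = (\<Sum>i<p. if i = j then (a ^^ i) z else 0)"
    unfolding interp_def poly_sum by (rule sum.cong) (simp_all add: lagr_eval assms)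
  then show ?thesis using assms by simp
qed

lemma interp_degree: "p > 0 \<Longrightarrow> degree (interp p pt a z) < p"
  unfolding interp_def by (intro degree_sum_less) (auto intro: le_less_trans[OF degree_smult_le] lagr_degree)

lemma poly_eq_if_agree:
  fixes q r :: "'b::field poly"
  assumes "inj_on pt {..<p}" "degree q < p" "degree r < p" "\<And>i. i < p \<Longrightarrow> poly q (pt i) = poly r (pt i)"
  shows "q = r"
proof (rule ccontr)
  assume "q \<noteq> r"
  then have nz: "q - r \<noteq> 0" by simp
  have "pt ` {..<p} \<subseteq> {x. poly (q - r) x = 0}" using assms(4) by auto
  then have "card (pt ` {..<p}) \<le> degree (q - r)"
    using poly_roots_degree[OF nz] card_mono[OF poly_roots_finite[OF nz]] by (meson order.trans)
  moreover have "card (pt ` {..<p}) = p" using assms(1) by (simp add: card_image)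
  moreover have "degree (q - r) \<le> max (degree q) (degree r)" by (rule degree_diff_le_max)
  ultimately show False using assms(2,3) by linarith
qed

lemma interp_unique:
  assumes "inj_on pt {..<p}" "degree q < p" "\<And>i. i < p \<Longrightarrow> poly q (pt i) = (a ^^ i) z"
  shows "q = interp p pt a z"
proof (rule poly_eq_if_agree[OF assms(1,2)])
  show "degree (interp p pt a z) < p" using assms(2) by (intro interp_degree) auto
  show "poly q (pt i) = poly (interp p pt a z) (pt i)" if "i < p" for i
    using assms(3)[OF that] interp_eval[OF assms(1) that, of a z] by simp
qed

lemma nodal_monic: "monic (nodal p pt)" and nodal_degree: "degree (nodal p pt) = p"
  and nodal_root: "i < p \<Longrightarrow> poly (nodal p pt) (pt i) = 0"
proof -
  show "monic (nodal p pt)" unfolding nodal_def by (rule monic_prod) auto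
  show "degree (nodal p pt) = p" unfolding nodal_def by (simp add: degree_prod_eq_sum_degree)
  show "poly (nodal p pt) (pt i) = 0" if "i < p" unfolding nodal_def using that by (auto simp: poly_prod)
qed

lemma twist_altdef: "twist p pt a v z = (\<Sum>i<p. (a ^^ i) z * poly (lagr p pt i) v)"
  by (simp add: twist_def interp_def poly_sum)

text \<open>The linear polynomial \<open>sh\<close> moves each node to the next one, cyclically:
  multiplication by \<open>\<zeta>\<close> or addition of 1. It plays the part of the automorphism
  of the cyclic extension generated by \<open>v\<close>; \<open>a\<close> itself fixes
  \<open>v\<close>, so it acts on the coefficients of interpolation polynomials.\<close>

locale twist_step =
  fixes S :: "'b::field set" and a :: "'b \<Rightarrow> 'b" and p :: nat and pt :: "nat \<Rightarrow> 'b" and sh :: "'b poly" and v :: 'b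
  assumes S: "subring_of S" and hom: "hom_on S a" and a_in: "\<And>x. x \<in> S \<Longrightarrow> a x \<in> S"
    and a_pow: "\<And>x. x \<in> S \<Longrightarrow> (a ^^ p) x = x"
    and p: "p > 0" and inj: "inj_on pt {..<p}"
    and pt: "\<And>i. i < p \<Longrightarrow> pt i \<in> S" "\<And>i. i < p \<Longrightarrow> a (pt i) = pt i"
    and pt_diff: "\<And>i j. i < p \<Longrightarrow> j < p \<Longrightarrow> inverse (pt i - pt j) \<in> S"
    and v: "v \<in> S" "a v = v"
    and sh: "sh \<in> polys S" "degree sh = 1" "\<And>i. i < p \<Longrightarrow> poly sh (pt i) = pt (Suc i mod p)"
      "pcompose (nodal p pt) sh = nodal p pt"
begin

lemma apow_hom: "hom_on S (a ^^ i)" and apow_in: "x \<in> S \<Longrightarrow> (a ^^ i) x \<in> S"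
proof (induction i arbitrary: x)
  case 0
  { case 1 show ?case by (simp add: hom_on_def) }
  { case 2 then show ?case by simp }
next
  case (Suc i)
  { case 1 show ?case using Suc(1) Suc(2) hom unfolding hom_on_def by simp }
  { case 2 then show ?case using Suc(2) a_in by simp }
qed

lemma lagr_polys:
  assumes "subring_of R" "\<And>i. i < p \<Longrightarrow> pt i \<in> R" "\<And>i j. i < p \<Longrightarrow> j < p \<Longrightarrow> inverse (pt i - pt j) \<in> R" "i < p"
  shows "lagr p pt i \<in> polys R"
  unfolding lagr_def using assms
  by (intro polys_prod polys_smult) (auto simp: polys_pCons_iff polys_0 subring_simps)

lemma interp_polys:
  assumes R: "subring_of R" "\<And>i. i < p \<Longrightarrow> pt i \<in> R" "\<And>i j. i < p \<Longrightarrow> j < p \<Longrightarrow> inverse (pt i - pt j) \<in> R"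
    and aR: "\<And>x. x \<in> R \<Longrightarrow> a x \<in> R" and z: "z \<in> R"
  shows "interp p pt a z \<in> polys R"
proof -
  have "(a ^^ i) z \<in> R" for i by (induction i) (auto intro: z aR)
  then show ?thesis unfolding interp_def using lagr_polys[OF R] by (intro polys_sum polys_smult R(1)) auto
qed

lemma twist_in: "z \<in> S \<Longrightarrow> twist p pt a v z \<in> S"
  unfolding twist_def by (intro poly_in[OF S] interp_polys[OF S] pt pt_diff a_in v)

lemma twist_add: "z \<in> S \<Longrightarrow> z' \<in> S \<Longrightarrow> twist p pt a v (z + z') = twist p pt a v z + twist p pt a v z'"
  unfolding twist_altdef by (simp add: hom_add[OF S apow_hom] distrib_right sum.distrib)

lemma apow_fixed: "a c = c \<Longrightarrow> (a ^^ i) c = c"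
  by (induction i) auto

lemma twist_scale: "c \<in> S \<Longrightarrow> a c = c \<Longrightarrow> z \<in> S \<Longrightarrow> twist p pt a v (c * z) = c * twist p pt a v z"
  unfolding twist_altdef by (simp add: hom_mult[OF S apow_hom] apow_fixed sum_distrib_left mult.assoc)

lemma twist_fixed:
  assumes "a z = z" shows "twist p pt a v z = z"
proof -
  have "[:z:] = interp p pt a z" by (rule interp_unique[OF inj]) (use p assms in \<open>auto simp: apow_fixed\<close>)
  then show ?thesis unfolding twist_def by (metis poly_pCons mult_zero_right poly_0 add.right_neutral)
qed

text \<open>Both sides have degree below \<open>p\<close> and value \<open>(a ^^ Suc i) z\<close> at
  \<open>pt i\<close>; at the last node this uses \<open>a_pow\<close>. Thus on interpolation
  polynomials \<open>a\<close> acts as the shift of the variable.\<close>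

lemma interp_shift:
  assumes z: "z \<in> S" shows "map_poly a (interp p pt a z) = pcompose (interp p pt a z) sh"
proof (rule poly_eq_if_agree[OF inj])
  note I = interp_polys[OF S pt(1) pt_diff a_in z]
  show "degree (map_poly a (interp p pt a z)) < p"
    by (rule le_less_trans[OF degree_map_poly_le interp_degree[OF p]])
  show "degree (pcompose (interp p pt a z) sh) < p"
    using interp_degree[OF p, of pt a z] sh(2) by simp
  fix i assume i: "i < p"
  have "poly (map_poly a (interp p pt a z)) (pt i) = a (poly (interp p pt a z) (pt i))"
    using poly_hom[OF S hom I pt(1)[OF i]] pt(2)[OF i] by simp
  also have "\<dots> = (a ^^ Suc i) z" by (simp add: interp_eval[OF inj i])
  also have "\<dots> = (a ^^ (Suc i mod p)) z"
    using a_pow[OF z] i by (cases "Suc i = p") auto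
  also have "\<dots> = poly (interp p pt a z) (pt (Suc i mod p))" using p by (simp add: interp_eval[OF inj])
  also have "\<dots> = poly (pcompose (interp p pt a z) sh) (pt i)" by (simp add: poly_pcompose sh(3)[OF i])
  finally show "poly (map_poly a (interp p pt a z)) (pt i) = poly (pcompose (interp p pt a z) sh) (pt i)" .
qed

lemma nodal_fixed: "nodal p pt \<in> polys S" "map_poly a (nodal p pt) = nodal p pt"
proof -
  have l: "[:- pt i, 1:] \<in> polys S" if "i < p" for i
    using pt(1)[OF that] by (simp add: polys_pCons_iff[OF S] polys_0[OF S] subring_simps[OF S])
  then show "nodal p pt \<in> polys S" unfolding nodal_def by (intro polys_prod[OF S]) auto
  have "map_poly a (nodal p pt) = (\<Prod>i<p. map_poly a [:- pt i, 1:])"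
    unfolding nodal_def by (rule hom_poly_prod[OF S hom]) (use l in auto)
  also have "\<dots> = nodal p pt" unfolding nodal_def
    by (rule prod.cong) (simp_all add: hom_poly_pCons[OF S hom] hom_0[OF S hom] hom_1[OF S hom] hom_uminus[OF S hom] pt)
  finally show "map_poly a (nodal p pt) = nodal p pt" .
qed

lemma nodal_value_fixed: "poly (nodal p pt) v \<in> S" "a (poly (nodal p pt) v) = poly (nodal p pt) v"
  using poly_in[OF S nodal_fixed(1) v(1)] poly_hom[OF S hom nodal_fixed(1) v(1)] nodal_fixed(2) v(2) by simp_all

text \<open>The interpolation polynomials of \<open>z\<close>, \<open>z'\<close> and \<open>z * z'\<close> agree at the nodes, so
  \<open>interp z * interp z' = interp (z * z') + nodal * H\<close>; as \<open>H\<close> inherits the shift equivariance and has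
  degree less than \<open>p\<close>, it is the interpolation polynomial of its value at the first node.\<close>

lemma twist_mult:
  assumes R: "subring_of R" "R \<subseteq> S" "\<And>i. i < p \<Longrightarrow> pt i \<in> R" "\<And>i j. i < p \<Longrightarrow> j < p \<Longrightarrow> inverse (pt i - pt j) \<in> R"
    and aR: "\<And>x. x \<in> R \<Longrightarrow> a x \<in> R" and z: "z \<in> R" "z' \<in> R"
  shows "\<exists>h\<in>R. twist p pt a v z * twist p pt a v z' = twist p pt a v (z * z' + poly (nodal p pt) v * h)"
proof -
  let ?I = "interp p pt a" and ?N = "nodal p pt"
  have zz: "z * z' \<in> R" using z subring_mult[OF R(1)] by blast
  have zS: "z \<in> S" "z' \<in> S" "z * z' \<in> S" using z zz R(2) by auto
  have IR: "?I y \<in> polys R" if "y \<in> R" for y by (rule interp_polys[OF R(1,3,4) aR that])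
  have NR: "?N \<in> polys R" unfolding nodal_def
    using R(1,3) by (intro polys_prod[OF R(1)]) (auto simp: polys_pCons_iff[OF R(1)] polys_0[OF R(1)] subring_simps[OF R(1)])
  have dR: "?I z * ?I z' - ?I (z * z') \<in> polys R" by (intro polys_diff[OF R(1)] polys_mult[OF R(1)] IR z zz)
  obtain H r where H: "H \<in> polys R" "r \<in> polys R" "?I z * ?I z' - ?I (z * z') = ?N * H + r" "r = 0 \<or> degree r < degree ?N"
    using monic_division[OF R(1) NR nodal_monic dR] by blast
  have "poly r (pt i) = 0" if i: "i < p" for i
  proof -
    have "poly r (pt i) = poly (?I z * ?I z' - ?I (z * z')) (pt i)" unfolding H(3) by (simp add: nodal_root i)
    then show ?thesis by (simp add: interp_eval[OF inj i] hom_mult[OF S apow_hom zS(1,2)])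
  qed
  then have "r = 0" using H(4) p by (intro poly_eq_if_agree[OF inj]) (auto simp: nodal_degree)
  then have H3: "?I z * ?I z' = ?I (z * z') + ?N * H" using H(3) by (simp add: algebra_simps)
  have HS: "H \<in> polys S" using H(1) polys_mono[OF R(2)] by blast
  have IS: "?I y \<in> polys S" if "y \<in> S" for y by (rule interp_polys[OF S pt(1) pt_diff a_in that])
  have "?N * map_poly a H = map_poly a (?I z * ?I z' - ?I (z * z'))"
    using H3 by (simp add: hom_poly_mult[OF S hom nodal_fixed(1) HS] nodal_fixed(2))
  also have "\<dots> = pcompose (?I z * ?I z' - ?I (z * z')) sh"
    using IS zS by (simp add: hom_poly_diff[OF S hom] hom_poly_mult[OF S hom] polys_mult[OF S] interp_shift pcompose_diff pcompose_mult)
  also have "\<dots> = ?N * pcompose H sh" using H3 sh(4) by (simp add: pcompose_mult)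
  \<comment> \<open>Both \<open>a\<close> and the shift preserve the nodal polynomial, so it can be
    cancelled.\<close>
  finally have Hs: "map_poly a H = pcompose H sh" using nodal_monic[of p pt] by auto
  \<comment> \<open>The product of two interpolation polynomials has degree below
    \<open>p + p\<close>, and dividing by the nodal polynomial removes \<open>p\<close>.\<close>
  have dH: "degree H < p"
  proof (cases "H = 0")
    case False
    have "?N * H = ?I z * ?I z' - ?I (z * z')" using H3 by simp
    moreover have "degree (?N * H) = p + degree H" using False nodal_monic[of p pt] by (subst degree_mult_eq) (auto simp: nodal_degree)
    moreover have "degree (?I z * ?I z' - ?I (z * z')) < p + p"
    proof -
      have "degree (?I z * ?I z') < p + p"
        using degree_mult_le[of "?I z" "?I z'"] interp_degree[OF p, of pt a z] interp_degree[OF p, of pt a z'] by linarith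
      moreover have "degree (?I (z * z')) < p + p" using interp_degree[OF p, of pt a "z * z'"] by linarith
      ultimately show ?thesis using degree_diff_le_max[of "?I z * ?I z'" "?I (z * z')"] by linarith
    qed
    ultimately show ?thesis by simp
  qed (use p in simp)
  define h where "h = poly H (pt 0)"
  have hR: "h \<in> R" unfolding h_def using poly_in[OF R(1) H(1) R(3)] p by simp
  have "poly H (pt i) = (a ^^ i) h" if "i < p" for i using that
  proof (induction i)
    case (Suc i)
    have "poly H (pt (Suc i)) = poly (pcompose H sh) (pt i)" using Suc.prems sh(3)[of i] by (simp add: poly_pcompose)
    also have "\<dots> = a (poly H (pt i))" using poly_hom[OF S hom HS pt(1)] pt(2) Suc.prems by (simp add: Hs[symmetric])
    finally show ?case using Suc by simp
  qed (simp add: h_def)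
  then have HI: "H = ?I h" by (intro interp_unique[OF inj dH])
  have hS: "h \<in> S" using hR R(2) by auto
  have "twist p pt a v z * twist p pt a v z' = poly (?I z * ?I z') v" by (simp add: twist_def)
  also have "\<dots> = twist p pt a v (z * z') + poly ?N v * twist p pt a v h"
    unfolding H3 twist_def by (subst HI) simp
  \<comment> \<open>The value of the nodal polynomial at \<open>v\<close> is invariant under
    \<open>a\<close>, hence a scalar for the twist: the error term moves inside.\<close>
  also have "\<dots> = twist p pt a v (z * z' + poly ?N v * h)"
    using twist_add[OF zS(3), of "poly ?N v * h"] twist_scale[OF nodal_value_fixed hS] subring_mult[OF S nodal_value_fixed(1) hS] by simp
  finally show ?thesis using hR by blast
qed

end

lemma lagr_hom:
  assumes S: "subring_of S" and b: "hom_on S b" and pt: "\<And>i. i < p \<Longrightarrow> pt i \<in> S"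
    "\<And>i j. i < p \<Longrightarrow> j < p \<Longrightarrow> inverse (pt i - pt j) \<in> S" "\<And>i. i < p \<Longrightarrow> b (pt i) = pt' i" and i: "i < p"
  shows "map_poly b (lagr p pt i) = lagr p pt' i"
proof -
  have l: "[:- pt j, 1:] \<in> polys S" if "j < p" for j
    using pt(1)[OF that] by (simp add: polys_pCons_iff[OF S] polys_0[OF S] subring_simps[OF S])
  have "map_poly b (lagr p pt i) = (\<Prod>j\<in>{..<p} - {i}. map_poly b (Polynomial.smult (inverse (pt i - pt j)) [:- pt j, 1:]))"
    unfolding lagr_def by (rule hom_poly_prod[OF S b]) (rule polys_smult[OF S], use l i pt in auto)
  also have "\<dots> = lagr p pt' i" unfolding lagr_def
  proof (rule prod.cong[OF refl])
    fix j assume "j \<in> {..<p} - {i}"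
    then have j: "j < p" by simp
    show "map_poly b (Polynomial.smult (inverse (pt i - pt j)) [:- pt j, 1:]) = Polynomial.smult (inverse (pt' i - pt' j)) [:- pt' j, 1:]"
      using hom_poly_smult[OF S b pt(2)[OF i j] l[OF j]] hom_inverse[OF S b subring_diff[OF S pt(1)[OF i] pt(1)[OF j]] pt(2)[OF i j]]
      by (simp add: hom_poly_pCons[OF S b] hom_0[OF S b] hom_1[OF S b] hom_uminus[OF S b] hom_diff[OF S b] pt i j)
  qed
  finally show ?thesis .
qed

text \<open>The twist is a polynomial expression in its data, so a homomorphism intertwining
  \<open>a\<close> and \<open>a'\<close> carries one twist to another. Applied to group elements,
  this shows that they permute a suitable family of twists.\<close>

lemma twist_hom:
  assumes S: "subring_of S" and b: "hom_on S b" and pt: "\<And>i. i < p \<Longrightarrow> pt i \<in> S"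
    "\<And>i j. i < p \<Longrightarrow> j < p \<Longrightarrow> inverse (pt i - pt j) \<in> S" "\<And>i. i < p \<Longrightarrow> b (pt i) = pt' i"
    and v: "v \<in> S" "b v = v'" and a: "\<And>x. x \<in> S \<Longrightarrow> a x \<in> S" "\<And>x. x \<in> S \<Longrightarrow> b (a x) = a' (b x)" and z: "z \<in> S"
  shows "b (twist p pt a v z) = twist p pt' a' v' (b z)"
proof -
  have lS: "lagr p pt i \<in> polys S" if "i < p" for i
    unfolding lagr_def using that pt
    by (intro polys_prod[OF S] polys_smult[OF S]) (auto simp: polys_pCons_iff[OF S] polys_0[OF S] subring_simps[OF S])
  have az: "(a ^^ i) z \<in> S \<and> b ((a ^^ i) z) = (a' ^^ i) (b z)" for i
    by (induction i) (auto simp: z a)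
  have vl: "poly (lagr p pt i) v \<in> S" if "i < p" for i using poly_in[OF S lS[OF that] v(1)] .
  have "b (twist p pt a v z) = (\<Sum>i<p. b ((a ^^ i) z * poly (lagr p pt i) v))"
    unfolding twist_altdef by (rule hom_sum[OF S b]) (use az vl in \<open>auto intro: subring_mult[OF S]\<close>)
  also have "\<dots> = (\<Sum>i<p. (a' ^^ i) (b z) * poly (lagr p pt' i) v')"
  proof (rule sum.cong[OF refl])
    fix i assume "i \<in> {..<p}"
    then have i: "i < p" by simp
    have "b (poly (lagr p pt i) v) = poly (lagr p pt' i) v'"
      using poly_hom[OF S b lS[OF i] v(1)] lagr_hom[OF S b pt i] v(2) by simp
    then show "b ((a ^^ i) z * poly (lagr p pt i) v) = (a' ^^ i) (b z) * poly (lagr p pt' i) v'"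
      using hom_mult[OF S b _ vl[OF i]] az by simp
  qed
  finally show ?thesis by (simp add: twist_altdef)
qed

section \<open>Constants and lowest coefficients of Laurent series\<close>

lemma fls_const_hom: "hom_on UNIV fls_const"
  by (simp add: hom_on_def fls_plus_const fls_const_mult_const)

lemma fls_const_inj: "fls_const c = fls_const d \<longleftrightarrow> c = d"
  by (metis fls_const_nth)

lemma fls_const_inverse: "fls_const (inverse c) = inverse (fls_const (c :: 'a::field))"
  using hom_inverse[OF subring_of_UNIV fls_const_hom, of c] by simp

lemma fls_const_diff: "fls_const (c - d) = fls_const c - fls_const (d :: 'a::field)"
  using hom_diff[OF subring_of_UNIV fls_const_hom, of c d] by simp

lemma polys_UNIV [simp]: "polys UNIV = UNIV"
  by (simp add: polys_def)

lemma nodal_const: "nodal p (\<lambda>i. fls_const (pt i)) = map_poly fls_const (nodal p (pt :: nat \<Rightarrow> 'a::field))"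
proof -
  note h = subring_of_UNIV fls_const_hom
  have "map_poly fls_const (nodal p pt) = (\<Prod>i<p. map_poly fls_const [:- pt i, 1:])"
    unfolding nodal_def by (rule hom_poly_prod[OF h]) simp
  also have "\<dots> = nodal p (\<lambda>i. fls_const (pt i))"
    unfolding nodal_def by (intro prod.cong) (simp_all add: hom_poly_pCons[OF h] hom_uminus[OF h])
  finally show ?thesis ..
qed

text \<open>With bounds on the supports instead of subdegrees, the lowest coefficients may
  vanish.\<close>

lemma lead_coeff_mult_fls:
  fixes f g :: "'a::field fls"
  assumes "\<And>m. m < 0 \<Longrightarrow> f $$ m = 0" "\<And>m. m < n \<Longrightarrow> g $$ m = 0"
  shows "\<And>m. m < n \<Longrightarrow> (g * f) $$ m = 0" "(g * f) $$ n = g $$ n * f $$ 0"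
proof -
  have *: "(g * f) $$ m = (\<Sum>i\<in>{fls_subdegree g..m - fls_subdegree f} \<inter> {n..m}. g $$ i * f $$ (m - i))" for m
    unfolding fls_times_nth(2)
    by (rule sum.mono_neutral_right) (use assms in \<open>auto simp: not_le\<close>)
  show "(g * f) $$ m = 0" if "m < n" for m using that unfolding * by simp
  show "(g * f) $$ n = g $$ n * f $$ 0"
  proof (cases "n \<in> {fls_subdegree g..n - fls_subdegree f}")
    case True
    then have "{fls_subdegree g..n - fls_subdegree f} \<inter> {n..n} = {n}" by auto
    then show ?thesis unfolding * by simp
  next
    case False
    then have "g $$ n = 0 \<or> f $$ 0 = 0" by (auto simp: not_le)
    moreover have "{fls_subdegree g..n - fls_subdegree f} \<inter> {n..n} = {}" using False by auto
    ultimately show ?thesis unfolding * by auto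
  qed
qed

lemma poly_const_coeff_fls:
  fixes q :: "'a::field poly" and v :: "'a fls"
  assumes "\<And>m. m < 0 \<Longrightarrow> v $$ m = 0"
  shows "(\<forall>m<0. poly (map_poly fls_const q) v $$ m = 0) \<and> poly (map_poly fls_const q) v $$ 0 = poly q (v $$ 0)"
proof (induction q)
  case (pCons a q)
  note * = lead_coeff_mult_fls[of "poly (map_poly fls_const q) v" 0 v]
  have "(v * poly (map_poly fls_const q) v) $$ m = 0" if "m < 0" for m
    using *(1)[OF _ assms that] pCons.IH by blast
  moreover have "(v * poly (map_poly fls_const q) v) $$ 0 = v $$ 0 * poly q (v $$ 0)"
    using *(2)[OF _ assms] pCons.IH by simp
  ultimately show ?case by (simp add: hom_poly_pCons[OF subring_of_UNIV fls_const_hom])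
qed simp

section \<open>Twisting by a family of commuting automorphisms\<close>

text \<open>\<open>el_perm\<close> says that \<open>el\<close> is equivariant for conjugation, and
  together with \<open>perm_el\<close> that the automorphisms \<open>el c\<close> commute. Nodes
  depend on \<open>c\<close> because the group moves them. The series start at the first node, where
  a twist is the identity.\<close>

locale twist_family = ring_action G M act
  for G :: "('i, 'm) monoid_scheme" (structure) and M :: "'a::field set" and act +
  fixes k :: "'a set" and C :: "'c set" and perm :: "'i \<Rightarrow> 'c \<Rightarrow> 'c" and el :: "'c \<Rightarrow> 'i"
    and pts :: "'c \<Rightarrow> nat \<Rightarrow> 'a" and sh :: "'c \<Rightarrow> 'a poly" and v :: "'c \<Rightarrow> 'a fls" and p :: nat
  assumes M: "subfield_of M" and k: "fixed = k"
    and C: "finite C" and perm_in: "\<And>g c. g \<in> carrier G \<Longrightarrow> c \<in> C \<Longrightarrow> perm g c \<in> C"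
    and perm_inj: "\<And>g. g \<in> carrier G \<Longrightarrow> inj_on (perm g) C"
    and el: "\<And>c. c \<in> C \<Longrightarrow> el c \<in> carrier G"
    and el_perm: "\<And>g c. g \<in> carrier G \<Longrightarrow> c \<in> C \<Longrightarrow> g \<otimes> el c = el (perm g c) \<otimes> g"
    and perm_el: "\<And>c d. c \<in> C \<Longrightarrow> d \<in> C \<Longrightarrow> perm (el c) d = d"
    and el_pow: "\<And>c. c \<in> C \<Longrightarrow> el c [^] p = \<one>" and p: "p > 0"
    and pts: "\<And>c i. c \<in> C \<Longrightarrow> i < p \<Longrightarrow> pts c i \<in> M" "\<And>c. c \<in> C \<Longrightarrow> inj_on (pts c) {..<p}"
      "\<And>g c i. g \<in> carrier G \<Longrightarrow> c \<in> C \<Longrightarrow> i < p \<Longrightarrow> act g (pts c i) = pts (perm g c) i"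
    and sh: "\<And>c. c \<in> C \<Longrightarrow> sh c \<in> polys M" "\<And>c. c \<in> C \<Longrightarrow> degree (sh c) = 1"
      "\<And>c i. c \<in> C \<Longrightarrow> i < p \<Longrightarrow> poly (sh c) (pts c i) = pts c (Suc i mod p)"
      "\<And>c. c \<in> C \<Longrightarrow> pcompose (nodal p (pts c)) (sh c) = nodal p (pts c)"
    and v: "\<And>c. c \<in> C \<Longrightarrow> v c \<in> ser M" "\<And>c n. c \<in> C \<Longrightarrow> n < 0 \<Longrightarrow> v c $$ n = 0"
      "\<And>c. c \<in> C \<Longrightarrow> v c $$ 0 = pts c 0"
      "\<And>g c. g \<in> carrier G \<Longrightarrow> c \<in> C \<Longrightarrow> ser_map (act g) (v c) = v (perm g c)"
    and w: "\<And>c. c \<in> C \<Longrightarrow> poly (nodal p (\<lambda>i. fls_const (pts c i))) (v c) \<in> ratx M k"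
begin

sublocale ser: ring_action G "ser M" "\<lambda>g. ser_map (act g)"
  by (rule ser_action[OF ring_action_axioms M])

abbreviation sact :: "'i \<Rightarrow> 'a fls \<Rightarrow> 'a fls"
  where "sact g \<equiv> ser_map (act g)"

definition tw :: "'c \<Rightarrow> 'a fls \<Rightarrow> 'a fls"
  where "tw c = twist p (\<lambda>i. fls_const (pts c i)) (sact (el c)) (v c)"

text \<open>The scalars of the construction: each twist fixes them and is linear over them.\<close>

definition good :: "'a fls \<Rightarrow> bool"
  where "good x \<longleftrightarrow> x \<in> ser M \<and> (\<forall>c\<in>C. sact (el c) x = x)"

lemma sact_const: "g \<in> carrier G \<Longrightarrow> sact g (fls_const c) = fls_const (act g c)"
  by (rule ser_map_const[OF M hom])

lemma const_ser: "fls_const c \<in> ser M \<longleftrightarrow> c \<in> M"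
  by (rule ser_const[OF subring_0[OF S]])

lemma sact_pow:
  assumes "a \<in> carrier G" "x \<in> ser M" shows "(sact a ^^ n) x = sact (a [^] n) x"
proof (induction n)
  case (Suc n)
  have "sact (a [^] Suc n) x = sact a (sact (a [^] n) x)"
    using assms by (subst nat_pow_Suc2) (simp_all add: ser.act_mult)
  then show ?case using Suc by simp
qed (simp add: ser.act_one assms)

lemma pts_good: "c \<in> C \<Longrightarrow> i < p \<Longrightarrow> good (fls_const (pts c i))"
  by (simp add: good_def const_ser pts(1) sact_const el pts(3) perm_el)

lemma v_good: "c \<in> C \<Longrightarrow> good (v c)"
  by (simp add: good_def v(1,4) el perm_el)

lemma good_subring: "subring_of {x. good x}"
  using ser.S ser.hom[OF el] by (auto simp: good_def subring_of_def hom_1[OF ser.S ser.hom[OF el]] hom_diff[OF ser.S ser.hom[OF el]] hom_mult[OF ser.S ser.hom[OF el]])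

lemma good_subfield: "subfield_of {x. good x}"
  using good_subring subfield_inverse[OF ser_subfield[OF M]] by (auto simp: subfield_of_def good_def hom_inverse[OF ser.S ser.hom[OF el]])

lemma pts_diff_good: "c \<in> C \<Longrightarrow> i < p \<Longrightarrow> j < p \<Longrightarrow> good (inverse (fls_const (pts c i) - fls_const (pts c j)))"
  using subfield_inverse[OF good_subfield] subring_diff[OF good_subring] pts_good by blast

lemma step:
  assumes c: "c \<in> C"
  shows "twist_step (ser M) (sact (el c)) p (\<lambda>i. fls_const (pts c i)) (map_poly fls_const (sh c)) (v c)"
proof
  note h = subring_of_UNIV fls_const_hom
  note ec = el[OF c]
  show "subring_of (ser M)" by (rule ser.S)
  show "hom_on (ser M) (sact (el c))" by (rule ser.hom[OF ec])
  show "sact (el c) x \<in> ser M" if "x \<in> ser M" for x by (rule ser.act_in[OF ec that])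
  show "(sact (el c) ^^ p) x = x" if "x \<in> ser M" for x
    using that by (simp add: sact_pow ec el_pow c ser.act_one)
  show "p > 0" by (rule p)
  show "inj_on (\<lambda>i. fls_const (pts c i)) {..<p}"
  proof (rule inj_onI)
    fix i j assume "i \<in> {..<p}" "j \<in> {..<p}" "fls_const (pts c i) = fls_const (pts c j)"
    then show "i = j" using pts(2)[OF c] by (simp add: inj_on_def fls_const_inj)
  qed
  show "fls_const (pts c i) \<in> ser M" "sact (el c) (fls_const (pts c i)) = fls_const (pts c i)" if "i < p" for i
    using pts_good[OF c that] c by (auto simp: good_def)
  show "inverse (fls_const (pts c i) - fls_const (pts c j)) \<in> ser M" if "i < p" "j < p" for i j
    using pts_diff_good[OF c that] by (simp add: good_def)
  show "v c \<in> ser M" "sact (el c) (v c) = v c" using v_good[OF c] c by (auto simp: good_def)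
  show "map_poly fls_const (sh c) \<in> polys (ser M)"
    using sh(1)[OF c] by (auto simp: polys_def coeff_hom_poly[OF h] const_ser)
  show "degree (map_poly fls_const (sh c)) = 1"
    using sh(2)[OF c] degree_map_poly[of fls_const "sh c"] leading_coeff_0_iff[of "sh c"] by simp
  show "poly (map_poly fls_const (sh c)) (fls_const (pts c i)) = fls_const (pts c (Suc i mod p))" if "i < p" for i
    using poly_hom[OF h, of "sh c" "pts c i"] sh(3)[OF c that] by simp
  show "pcompose (nodal p (\<lambda>i. fls_const (pts c i))) (map_poly fls_const (sh c)) = nodal p (\<lambda>i. fls_const (pts c i))"
    unfolding nodal_const using hom_poly_pcompose[OF h, of "nodal p (pts c)" "sh c"] sh(4)[OF c] by simp
qed

lemma tw_in: "c \<in> C \<Longrightarrow> x \<in> ser M \<Longrightarrow> tw c x \<in> ser M"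
  unfolding tw_def by (rule twist_step.twist_in[OF step])

lemma tw_add: "c \<in> C \<Longrightarrow> x \<in> ser M \<Longrightarrow> y \<in> ser M \<Longrightarrow> tw c (x + y) = tw c x + tw c y"
  unfolding tw_def by (rule twist_step.twist_add[OF step])

lemma tw_scale: "c \<in> C \<Longrightarrow> good y \<Longrightarrow> x \<in> ser M \<Longrightarrow> tw c (y * x) = y * tw c x"
  unfolding tw_def by (rule twist_step.twist_scale[OF step]) (auto simp: good_def)

lemma tw_good: "c \<in> C \<Longrightarrow> good x \<Longrightarrow> tw c x = x"
  unfolding tw_def by (rule twist_step.twist_fixed[OF step]) (auto simp: good_def)

lemma tw_act:
  assumes g: "g \<in> carrier G" and c: "c \<in> C" and x: "x \<in> ser M"
  shows "sact g (tw c x) = tw (perm g c) (sact g x)"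
  unfolding tw_def
proof (rule twist_hom[OF ser.S ser.hom[OF g]])
  show "fls_const (pts c i) \<in> ser M" "sact g (fls_const (pts c i)) = fls_const (pts (perm g c) i)" if "i < p" for i
    using pts(1)[OF c that] pts(3)[OF g c that] by (simp_all add: const_ser sact_const g)
  show "inverse (fls_const (pts c i) - fls_const (pts c j)) \<in> ser M" if "i < p" "j < p" for i j
    using pts_diff_good[OF c that] by (simp add: good_def)
  show "v c \<in> ser M" "sact g (v c) = v (perm g c)" using v c g by auto
  show "sact (el c) y \<in> ser M" if "y \<in> ser M" for y by (rule ser.act_in[OF el[OF c] that])
  show "sact g (sact (el c) y) = sact (el (perm g c)) (sact g y)" if "y \<in> ser M" for y
    using el_perm[OF g c] ser.act_mult[OF g el[OF c] that] ser.act_mult[OF el[OF perm_in[OF g c]] g that] by simp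
qed (rule x)

text \<open>Since \<open>v c\<close> starts with the first node, the Lagrange polynomials evaluated
  at it start with 1 for \<open>i = 0\<close> and with 0 otherwise. Injectivity of the twists and
  their value at $X = 0$ both rest on this.\<close>

lemma tw_lead:
  assumes c: "c \<in> C" and x: "x \<in> ser M" "\<And>m. m < n \<Longrightarrow> x $$ m = 0"
  shows "\<And>m. m < n \<Longrightarrow> tw c x $$ m = 0" "tw c x $$ n = x $$ n"
proof -
  have l: "lagr p (\<lambda>i. fls_const (pts c i)) i = map_poly fls_const (lagr p (pts c) i)" if "i < p" for i
    using lagr_hom[OF subring_of_UNIV fls_const_hom, of p "pts c" "\<lambda>i. fls_const (pts c i)" i] that by simp
  have g: "(\<forall>m<0. poly (lagr p (\<lambda>i. fls_const (pts c i)) i) (v c) $$ m = 0)"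
    "poly (lagr p (\<lambda>i. fls_const (pts c i)) i) (v c) $$ 0 = (if i = 0 then 1 else 0)" if "i < p" for i
    using poly_const_coeff_fls[of "v c" "lagr p (pts c) i"] v(2,3)[OF c] lagr_eval[OF pts(2)[OF c] that p]
    by (simp_all add: l[OF that])
  have a: "(sact (el c) ^^ i) x $$ m = 0" if "m < n" for m i
    using that x by (simp add: sact_pow el c ser_map_nth'[OF M hom] hom_0[OF S hom])
  note lm = lead_coeff_mult_fls[of "poly (lagr p (\<lambda>i. fls_const (pts c i)) _) (v c)" n "(sact (el c) ^^ _) x"]
  show "tw c x $$ m = 0" if "m < n" for m
    unfolding tw_def twist_altdef fls_nth_sum
    by (rule sum.neutral) (use lm(1)[OF _ a that] g(1) in auto)
  have "tw c x $$ n = (\<Sum>i<p. (sact (el c) ^^ i) x $$ n * (if i = 0 then 1 else 0))"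
    unfolding tw_def twist_altdef fls_nth_sum
    by (rule sum.cong[OF refl]) (use lm(2)[OF _ a] g in auto)
  also have "\<dots> = (\<Sum>i<p. if i = 0 then x $$ n else 0)" by (rule sum.cong) auto
  also have "\<dots> = x $$ n" using p by simp
  finally show "tw c x $$ n = x $$ n" .
qed

lemma tw_sum: "c \<in> C \<Longrightarrow> (\<And>i. i \<in> I \<Longrightarrow> f i \<in> ser M) \<Longrightarrow> tw c (sum f I) = (\<Sum>i\<in>I. tw c (f i))"
proof (induction I rule: infinite_finite_induct)
  case (insert i I)
  then show ?case using tw_add[of c "f i" "sum f I"] subring_sum[OF ser.S, of I f] by simp
qed (auto simp: tw_good good_def ser.fixedD hom_0[OF ser.S ser.hom[OF el]] subring_0[OF ser.S])

text \<open>The Lagrange coefficients of one twist are scalars for the other, and the other twist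
  commutes with \<open>el c\<close> by \<open>tw_act\<close>, because \<open>el c\<close> fixes all
  indices.\<close>

lemma tw_comm:
  assumes c: "c \<in> C" and d: "d \<in> C" and x: "x \<in> ser M"
  shows "tw d (tw c x) = tw c (tw d x)"
proof -
  define \<gamma> where "\<gamma> i = poly (lagr p (\<lambda>i. fls_const (pts c i)) i) (v c)" for i
  have \<gamma>: "good (\<gamma> i)" if "i < p" for i
  proof -
    have "lagr p (\<lambda>i. fls_const (pts c i)) i \<in> polys {x. good x}"
      using twist_step.lagr_polys[OF step[OF c] good_subring, of i] pts_good[OF c] pts_diff_good[OF c] that by simp
    then show ?thesis using poly_in[OF good_subring _, of _ "v c"] v_good[OF c] by (simp add: \<gamma>_def)
  qed
  have a: "(sact (el c) ^^ i) y \<in> ser M" if "y \<in> ser M" for i y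
    using that by (simp add: sact_pow el c ser.act_in)
  have comm: "tw d ((sact (el c) ^^ i) x) = (sact (el c) ^^ i) (tw d x)" for i
  proof (induction i)
    case (Suc i)
    have "tw d (sact (el c) ((sact (el c) ^^ i) x)) = sact (el c) (tw d ((sact (el c) ^^ i) x))"
      using tw_act[OF el[OF c] d a[OF x]] perm_el[OF c d] by simp
    then show ?case using Suc by simp
  qed simp
  have "tw d (tw c x) = tw d (\<Sum>i<p. \<gamma> i * (sact (el c) ^^ i) x)"
    by (simp add: tw_def[of c] twist_altdef \<gamma>_def mult.commute)
  also have "\<dots> = (\<Sum>i<p. tw d (\<gamma> i * (sact (el c) ^^ i) x))"
    by (rule tw_sum[OF d]) (use \<gamma> a x in \<open>auto simp: good_def intro: subring_mult[OF ser.S]\<close>)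
  also have "\<dots> = (\<Sum>i<p. \<gamma> i * (sact (el c) ^^ i) (tw d x))"
    by (rule sum.cong[OF refl]) (simp add: tw_scale[OF d \<gamma> a[OF x]] comm)
  also have "\<dots> = tw c (tw d x)" by (simp add: tw_def[of c] twist_altdef \<gamma>_def mult.commute)
  finally show ?thesis .
qed

lemma fold_tw_in: "set cs \<subseteq> C \<Longrightarrow> x \<in> ser M \<Longrightarrow> fold tw cs x \<in> ser M"
  by (induction cs arbitrary: x) (auto simp: tw_in)

lemma fold_tw_add: "set cs \<subseteq> C \<Longrightarrow> x \<in> ser M \<Longrightarrow> y \<in> ser M \<Longrightarrow> fold tw cs (x + y) = fold tw cs x + fold tw cs y"
  by (induction cs arbitrary: x y) (auto simp: tw_in tw_add)

lemma fold_tw_scale: "set cs \<subseteq> C \<Longrightarrow> good y \<Longrightarrow> x \<in> ser M \<Longrightarrow> fold tw cs (y * x) = y * fold tw cs x"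
  by (induction cs arbitrary: x) (auto simp: tw_in tw_scale)

lemma fold_tw_good: "set cs \<subseteq> C \<Longrightarrow> good x \<Longrightarrow> fold tw cs x = x"
  by (induction cs) (auto simp: tw_good)

lemma good_uminus_one: "good (- 1)"
  using subring_uminus[OF good_subring] subring_1[OF good_subring] by blast

lemma fold_tw_diff: "set cs \<subseteq> C \<Longrightarrow> x \<in> ser M \<Longrightarrow> y \<in> ser M \<Longrightarrow> fold tw cs (x - y) = fold tw cs x - fold tw cs y"
  using fold_tw_add[of cs x "- 1 * y"] fold_tw_scale[OF _ good_uminus_one, of cs y] subring_uminus[OF ser.S, of y] by simp

lemma fold_tw_lead:
  "set cs \<subseteq> C \<Longrightarrow> x \<in> ser M \<Longrightarrow> (\<And>m. m < n \<Longrightarrow> x $$ m = 0) \<Longrightarrow>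
    (\<forall>m<n. fold tw cs x $$ m = 0) \<and> fold tw cs x $$ n = x $$ n"
proof (induction cs arbitrary: x)
  case (Cons c cs)
  then have c: "c \<in> C" by simp
  show ?case using Cons.IH[of "tw c x"] Cons.prems tw_lead[OF c Cons.prems(2,3)] tw_in[OF c] by simp
qed simp

lemma fold_tw_act:
  "set cs \<subseteq> C \<Longrightarrow> g \<in> carrier G \<Longrightarrow> x \<in> ser M \<Longrightarrow> sact g (fold tw cs x) = fold tw (map (perm g) cs) (sact g x)"
  by (induction cs arbitrary: x) (auto simp: tw_act tw_in)

lemma ratx_act:
  assumes "g \<in> carrier G" "x \<in> ratx M k" shows "sact g x \<in> ratx M k"
proof -
  obtain a b where *: "a \<in> polys M" "b \<in> polys k" "b \<noteq> 0" "x = fls_of_poly a / fls_of_poly b"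
    using assms(2) by (rule ratxE)
  have bM: "b \<in> polys M" using *(2) k polys_mono[of k M] fixedD(1) by blast
  have "map_poly (act g) b = b"
    using *(2) k fixedD(2) assms(1) by (intro poly_eqI) (auto simp: coeff_hom_poly[OF S hom] polys_def)
  then have "sact g x = fls_of_poly (map_poly (act g) a) / fls_of_poly b"
    using ser_map_ratx[OF M hom[OF assms(1)] *(1) bM] *(4) by simp
  then show ?thesis using * polys_act[OF assms(1) *(1)] by (simp add: ratxI)
qed

lemma k_sub: "k \<subseteq> M" and k_subfield: "subfield_of k"
  using k fixedD(1) fixed_subfield[OF M] by auto

lemma R0: "subring_of (ratx M k)" "ratx M k \<subseteq> ser M"
  using ratx_subring[OF S subfield_ring[OF k_subfield] k_sub] ratx_ser[OF M k_sub] by auto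

text \<open>The last twist is split off. The image \<open>R\<close> of the previous ones is a ring
  by induction, is stable under \<open>el c\<close>, and contains the nodes, the inverses of their
  differences and the nodal value at \<open>v c\<close>; so the error term of
  \<open>twist_mult\<close> stays in \<open>R\<close> and is again an image.\<close>

lemma fold_tw_mult:
  "set cs \<subseteq> C \<Longrightarrow> x \<in> ratx M k \<Longrightarrow> y \<in> ratx M k \<Longrightarrow>
    \<exists>z\<in>ratx M k. fold tw cs x * fold tw cs y = fold tw cs z"
proof (induction cs arbitrary: x y rule: rev_induct)
  case Nil
  then show ?case using subring_mult[OF R0(1)] by auto
next
  case (snoc c cs)
  let ?f = "fold tw cs"
  define R where "R = ?f ` ratx M k"
  have c: "c \<in> C" and cs: "set cs \<subseteq> C" using snoc.prems by auto
  have fixR: "z \<in> R" if "z \<in> ratx M k" "good z" for z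
    using fold_tw_good[OF cs that(2)] that(1) unfolding R_def by force
  have cM: "fls_const u \<in> ratx M k" if "u \<in> M" for u
    by (rule ratx_const[OF subfield_ring[OF k_subfield] S that])
  have R: "subring_of R"
    unfolding subring_of_def
  proof (intro conjI ballI)
    show "1 \<in> R" using fixR[OF subring_1[OF R0(1)]] subring_1[OF good_subring] by simp
    fix a b assume "a \<in> R" "b \<in> R"
    then obtain a' b' where ab: "a' \<in> ratx M k" "b' \<in> ratx M k" "a = ?f a'" "b = ?f b'" unfolding R_def by auto
    have "a' \<in> ser M" "b' \<in> ser M" using ab R0(2) by auto
    then have "a - b = ?f (a' - b')" using fold_tw_diff[OF cs] ab by simp
    then show "a - b \<in> R" using subring_diff[OF R0(1)] ab unfolding R_def by blast
    show "a * b \<in> R" using snoc.IH[OF cs ab(1,2)] ab unfolding R_def by auto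
  qed
  have RS: "R \<subseteq> ser M" unfolding R_def using fold_tw_in[OF cs] R0(2) by auto
  have pR: "fls_const (pts c i) \<in> R" if "i < p" for i
    using fixR[OF cM pts_good[OF c that]] pts(1)[OF c that] by simp
  have dR: "inverse (fls_const (pts c i) - fls_const (pts c j)) \<in> R" if "i < p" "j < p" for i j
  proof -
    have "inverse (fls_const (pts c i) - fls_const (pts c j)) = fls_const (inverse (pts c i - pts c j))"
      by (simp add: fls_const_inverse fls_const_diff)
    moreover have "inverse (pts c i - pts c j) \<in> M"
      using subfield_inverse[OF M] subring_diff[OF S] pts(1)[OF c] that by blast
    ultimately show ?thesis using fixR[OF _ pts_diff_good[OF c that]] cM by simp
  qed
  have aR: "sact (el c) z \<in> R" if z: "z \<in> R" for z
  proof -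
    obtain z' where z': "z' \<in> ratx M k" "z = ?f z'" using z unfolding R_def by auto
    \<comment> \<open>\<open>el c\<close> fixes every index, so it commutes with the composite of
      the previous twists.\<close>
    have "map (perm (el c)) cs = cs" by (rule map_idI) (use perm_el c cs in auto)
    then have "sact (el c) z = ?f (sact (el c) z')" using fold_tw_act[OF cs el[OF c]] z' R0(2) by auto
    then show ?thesis using ratx_act[OF el[OF c] z'(1)] unfolding R_def by blast
  qed
  have fx: "?f x \<in> R" "?f y \<in> R" using snoc.prems unfolding R_def by auto
  obtain h where h: "h \<in> R" "tw c (?f x) * tw c (?f y) =
      tw c (?f x * ?f y + poly (nodal p (\<lambda>i. fls_const (pts c i))) (v c) * h)"
    using twist_step.twist_mult[OF step[OF c] R RS pR dR aR fx] unfolding tw_def by blast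
  have "good (poly (nodal p (\<lambda>i. fls_const (pts c i))) (v c))"
  proof -
    have "nodal p (\<lambda>i. fls_const (pts c i)) \<in> polys {x. good x}" unfolding nodal_def
      using pts_good[OF c] subring_uminus[OF good_subring] subring_simps(1,2)[OF good_subring]
      by (intro polys_prod[OF good_subring]) (auto simp: polys_pCons_iff[OF good_subring] polys_0[OF good_subring])
    then show ?thesis using poly_in[OF good_subring _, of _ "v c"] v_good[OF c] by simp
  qed
  then have "poly (nodal p (\<lambda>i. fls_const (pts c i))) (v c) \<in> R" by (rule fixR[OF w[OF c]])
  then have "?f x * ?f y + poly (nodal p (\<lambda>i. fls_const (pts c i))) (v c) * h \<in> R"
    using h(1) fx by (intro subring_add[OF R] subring_mult[OF R])
  then show ?case using h(2) unfolding R_def by auto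
qed

text \<open>Any enumeration serves, as the twists commute.\<close>

definition cs :: "'c list"
  where "cs = (SOME cs. set cs = C \<and> distinct cs)"

lemma cs: "set cs = C" "distinct cs"
  using someI_ex[OF finite_distinct_list[OF C]] by (auto simp: cs_def)

definition Tw :: "'a fls \<Rightarrow> 'a fls"
  where "Tw = fold tw cs"

lemma Tw_in: "x \<in> ser M \<Longrightarrow> Tw x \<in> ser M"
  and Tw_add: "x \<in> ser M \<Longrightarrow> y \<in> ser M \<Longrightarrow> Tw (x + y) = Tw x + Tw y"
  and Tw_diff: "x \<in> ser M \<Longrightarrow> y \<in> ser M \<Longrightarrow> Tw (x - y) = Tw x - Tw y"
  and Tw_scale: "good y \<Longrightarrow> x \<in> ser M \<Longrightarrow> Tw (y * x) = y * Tw x"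
  and Tw_good: "good x \<Longrightarrow> Tw x = x"
  and Tw_mult: "x \<in> ratx M k \<Longrightarrow> y \<in> ratx M k \<Longrightarrow> \<exists>z\<in>ratx M k. Tw x * Tw y = Tw z"
  unfolding Tw_def using fold_tw_in fold_tw_add fold_tw_diff fold_tw_scale fold_tw_good fold_tw_mult cs(1) by auto

lemma Tw_lead:
  assumes "x \<in> ser M" "\<And>m. m < n \<Longrightarrow> x $$ m = 0"
  shows "\<And>m. m < n \<Longrightarrow> Tw x $$ m = 0" "Tw x $$ n = x $$ n"
  using fold_tw_lead[of cs x n] assms cs(1) by (auto simp: Tw_def)

lemma Tw_eq_0:
  assumes "x \<in> ser M" "Tw x = 0" shows "x = 0"
proof (rule ccontr)
  assume "x \<noteq> 0"
  then have "x $$ fls_subdegree x \<noteq> 0" by simp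
  then show False using Tw_lead(2)[OF assms(1), of "fls_subdegree x"] assms(2) by simp
qed

lemma Tw_inj: "x \<in> ser M \<Longrightarrow> y \<in> ser M \<Longrightarrow> Tw x = Tw y \<Longrightarrow> x = y"
  using Tw_eq_0[of "x - y"] Tw_diff[of x y] subring_diff[OF ser.S] by simp

text \<open>A group element turns the composite along \<open>cs\<close> into the one along a
  permuted list, and commutation restores the order.\<close>

lemma Tw_act:
  assumes g: "g \<in> carrier G" and x: "x \<in> ser M" shows "sact g (Tw x) = Tw (sact g x)"
proof -
  have "sact g (Tw x) = fold tw (map (perm g) cs) (sact g x)"
    unfolding Tw_def using fold_tw_act[OF _ g x] cs(1) by simp
  also have "\<dots> = fold tw cs (sact g x)"
  proof (rule fold_permuted_eq[where P = "\<lambda>z. z \<in> ser M"])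
    have "perm g ` C = C" using perm_in[OF g] perm_inj[OF g] C by (intro endo_inj_surj) auto
    then show "mset (map (perm g) cs) = mset cs"
      using cs perm_inj[OF g] by (subst set_eq_iff_mset_eq_distinct[symmetric]) (auto simp: distinct_map)
    show "sact g x \<in> ser M" by (rule ser.act_in[OF g x])
    show "tw c z \<in> ser M" if "c \<in> set (map (perm g) cs)" "z \<in> ser M" for c z
      using that perm_in[OF g] cs(1) by (auto intro: tw_in)
    show "tw c (tw d z) = tw d (tw c z)" if "c \<in> set (map (perm g) cs)" "d \<in> set (map (perm g) cs)" "z \<in> ser M" for c d z
      using that perm_in[OF g] cs(1) by (auto intro: tw_comm)
  qed
  finally show ?thesis by (simp add: Tw_def)
qed

end

text \<open>\<open>M\<close> is auxiliary: it supplies the nodes, while the new field must descend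
  to \<open>F\<close>. The assumption \<open>F_fixed\<close> makes \<open>F\<close> the fixed field
  of its pointwise stabilizer.\<close>

locale twist_descent = twist_family G M act k C perm el pts sh v p
  for G :: "('i, 'm) monoid_scheme" (structure) and M :: "'a::field set" and act k
    and C :: "'c set" and perm el pts sh v p +
  fixes F :: "'a set"
  assumes F: "subfield_of F" "F \<subseteq> M" "k \<subseteq> F"
    and F_act: "\<And>g x. g \<in> carrier G \<Longrightarrow> x \<in> F \<Longrightarrow> act g x \<in> F"
    and F_fixed: "\<And>x. x \<in> M \<Longrightarrow> (\<And>g. g \<in> carrier G \<Longrightarrow> (\<And>y. y \<in> F \<Longrightarrow> act g y = y) \<Longrightarrow> act g x = x) \<Longrightarrow> x \<in> F"
begin

definition E :: "'a fls set"
  where "E = Tw ` ratx F k"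

lemma FR: "ratx F k \<subseteq> ratx M k" "ratx F k \<subseteq> ser M"
  using ratx_mono[OF F(2) order_refl, of k] R0 by auto

text \<open>The denominators have coefficients in \<open>k\<close> and do not move, so invariance of
  the fraction is invariance of the coefficients of the numerator.\<close>

lemma ratx_fixed_coeffs:
  assumes x: "x \<in> ratx M k" and H: "H \<subseteq> carrier G" "\<And>g. g \<in> H \<Longrightarrow> sact g x = x"
    and L: "\<And>y. y \<in> M \<Longrightarrow> (\<And>g. g \<in> H \<Longrightarrow> act g y = y) \<Longrightarrow> y \<in> L"
  shows "x \<in> ratx L k"
proof -
  obtain a b where *: "a \<in> polys M" "b \<in> polys k" "b \<noteq> 0" "x = fls_of_poly a / fls_of_poly b"
    using x by (rule ratxE)
  have bM: "b \<in> polys M" using *(2) polys_mono[OF k_sub] by blast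
  have "poly.coeff a i \<in> L" for i
  proof (rule L)
    show "poly.coeff a i \<in> M" using *(1) by (simp add: polys_def)
    fix g assume g: "g \<in> H"
    then have gG: "g \<in> carrier G" using H(1) by auto
    have "map_poly (act g) b = b"
      using *(2) k fixedD(2)[OF _ gG] by (intro poly_eqI) (auto simp: coeff_hom_poly[OF S hom[OF gG]] polys_def)
    then have "fls_of_poly (map_poly (act g) a) / fls_of_poly b = fls_of_poly a / fls_of_poly b"
      using ser_map_ratx[OF M hom[OF gG] *(1) bM] *(4) H(2)[OF g] by simp
    then have "map_poly (act g) a = a" using *(3) by (simp add: fls_of_poly_inj)
    then show "act g (poly.coeff a i) = poly.coeff a i" using coeff_hom_poly[OF S hom[OF gG], of a i] by simp
  qed
  then show ?thesis using * by (auto intro!: ratxI simp: polys_def)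
qed

lemma E_subring: "subring_of E"
  unfolding subring_of_def
proof (intro conjI ballI)
  note RF = ratx_subring[OF subfield_ring[OF F(1)] subfield_ring[OF k_subfield] F(3)]
  show "1 \<in> E" unfolding E_def using Tw_good[of 1] subring_1[OF good_subring] subring_1[OF RF] by force
  fix x y assume "x \<in> E" "y \<in> E"
  then obtain x' y' where *: "x' \<in> ratx F k" "y' \<in> ratx F k" "x = Tw x'" "y = Tw y'" unfolding E_def by auto
  then have S': "x' \<in> ser M" "y' \<in> ser M" using FR by auto
  show "x - y \<in> E" using Tw_diff[OF S'] * subring_diff[OF RF] unfolding E_def by (metis image_eqI)
  obtain z where z: "z \<in> ratx M k" "x * y = Tw z" using Tw_mult[of x' y'] * FR by auto
  \<comment> \<open>Closure under products is known over \<open>M\<close> only. The pointwise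
    stabilizer of \<open>F\<close> fixes the product, hence also its untwisted form \<open>z\<close>
    by injectivity of \<open>Tw\<close>.\<close>
  have "z \<in> ratx F k"
  proof (rule ratx_fixed_coeffs[OF z(1), of "{g \<in> carrier G. \<forall>y\<in>F. act g y = y}"])
    fix g assume g: "g \<in> {g \<in> carrier G. \<forall>y\<in>F. act g y = y}"
    have triv: "sact g u = u" if "u \<in> ser F" for u
      using that g by (intro fls_eqI) (simp add: ser_map_nth'[OF M hom] ser_nth)
    have "x' \<in> ser F" "y' \<in> ser F" using *(1,2) ratx_ser[OF F(1,3)] by auto
    then have "sact g (x * y) = x * y"
      using * g hom_mult[OF ser.S ser.hom[of g]] Tw_in S' Tw_act triv by simp
    then have "Tw (sact g z) = Tw z" using z g Tw_act R0 by auto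
    then show "sact g z = z" using Tw_inj ser.act_in z g R0 by auto
  qed (use F_fixed in auto)
  then show "x * y \<in> E" using z unfolding E_def by auto
qed

lemma E_ser: "E \<subseteq> ser F"
proof
  fix e assume "e \<in> E"
  then obtain x where x: "x \<in> ratx F k" "e = Tw x" unfolding E_def by auto
  then have xM: "x \<in> ser M" "x \<in> ser F" using FR ratx_ser[OF F(1,3)] by auto
  have "e $$ n \<in> F" for n
  proof (rule F_fixed)
    show "e $$ n \<in> M" using Tw_in[OF xM(1)] x by (simp add: ser_nth)
    fix g assume g: "g \<in> carrier G" "\<And>y. y \<in> F \<Longrightarrow> act g y = y"
    have "sact g x = x" using xM g by (intro fls_eqI) (simp add: ser_map_nth'[OF M hom] ser_nth)
    then have "sact g e = e" using Tw_act[OF g(1) xM(1)] x by simp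
    then show "act g (e $$ n) = e $$ n" using ser_map_nth'[OF M hom[OF g(1)], of e n] by simp
  qed
  then show "e \<in> ser F" by (simp add: ser_def)
qed

lemma E_base: "ratx k k \<subseteq> E"
proof
  fix x assume x: "x \<in> ratx k k"
  have xs: "x \<in> ser k" using x ratx_ser[OF k_subfield order_refl] by auto
  then have "sact g x = x" if "g \<in> carrier G" for g
    using that k fixedD by (intro fls_eqI) (auto simp: ser_map_nth'[OF M hom] ser_def)
  then have "good x" using xs ser_mono[OF k_sub] el by (auto simp: good_def)
  then show "x \<in> E" using Tw_good[of x] ratx_mono[OF F(3) order_refl, of k] x unfolding E_def by force
qed

lemma E_act: "g \<in> carrier G \<Longrightarrow> e \<in> E \<Longrightarrow> sact g e \<in> E"
proof -
  assume g: "g \<in> carrier G" and "e \<in> E"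
  then obtain x where x: "x \<in> ratx F k" "e = Tw x" unfolding E_def by auto
  obtain a b where *: "a \<in> polys F" "b \<in> polys k" "b \<noteq> 0" "x = fls_of_poly a / fls_of_poly b"
    using x(1) by (rule ratxE)
  have abM: "a \<in> polys M" "b \<in> polys M" using * polys_mono[OF k_sub] polys_mono[OF F(2)] by auto
  have "map_poly (act g) b = b"
    using *(2) k fixedD(2)[OF _ g] by (intro poly_eqI) (auto simp: coeff_hom_poly[OF S hom[OF g]] polys_def)
  then have "sact g x = fls_of_poly (map_poly (act g) a) / fls_of_poly b"
    using ser_map_ratx[OF M hom[OF g] abM] *(4) by simp
  moreover have "map_poly (act g) a \<in> polys F"
    using *(1) F_act[OF g] by (simp add: polys_def coeff_hom_poly[OF S hom[OF g]])
  ultimately have "sact g x \<in> ratx F k" using * by (simp add: ratxI)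
  then show ?thesis using Tw_act[OF g] x FR unfolding E_def by auto
qed

text \<open>As \<open>Tw\<close> is injective and equivariant, an invariant image has an invariant
  preimage, which is a rational function over \<open>k\<close> and is fixed by
  \<open>Tw\<close>.\<close>

lemma E_fixed:
  assumes "e \<in> E" "\<And>g. g \<in> carrier G \<Longrightarrow> sact g e = e" shows "e \<in> ratx k k"
proof -
  obtain x where x: "x \<in> ratx F k" "e = Tw x" using assms unfolding E_def by auto
  have xM: "x \<in> ratx M k" "x \<in> ser M" using x FR by auto
  have fx: "sact g x = x" if g: "g \<in> carrier G" for g
  proof (rule Tw_inj[OF ser.act_in[OF g xM(2)] xM(2)])
    show "Tw (sact g x) = Tw x" using Tw_act[OF g xM(2)] assms(2)[OF g] x(2) by simp
  qed
  have "x \<in> ratx k k"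
  proof (rule ratx_fixed_coeffs[OF xM(1) order_refl fx])
    show "y \<in> k" if "y \<in> M" "\<And>g. g \<in> carrier G \<Longrightarrow> act g y = y" for y
      using that unfolding k[symmetric] fixed_def by simp
  qed
  moreover have "good x" using fx xM(2) el by (simp add: good_def)
  ultimately show ?thesis using Tw_good x by simp
qed

end

section \<open>Comparison with the list-based polynomials\<close>

lemma Om_univ_poly_carrier: "l \<in> carrier (univ_poly \<Omega> K) \<longleftrightarrow> l = [] \<or> set l \<subseteq> K \<and> hd l \<noteq> (0 :: 'a::field)"
  by (simp add: univ_poly_def polynomial_def)

lemma Om_nat_pow [simp]: "x [^]\<^bsub>\<Omega>\<^esub> (n :: nat) = (x :: 'a::field) ^ n"
  by (induction n) (simp_all add: mult.commute)

text \<open>Lists in HOL-Algebra start with the leading coefficient, \<open>Poly\<close> with the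
  constant one; hence \<open>rev\<close> here and below.\<close>

lemma Om_eval: "ring.eval \<Omega> l x = poly (Poly (rev l)) (x :: 'a::field)"
  by (induction l) (simp_all add: Poly_append poly_monom mult.commute)

lemma Poly_polys: "subring_of K \<Longrightarrow> set l \<subseteq> K \<Longrightarrow> Poly l \<in> polys K"
  by (induction l) (auto simp: polys_0 polys_pCons_iff)

lemma Poly_rev_polys: "subring_of K \<Longrightarrow> set l \<subseteq> K \<Longrightarrow> Poly (rev l) \<in> polys K"
  by (rule Poly_polys) auto

lemma Poly_rev_degree: "l \<noteq> [] \<Longrightarrow> hd l \<noteq> 0 \<Longrightarrow> Poly (rev l) \<noteq> 0 \<and> degree (Poly (rev l)) = length l - 1 \<and> lead_coeff (Poly (rev l)) = hd l"
proof -
  assume l: "l \<noteq> []" "hd l \<noteq> 0"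
  have c: "poly.coeff (Poly (rev l)) i = (if i < length l then rev l ! i else 0)" for i
    by (simp add: nth_default_def)
  have h: "rev l ! (length l - 1) = hd l" using l(1) by (simp add: rev_nth hd_conv_nth)
  have "degree (Poly (rev l)) = length l - 1"
  proof (rule antisym)
    show "degree (Poly (rev l)) \<le> length l - 1" by (rule degree_le) (use c in auto)
    show "length l - 1 \<le> degree (Poly (rev l))" by (rule le_degree) (use c h l in auto)
  qed
  moreover have "poly.coeff (Poly (rev l)) (length l - 1) = hd l" using c h l(1) by simp
  moreover from this have "Poly (rev l) \<noteq> 0" using l(2) by (metis coeff_0)
  ultimately show ?thesis by simp
qed

lemma rev_coeffs:
  assumes "subring_of K" "q \<in> polys K"
  shows "rev (coeffs q) \<in> carrier (univ_poly \<Omega> K)"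
    "ring.eval \<Omega> (rev (coeffs q)) x = poly q x"
    "length (rev (coeffs q)) - 1 = degree q" "rev (coeffs q) = [] \<longleftrightarrow> q = 0" "q \<noteq> 0 \<Longrightarrow> hd (rev (coeffs q)) = lead_coeff q"
proof -
  have "set (coeffs q) \<subseteq> K" using assms(2) by (auto simp: coeffs_def polys_def split: if_splits)
  moreover have h: "q \<noteq> 0 \<Longrightarrow> hd (rev (coeffs q)) = lead_coeff q"
    by (simp add: hd_rev last_coeffs_eq_coeff_degree)
  ultimately show "rev (coeffs q) \<in> carrier (univ_poly \<Omega> K)"
    by (cases "q = 0") (simp_all add: Om_univ_poly_carrier)
  show "q \<noteq> 0 \<Longrightarrow> hd (rev (coeffs q)) = lead_coeff q" by (rule h)
  show "ring.eval \<Omega> (rev (coeffs q)) x = poly q x" by (simp add: Om_eval)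
  show "length (rev (coeffs q)) - 1 = degree q" by (simp add: degree_eq_length_coeffs)
  show "rev (coeffs q) = [] \<longleftrightarrow> q = 0" by simp
qed

lemma Om_algebraic_iff:
  assumes K: "subring_of (K :: 'a::field set)"
  shows "(ring.algebraic \<Omega> over K) x \<longleftrightarrow> alg_over K x"
proof
  assume *: "(ring.algebraic \<Omega> over K) x"
  have "subring K \<Omega>" "x \<in> carrier \<Omega>" using K Om_subring_iff by auto
  then obtain l where l: "l \<in> carrier (univ_poly \<Omega> K)" "l \<noteq> []" "ring.eval \<Omega> l x = \<zero>\<^bsub>\<Omega>\<^esub>"
    using Om.algebraicE * by blast
  then show "alg_over K x" unfolding alg_over_def
    by (intro bexI[of _ "Poly (rev l)"]) (auto simp: Om_univ_poly_carrier Om_eval Poly_rev_degree Poly_rev_polys[OF K])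
next
  assume "alg_over K x"
  then obtain q where q: "q \<in> polys K" "q \<noteq> 0" "poly q x = 0" unfolding alg_over_def by blast
  show "(ring.algebraic \<Omega> over K) x"
    using Om.algebraicI[of "rev (coeffs q)" K x] rev_coeffs[OF K q(1)] q by simp
qed

lemma Om_transcendental_iff:
  "subring_of (K :: 'a::field set) \<Longrightarrow> (ring.transcendental \<Omega> over K) x \<longleftrightarrow> \<not> alg_over K x"
  using Om_algebraic_iff[of K x] unfolding over_def by blast

lemma Om_simple_extension: 
  assumes K: "subring_of (K :: 'a::field set)"
  shows "ring.simple_extension \<Omega> K x = simple_ext K x"
proof -
  have "ring.simple_extension \<Omega> K x =
    (\<lambda>l. ring.eval \<Omega> l x) ` carrier (univ_poly \<Omega> K)"
    by (rule Om.simple_extension_as_eval_img) auto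
  also have "\<dots> = simple_ext K x"
  proof
    show "(\<lambda>l. ring.eval \<Omega> l x) ` carrier (univ_poly \<Omega> K) \<subseteq> simple_ext K x"
    proof
      fix y assume "y \<in> (\<lambda>l. ring.eval \<Omega> l x) ` carrier (univ_poly \<Omega> K)"
      then obtain l where l: "l \<in> carrier (univ_poly \<Omega> K)" "y = poly (Poly (rev l)) x" by (auto simp: Om_eval)
      have "Poly (rev l) \<in> polys K" by (rule Poly_rev_polys[OF K]) (use l(1) in \<open>auto simp: Om_univ_poly_carrier\<close>)
      then show "y \<in> simple_ext K x" using l(2) by (auto simp: simple_ext_def)
    qed
    show "simple_ext K x \<subseteq> (\<lambda>l. ring.eval \<Omega> l x) ` carrier (univ_poly \<Omega> K)"
      unfolding simple_ext_def using rev_coeffs(1,2)[OF K] by (auto intro!: image_eqI[of _ _ "rev (coeffs _)"])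
  qed
  finally show ?thesis .
qed

text \<open>Quotients with vanishing denominator equal 0 and do no harm in the description;
  \<open>B1\<close> replaces them by \<open>0 / 1\<close> where a nonzero denominator
  matters.\<close>

lemma adjoin_eq:
  assumes K: "subfield_of (K :: 'a::field set)"
  shows "field.adjoin \<Omega> K x = {poly p x / poly q x | p q. p \<in> polys K \<and> q \<in> polys K}"
    and "subfield_of (field.adjoin \<Omega> K x)"
proof -
  note R = subfield_ring[OF K]
  let ?A = "field.adjoin \<Omega> K x" and ?B = "{poly p x / poly q x | p q. p \<in> polys K \<and> q \<in> polys K}"
  have A: "?A = generate_field \<Omega> (insert x K)" by (rule field.adjoin_def[OF Om_field])
  have "subfield ?A \<Omega>" unfolding A by (rule field.generate_field_is_subfield[OF Om_field]) auto
  then show sA: "subfield_of ?A" using Om_subfield_iff by blast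
  have inc: "insert x K \<subseteq> ?A" unfolding A by (auto intro: generate_field.incl)
  have B0: "a / b \<in> ?B" if "a \<in> simple_ext K x" "b \<in> simple_ext K x" for a b
    using that unfolding simple_ext_def by auto
  have B1: "\<exists>a\<in>simple_ext K x. \<exists>b\<in>simple_ext K x. b \<noteq> 0 \<and> y = a / b" if y: "y \<in> ?B" for y
  proof -
    obtain p q where pq: "p \<in> polys K" "q \<in> polys K" "y = poly p x / poly q x" using y by auto
    show ?thesis
    proof (cases "poly q x = 0")
      case True
      then have "y = 0 / 1" using pq by simp
      then show ?thesis
        by (intro bexI[of _ 0] bexI[of _ 1]) (auto intro: subring_0 subring_1 simple_ext_subring[OF R])
    next
      case False
      then show ?thesis using pq unfolding simple_ext_def by blast
    qed
  qed
  note SR = simple_ext_subring[OF R, of x]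
  show "?A = ?B"
  proof
    show "?A \<subseteq> ?B"
    proof
      fix y assume "y \<in> ?A"
      then have "y \<in> generate_field \<Omega> (insert x K)" using A by simp
      then show "y \<in> ?B"
      proof induction
        case one
        then show ?case using B0[OF subring_1[OF SR] subring_1[OF SR]] by simp
      next
        case (incl h)
        then have "h \<in> simple_ext K x" using simple_ext_base[OF R, of x] simple_ext_gen[OF R, of x] by auto
        then show ?case using B0[OF _ subring_1[OF SR], of h] by simp
      next
        case (a_inv h)
        then obtain a b where ab: "a \<in> simple_ext K x" "b \<in> simple_ext K x" "h = a / b" using B1 by blast
        then show ?case using B0[OF subring_uminus[OF SR ab(1)] ab(2)] by simp
      next
        case (m_inv h)
        then obtain a b where ab: "a \<in> simple_ext K x" "b \<in> simple_ext K x" "h = a / b" using B1 by blast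
        then show ?case using B0[OF ab(2,1)] m_inv by (simp add: Om_inv)
      next
        case (eng_add h1 h2)
        then obtain a b c d where ab: "a \<in> simple_ext K x" "b \<in> simple_ext K x" "b \<noteq> 0" "h1 = a / b"
          "c \<in> simple_ext K x" "d \<in> simple_ext K x" "d \<noteq> 0" "h2 = c / d" using B1 by meson
        have "(a * d + c * b) / (b * d) \<in> ?B" by (rule B0; intro subring_add[OF SR] subring_mult[OF SR] ab)
        moreover have "h1 + h2 = (a * d + c * b) / (b * d)" using ab by (simp add: add_frac_eq)
        ultimately show ?case by simp
      next
        case (eng_mult h1 h2)
        then obtain a b c d where ab: "a \<in> simple_ext K x" "b \<in> simple_ext K x" "h1 = a / b"
          "c \<in> simple_ext K x" "d \<in> simple_ext K x" "h2 = c / d" using B1 by meson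
        have "(a * c) / (b * d) \<in> ?B" by (rule B0; intro subring_mult[OF SR] ab)
        then show ?case using ab by simp
      qed
    qed
    show "?B \<subseteq> ?A"
    proof
      fix y assume "y \<in> ?B"
      then obtain p q where pq: "p \<in> polys K" "q \<in> polys K" "y = poly p x / poly q x" by auto
      have "poly p x \<in> ?A" "poly q x \<in> ?A"
        using pq(1,2) inc polys_mono[of K ?A] by (auto intro!: poly_in[OF subfield_ring[OF sA]])
      then show "y \<in> ?A" using subfield_divide[OF sA] pq(3) by simp
    qed
  qed
qed

lemma alg_over_mono: "K \<subseteq> L \<Longrightarrow> alg_over K x \<Longrightarrow> alg_over L x"
  unfolding alg_over_def using polys_mono by blast

text \<open>The coefficients generate a finite extension of \<open>k\<close>, over which
  \<open>x\<close> generates a finite one, and finiteness passes through the tower.\<close>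

lemma alg_over_trans:
  assumes k: "subfield_of (k :: 'a::field set)" and q: "q \<noteq> 0" "poly q x = 0" "\<And>i. alg_over k (poly.coeff q i)"
  shows "alg_over k x"
proof -
  note R = subfield_ring[OF k]
  have sk: "subfield k \<Omega>" using k Om_subfield_iff by blast
  let ?E = "ring.finite_extension \<Omega> k (coeffs q)"
  have alg: "(ring.algebraic \<Omega> over k) c" if "c \<in> set (coeffs q)" for c
    using that q(3) unfolding Om_algebraic_iff[OF R] by (auto simp: coeffs_def split: if_splits)
  have E: "subfield ?E \<Omega>"
    by (rule Om.finite_extension_is_subfield[OF sk]) (use alg in auto)
  have fE: "Om.finite_dimension k ?E"
    by (rule Om.finite_extension_finite_dimension(1)[OF sk]) (use alg in auto)
  have cE: "set (coeffs q) \<subseteq> ?E" using Om.finite_extension_mem[of k "coeffs q"] sk subfieldE(1) by auto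
  have RE: "subring_of ?E" using E Om_subfield_iff subfield_ring by blast
  have "q \<in> polys ?E"
    unfolding polys_def
  proof safe
    fix i show "poly.coeff q i \<in> ?E"
    proof (cases "i \<le> degree q")
      case True
      then have "poly.coeff q i \<in> set (coeffs q)" using q(1) by (simp add: coeff_in_coeffs)
      then show ?thesis using cE by blast
    next
      case False
      then show ?thesis using subring_0[OF RE] by (simp add: coeff_eq_0)
    qed
  qed
  then have "alg_over ?E x" using q unfolding alg_over_def by blast
  then have xE: "(ring.algebraic \<Omega> over ?E) x" using Om_algebraic_iff[OF RE] by blast
  have "Om.finite_dimension ?E (ring.simple_extension \<Omega> ?E x)"
    using Om.finite_dimension_simple_extension[OF E, of x] xE by simp
  then have "Om.finite_dimension k (ring.simple_extension \<Omega> ?E x)"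
    using Om.telescopic_base_dim(1)[OF sk E fE] by blast
  moreover have "subring (ring.simple_extension \<Omega> ?E x) \<Omega>"
    unfolding Om_simple_extension[OF RE] using simple_ext_subring[OF RE] Om_subring_iff by blast
  moreover have "x \<in> ring.simple_extension \<Omega> ?E x"
    unfolding Om_simple_extension[OF RE] by (rule simple_ext_gen[OF RE])
  ultimately have "(ring.algebraic \<Omega> over k) x"
    using Om.finite_dimension_imp_algebraic[OF sk] by blast
  then show ?thesis using Om_algebraic_iff[OF R] by blast
qed

section \<open>Galois extensions from group actions\<close>

context ring_action
begin

definition orbit :: "'b \<Rightarrow> 'b set"
  where "orbit x = (\<lambda>g. act g x) ` carrier G"

lemma orbit_simps: "x \<in> S \<Longrightarrow> x \<in> orbit x" "x \<in> S \<Longrightarrow> orbit x \<subseteq> S" "finite (orbit x)"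
  using act_one act_in fin by (auto simp: orbit_def intro!: image_eqI[of x _ \<one>])

lemma act_orbit:
  assumes "k \<in> carrier G" "x \<in> S" shows "bij_betw (act k) (orbit x) (orbit x)"
proof -
  have "act k ` orbit x \<subseteq> orbit x"
  proof
    fix y assume "y \<in> act k ` orbit x"
    then obtain g where "g \<in> carrier G" "y = act k (act g x)" by (auto simp: orbit_def)
    then show "y \<in> orbit x" using act_mult[OF assms(1) _ assms(2), of g] assms(1)
      by (auto simp: orbit_def intro!: image_eqI[of _ _ "k \<otimes> g"])
  qed
  moreover have "inj_on (act k) (orbit x)" using act_inj[OF assms(1)] orbit_simps(2)[OF assms(2)] inj_on_subset by blast
  ultimately show ?thesis using orbit_simps(3) by (simp add: bij_betw_def endo_inj_surj)
qed

text \<open>The squarefree counterpart of \<open>orbit_poly\<close>: each conjugate occurs once, so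
  the degree counts distinct conjugates.\<close>

lemma orbit_set_poly:
  assumes x: "x \<in> S" shows "(\<Prod>y\<in>orbit x. [:- y, 1:]) \<in> polys fixed"
proof -
  let ?h = "\<Prod>y\<in>orbit x. [:- y, 1:]"
  have l: "[:- y, 1:] \<in> polys S" if "y \<in> orbit x" for y
    using that orbit_simps(2)[OF x] by (auto simp: polys_pCons_iff[OF S] polys_0[OF S] subring_simps[OF S])
  have hS: "?h \<in> polys S" by (rule polys_prod[OF S l])
  have "map_poly (act k) ?h = ?h" if k: "k \<in> carrier G" for k
  proof -
    have "map_poly (act k) ?h = (\<Prod>y\<in>orbit x. map_poly (act k) [:- y, 1:])" by (rule hom_poly_prod[OF S hom[OF k] l])
    also have "\<dots> = (\<Prod>y\<in>orbit x. [:- act k y, 1:])"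
      using orbit_simps(2)[OF x] by (intro prod.cong[OF refl])
        (auto simp: hom_poly_pCons[OF S hom[OF k]] hom_0[OF S hom[OF k]] hom_1[OF S hom[OF k]] hom_uminus[OF S hom[OF k]])
    also have "\<dots> = ?h" by (rule prod.reindex_bij_betw[OF act_orbit[OF k x]])
    finally show ?thesis .
  qed
  then have "act k (poly.coeff ?h i) = poly.coeff ?h i" if "k \<in> carrier G" for k i
    using coeff_hom_poly[OF S hom[OF that], of ?h i] that by simp
  with hS show ?thesis by (auto simp: polys_def fixed_def)
qed

lemma alg_over_fixed: "x \<in> S \<Longrightarrow> alg_over fixed x"
  unfolding alg_over_def using orbit_poly[of x] by (intro bexI[of _ "orbit_poly x"]) auto

context
  assumes sf: "subfield_of S"
begin

lemma fixed_sub: "subfield fixed \<Omega>" "subfield S \<Omega>" "fixed \<subseteq> S"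
  using fixed_subfield[OF sf] sf Om_subfield_iff fixedD(1) by blast+

text \<open>An irreducible polynomial with root \<open>x\<close> is associated to the minimal
  polynomial, which divides the squarefree orbit polynomial; being invariant, it vanishes on the
  whole orbit. Thus its roots are the orbit, each simple: normality and separability follow by
  counting.\<close>

lemma irreducible_degree_le:
  assumes p: "p \<in> carrier (univ_poly \<Omega> fixed)" "pirreducible\<^bsub>\<Omega>\<^esub> fixed p"
    and x: "x \<in> S" "ring.is_root \<Omega> p x"
  shows "length p - 1 \<le> card (orbit x)" and "\<And>y. y \<in> orbit x \<Longrightarrow> ring.eval \<Omega> p y = 0"
proof -
  let ?R = "\<Omega> :: 'b ring"
  let ?h = "\<Prod>y\<in>orbit x. [:- y, 1:]"
  note FR = fixed_subring
  have px: "ring.eval ?R p x = 0" using x(2) by (simp add: Om.is_root_def)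
  have alg: "(ring.algebraic ?R over fixed) x" using alg_over_fixed[OF x(1)] Om_algebraic_iff[OF FR] by blast
  note Irr = Om.IrrE[OF fixed_sub(1) _ alg, simplified]
  have "Om.Irr fixed x divides\<^bsub>univ_poly ?R fixed\<^esub> p"
    using Om.Irr_minimal[OF fixed_sub(1) _ alg p(1)] px Om.pdivides_iff_shell[OF fixed_sub(1) Irr(1) p(1)] by simp
  then have "Om.Irr fixed x \<in> Units (univ_poly ?R fixed) \<or> Om.Irr fixed x \<sim>\<^bsub>univ_poly ?R fixed\<^esub> p"
    using Om.divides_pirreducible_condition[OF p(2) Irr(1)] by blast
  moreover have "Om.Irr fixed x \<notin> Units (univ_poly ?R fixed)"
    using Om.pirreducibleE(2)[OF subfieldE(1)[OF fixed_sub(1)] Irr(1,2)] by blast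
  ultimately have "length (Om.Irr fixed x) = length p"
    using Om.associated_polynomials_imp_same_length[OF subfieldE(1)[OF fixed_sub(1)] Irr(1) p(1)] by blast
  moreover
  have h: "?h \<in> polys fixed" "?h \<noteq> 0" "poly ?h x = 0" "degree ?h = card (orbit x)"
    using orbit_set_poly[OF x(1)] orbit_simps[of x] x(1)
    by (auto simp: poly_prod degree_prod_eq_sum_degree intro!: prod_zero)
  note rh = rev_coeffs[OF FR h(1)]
  have "Om.Irr fixed x pdivides\<^bsub>?R\<^esub> rev (coeffs ?h)"
    using Om.Irr_minimal[OF fixed_sub(1) _ alg rh(1)] rh(2)[of x] h(3) by simp
  then have "length (Om.Irr fixed x) - 1 \<le> length (rev (coeffs ?h)) - 1"
    using Om.pdivides_imp_degree_le[OF subfieldE(1)[OF fixed_sub(1)] Irr(1) rh(1)] rh(4) h(2) by simp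
  ultimately show "length p - 1 \<le> card (orbit x)" using rh(3) h(4) by simp
  fix y assume "y \<in> orbit x"
  then obtain g where g: "g \<in> carrier G" "y = act g x" by (auto simp: orbit_def)
  define q where "q = Poly (rev p)"
  have q: "q \<in> polys fixed" using p(1) Poly_rev_polys[OF FR] polys_0[OF FR] by (auto simp: q_def Om_univ_poly_carrier)
  then have qS: "q \<in> polys S" using polys_mono[OF fixed_sub(3)] by blast
  have "map_poly (act g) q = q"
    using q fixedD(2)[OF _ g(1)] by (intro poly_eqI) (simp add: coeff_hom_poly[OF S hom[OF g(1)]] polys_def)
  then have "poly q y = act g (poly q x)" using poly_hom[OF S hom[OF g(1)] qS x(1)] g(2) by simp
  then show "ring.eval ?R p y = 0" using px hom_0[OF S hom[OF g(1)]] by (simp add: Om_eval q_def)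
qed

lemma normal_fixed: "field.normal_extension \<Omega> fixed S"
  unfolding field.normal_extension_def[OF Om_field]
proof (intro conjI ballI impI)
  let ?R = "\<Omega> :: 'b ring"
  show "(ring.algebraic ?R over fixed) x" if "x \<in> S" for x
    using alg_over_fixed[OF that] Om_algebraic_iff[OF fixed_subring] by blast
  fix p assume p: "p \<in> carrier (univ_poly ?R fixed)" and "pirreducible\<^bsub>?R\<^esub> fixed p \<and> (\<exists>x\<in>S. ring.is_root ?R p x)"
  then obtain x where pr: "pirreducible\<^bsub>?R\<^esub> fixed p" and x: "x \<in> S" "ring.is_root ?R p x" by blast
  interpret L: field "?R\<lparr>carrier := S\<rparr>" using Om.subfield_iff(2)[OF fixed_sub(2)] .
  have pne: "p \<noteq> []" using x(2) by (simp add: Om.is_root_def)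
  have pS: "p \<in> carrier (poly_ring (?R\<lparr>carrier := S\<rparr>))"
    using p fixed_sub(3) by (auto simp: univ_poly_def polynomial_def)
  have "orbit x \<subseteq> set_mset (L.roots p)"
  proof
    fix y assume y: "y \<in> orbit x"
    have "L.is_root p y"
      using irreducible_degree_le(2)[OF p pr x y] orbit_simps(2)[OF x(1)] y pne
        Om.eval_consistent[OF subfieldE(1)[OF fixed_sub(2)]]
      by (auto simp: L.is_root_def)
    then show "y \<in> set_mset (L.roots p)" using L.roots_mem_iff_is_root[OF pS] by simp
  qed
  then have "card (orbit x) \<le> card (set_mset (L.roots p))" by (rule card_mono[OF finite_set_mset])
  also have "\<dots> \<le> size (L.roots p)" by (metis mset_set_set_mset_msubset size_mset_mono size_mset_set)
  finally show "L.splitted p"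
    using irreducible_degree_le(1)[OF p pr x] L.size_roots_le_degree[OF pS] by (simp add: L.splitted_def)
qed

lemma separable_fixed: "field.separable_extension \<Omega> fixed S"
  unfolding field.separable_extension_def[OF Om_field]
proof (intro conjI ballI impI)
  let ?R = "\<Omega> :: 'b ring"
  show "(ring.algebraic ?R over fixed) x" if "x \<in> S" for x
    using alg_over_fixed[OF that] Om_algebraic_iff[OF fixed_subring] by blast
  fix p a assume p: "p \<in> carrier (univ_poly ?R fixed)" and "pirreducible\<^bsub>?R\<^esub> fixed p \<and> (\<exists>x\<in>S. ring.is_root ?R p x)"
  then obtain x where pr: "pirreducible\<^bsub>?R\<^esub> fixed p" and x: "x \<in> S" "ring.is_root ?R p x" by blast
  have pne: "p \<noteq> []" using x(2) by (simp add: Om.is_root_def)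
  have pS: "p \<in> carrier (poly_ring ?R)" using p by (auto simp: univ_poly_def polynomial_def)
  show "Om.alg_mult p a \<le> 1"
  proof (rule ccontr)
    assume "\<not> Om.alg_mult p a \<le> 1"
    then have ca: "count (Om.roots p) a \<ge> 2" using Om.alg_mult_eq_count_roots[OF pS] by (metis not_less_eq_eq one_add_one plus_1_eq_Suc)
    \<comment> \<open>A multiple root, in the orbit or not, would give more roots than the degree
      permits.\<close>
    have "add_mset a (mset_set (orbit x)) \<subseteq># Om.roots p"
    proof (rule mset_subset_eqI)
      fix y
      have "y \<in># Om.roots p" if "y \<in> orbit x"
        using irreducible_degree_le(2)[OF p pr x that] pne Om.roots_mem_iff_is_root[OF pS] by (simp add: Om.is_root_def)
      then have "count (mset_set (orbit x)) y \<le> count (Om.roots p) y" "count (mset_set (orbit x)) y \<le> 1"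
        using orbit_simps(3)[of x] by (auto simp: count_mset_set')
      then show "count (add_mset a (mset_set (orbit x))) y \<le> count (Om.roots p) y" using ca by auto
    qed
    then have "Suc (card (orbit x)) \<le> size (Om.roots p)" using size_mset_mono by fastforce
    also have "\<dots> \<le> length p - 1" by (rule field.size_roots_le_degree[OF Om_field pS])
    finally show False using irreducible_degree_le(1)[OF p pr x] by simp
  qed
qed

text \<open>Artin's theorem. An automorphism over the fixed field sends \<open>\<theta>\<close> to a
  root of \<open>orbit_poly \<theta>\<close>, so it agrees with some \<open>act g\<close> on
  \<open>\<theta>\<close> and therefore on everything.\<close>

lemma galois_extension_fixed:
  assumes \<theta>: "\<theta> \<in> S" "inj_on (\<lambda>g. act g \<theta>) (carrier G)"
  shows "field.galois_extension_of_group \<Omega> fixed S G"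
proof -
  let ?R = "\<Omega> :: 'b ring"
  have S_ext: "S = simple_ext fixed \<theta>"
    using simple_ext_subset[OF S fixed_sub(3) \<theta>(1)] primitive_span[OF sf \<theta>] unfolding simple_ext_def by blast
  have "Om.finite_dimension fixed S"
    using Om.finite_dimension_simple_extension[OF fixed_sub(1), of \<theta>] Om_simple_extension[OF fixed_subring, of \<theta>]
      S_ext alg_over_fixed[OF \<theta>(1)] Om_algebraic_iff[OF fixed_subring] by auto
  then have fg: "field.finite_galois_extension ?R fixed S"
    using fixed_sub normal_fixed separable_fixed by (simp add: field.finite_galois_extension_def[OF Om_field])
  let ?GG = "field.galois_group ?R fixed S"
  have carrier_GG: "carrier ?GG = {\<sigma> \<in> Bij S. \<sigma> \<in> Ring.ring_hom (?R\<lparr>carrier := S\<rparr>) (?R\<lparr>carrier := S\<rparr>) \<and> (\<forall>x\<in>fixed. \<sigma> x = x)}"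
    by (simp add: field.galois_group_def[OF Om_field])
  define \<phi> where "\<phi> g = restrict (act g) S" for g
  have bij: "bij_betw (act g) S S" if g: "g \<in> carrier G" for g
  proof (rule bij_betw_byWitness[where f' = "act (inv g)"])
    show "\<forall>a\<in>S. act (inv g) (act g a) = a" using act_inv[OF g] by blast
    show "\<forall>a\<in>S. act g (act (inv g) a) = a" using act_inv[OF inv_closed[OF g]] g by simp
    show "act g ` S \<subseteq> S" using act_in[OF g] by blast
    show "act (inv g) ` S \<subseteq> S" using act_in[OF inv_closed[OF g]] by blast
  qed
  have \<phi>: "\<phi> g \<in> carrier ?GG" if g: "g \<in> carrier G" for g
  proof -
    have "\<phi> g \<in> Bij S"
      unfolding Bij_def \<phi>_def using bij[OF g] by (simp cong: bij_betw_cong)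
    moreover have "\<phi> g \<in> Ring.ring_hom (?R\<lparr>carrier := S\<rparr>) (?R\<lparr>carrier := S\<rparr>)"
    proof (rule ring_hom_memI)
      fix x y assume "x \<in> carrier (?R\<lparr>carrier := S\<rparr>)" "y \<in> carrier (?R\<lparr>carrier := S\<rparr>)"
      then have xy: "x \<in> S" "y \<in> S" by simp_all
      show "\<phi> g x \<in> carrier (?R\<lparr>carrier := S\<rparr>)" using act_in[OF g xy(1)] xy by (simp add: \<phi>_def)
      show "\<phi> g (x \<otimes>\<^bsub>?R\<lparr>carrier := S\<rparr>\<^esub> y) = \<phi> g x \<otimes>\<^bsub>?R\<lparr>carrier := S\<rparr>\<^esub> \<phi> g y"
        using xy hom_mult[OF S hom[OF g] xy] subring_mult[OF S xy] by (simp add: \<phi>_def)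
      show "\<phi> g (x \<oplus>\<^bsub>?R\<lparr>carrier := S\<rparr>\<^esub> y) = \<phi> g x \<oplus>\<^bsub>?R\<lparr>carrier := S\<rparr>\<^esub> \<phi> g y"
        using xy hom_add[OF S hom[OF g] xy] subring_add[OF S xy] by (simp add: \<phi>_def)
    next
      show "\<phi> g \<one>\<^bsub>?R\<lparr>carrier := S\<rparr>\<^esub> = \<one>\<^bsub>?R\<lparr>carrier := S\<rparr>\<^esub>"
        using hom_1[OF S hom[OF g]] subring_1[OF S] by (simp add: \<phi>_def)
    qed
    moreover have "\<phi> g x = x" if "x \<in> fixed" for x
      using fixedD(1)[OF that] fixedD(2)[OF that g] by (simp add: \<phi>_def)
    ultimately show ?thesis unfolding carrier_GG by blast
  qed
  have mult: "\<phi> (g \<otimes> h) = \<phi> g \<otimes>\<^bsub>?GG\<^esub> \<phi> h" if gh: "g \<in> carrier G" "h \<in> carrier G" for g h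
  proof -
    have "\<phi> g \<in> Bij S" "\<phi> h \<in> Bij S" using \<phi>[OF gh(1)] \<phi>[OF gh(2)] carrier_GG by auto
    then have "\<phi> g \<otimes>\<^bsub>?GG\<^esub> \<phi> h = compose S (\<phi> g) (\<phi> h)"
      by (simp add: field.galois_group_def[OF Om_field] BijGroup_def)
    also have "\<dots> = \<phi> (g \<otimes> h)"
    proof
      fix x show "compose S (\<phi> g) (\<phi> h) x = \<phi> (g \<otimes> h) x"
        using act_mult[OF gh, of x] act_in[OF gh(2), of x] by (cases "x \<in> S") (simp_all add: compose_def \<phi>_def)
    qed
    finally show ?thesis ..
  qed
  have "inj_on \<phi> (carrier G)"
  proof (rule inj_onI)
    fix g h assume gh: "g \<in> carrier G" "h \<in> carrier G" "\<phi> g = \<phi> h"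
    then have "act g \<theta> = act h \<theta>" using \<theta>(1) by (metis \<phi>_def restrict_apply')
    then show "g = h" using \<theta>(2) gh by (simp add: inj_on_def)
  qed
  moreover have "\<sigma> \<in> \<phi> ` carrier G" if \<sigma>: "\<sigma> \<in> carrier ?GG" for \<sigma>
  proof -
    have sB: "\<sigma> \<in> Bij S" and sr: "\<sigma> \<in> Ring.ring_hom (?R\<lparr>carrier := S\<rparr>) (?R\<lparr>carrier := S\<rparr>)"
      and sk: "\<And>x. x \<in> fixed \<Longrightarrow> \<sigma> x = x" using \<sigma> carrier_GG by auto
    have sh: "hom_on S \<sigma>" using sr by (auto simp: hom_on_def Ring.ring_hom_def)
    have fp: "map_poly \<sigma> q = q" if "q \<in> polys fixed" for q
      using that sk by (intro poly_eqI) (simp add: coeff_hom_poly[OF S sh] polys_def)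
    have fS: "q \<in> polys S" if "q \<in> polys fixed" for q using that polys_mono[OF fixed_sub(3)] by blast
    note op = orbit_poly[OF \<theta>(1)]
    have "poly (orbit_poly \<theta>) (\<sigma> \<theta>) = \<sigma> (poly (orbit_poly \<theta>) \<theta>)"
      using poly_hom[OF S sh fS[OF op(1)] \<theta>(1)] fp[OF op(1)] by simp
    then have "(\<Prod>g\<in>carrier G. \<sigma> \<theta> - act g \<theta>) = 0" using op(3,5) hom_0[OF S sh] by simp
    then obtain g where g: "g \<in> carrier G" "\<sigma> \<theta> = act g \<theta>" using fin by (auto simp: prod_zero_iff)
    have "\<sigma> x = act g x" if x: "x \<in> S" for x
    proof -
      obtain q where q: "q \<in> polys fixed" "poly q \<theta> = x" using primitive_span[OF sf \<theta> x] by blast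
      have "map_poly (act g) q = q"
        using q fixedD(2)[OF _ g(1)] by (intro poly_eqI) (simp add: coeff_hom_poly[OF S hom[OF g(1)]] polys_def)
      then show ?thesis
        using poly_hom[OF S sh fS[OF q(1)] \<theta>(1)] poly_hom[OF S hom[OF g(1)] fS[OF q(1)] \<theta>(1)] fp[OF q(1)] g(2) q(2) by simp
    qed
    moreover have "\<sigma> x = undefined" if "x \<notin> S" for x using sB that by (auto simp: Bij_def extensional_def)
    ultimately have "\<sigma> = \<phi> g" by (intro ext) (simp add: \<phi>_def restrict_def)
    then show ?thesis using g(1) by blast
  qed
  ultimately have "bij_betw \<phi> (carrier G) (carrier ?GG)" using \<phi> by (auto simp: bij_betw_def)
  then have iso: "\<phi> \<in> Group.iso G ?GG" using \<phi> mult by (auto simp: Group.iso_def hom_def)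
  then have "G \<cong> ?GG" by (rule is_isoI)
  then have "?GG \<cong> G" by (rule iso_sym)
  with fg show ?thesis by (simp add: field.galois_extension_of_group_def[OF Om_field])
qed

end

end

section \<open>Specialization of a Galois extension\<close>

lemma integral_closure_eq:
  assumes A: "subring_of (A :: 'a::field set)"
  shows "field.integral_closure \<Omega> A E = {x \<in> E. integral_over A x}"
proof -
  let ?R = "\<Omega> :: 'a ring"
  have "(\<exists>l\<in>carrier (univ_poly ?R A). l \<noteq> [] \<and> hd l = 1 \<and> ring.eval ?R l x = 0) \<longleftrightarrow> integral_over A x" for x
  proof
    assume "\<exists>l\<in>carrier (univ_poly ?R A). l \<noteq> [] \<and> hd l = 1 \<and> ring.eval ?R l x = 0"
    then obtain l where l: "l \<in> carrier (univ_poly ?R A)" "l \<noteq> []" "hd l = 1" "ring.eval ?R l x = 0" by blast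
    show "integral_over A x" unfolding integral_over_def
      by (intro bexI[of _ "Poly (rev l)"]) (use l Poly_rev_degree[of l] Poly_rev_polys[OF A, of l] in \<open>auto simp: Om_univ_poly_carrier Om_eval\<close>)
  next
    assume "integral_over A x"
    then obtain q where q: "q \<in> polys A" "monic q" "poly q x = 0" unfolding integral_over_def by blast
    then have "q \<noteq> 0" by auto
    then show "\<exists>l\<in>carrier (univ_poly ?R A). l \<noteq> [] \<and> hd l = 1 \<and> ring.eval ?R l x = 0"
      using rev_coeffs[OF A q(1)] q by (intro bexI[of _ "rev (coeffs q)"]) auto
  qed
  then show ?thesis by (simp add: field.integral_closure_def[OF Om_field])
qed

text \<open>Prime avoidance for kernels. Let \<open>z i\<close> avoid all kernels but the
  \<open>i\<close>-th. If it lies in that one for every \<open>i\<close>, then \<open>z i0\<close>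
  plus the product of the other \<open>z i\<close> lies in none.\<close>

lemma hom_avoidance:
  fixes h :: "'i \<Rightarrow> 'a::field \<Rightarrow> 'b::field"
  assumes B: "subring_of B" and I: "finite I" "I \<noteq> {}" and h: "\<And>i. i \<in> I \<Longrightarrow> hom_on B (h i)"
    and P: "P \<subseteq> B" "\<And>x y. x \<in> P \<Longrightarrow> y \<in> P \<Longrightarrow> x + y \<in> P" "\<And>x y. x \<in> P \<Longrightarrow> y \<in> P \<Longrightarrow> x * y \<in> P"
    and ex: "\<And>i. i \<in> I \<Longrightarrow> \<exists>x\<in>P. h i x \<noteq> 0"
  shows "\<exists>x\<in>P. \<forall>i\<in>I. h i x \<noteq> 0"
  using I h ex
proof (induction I rule: finite_psubset_induct)
  case (psubset I)
  obtain i0 where i0: "i0 \<in> I" using psubset.prems(1) by blast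
  show ?case
  proof (cases "I = {i0}")
    case True
    then show ?thesis using psubset.prems(3) by blast
  next
    case False
    have "\<exists>x\<in>P. \<forall>j\<in>I - {i}. h j x \<noteq> 0" if "i \<in> I" for i
    proof (rule psubset.IH)
      show "I - {i} \<subset> I" using that by auto
      show "I - {i} \<noteq> {}" using False i0 that by auto
    qed (use psubset.prems in auto)
    then obtain z where z: "\<And>i. i \<in> I \<Longrightarrow> z i \<in> P" "\<And>i j. i \<in> I \<Longrightarrow> j \<in> I \<Longrightarrow> j \<noteq> i \<Longrightarrow> h j (z i) \<noteq> 0"
      by (metis Diff_iff singletonD)
    show ?thesis
    proof (cases "\<exists>i\<in>I. h i (z i) \<noteq> 0")
      case True
      then show ?thesis using z by metis
    next
      case False: False
      let ?J = "I - {i0}"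
      have J: "finite ?J" "?J \<noteq> {}" using psubset.hyps \<open>I \<noteq> {i0}\<close> i0 by auto
      have "prod z J \<in> P" if "finite J" "J \<noteq> {}" "J \<subseteq> I" for J
        using that by (induction J rule: finite_ne_induct) (auto intro: z P(3))
      then have pP: "prod z ?J \<in> P" using J by auto
      have zB: "z i \<in> B" if "i \<in> I" for i using z(1)[OF that] P(1) by auto
      have hs: "h j (z i0 + prod z ?J) = h j (z i0) + (\<Prod>i\<in>?J. h j (z i))" if "j \<in> I" for j
        using hom_add[OF B psubset.prems(2)[OF that] zB[OF i0], of "prod z ?J"] hom_prod[OF B psubset.prems(2)[OF that], of ?J z] zB pP P(1)
        by auto
      have "h j (z i0 + prod z ?J) \<noteq> 0" if j: "j \<in> I" for j
      proof (cases "j = i0")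
        case True
        then show ?thesis using hs[OF j] False j z(2) J by (auto simp: prod_zero_iff)
      next
        case jn: False
        then have "(\<Prod>i\<in>?J. h j (z i)) = 0" using j False J by (intro prod_zero) auto
        then show ?thesis using hs[OF j] z(2)[OF i0 j jn] by simp
      qed
      then show ?thesis using P(2)[OF z(1)[OF i0] pP] by blast
    qed
  qed
qed

text \<open>The maximal ideals over $T$ are the kernels of the conjugate places,
  \<open>\<pi>\<close> composed with \<open>\<alpha> i\<close>, all with residue field
  \<open>F\<close>. Such an ideal lies in one of these kernels: otherwise some element of it avoids
  them all, while its norm lies in the ideal generated by $T$ and is killed by
  \<open>\<pi>\<close>.\<close>

lemma specialization_if_place:
  fixes k F E :: "'a::field set" and T :: 'a and \<pi> :: "'a \<Rightarrow> 'a" and \<alpha> :: "'i \<Rightarrow> 'a \<Rightarrow> 'a"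
  defines "A \<equiv> simple_ext k T"
  defines "B \<equiv> {x \<in> E. integral_over A x}"
  assumes k: "subfield_of k" and F: "subfield_of F" "k \<subseteq> F" and E: "subring_of E" "A \<subseteq> E"
    and \<pi>: "hom_on B \<pi>" "\<pi> ` B = F" "\<And>c. c \<in> k \<Longrightarrow> \<pi> c = c" "\<pi> T = 0"
    and I: "finite I" "i0 \<in> I" and \<alpha>: "\<And>i. i \<in> I \<Longrightarrow> hom_on B (\<alpha> i)" "\<And>i. i \<in> I \<Longrightarrow> \<alpha> i ` B = B"
      "\<And>i c. i \<in> I \<Longrightarrow> c \<in> A \<Longrightarrow> \<alpha> i c = c" "\<And>x. x \<in> B \<Longrightarrow> \<alpha> i0 x = x"
    and norm: "\<And>x. x \<in> B \<Longrightarrow> (\<Prod>i\<in>I. \<alpha> i x) \<in> A"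
  shows "field.specialization_equals \<Omega> k T E 0 F"
proof -
  let ?R = "\<Omega> :: 'a ring"
  note kR = subfield_ring[OF k]
  have AR: "subring_of A" unfolding A_def by (rule simple_ext_subring[OF kR])
  have BR: "subring_of B" using E(1) integral_subring[OF AR] by (auto simp: B_def subring_of_def)
  have AB: "A \<subseteq> B" using E(2) integral_base[OF AR] by (auto simp: B_def)
  have sA: "ring.simple_extension ?R k T = A" unfolding A_def by (rule Om_simple_extension[OF kR])
  have sB: "field.integral_closure ?R A E = B" unfolding B_def by (rule integral_closure_eq[OF AR])
  let ?B = "?R\<lparr>carrier := B\<rparr>" and ?A = "?R\<lparr>carrier := A\<rparr>" and ?F = "?R\<lparr>carrier := F\<rparr>"
  have rB: "ring ?B" and rF: "ring ?F" and cA: "cring ?A"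
    using BR subfield_ring[OF F(1)] AR Om_subring_iff Om.subring_is_ring apply blast
    using BR subfield_ring[OF F(1)] AR Om_subring_iff Om.subring_is_ring apply blast
    using AR Om_subring_iff Om.subring_is_domain domain.axioms(1) by blast
  have kA: "k \<subseteq> A" "T \<in> A" unfolding A_def using simple_ext_base[OF kR] simple_ext_gen[OF kR] by auto
  define h where "h i x = \<pi> (\<alpha> i x)" for i x
  have hh: "hom_on B (h i)" if "i \<in> I" for i
  proof -
    have "\<alpha> i x \<in> B" if "x \<in> B" for x using \<alpha>(2)[OF \<open>i \<in> I\<close>] that by blast
    then show ?thesis using \<pi>(1) \<alpha>(1)[OF that] by (simp add: hom_on_def h_def)
  qed
  have himg: "h i ` B = F" if "i \<in> I" for i using \<pi>(2) \<alpha>(2)[OF that] unfolding h_def by (metis image_image)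
  have hA: "h i c = \<pi> c" if "i \<in> I" "c \<in> A" for i c using \<alpha>(3)[OF that] by (simp add: h_def)
  define N where "N i = {x \<in> B. h i x = 0}" for i
  have hring: "ring_hom_ring ?B ?F (h i)" if "i \<in> I" for i
  proof (rule ring_hom_ringI2[OF rB rF], rule ring_hom_memI)
    show "h i x \<in> carrier ?F" if "x \<in> carrier ?B" for x using himg[OF \<open>i \<in> I\<close>] that by auto
  qed (use hom_1[OF BR hh[OF that]] hom_add[OF BR hh[OF that]] hom_mult[OF BR hh[OF that]] in auto)
  have ker: "a_kernel ?B ?F (h i) = N i" for i by (simp add: a_kernel_def' N_def)
  have Nideal: "ideal (N i) ?B" if "i \<in> I" for i
    using ring_hom_ring.kernel_is_ideal[OF hring[OF that]] ker by simp
  have one_N: "1 \<notin> N i" if "i \<in> I" for i using hom_1[OF BR hh[OF that]] by (simp add: N_def)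
  have Nmax: "maximalideal (N i) ?B" if i: "i \<in> I" for i
  proof (rule maximalidealI[OF Nideal[OF i]])
    show "carrier ?B \<noteq> N i" using one_N[OF i] subring_1[OF BR] by auto
    fix J assume J: "ideal J ?B" "N i \<subseteq> J" "J \<subseteq> carrier ?B"
    show "J = N i \<or> J = carrier ?B"
    proof (rule disjCI)
      assume "J \<noteq> carrier ?B"
      show "J = N i"
      proof (rule ccontr)
        assume "J \<noteq> N i"
        then obtain x where x: "x \<in> J" "x \<notin> N i" using J(2) by blast
        then have xB: "x \<in> B" and hx: "h i x \<noteq> 0" using J(3) by (auto simp: N_def)
        have "inverse (h i x) \<in> h i ` B"
          using himg[OF i] xB subfield_inverse[OF F(1)] by blast
        then obtain y where y: "y \<in> B" "h i y = inverse (h i x)" by auto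
        have xy: "x * y \<in> B" using subring_mult[OF BR xB y(1)] .
        have "h i (1 - x * y) = 0" using hom_diff[OF BR hh[OF i] subring_1[OF BR] xy] hom_mult[OF BR hh[OF i] xB y(1)]
          hom_1[OF BR hh[OF i]] y(2) hx by simp
        then have "1 - x * y \<in> J" using J(2) subring_diff[OF BR subring_1[OF BR] xy] by (auto simp: N_def)
        moreover have "x * y \<in> J" using ideal.I_r_closed[OF J(1) x(1), of y] y(1) by simp
        ultimately have "1 - x * y + x * y \<in> J"
          using additive_subgroup.a_closed[OF ideal.axioms(1)[OF J(1)]] by fastforce
        then have "1 \<in> J" by simp
        then have "J = carrier ?B" using ideal.one_imp_carrier[OF J(1)] by simp
        then show False using \<open>J \<noteq> carrier ?B\<close> by simp
      qed
    qed
  qed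
  have PA: "PIdl\<^bsub>?A\<^esub> T = {x \<in> A. \<pi> x = 0}"
  proof
    have "hom_on A \<pi>" using hom_on_subset[OF \<pi>(1) AB] .
    then show "PIdl\<^bsub>?A\<^esub> T \<subseteq> {x \<in> A. \<pi> x = 0}"
      using kA(2) \<pi>(4) subring_mult[OF AR] hom_mult[OF AR \<open>hom_on A \<pi>\<close>] by (auto simp: cgenideal_def)
    show "{x \<in> A. \<pi> x = 0} \<subseteq> PIdl\<^bsub>?A\<^esub> T"
    proof
      fix x assume "x \<in> {x \<in> A. \<pi> x = 0}"
      then obtain p where p: "p \<in> polys k" "x = poly p T" "\<pi> x = 0" by (auto simp: A_def simple_ext_def)
      obtain c q where cq: "p = pCons c q" by (cases p) auto
      have ck: "c \<in> k" "q \<in> polys k" using p(1) cq polys_pCons_iff[OF kR] by auto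
      have qA: "poly q T \<in> A" using ck by (auto simp: A_def simple_ext_def)
      \<comment> \<open>On $k[T]$ the place reads off the constant coefficient.\<close>
      have "\<pi> x = \<pi> c + \<pi> T * \<pi> (poly q T)"
        using hom_add[OF AR \<open>hom_on A \<pi>\<close>, of c "T * poly q T"] hom_mult[OF AR \<open>hom_on A \<pi>\<close> kA(2) qA]
          subring_mult[OF AR kA(2) qA] ck(1) kA(1) p(2) cq by auto
      then have "c = 0" using p(3) \<pi>(3,4) ck by simp
      then have "x = poly q T * T" using p(2) cq by simp
      then show "x \<in> PIdl\<^bsub>?A\<^esub> T" using qA by (auto simp: cgenideal_def)
    qed
  qed
  have NA: "N i \<inter> A = PIdl\<^bsub>?A\<^esub> T" if "i \<in> I" for i
    unfolding PA using hA[OF that] AB by (auto simp: N_def)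
  have over: "field.maximal_ideal_over ?R k T E 0 P \<longleftrightarrow> maximalideal P ?B \<and> P \<inter> A = PIdl\<^bsub>?A\<^esub> T" for P
    by (simp add: field.maximal_ideal_over_def[OF Om_field] sA sB)
  have "\<exists>P. field.maximal_ideal_over ?R k T E 0 P" unfolding over using Nmax[OF I(2)] NA[OF I(2)] by blast
  moreover have "\<exists>f\<in>ring_iso (field.residue_field ?R k T E P) ?F. \<forall>c\<in>k. f (P +>\<^bsub>?B\<^esub> c) = c"
    if "field.maximal_ideal_over ?R k T E 0 P" for P
  proof -
    have P: "maximalideal P ?B" "P \<inter> A = PIdl\<^bsub>?A\<^esub> T" using that over by auto
    note Pi = maximalideal.axioms(1)[OF P(1)]
    have PB: "P \<subseteq> B" using additive_subgroup.a_subset[OF ideal.axioms(1)[OF Pi]] by simp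
    have Padd: "x + y \<in> P" if "x \<in> P" "y \<in> P" for x y
      using additive_subgroup.a_closed[OF ideal.axioms(1)[OF Pi] that] by simp
    have Pmul: "x * y \<in> P" if "x \<in> P" "y \<in> B" for x y using ideal.I_r_closed[OF Pi that(1), of y] that(2) by simp
    have "\<exists>i\<in>I. P \<subseteq> N i"
    proof (rule ccontr)
      assume "\<not> ?thesis"
      then have ex: "\<exists>x\<in>P. h i x \<noteq> 0" if "i \<in> I" for i using that PB by (auto simp: N_def)
      have "\<exists>x\<in>P. \<forall>i\<in>I. h i x \<noteq> 0"
      proof (rule hom_avoidance[OF BR I(1) _ hh PB Padd _ ex])
        show "I \<noteq> {}" using I(2) by blast
        show "x * y \<in> P" if "x \<in> P" "y \<in> P" for x y using Pmul[OF that(1)] that(2) PB by blast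
      qed
      then obtain x where x: "x \<in> P" "\<forall>i\<in>I. h i x \<noteq> 0" by blast
      have xB: "x \<in> B" using x PB by auto
      have aB: "\<alpha> i x \<in> B" if "i \<in> I" for i using \<alpha>(2)[OF that] xB by auto
      \<comment> \<open>\<open>\<alpha> i0\<close> is the identity, so the norm is a multiple of
        \<open>x\<close> within \<open>B\<close>.\<close>
      have "(\<Prod>i\<in>I. \<alpha> i x) = x * (\<Prod>i\<in>I - {i0}. \<alpha> i x)" using prod.remove[OF I, of "\<lambda>i. \<alpha> i x"] \<alpha>(4)[OF xB] by simp
      then have "(\<Prod>i\<in>I. \<alpha> i x) \<in> P" using Pmul[OF x(1)] subring_prod[OF BR, of "I - {i0}"] aB by auto
      then have "\<pi> (\<Prod>i\<in>I. \<alpha> i x) = 0" using P(2) PA norm[OF xB] by auto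
      moreover have "\<pi> (\<Prod>i\<in>I. \<alpha> i x) = (\<Prod>i\<in>I. h i x)" unfolding h_def by (rule hom_prod[OF BR \<pi>(1) aB])
      ultimately show False using x(2) I(1) by simp
    qed
    then obtain i where i: "i \<in> I" "P \<subseteq> N i" by blast
    have "N i = P \<or> N i = carrier ?B"
      by (rule maximalideal.I_maximal[OF P(1) Nideal[OF i(1)] i(2)]) (auto simp: N_def)
    then have PN: "P = N i" using one_N[OF i(1)] subring_1[OF BR] by auto
    let ?f = "\<lambda>Y. the_elem (h i ` Y)"
    have res: "field.residue_field ?R k T E P = ?B Quot P" by (simp add: field.residue_field_def[OF Om_field] sA sB)
    have "?f \<in> ring_iso (?B Quot P) ?F"
      using ring_hom_ring.FactRing_iso_set[OF hring[OF i(1)]] himg[OF i(1)] ker PN by simp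
    moreover have "?f (P +>\<^bsub>?B\<^esub> c) = c" if c: "c \<in> k" for c
    proof -
      have cB: "c \<in> B" using c kA AB by auto
      have "h i ` (P +>\<^bsub>?B\<^esub> c) = {c}"
      proof -
        have "h i (x + c) = c" if "x \<in> P" for x
          using that PN hom_add[OF BR hh[OF i(1)] _ cB, of x] hA[OF i(1)] \<pi>(3)[OF c] c kA by (auto simp: N_def)
        moreover have "P +>\<^bsub>?B\<^esub> c = (\<lambda>x. x + c) ` P" by (auto simp: a_r_coset_def')
        moreover have "0 \<in> P" using additive_subgroup.zero_closed[OF ideal.axioms(1)[OF Pi]] by simp
        ultimately show ?thesis by (auto simp: image_image)
      qed
      then show ?thesis by simp
    qed
    ultimately show ?thesis unfolding res by (intro bexI[of _ ?f] ballI)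
  qed
  ultimately show ?thesis by (simp add: field.specialization_equals_def[OF Om_field] sA sB)
qed

section \<open>From Laurent series to the algebraic closure of the rational function field\<close>

definition nonneg :: "'a::field fls set"
  where "nonneg = {f. \<forall>m<0. f $$ m = 0}"

lemma nonneg_subring: "subring_of nonneg"
  unfolding subring_of_def nonneg_def using lead_coeff_mult_fls(1)[where n = 0] by auto

lemma nonneg_coeff_hom: "hom_on nonneg (\<lambda>f. f $$ 0)"
  unfolding hom_on_def nonneg_def using lead_coeff_mult_fls(2)[where n = 0] by auto

text \<open>A pole of \<open>e\<close> makes \<open>inverse e\<close> regular; dividing a monic
  equation of degree \<open>Suc n\<close> by \<open>e ^ n\<close> then exhibits \<open>e\<close> as
  a regular series. Hence integral elements have a value at $X = 0$.\<close>

lemma nonneg_integrally_closed: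
  assumes e: "integral_over A e" and A: "A \<subseteq> nonneg" shows "e \<in> nonneg"
proof (rule ccontr)
  assume n: "e \<notin> nonneg"
  then have e0: "e \<noteq> 0" by (auto simp: nonneg_def)
  have "fls_subdegree e < 0" using n by (auto simp: nonneg_def not_less intro: fls_subdegree_leI order.strict_trans1)
  then have ie: "inverse e \<in> nonneg" by (auto simp: nonneg_def)
  obtain f where f: "f \<in> polys A" "monic f" "poly f e = 0" using e unfolding integral_over_def by blast
  have d: "degree f \<noteq> 0"
  proof
    assume "degree f = 0"
    then obtain c where "f = [:c:]" by (metis degree_eq_zeroE)
    then show False using f by auto
  qed
  define n where "n = degree f - 1"
  have dn: "degree f = Suc n" using d by (simp add: n_def)
  have "(\<Sum>i\<le>Suc n. poly.coeff f i * e ^ i) = 0" using f(3) by (simp add: poly_altdef dn)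
  then have "e ^ Suc n = - (\<Sum>i\<le>n. poly.coeff f i * e ^ i)" using f(2) dn by (simp add: eq_neg_iff_add_eq_0 add.commute)
  then have "e ^ Suc n * inverse e ^ n = - (\<Sum>i\<le>n. poly.coeff f i * (e ^ i * inverse e ^ n))"
    by (simp add: sum_distrib_right mult.assoc)
  also have "(\<Sum>i\<le>n. poly.coeff f i * (e ^ i * inverse e ^ n)) = (\<Sum>i\<le>n. poly.coeff f i * inverse e ^ (n - i))"
  proof (rule sum.cong[OF refl])
    fix i assume "i \<in> {..n}"
    then have "inverse e ^ n = inverse e ^ i * inverse e ^ (n - i)" by (metis atMost_iff le_add_diff_inverse power_add)
    then have "e ^ i * inverse e ^ n = (e * inverse e) ^ i * inverse e ^ (n - i)" by (simp add: power_mult_distrib mult.assoc)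
    then show "poly.coeff f i * (e ^ i * inverse e ^ n) = poly.coeff f i * inverse e ^ (n - i)" using e0 by simp
  qed
  also have "e ^ Suc n * inverse e ^ n = e * (e * inverse e) ^ n" by (simp add: power_mult_distrib mult.assoc)
  also have "\<dots> = e" using e0 by simp
  finally have "e = - (\<Sum>i\<le>n. poly.coeff f i * inverse e ^ (n - i))" .
  moreover have "- (\<Sum>i\<le>n. poly.coeff f i * inverse e ^ (n - i)) \<in> nonneg"
    using f(1) A ie by (intro subring_simps[OF nonneg_subring]) (auto simp: polys_def)
  ultimately show False using n by simp
qed

definition polyx :: "'a::field set \<Rightarrow> 'a fls set"
  where "polyx k = fls_of_poly ` polys k"

lemma polyx_nonneg: "polyx k \<subseteq> nonneg"
  by (auto simp: polyx_def nonneg_def fls_of_poly_nth)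

lemma polyx_ratx: "subring_of k \<Longrightarrow> polyx k \<subseteq> ratx k k"
  by (auto simp: polyx_def ratx_poly)

text \<open>For a fraction in lowest terms over the whole field, a root of the denominator is not
  one of the numerator; inserting it into the cleared integral equation leaves only the power of the
  numerator. The coefficients of the resulting polynomial lie in \<open>k\<close> because
  \<open>n\<close> is a series over \<open>k\<close>.\<close>

lemma ratx_integrally_closed:
  fixes k :: "'a::field set" and n :: "'a fls"
  assumes ac: "\<And>q :: 'a poly. degree q > 0 \<Longrightarrow> \<exists>z. poly q z = 0"
    and k: "subfield_of k" and n: "n \<in> ratx k k" "integral_over (polyx k) n"
  shows "n \<in> polyx k"
proof -
  define Q where "Q pq \<longleftrightarrow> snd pq \<noteq> 0 \<and> n = fls_of_poly (fst pq) / fls_of_poly (snd pq)" for pq :: "'a poly \<times> 'a poly"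
  have "\<exists>pq. Q pq" using n(1) by (auto simp: ratx_def Q_def)
  then obtain pq where pq: "Q pq" "\<And>pq'. Q pq' \<Longrightarrow> degree (snd pq) \<le> degree (snd pq')"
    using ex_has_least_nat[of Q _ "\<lambda>pq. degree (snd pq)"] by blast
  obtain p q where "pq = (p, q)" by (cases pq)
  then have q0: "q \<noteq> 0" and npq: "n = fls_of_poly p / fls_of_poly q"
    using pq by (auto simp: Q_def)
  have least: "degree q \<le> degree q'" if "q' \<noteq> 0" "n = fls_of_poly p' / fls_of_poly q'" for p' q'
    using pq(2)[of "(p', q')"] that \<open>pq = (p, q)\<close> by (simp add: Q_def)
  have "degree q = 0"
  proof (rule ccontr)
    assume "degree q \<noteq> 0"
    then obtain z where z: "poly q z = 0" using ac by auto
    have pz: "poly p z \<noteq> 0"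
    proof
      assume "poly p z = 0"
      then obtain p' where p': "p = [:- z, 1:] * p'" by (metis dvdE poly_eq_0_iff_dvd)
      obtain q' where q': "q = [:- z, 1:] * q'" using z by (metis dvdE poly_eq_0_iff_dvd)
      have "q' \<noteq> 0" using q' q0 by auto
      moreover have "n = fls_of_poly p' / fls_of_poly q'"
        unfolding npq p' q' fls_of_poly_hom(5) by (rule mult_divide_mult_cancel_left) simp
      ultimately have "degree q \<le> degree q'" using least by blast
      moreover have "degree q = Suc (degree q')" using q' \<open>q' \<noteq> 0\<close> by (simp add: degree_mult_eq del: mult_pCons_left)
      ultimately show False by simp
    qed
    obtain f where f: "f \<in> polys (polyx k)" "monic f" "poly f n = 0" using n(2) unfolding integral_over_def by blast
    define m where "m = degree f"
    have "\<exists>a. poly.coeff f i = fls_of_poly a" for i using f(1) by (auto simp: polys_def polyx_def)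
    then obtain a where a: "\<And>i. poly.coeff f i = fls_of_poly (a i)" by metis
    have sum_hom: "fls_of_poly (sum g J) = (\<Sum>i\<in>J. fls_of_poly (g i))" for g :: "nat \<Rightarrow> 'a poly" and J
      by (induction J rule: infinite_finite_induct) (auto simp: fls_of_poly_hom)
    have nq: "n * fls_of_poly q = fls_of_poly p" using npq q0 by simp
    have "0 = (\<Sum>i\<le>m. poly.coeff f i * n ^ i) * fls_of_poly q ^ m" using f(3) by (simp add: poly_altdef m_def)
    also have "\<dots> = (\<Sum>i\<le>m. fls_of_poly (a i * p ^ i * q ^ (m - i)))"
      unfolding sum_distrib_right
    proof (rule sum.cong[OF refl])
      fix i assume "i \<in> {..m}"
      then have "fls_of_poly q ^ m = fls_of_poly q ^ i * fls_of_poly q ^ (m - i)" by (metis atMost_iff le_add_diff_inverse power_add)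
      then show "poly.coeff f i * n ^ i * fls_of_poly q ^ m = fls_of_poly (a i * p ^ i * q ^ (m - i))"
        by (simp add: a fls_of_poly_hom nq[symmetric] power_mult_distrib)
    qed
    finally have "(\<Sum>i\<le>m. a i * p ^ i * q ^ (m - i)) = 0" unfolding sum_hom[symmetric] by simp
    then have "poly (\<Sum>i\<le>m. a i * p ^ i * q ^ (m - i)) z = 0" by simp
    moreover have "poly (\<Sum>i\<le>m. a i * p ^ i * q ^ (m - i)) z = (\<Sum>i\<le>m. if i = m then poly (a i) z * poly p z ^ i else 0)"
      unfolding poly_sum by (rule sum.cong) (auto simp: z)
    ultimately have "poly (a m) z * poly p z ^ m = 0" by simp
    moreover have "a m = 1" using a[of m] f(2) fls_of_poly_inj[of "a m" 1] by (simp add: m_def fls_of_poly_hom)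
    ultimately show False using pz by simp
  qed
  then obtain c where c: "q = [:c:]" "c \<noteq> 0" using q0 by (metis degree_eq_zeroE pCons_0_0)
  have "n = fls_of_poly (Polynomial.smult (inverse c) p)"
  proof -
    have "fls_of_poly (Polynomial.smult (inverse c) p) = fls_of_poly [:inverse c:] * fls_of_poly p"
      unfolding fls_of_poly_hom(5)[symmetric] by simp
    then show ?thesis using npq c by (simp add: fls_of_poly_hom fls_const_inverse divide_inverse)
  qed
  moreover have "n \<in> ser k" using n(1) ratx_ser[OF k order_refl] by auto
  ultimately show ?thesis using fls_of_poly_ser[OF subfield_ring[OF k]] by (auto simp: polyx_def)
qed

text \<open>Series cannot be evaluated at \<open>T\<close>, but rational functions can: a nonzero
  denominator does not vanish there, as \<open>T\<close> is transcendental.\<close>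

lemma rat_eval_hom:
  assumes L: "subfield_of (L :: 'a::field set)" and T: "\<not> alg_over L T"
  obtains \<psi> where "hom_on (ratx L L) \<psi>"
    "\<And>p q. p \<in> polys L \<Longrightarrow> q \<in> polys L \<Longrightarrow> q \<noteq> 0 \<Longrightarrow> \<psi> (fls_of_poly p / fls_of_poly q) = poly p T / poly q T"
proof -
  note R = subfield_ring[OF L]
  have nz: "poly q T \<noteq> 0" if "q \<in> polys L" "q \<noteq> 0" for q using T that unfolding alg_over_def by blast
  define Q where "Q z p q \<longleftrightarrow> p \<in> polys L \<and> q \<in> polys L \<and> q \<noteq> 0 \<and> z = fls_of_poly p / fls_of_poly q" for z p q
  define \<psi> where "\<psi> z = (SOME y. \<exists>p q. Q z p q \<and> y = poly p T / poly q T)" for z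
  have \<psi>: "\<psi> z = poly p T / poly q T" if "Q z p q" for z p q
    unfolding \<psi>_def
  proof (rule some_equality)
    show "\<exists>p' q'. Q z p' q' \<and> poly p T / poly q T = poly p' T / poly q' T" using that by blast
    fix y assume "\<exists>p q. Q z p q \<and> y = poly p T / poly q T"
    then obtain p' q' where *: "Q z p' q'" "y = poly p' T / poly q' T" by blast
    then have "fls_of_poly p / fls_of_poly q = fls_of_poly p' / fls_of_poly q'" using that by (simp add: Q_def)
    then have "fls_of_poly (p * q') = fls_of_poly (p' * q)" using * that by (simp add: Q_def frac_eq_eq fls_of_poly_hom)
    then have "poly p T * poly q' T = poly p' T * poly q T" by (metis fls_of_poly_inj poly_mult)
    then show "y = poly p T / poly q T" using * that nz by (simp add: Q_def frac_eq_eq)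
  qed
  have "hom_on (ratx L L) \<psi>"
    unfolding hom_on_def
  proof (intro conjI ballI)
    have "Q 1 1 1" by (simp add: Q_def polys_1[OF R] fls_of_poly_hom)
    from \<psi>[OF this] show "\<psi> 1 = 1" by simp
    fix x y assume "x \<in> ratx L L" "y \<in> ratx L L"
    obtain p q where "Q x p q" using \<open>x \<in> ratx L L\<close> by (auto simp: ratx_def Q_def)
    moreover obtain p' q' where "Q y p' q'" using \<open>y \<in> ratx L L\<close> by (auto simp: ratx_def Q_def)
    ultimately have *: "Q x p q" "Q y p' q'" .
    then have n: "poly q T \<noteq> 0" "poly q' T \<noteq> 0" "fls_of_poly q \<noteq> 0" "fls_of_poly q' \<noteq> 0" using nz by (auto simp: Q_def)
    have "x + y = fls_of_poly (p * q' + p' * q) / fls_of_poly (q * q')"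
      using * n by (simp add: Q_def add_frac_eq fls_of_poly_hom)
    then have "Q (x + y) (p * q' + p' * q) (q * q')"
      using * by (auto simp: Q_def intro!: polys_add[OF R] polys_mult[OF R])
    then show "\<psi> (x + y) = \<psi> x + \<psi> y" using \<psi>[OF *(1)] \<psi>[OF *(2)] \<psi> n by (simp add: add_frac_eq)
    have "Q (x * y) (p * p') (q * q')" using * by (auto simp: Q_def fls_of_poly_hom intro!: polys_mult[OF R])
    then show "\<psi> (x * y) = \<psi> x * \<psi> y" using \<psi>[OF *(1)] \<psi>[OF *(2)] \<psi> by simp
  qed
  then show ?thesis using that \<psi> by (auto simp: Q_def)
qed

lemma integral_hom:
  assumes E: "subring_of E" and h: "hom_on E h" and A: "A \<subseteq> E" and e: "e \<in> E" "integral_over A e"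
  shows "integral_over (h ` A) (h e)"
proof -
  obtain f where f: "f \<in> polys A" "monic f" "poly f e = 0" using e(2) unfolding integral_over_def by blast
  have fE: "f \<in> polys E" using f(1) polys_mono[OF A] by blast
  have "degree (map_poly h f) = degree f"
  proof (rule antisym[OF degree_map_poly_le])
    show "degree f \<le> degree (map_poly h f)" using f(2) by (intro le_degree) (simp add: coeff_hom_poly[OF E h] hom_1[OF E h])
  qed
  moreover have "poly (map_poly h f) (h e) = 0" using poly_hom[OF E h fE e(1)] f(3) hom_0[OF E h] by simp
  ultimately show ?thesis unfolding integral_over_def using f(1,2)
    by (intro bexI[of _ "map_poly h f"]) (auto simp: coeff_hom_poly[OF E h] hom_1[OF E h] polys_def)
qed

lemma (in ring_action) transport:
  fixes \<psi> :: "'b \<Rightarrow> 'c::field"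
  assumes sf: "subfield_of S" and \<psi>: "hom_on S \<psi>"
  defines "act' \<equiv> \<lambda>g y. \<psi> (act g (the_inv_into S \<psi> y))"
  shows "ring_action G (\<psi> ` S) act'" "ring_action.fixed G (\<psi> ` S) act' = \<psi> ` fixed"
    "\<And>g x. x \<in> S \<Longrightarrow> act' g (\<psi> x) = \<psi> (act g x)"
proof -
  note inj = hom_inj[OF sf \<psi>]
  have inv: "the_inv_into S \<psi> (\<psi> x) = x" if "x \<in> S" for x by (rule the_inv_into_f_f[OF inj that])
  show a: "act' g (\<psi> x) = \<psi> (act g x)" if "x \<in> S" for g x using inv[OF that] by (simp add: act'_def)
  show ra: "ring_action G (\<psi> ` S) act'"
  proof unfold_locales
    show "subring_of (\<psi> ` S)" by (rule subfield_ring[OF hom_image_subfield[OF sf \<psi>]])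
    show "finite (carrier G)" by (rule fin)
    fix g assume g: "g \<in> carrier G"
    have "act' g (\<psi> x + \<psi> y) = act' g (\<psi> x) + act' g (\<psi> y)" "act' g (\<psi> x * \<psi> y) = act' g (\<psi> x) * act' g (\<psi> y)"
      if "x \<in> S" "y \<in> S" for x y
      using that g a[of "x + y" g] a[of "x * y" g]
      by (simp_all add: a hom_add[OF S \<psi>] hom_mult[OF S \<psi>] hom_add[OF S hom] hom_mult[OF S hom] subring_simps[OF S] act_in)
    moreover have "act' g 1 = 1" using a[OF subring_1[OF S], of g] hom_1[OF S \<psi>] hom_1[OF S hom[OF g]] by simp
    ultimately show "hom_on (\<psi> ` S) (act' g)" by (auto simp: hom_on_def)
    fix x assume "x \<in> \<psi> ` S"
    then obtain y where y: "y \<in> S" "x = \<psi> y" by blast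
    show "act' g x \<in> \<psi> ` S" using a y act_in[OF g] by auto
    fix h assume h: "h \<in> carrier G"
    show "act' (g \<otimes> h) x = act' g (act' h x)" using a y act_mult[OF g h y(1)] act_in[OF h] by simp
  next
    fix x assume "x \<in> \<psi> ` S"
    then show "act' \<one> x = x" using a act_one by auto
  qed
  show "ring_action.fixed G (\<psi> ` S) act' = \<psi> ` fixed"
  proof
    show "ring_action.fixed G (\<psi> ` S) act' \<subseteq> \<psi> ` fixed"
    proof
      fix y assume "y \<in> ring_action.fixed G (\<psi> ` S) act'"
      then have "y \<in> \<psi> ` S" and fy: "\<And>g. g \<in> carrier G \<Longrightarrow> act' g y = y"
        unfolding ring_action.fixed_def[OF ra] by blast+
      then obtain x where x: "x \<in> S" "y = \<psi> x" "\<And>g. g \<in> carrier G \<Longrightarrow> act' g y = y"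
        by blast
      have "act g x = x" if g: "g \<in> carrier G" for g
      proof (rule inj_onD[OF inj _ act_in[OF g x(1)] x(1)])
        show "\<psi> (act g x) = \<psi> x" using x(3)[OF g] a[OF x(1), of g] x(2) by simp
      qed
      then show "y \<in> \<psi> ` fixed" using x(1,2) by (auto simp: fixed_def)
    qed
    show "\<psi> ` fixed \<subseteq> ring_action.fixed G (\<psi> ` S) act'"
      unfolding ring_action.fixed_def[OF ra] using a fixedD by auto
  qed
qed

text \<open>The field \<open>E\<close> lives in \<open>F((X))\<close>, but the extension must be a subset of the type \<open>'a\<close>.  It is transported
  there by a homomorphism with \<open>X \<mapsto> T\<close>; to extend it from \<open>k(X)\<close> to \<open>E\<close>, \<open>'a\<close> must be algebraically closed.\<close>

locale series_extension = ring_action G F act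
  for G :: "('i, 'm) monoid_scheme" (structure) and F :: "'a::field set" and act +
  fixes k :: "'a set" and T :: 'a and E :: "'a fls set"
  assumes ac: "\<And>q :: 'a poly. degree q > 0 \<Longrightarrow> \<exists>z. poly q z = 0"
    and F: "subfield_of F" and k: "fixed = k" and T: "\<not> alg_over k T"
    and faithful: "\<And>g. g \<in> carrier G \<Longrightarrow> (\<And>x. x \<in> F \<Longrightarrow> act g x = x) \<Longrightarrow> g = \<one>"
    and E: "subring_of E" "E \<subseteq> ser F" "ratx k k \<subseteq> E"
    and E_act: "\<And>g e. g \<in> carrier G \<Longrightarrow> e \<in> E \<Longrightarrow> ser_map (act g) e \<in> E"
    and E_fixed: "\<And>e. e \<in> E \<Longrightarrow> (\<And>g. g \<in> carrier G \<Longrightarrow> ser_map (act g) e = e) \<Longrightarrow> e \<in> ratx k k"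
    and E_place: "\<And>z. z \<in> F \<Longrightarrow> \<exists>e\<in>E. integral_over (polyx k) e \<and> e $$ 0 = z"
    and E_nonconst: "\<not> E \<subseteq> ratx UNIV UNIV"
begin

lemma kF: "subfield_of k" "k \<subseteq> F"
  using k fixed_subfield[OF F] fixedD(1) by auto

sublocale ext: ring_action G E "\<lambda>g. ser_map (act g)"
proof -
  interpret s: ring_action G "ser F" "\<lambda>g. ser_map (act g)" by (rule ser_action[OF ring_action_axioms F])
  show "ring_action G E (\<lambda>g. ser_map (act g))"
  proof unfold_locales
    show "subring_of E" "finite (carrier G)" using E(1) fin by auto
    show "hom_on E (ser_map (act g))" if "g \<in> carrier G" for g by (rule hom_on_subset[OF s.hom[OF that] E(2)])
    show "ser_map (act g) x \<in> E" if "g \<in> carrier G" "x \<in> E" for g x by (rule E_act[OF that])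
    show "ser_map (act (g \<otimes> h)) x = ser_map (act g) (ser_map (act h) x)" if "g \<in> carrier G" "h \<in> carrier G" "x \<in> E" for g h x
      using s.act_mult[OF that(1,2)] that(3) E(2) by auto
    show "ser_map (act \<one>) x = x" if "x \<in> E" for x using s.act_one that E(2) by auto
  qed
qed

lemma ext_fixed: "ext.fixed = ratx k k"
proof
  show "ext.fixed \<subseteq> ratx k k" using E_fixed unfolding ext.fixed_def by auto
  show "ratx k k \<subseteq> ext.fixed"
  proof
    fix x assume x: "x \<in> ratx k k"
    then have "x \<in> ser k" using ratx_ser[OF kF(1) order_refl] by auto
    then have "ser_map (act g) x = x" if "g \<in> carrier G" for g
      using that k fixedD(2) by (intro fls_eqI) (simp add: ser_map_nth'[OF F hom] ser_nth)
    then show "x \<in> ext.fixed" using x E(3) unfolding ext.fixed_def by blast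
  qed
qed

lemma E_subfield: "subfield_of E"
  by (rule ext.subfield_if_fixed_subfield) (simp add: ext_fixed ratx_subfield subfield_ring[OF kF(1)])

lemma obtain_primitive:
  obtains \<theta> where "\<theta> \<in> E" "inj_on (\<lambda>g. ser_map (act g) \<theta>) (carrier G)"
proof -
  obtain \<theta> where \<theta>: "\<theta> \<in> E" "\<forall>g\<in>carrier G. ser_map (act g) \<theta> = \<theta> \<longrightarrow> (\<forall>x\<in>E. ser_map (act g) x = x)"
    using ext.primitive_element[OF E_subfield E_subfield order_refl] ext.fixed_def by blast
  \<comment> \<open>The constant coefficients of elements of \<open>E\<close> exhaust
    \<open>F\<close>, so acting trivially on \<open>E\<close> forces acting trivially on
    \<open>F\<close>.\<close>
  have "g = \<one>" if g: "g \<in> carrier G" "ser_map (act g) \<theta> = \<theta>" for g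
  proof (rule faithful[OF g(1)])
    fix z assume "z \<in> F"
    then obtain e where e: "e \<in> E" "e $$ 0 = z" using E_place by blast
    then have "ser_map (act g) e = e" using \<theta>(2) g by blast
    then show "act g z = z" using ser_map_nth'[OF F hom[OF g(1)], of e 0] e(2) by simp
  qed
  then show ?thesis using that \<theta>(1) ext.primitive_inj by blast
qed

lemma alg_closure_eq: "field.alg_closure_in \<Omega> k = {x. alg_over k x}"
  using Om_algebraic_iff[OF subfield_ring[OF kF(1)]] by (simp add: field.alg_closure_in_def[OF Om_field])

lemma alg_closure_subfield: "subfield_of {x. alg_over k x}"
  using field.subfield_of_algebraics[OF Om_field Om_subfield_iff[THEN iffD2, OF kF(1)]]
  unfolding Om_subfield_iff alg_closure_eq[unfolded field.alg_closure_in_def[OF Om_field]] .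

theorem extension_exists:
  "\<exists>L. field.galois_extension_of_group \<Omega> (field.adjoin \<Omega> k T) L G \<and>
    \<not> L \<subseteq> field.adjoin \<Omega> (field.alg_closure_in \<Omega> k) T \<and>
    field.specialization_equals \<Omega> k T L 0 F"
proof -
  note kR = subfield_ring[OF kF(1)]
  let ?K = "ratx k k" and ?kb = "{x. alg_over k x}"
  have kb: "subfield_of ?kb" by (rule alg_closure_subfield)
  have k_kb: "k \<subseteq> ?kb"
  proof
    fix x assume "x \<in> k"
    then have "[:- x, 1:] \<in> polys k" by (simp add: polys_pCons_iff[OF kR] polys_0[OF kR] subring_simps[OF kR])
    then show "x \<in> ?kb" unfolding alg_over_def by (intro CollectI bexI[of _ "[:- x, 1:]"]) auto
  qed
  have Tkb: "\<not> alg_over ?kb T"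
  proof
    assume "alg_over ?kb T"
    then obtain q where "q \<noteq> 0" "poly q T = 0" "\<And>i. alg_over k (poly.coeff q i)" unfolding alg_over_def[of ?kb] polys_def by auto
    then show False using alg_over_trans[OF kF(1)] T by blast
  qed
  obtain \<theta> where \<theta>: "\<theta> \<in> E" "inj_on (\<lambda>g. ser_map (act g) \<theta>) (carrier G)" by (rule obtain_primitive)
  obtain \<psi>b where \<psi>b: "hom_on (ratx ?kb ?kb) \<psi>b"
    "\<And>p q. p \<in> polys ?kb \<Longrightarrow> q \<in> polys ?kb \<Longrightarrow> q \<noteq> 0 \<Longrightarrow> \<psi>b (fls_of_poly p / fls_of_poly q) = poly p T / poly q T"
    using rat_eval_hom[OF kb Tkb] by metis
  have K_kb: "?K \<subseteq> ratx ?kb ?kb" by (rule ratx_mono[OF k_kb k_kb])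
  have \<psi>K: "hom_on ?K \<psi>b" by (rule hom_on_subset[OF \<psi>b(1) K_kb])
  have Kf: "subfield_of ?K" by (rule ratx_subfield[OF kR])
  have E_ext: "simple_ext ?K \<theta> = E"
  proof
    show "simple_ext ?K \<theta> \<subseteq> E" by (rule simple_ext_subset[OF E(1,3) \<theta>(1)])
    show "E \<subseteq> simple_ext ?K \<theta>" using ext.primitive_span[OF E_subfield \<theta>] unfolding simple_ext_def ext_fixed by blast
  qed
  obtain f where f: "is_minpoly ?K \<theta> f"
    using minpoly_exists[OF Kf] ext.alg_over_fixed[OF \<theta>(1)] unfolding ext_fixed by blast
  have f': "f \<in> polys ?K" "monic f" "poly f \<theta> = 0" using f by (auto simp: is_minpoly_def)
  have df: "degree f > 0"
  proof (rule ccontr)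
    assume "\<not> degree f > 0"
    then obtain c where "f = [:c:]" by (metis degree_eq_zeroE not_gr0)
    then show False using f' by auto
  qed
  have "degree (map_poly \<psi>b f) = degree f"
  proof (rule antisym[OF degree_map_poly_le])
    show "degree f \<le> degree (map_poly \<psi>b f)"
      using f'(2) by (intro le_degree) (simp add: coeff_hom_poly[OF subfield_ring[OF Kf] \<psi>K] hom_1[OF subfield_ring[OF Kf] \<psi>K])
  qed
  \<comment> \<open>Any root of the transported minimal polynomial may serve as the image of
    \<open>\<theta>\<close>, and it determines \<open>\<psi>\<close> on \<open>E\<close>.\<close>
  then obtain \<theta>' where \<theta>': "poly (map_poly \<psi>b f) \<theta>' = 0" using ac[of "map_poly \<psi>b f"] df by auto
  obtain \<psi> where \<psi>: "hom_on E \<psi>" "\<psi> \<theta> = \<theta>'" "\<And>c. c \<in> ?K \<Longrightarrow> \<psi> c = \<psi>b c"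
    using extend_hom[OF Kf f \<psi>K \<theta>'] unfolding E_ext by metis
  define L where "L = \<psi> ` E"
  define act' where "act' = (\<lambda>g y. \<psi> (ser_map (act g) (the_inv_into E \<psi> y)))"
  note tr = ext.transport[OF E_subfield \<psi>(1), folded act'_def L_def]
  interpret L: ring_action G L act' by (rule tr(1))
  have tr3: "act' g (\<psi> x) = \<psi> (ser_map (act g) x)" if "x \<in> E" for g x
    using ext.transport(3)[OF E_subfield \<psi>(1) that, of g] by (simp add: act'_def)
  have Lsf: "subfield_of L" unfolding L_def by (rule hom_image_subfield[OF E_subfield \<psi>(1)])
  have \<psi>rat: "\<psi> (fls_of_poly p / fls_of_poly q) = poly p T / poly q T" if "p \<in> polys k" "q \<in> polys k" "q \<noteq> 0" for p q
    using \<psi>(3)[OF ratxI[OF that]] \<psi>b(2)[OF subsetD[OF polys_mono[OF k_kb] that(1)] subsetD[OF polys_mono[OF k_kb] that(2)] that(3)]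
    by simp
  have \<psi>K_img: "\<psi> ` ?K = field.adjoin \<Omega> k T"
  proof
    show "\<psi> ` ?K \<subseteq> field.adjoin \<Omega> k T"
      unfolding adjoin_eq(1)[OF kF(1)] ratx_def using \<psi>rat by blast
    show "field.adjoin \<Omega> k T \<subseteq> \<psi> ` ?K"
    proof
      fix y assume "y \<in> field.adjoin \<Omega> k T"
      then obtain p q where pq: "p \<in> polys k" "q \<in> polys k" "y = poly p T / poly q T"
        unfolding adjoin_eq(1)[OF kF(1)] by blast
      show "y \<in> \<psi> ` ?K"
      proof (cases "q = 0")
        case True
        then have "y = \<psi> 0" using pq hom_0[OF E(1) \<psi>(1)] by simp
        then show ?thesis using subring_0[OF subfield_ring[OF Kf]] by blast
      next
        case False
        then show ?thesis using \<psi>rat[OF pq(1,2)] pq(3) ratxI[OF pq(1,2)] by (metis image_eqI)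
      qed
    qed
  qed
  have Lfix: "L.fixed = field.adjoin \<Omega> k T" using tr(2) ext_fixed \<psi>K_img by simp
  have \<theta>L: "\<theta>' \<in> L" using \<psi>(2) \<theta>(1) by (auto simp: L_def)
  have "inj_on (\<lambda>g. act' g \<theta>') (carrier G)"
  proof (rule inj_onI)
    fix g h assume gh: "g \<in> carrier G" "h \<in> carrier G" "act' g \<theta>' = act' h \<theta>'"
    then have "\<psi> (ser_map (act g) \<theta>) = \<psi> (ser_map (act h) \<theta>)" unfolding \<psi>(2)[symmetric] tr3[OF \<theta>(1)] by simp
    then have "ser_map (act g) \<theta> = ser_map (act h) \<theta>"
      using hom_inj[OF E_subfield \<psi>(1)] E_act[OF _ \<theta>(1)] gh by (auto simp: inj_on_def)
    then show "g = h" using \<theta>(2) gh by (auto simp: inj_on_def)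
  qed
  then have 1: "field.galois_extension_of_group \<Omega> (field.adjoin \<Omega> k T) L G"
    using L.galois_extension_fixed[OF Lsf \<theta>L] Lfix by simp
  have 2: "\<not> L \<subseteq> field.adjoin \<Omega> (field.alg_closure_in \<Omega> k) T"
  proof
    assume "L \<subseteq> field.adjoin \<Omega> (field.alg_closure_in \<Omega> k) T"
    then have "\<theta>' \<in> field.adjoin \<Omega> ?kb T" using \<theta>L alg_closure_eq by auto
    then obtain p q where pq: "p \<in> polys ?kb" "q \<in> polys ?kb" "\<theta>' = poly p T / poly q T"
      unfolding adjoin_eq(1)[OF kb] by blast
    have "\<exists>z\<in>ratx ?kb ?kb. \<psi>b z = \<theta>'"
    proof (cases "q = 0")
      case True
      have "0 \<in> ratx ?kb ?kb" by (rule subring_0[OF subfield_ring[OF ratx_subfield[OF subfield_ring[OF kb]]]])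
      moreover have "\<psi>b 0 = \<theta>'" using pq True hom_0[OF subfield_ring[OF ratx_subfield[OF subfield_ring[OF kb]]] \<psi>b(1)] by simp
      ultimately show ?thesis by blast
    next
      case False
      then show ?thesis using \<psi>b(2)[OF pq(1,2)] pq(3) ratxI[OF pq(1,2)] by metis
    qed
    then obtain z where z: "z \<in> ratx ?kb ?kb" "\<psi>b z = \<theta>'" by blast
    have kbf: "subfield_of (ratx ?kb ?kb)" by (rule ratx_subfield[OF subfield_ring[OF kb]])
    \<comment> \<open>The maps \<open>\<psi>\<close> and \<open>\<psi>b\<close> agree on $k(X)$ but
      need not be compatible beyond it. Hence \<open>z\<close> is shown only to be a root of
      \<open>f\<close>, and so a conjugate of \<open>\<theta>\<close>; this suffices to make
      \<open>E\<close> rational.\<close>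
    have "f \<in> polys (ratx ?kb ?kb)" using f'(1) polys_mono[OF K_kb] by blast
    then have "\<psi>b (poly f z) = 0" using poly_hom[OF subfield_ring[OF kbf] \<psi>b(1) _ z(1), of f] z(2) \<theta>' by simp
    moreover have "poly f z \<in> ratx ?kb ?kb" using \<open>f \<in> polys (ratx ?kb ?kb)\<close> z(1) by (rule poly_in[OF subfield_ring[OF kbf]])
    ultimately have fz: "poly f z = 0"
      using hom_inj[OF kbf \<psi>b(1)] hom_0[OF subfield_ring[OF kbf] \<psi>b(1)] subring_0[OF subfield_ring[OF kbf]] by (auto simp: inj_on_def)
    have "poly (ext.orbit_poly \<theta>) z = 0"
    proof -
      obtain r where "ext.orbit_poly \<theta> = f * r"
        using f ext.orbit_poly(1,5)[OF \<theta>(1)] unfolding is_minpoly_def ext_fixed by blast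
      then show ?thesis using fz by simp
    qed
    then have "(\<Prod>g\<in>carrier G. z - ser_map (act g) \<theta>) = 0" using ext.orbit_poly(3)[OF \<theta>(1)] by simp
    then obtain g where g: "g \<in> carrier G" "z = ser_map (act g) \<theta>" using fin by (auto simp: prod_zero_iff)
    have UU: "ratx ?kb ?kb \<subseteq> ratx UNIV UNIV" "?K \<subseteq> ratx UNIV UNIV" by (rule ratx_mono[OF subset_UNIV subset_UNIV])+
    have "E \<subseteq> ratx UNIV UNIV"
    proof
      fix e assume e: "e \<in> E"
      \<comment> \<open>With \<open>g\<close> undone first, \<open>e\<close> becomes a polynomial
        over $k(X)$ in the conjugate \<open>z\<close> instead of \<open>\<theta>\<close>.\<close>
      define e' where "e' = ser_map (act (inv g)) e"
      have e': "e' \<in> E" "ser_map (act g) e' = e"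
        using E_act[OF inv_closed[OF g(1)] e] ext.act_mult[OF g(1) inv_closed[OF g(1)] e] ext.act_one[OF e] g(1)
        by (auto simp: e'_def)
      obtain p where p: "p \<in> polys ?K" "e' = poly p \<theta>" using e'(1) unfolding E_ext[symmetric] simple_ext_def by blast
      have pE: "p \<in> polys E" using p(1) polys_mono[OF E(3)] by blast
      have "map_poly (ser_map (act g)) p = p"
        using p(1) ext.fixedD(2)[OF _ g(1)] unfolding ext_fixed
        by (intro poly_eqI) (simp add: coeff_hom_poly[OF E(1) ext.hom[OF g(1)]] polys_def)
      then have "e = poly p z" using poly_hom[OF E(1) ext.hom[OF g(1)] pE \<theta>(1)] e'(2) p(2) g(2) by simp
      moreover have "poly p z \<in> ratx UNIV UNIV"
        by (rule poly_in[OF subfield_ring[OF ratx_subfield[OF subring_of_UNIV]]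
            subsetD[OF polys_mono[OF UU(2)] p(1)] subsetD[OF UU(1) z(1)]])
      ultimately show "e \<in> ratx UNIV UNIV" by simp
    qed
    then show False using E_nonconst by blast
  qed
  have 3: "field.specialization_equals \<Omega> k T L 0 F"
  proof -
    let ?A = "simple_ext k T"
    define B where "B = {x \<in> L. integral_over ?A x}"
    define \<psi>' where "\<psi>' = the_inv_into E \<psi>"
    have inj: "inj_on \<psi> E" by (rule hom_inj[OF E_subfield \<psi>(1)])
    have inv: "\<psi>' (\<psi> x) = x" if "x \<in> E" for x unfolding \<psi>'_def by (rule the_inv_into_f_f[OF inj that])
    have \<psi>'h: "hom_on L \<psi>'" unfolding L_def \<psi>'_def by (rule hom_on_the_inv[OF E_subfield \<psi>(1)])
    have pE: "polyx k \<subseteq> E" using polyx_ratx[OF kR] E(3) by blast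
    have \<psi>p: "\<psi> (fls_of_poly p) = poly p T" if "p \<in> polys k" for p
      using \<psi>rat[OF that polys_1[OF kR]] by (simp add: fls_of_poly_hom)
    have \<psi>A: "\<psi> ` polyx k = ?A" unfolding polyx_def simple_ext_def image_image using \<psi>p by (intro image_cong) auto
    have \<psi>'A: "\<psi>' ` ?A = polyx k" unfolding \<psi>A[symmetric] image_image using inv subsetD[OF pE] by simp
    have AL: "?A \<subseteq> L" unfolding \<psi>A[symmetric] L_def using pE by blast
    have Bint: "\<psi> e \<in> B \<longleftrightarrow> integral_over (polyx k) e" if e: "e \<in> E" for e
    proof
      assume "\<psi> e \<in> B"
      then show "integral_over (polyx k) e"
        using integral_hom[OF L.S \<psi>'h AL, of "\<psi> e"] inv[OF e] \<psi>'A by (simp add: B_def)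
    next
      assume "integral_over (polyx k) e"
      then show "\<psi> e \<in> B" using integral_hom[OF E(1) \<psi>(1) pE e] \<psi>A e by (simp add: B_def L_def)
    qed
    have Bel: "\<exists>e\<in>E. integral_over (polyx k) e \<and> y = \<psi> e" if y: "y \<in> B" for y
    proof -
      obtain e where e: "e \<in> E" "y = \<psi> e" using y by (auto simp: B_def L_def)
      then show ?thesis using Bint[OF e(1)] y by blast
    qed
    have \<psi>'n: "\<psi>' y \<in> nonneg" if "y \<in> B" for y
      using Bel[OF that] nonneg_integrally_closed[OF _ polyx_nonneg] inv by auto
    have BL: "B \<subseteq> L" by (auto simp: B_def)
    \<comment> \<open>The place is the value at $X = 0$ of the series behind \<open>y\<close>, which
      is regular because it is integral.\<close>
    define \<pi> where "\<pi> y = \<psi>' y $$ 0" for y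
    have act_A: "act' g c = c" if gc: "g \<in> carrier G" "c \<in> ?A" for g c
    proof -
      obtain p where p: "p \<in> polyx k" "c = \<psi> p" using gc(2) unfolding \<psi>A[symmetric] by blast
      have "ser_map (act g) p = p" using p(1) polyx_ratx[OF kR] ext.fixedD(2)[OF _ gc(1)] unfolding ext_fixed by auto
      then show ?thesis using tr3[of p g] p pE by auto
    qed
    have act_B: "act' g y \<in> B" if "g \<in> carrier G" "y \<in> B" for g y
    proof -
      have "integral_over (act' g ` ?A) (act' g y)"
        by (rule integral_hom[OF L.S L.hom[OF that(1)] AL]) (use that(2) in \<open>auto simp: B_def\<close>)
      moreover have "act' g ` ?A = ?A" using act_A[OF that(1)] by force
      ultimately show ?thesis using L.act_in[OF that(1)] that(2) by (auto simp: B_def)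
    qed
    show ?thesis
    proof (rule specialization_if_place[where E = L and k = k and T = T and F = F and \<alpha> = act' and \<pi> = \<pi> and I = "carrier G" and ?i0.0 = \<one>, folded B_def])
      show "subfield_of k" "subfield_of F" "k \<subseteq> F" "subring_of L" "?A \<subseteq> L" "finite (carrier G)" "\<one> \<in> carrier G"
        using kF F L.S AL fin by auto
      show "hom_on B \<pi>"
        using nonneg_coeff_hom \<psi>'n hom_on_subset[OF \<psi>'h BL] unfolding hom_on_def \<pi>_def by auto
      show "\<pi> ` B = F"
      proof
        show "\<pi> ` B \<subseteq> F"
        proof
          fix z assume "z \<in> \<pi> ` B"
          then obtain y where "y \<in> B" "z = \<psi>' y $$ 0" by (auto simp: \<pi>_def)
          moreover from this obtain e where "e \<in> E" "y = \<psi> e" using Bel by blast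
          ultimately show "z \<in> F" using inv E(2) by (auto simp: ser_def)
        qed
        show "F \<subseteq> \<pi> ` B"
        proof
          fix z assume "z \<in> F"
          then obtain e where e: "e \<in> E" "integral_over (polyx k) e" "e $$ 0 = z" using E_place by blast
          then show "z \<in> \<pi> ` B" using Bint[OF e(1)] inv[OF e(1)] by (intro image_eqI[of _ _ "\<psi> e"]) (auto simp: \<pi>_def)
        qed
      qed
      show "\<pi> c = c" if "c \<in> k" for c
      proof -
        have "[:c:] \<in> polys k" using that by (simp add: polys_pCons_iff[OF kR] polys_0[OF kR])
        then have "\<psi> (fls_const c) = c" "fls_const c \<in> E" using \<psi>p[of "[:c:]"] pE by (auto simp: fls_of_poly_hom polyx_def)
        then show ?thesis using inv[of "fls_const c"] by (simp add: \<pi>_def)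
      qed
      show "\<pi> T = 0"
      proof -
        have "[:0, 1:] \<in> polys k" by (simp add: polys_pCons_iff[OF kR] polys_0[OF kR] subring_simps[OF kR])
        then have "\<psi> fls_X = T" "fls_X \<in> E" using \<psi>p[of "[:0, 1:]"] pE unfolding polyx_def by (auto simp: fls_of_poly_hom(9))
        then show ?thesis using inv[of fls_X] by (simp add: \<pi>_def)
      qed
      show "hom_on B (act' g)" if "g \<in> carrier G" for g by (rule hom_on_subset[OF L.hom[OF that] BL])
      show "act' g ` B = B" if g: "g \<in> carrier G" for g
      proof
        show "act' g ` B \<subseteq> B" using act_B[OF g] by blast
        show "B \<subseteq> act' g ` B"
        proof
          fix y assume y: "y \<in> B"
          then have "y = act' g (act' (inv g) y)"
            using L.act_mult[OF g inv_closed[OF g], of y] L.act_one[of y] g BL by auto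
          then show "y \<in> act' g ` B" using act_B[OF inv_closed[OF g] y] by blast
        qed
      qed
      show "act' g c = c" if "g \<in> carrier G" "c \<in> ?A" for g c by (rule act_A[OF that])
      show "act' \<one> x = x" if "x \<in> B" for x using L.act_one that BL by auto
      fix x assume x: "x \<in> B"
      then obtain e where e: "e \<in> E" "integral_over (polyx k) e" "x = \<psi> e" using Bel by blast
      have "(\<Prod>g\<in>carrier G. act' g x) = \<psi> (\<Prod>g\<in>carrier G. ser_map (act g) e)"
        using hom_prod[OF E(1) \<psi>(1), of "carrier G" "\<lambda>g. ser_map (act g) e"] E_act[OF _ e(1)] tr3[OF e(1)] e(3) by simp
      \<comment> \<open>The norm is invariant, hence rational over \<open>k\<close>, and integral,
        hence a polynomial.\<close>
      moreover have "(\<Prod>g\<in>carrier G. ser_map (act g) e) \<in> polyx k"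
      proof (rule ratx_integrally_closed[OF ac kF(1)])
        show nk: "(\<Prod>g\<in>carrier G. ser_map (act g) e) \<in> ?K" using ext.prod_fixed[OF e(1)] unfolding ext_fixed .
        have "\<psi> (\<Prod>g\<in>carrier G. ser_map (act g) e) \<in> B"
        proof -
          have BR: "subring_of B" using L.S integral_subring[OF simple_ext_subring[OF kR]] by (auto simp: B_def subring_of_def)
          have "(\<Prod>g\<in>carrier G. act' g x) \<in> B" by (rule subring_prod[OF BR]) (rule act_B[OF _ x])
          then show ?thesis using calculation by simp
        qed
        then show "integral_over (polyx k) (\<Prod>g\<in>carrier G. ser_map (act g) e)" using Bint nk E(3) by blast
      qed
      ultimately show "(\<Prod>g\<in>carrier G. act' g x) \<in> ?A" unfolding \<psi>A[symmetric] by simp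
    qed
  qed
  show ?thesis using 1 2 3 by blast
qed

end

section \<open>Two facts on finite groups\<close>

text \<open>The last nontrivial term of the derived series is abelian and normal; within it the
  elements killed by \<open>p\<close> form a subgroup stable under conjugation, nontrivial if
  \<open>p\<close> divides the order of some element.\<close>

lemma (in group) elementary_abelian_normal_subgroup:
  assumes sol: "solvable G" and fin: "finite (carrier G)" and nt: "carrier G \<noteq> {\<one>}"
  obtains A and p :: nat where "Factorial_Ring.prime p" "A \<lhd> G" "A \<noteq> {\<one>}"
    "\<And>a b. a \<in> A \<Longrightarrow> b \<in> A \<Longrightarrow> a \<otimes> b = b \<otimes> a" "\<And>a. a \<in> A \<Longrightarrow> a [^] p = \<one>"
proof -
  let ?D = "\<lambda>n. (derived G ^^ n) (carrier G)"
  have "\<exists>n. ?D n = {\<one>}" using sol solvable_iff_trivial_derived_seq by blast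
  then obtain n where n: "?D n = {\<one>}" "\<And>m. m < n \<Longrightarrow> ?D m \<noteq> {\<one>}" using exists_least_iff[of "\<lambda>n. ?D n = {\<one>}"] by blast
  have "n \<noteq> 0" using n(1) nt by (metis funpow_0)
  then obtain m where m: "n = Suc m" by (metis not0_implies_Suc)
  define D where "D = ?D m"
  have Dn: "?D i \<lhd> G" for i
  proof (induction i)
    case 0
    show ?case by (simp add: normal_inv_iff subgroup_self)
  next
    case (Suc i)
    then show ?case using derived_is_normal by simp
  qed
  have D: "D \<lhd> G" "D \<noteq> {\<one>}" "derived G D = {\<one>}" using Dn n m by (auto simp: D_def)
  have Dsub: "subgroup D G" using D(1) normal_imp_subgroup by blast
  then have DG: "D \<subseteq> carrier G" by (rule subgroup.subset)
  have comm: "a \<otimes> b = b \<otimes> a" if ab: "a \<in> D" "b \<in> D" for a b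
  proof -
    have "a \<otimes> b \<otimes> inv a \<otimes> inv b \<in> derived_set G D" using ab by blast
    then have "a \<otimes> b \<otimes> inv a \<otimes> inv b \<in> derived G D" by (simp add: derived_def generate.incl)
    then have e: "a \<otimes> b \<otimes> inv a \<otimes> inv b = \<one>" using D(3) by simp
    have c: "a \<in> carrier G" "b \<in> carrier G" using ab DG by auto
    have "a \<otimes> b \<otimes> inv (b \<otimes> a) = \<one>" using e c by (simp add: inv_mult_group m_assoc)
    then show ?thesis using c by (metis inv_equality inv_inv inv_closed m_closed)
  qed
  obtain d where d: "d \<in> D" "d \<noteq> \<one>" using D(2) subgroup.one_closed[OF Dsub] by blast
  then have dG: "d \<in> carrier G" using DG by auto
  have "ord d \<noteq> 1" using d dG by (metis pow_ord_eq_1 nat_pow_eone)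
  then obtain p where p: "Factorial_Ring.prime p" "p dvd ord d" using prime_factor_nat by blast
  have od: "ord d > 0" using ord_ge_1[OF fin dG] by simp
  define q where "q = ord d div p"
  have pq: "ord d = q * p" using p by (simp add: q_def)
  have q: "0 < q" "q < ord d" using pq od prime_gt_1_nat[OF p(1)] by auto
  define A where "A = {a \<in> D. a [^] p = \<one>}"
  have powD: "x [^] (i::nat) \<in> D" if "x \<in> D" for x i
    by (induction i) (auto simp: subgroup.one_closed[OF Dsub] intro: subgroup.m_closed[OF Dsub] that)
  have conj_pow: "(g \<otimes> a \<otimes> inv g) [^] (i::nat) = g \<otimes> a [^] i \<otimes> inv g" if "g \<in> carrier G" "a \<in> carrier G" for g a i
  proof (induction i)
    case (Suc i)
    have "(g \<otimes> a [^] i \<otimes> inv g) \<otimes> (g \<otimes> a \<otimes> inv g) = g \<otimes> (a [^] i \<otimes> (inv g \<otimes> g) \<otimes> a) \<otimes> inv g"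
      using that by (simp only: m_assoc inv_closed nat_pow_closed m_closed)
    then show ?case using Suc that by (simp add: m_assoc)
  qed (use that in simp)
  have "subgroup A G"
  proof (rule subgroupI)
    show "A \<subseteq> carrier G" using DG by (auto simp: A_def)
    show "A \<noteq> {}" using subgroup.one_closed[OF Dsub] by (auto simp: A_def)
    show "inv a \<in> A" if "a \<in> A" for a
    proof -
      have "a \<in> D" "a [^] p = \<one>" "a \<in> carrier G" using that DG by (auto simp: A_def)
      then show ?thesis using subgroup.m_inv_closed[OF Dsub] nat_pow_inv[of a p] by (simp add: A_def)
    qed
    show "a \<otimes> b \<in> A" if "a \<in> A" "b \<in> A" for a b
    proof -
      have ab: "a \<in> D" "b \<in> D" "a \<in> carrier G" "b \<in> carrier G" "a [^] p = \<one>" "b [^] p = \<one>" using that DG by (auto simp: A_def)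
      have "(a \<otimes> b) [^] p = a [^] p \<otimes> b [^] p" by (rule pow_mult_distrib[OF comm[OF ab(1,2)] ab(3,4)])
      then show ?thesis using ab subgroup.m_closed[OF Dsub] by (simp add: A_def)
    qed
  qed
  moreover have "g \<otimes> a \<otimes> inv g \<in> A" if "g \<in> carrier G" "a \<in> A" for g a
  proof -
    have a: "a \<in> D" "a \<in> carrier G" "a [^] p = \<one>" using that DG by (auto simp: A_def)
    have "g \<otimes> a \<otimes> inv g \<in> D" using D(1) that(1) a(1) by (auto simp: normal_inv_iff)
    then show ?thesis using conj_pow[OF that(1) a(2)] a that(1) by (simp add: A_def)
  qed
  ultimately have "A \<lhd> G" by (auto simp: normal_inv_iff)
  moreover have "A \<noteq> {\<one>}"
  proof -
    have "d [^] q \<in> A" using powD[OF d(1)] dG pq by (simp add: A_def nat_pow_pow pow_ord_eq_1[symmetric])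
    moreover have "d [^] q \<noteq> \<one>" using pow_eq_id[OF dG, of q] q by (auto dest: dvd_imp_le)
    ultimately show ?thesis by blast
  qed
  ultimately show ?thesis using that[OF p(1)] comm by (auto simp: A_def)
qed

text \<open>For a proper subgroup \<open>B\<close> of \<open>A\<close> of maximal size and
  \<open>a0\<close> outside it, every element of \<open>A\<close> is an element of \<open>B\<close>
  times a power of \<open>a0\<close>; the exponent modulo \<open>p\<close> is the character.\<close>

lemma (in group) prime_exponent_character:
  fixes p :: nat
  assumes p: "Factorial_Ring.prime p" and A: "subgroup A G" "finite A" "A \<noteq> {\<one>}"
    and comm: "\<And>a b. a \<in> A \<Longrightarrow> b \<in> A \<Longrightarrow> a \<otimes> b = b \<otimes> a" and exp: "\<And>a. a \<in> A \<Longrightarrow> a [^] p = \<one>"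
  obtains a0 and \<chi> :: "'a \<Rightarrow> nat" where "a0 \<in> A" "\<chi> a0 = 1" "\<And>a. a \<in> A \<Longrightarrow> \<chi> a < p"
    "\<And>a b. a \<in> A \<Longrightarrow> b \<in> A \<Longrightarrow> \<chi> (a \<otimes> b) mod p = (\<chi> a + \<chi> b) mod p"
proof -
  define Sub where "Sub = {B. subgroup B G \<and> B \<subset> A}"
  have AG: "A \<subseteq> carrier G" using A(1) by (rule subgroup.subset)
  have "finite Sub" using A(2) by (intro finite_subset[of Sub "Pow A"]) (auto simp: Sub_def)
  moreover have "{\<one>} \<in> Sub" using triv_subgroup A(3) subgroup.one_closed[OF A(1)] by (auto simp: Sub_def)
  ultimately obtain B where B: "B \<in> Sub" "\<And>B'. B' \<in> Sub \<Longrightarrow> card B' \<le> card B"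
    using finite_has_maximal[of "card ` Sub"] by (metis (no_types, lifting) empty_iff finite_imageI image_iff nat_le_linear)
  have Bs: "subgroup B G" "B \<subset> A" using B(1) by (auto simp: Sub_def)
  then obtain a0 where a0: "a0 \<in> A" "a0 \<notin> B" by blast
  have a0G: "a0 \<in> carrier G" using a0 AG by auto
  have BG: "B \<subseteq> carrier G" using Bs(2) AG by auto
  have powA: "x [^] (i::nat) \<in> A" if "x \<in> A" for x i
    by (induction i) (auto simp: subgroup.one_closed[OF A(1)] intro: subgroup.m_closed[OF A(1)] that)
  have powB: "x [^] (i::nat) \<in> B" if "x \<in> B" for x i
    by (induction i) (auto simp: subgroup.one_closed[OF Bs(1)] intro: subgroup.m_closed[OF Bs(1)] that)
  have split: "(b \<otimes> a0 [^] i) \<otimes> (b' \<otimes> a0 [^] j) = (b \<otimes> b') \<otimes> a0 [^] (i + j)" if "b \<in> B" "b' \<in> B" for b b' and i j :: nat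
  proof -
    have c: "b \<in> carrier G" "b' \<in> carrier G" using that BG by auto
    have "a0 [^] i \<otimes> b' = b' \<otimes> a0 [^] i" using comm[OF powA[OF a0(1)], of b' i] that Bs(2) by auto
    then have "(b \<otimes> a0 [^] i) \<otimes> (b' \<otimes> a0 [^] j) = b \<otimes> (b' \<otimes> a0 [^] i) \<otimes> a0 [^] j"
      using c a0G by (metis m_assoc m_closed nat_pow_closed)
    then show ?thesis using c a0G by (simp add: m_assoc nat_pow_mult[symmetric])
  qed
  define U where "U = {b \<otimes> a0 [^] i | b (i::nat). b \<in> B}"
  have "subgroup U G"
  proof (rule subgroupI)
    show "U \<subseteq> carrier G" using BG a0G by (auto simp: U_def)
    show "U \<noteq> {}" using subgroup.one_closed[OF Bs(1)] by (auto simp: U_def)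
    show "inv u \<in> U" if u: "u \<in> U" for u
    proof -
      obtain b and i :: nat where b: "b \<in> B" "u = b \<otimes> a0 [^] i" using u by (auto simp: U_def)
      have ib: "inv b \<in> B" using subgroup.m_inv_closed[OF Bs(1) b(1)] .
      have p1: "i + i * (p - 1) = p * i" using prime_gt_1_nat[OF p] by (cases p) auto
      have "(b \<otimes> a0 [^] i) \<otimes> (inv b \<otimes> a0 [^] (i * (p - 1))) = (b \<otimes> inv b) \<otimes> a0 [^] (p * i)"
        using split[OF b(1) ib, of i "i * (p - 1)"] p1 by simp
      also have "\<dots> = \<one>" using b(1) BG a0G exp[OF a0(1)] by (auto simp: nat_pow_pow[symmetric])
      finally have e: "u \<otimes> (inv b \<otimes> a0 [^] (i * (p - 1))) = \<one>" using b(2) by simp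
      have c: "u \<in> carrier G" "inv b \<otimes> a0 [^] (i * (p - 1)) \<in> carrier G" using b BG a0G ib by auto
      have "inv u = inv b \<otimes> a0 [^] (i * (p - 1))" by (rule inv_equality[OF inv_comm[OF e c] c])
      then show ?thesis using ib by (auto simp: U_def)
    qed
    show "u \<otimes> u' \<in> U" if uu: "u \<in> U" "u' \<in> U" for u u'
    proof -
      obtain b and i :: nat where b: "b \<in> B" "u = b \<otimes> a0 [^] i" using uu(1) by (auto simp: U_def)
      obtain b' and j :: nat where b': "b' \<in> B" "u' = b' \<otimes> a0 [^] j" using uu(2) by (auto simp: U_def)
      show ?thesis using split[OF b(1) b'(1), of i j] b b' subgroup.m_closed[OF Bs(1) b(1) b'(1)] by (auto simp: U_def)
    qed
  qed
  moreover have UA: "U \<subseteq> A" using subgroup.m_closed[OF A(1)] powA[OF a0(1)] Bs(2) by (auto simp: U_def)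
  moreover have "B \<subset> U"
  proof
    show "B \<subseteq> U"
    proof
      fix b assume "b \<in> B"
      moreover from this have "b = b \<otimes> a0 [^] (0::nat)" using BG by auto
      ultimately show "b \<in> U" unfolding U_def by blast
    qed
    have "a0 = \<one> \<otimes> a0 [^] (1::nat)" using a0G by simp
    then have "a0 \<in> U" using subgroup.one_closed[OF Bs(1)] unfolding U_def by blast
    then show "B \<noteq> U" using a0 by auto
  qed
  then have "card B < card U" using finite_subset[OF UA A(2)] by (rule psubset_card_mono[rotated])
  ultimately have "U = A" using B(2)[of U] by (auto simp: Sub_def)
  then have ex: "\<exists>i<p. \<exists>b\<in>B. a = b \<otimes> a0 [^] i" if "a \<in> A" for a
  proof -
    obtain b and i :: nat where b: "b \<in> B" "a = b \<otimes> a0 [^] i" using \<open>U = A\<close> \<open>a \<in> A\<close> by (auto simp: U_def)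
    have "a0 [^] i = a0 [^] (p * (i div p) + i mod p)" by simp
    also have "\<dots> = a0 [^] (i mod p)"
      using exp[OF a0(1)] a0G unfolding nat_pow_mult[OF a0G, symmetric] nat_pow_pow[OF a0G, symmetric] by simp
    finally show ?thesis using b prime_gt_0_nat[OF p] by (intro exI[of _ "i mod p"]) auto
  qed
  have uniq_le: "[i = j] (mod p)" if "b \<in> B" "b' \<in> B" "b \<otimes> a0 [^] i = b' \<otimes> a0 [^] j" "i \<le> j" for b b' and i j :: nat
  proof (rule ccontr)
    assume nc: "\<not> [i = j] (mod p)"
    have c: "b \<in> carrier G" "b' \<in> carrier G" using that BG by auto
    have "b \<otimes> a0 [^] i = (b' \<otimes> a0 [^] (j - i)) \<otimes> a0 [^] i"
      using that(3,4) c a0G by (simp add: m_assoc nat_pow_mult)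
    then have "b = b' \<otimes> a0 [^] (j - i)" using c a0G by (simp add: r_cancel)
    then have "a0 [^] (j - i) = inv b' \<otimes> b" using c a0G by (metis inv_solve_left nat_pow_closed)
    then have aB: "a0 [^] (j - i) \<in> B" using that subgroup.m_inv_closed[OF Bs(1)] subgroup.m_closed[OF Bs(1)] by simp
    \<comment> \<open>If the exponents differ modulo \<open>p\<close>, a power of \<open>a0\<close>
      with exponent invertible modulo \<open>p\<close> lies in \<open>B\<close>, and then so does
      \<open>a0\<close>.\<close>
    have "\<not> p dvd (j - i)" using nc that(4) by (metis cong_altdef_nat cong_sym)
    then have "coprime (j - i) p" using p by (metis coprime_commute prime_imp_coprime)
    then obtain u where u: "[(j - i) * u = Suc 0] (mod p)" using cong_solve_coprime_nat by blast
    define N where "N = (j - i) * u"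
    have N: "N mod p = 1" using u prime_gt_1_nat[OF p] by (simp add: cong_def N_def)
    have "a0 [^] N = a0 [^] (p * (N div p) + N mod p)" by simp
    also have "\<dots> = a0"
      using exp[OF a0(1)] a0G unfolding nat_pow_mult[OF a0G, symmetric] nat_pow_pow[OF a0G, symmetric] N by simp
    finally have "a0 [^] ((j - i) * u) = a0" by (simp add: N_def)
    then have "a0 \<in> B" using powB[OF aB, of u] nat_pow_pow[OF a0G] by simp
    then show False using a0 by simp
  qed
  then have uniq: "[i = j] (mod p)" if "b \<in> B" "b' \<in> B" "b \<otimes> a0 [^] i = b' \<otimes> a0 [^] j" for b b' and i j :: nat
    using that by (metis cong_sym nat_le_linear)
  define \<chi> where "\<chi> a = (SOME i. i < p \<and> (\<exists>b\<in>B. a = b \<otimes> a0 [^] i))" for a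
  have \<chi>: "\<chi> a < p \<and> (\<exists>b\<in>B. a = b \<otimes> a0 [^] \<chi> a)" if "a \<in> A" for a
    unfolding \<chi>_def by (rule someI_ex) (use ex[OF that] in blast)
  have "\<chi> (a \<otimes> a') mod p = (\<chi> a + \<chi> a') mod p" if aa: "a \<in> A" "a' \<in> A" for a a'
  proof -
    obtain b where b: "b \<in> B" "a = b \<otimes> a0 [^] \<chi> a" using \<chi>[OF aa(1)] by blast
    obtain b' where b': "b' \<in> B" "a' = b' \<otimes> a0 [^] \<chi> a'" using \<chi>[OF aa(2)] by blast
    obtain b'' where b'': "b'' \<in> B" "a \<otimes> a' = b'' \<otimes> a0 [^] \<chi> (a \<otimes> a')"
      using \<chi>[OF subgroup.m_closed[OF A(1) aa]] by blast
    have "b'' \<otimes> a0 [^] \<chi> (a \<otimes> a') = (b \<otimes> b') \<otimes> a0 [^] (\<chi> a + \<chi> a')"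
      using split[OF b(1) b'(1), of "\<chi> a" "\<chi> a'"] b(2) b'(2) b''(2) by simp
    then show ?thesis using uniq[OF b''(1) subgroup.m_closed[OF Bs(1) b(1) b'(1)]] by (simp add: cong_def)
  qed
  moreover have "\<chi> a0 = 1"
  proof -
    obtain b where b: "b \<in> B" "a0 = b \<otimes> a0 [^] \<chi> a0" using \<chi>[OF a0(1)] by blast
    have "b \<otimes> a0 [^] \<chi> a0 = \<one> \<otimes> a0 [^] (1::nat)" using b a0G by simp
    then have "[\<chi> a0 = 1] (mod p)" using uniq[OF b(1) subgroup.one_closed[OF Bs(1)]] by blast
    then show ?thesis using \<chi>[OF a0(1)] prime_gt_1_nat[OF p] by (simp add: cong_def)
  qed
  ultimately show ?thesis using that a0(1) \<chi> by blast
qed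

section \<open>Embeddings of a finite Galois extension\<close>

text \<open>If all power sums vanish, so do the sums with any polynomial in place of the power, in
  particular with one vanishing at every \<open>y i\<close> except \<open>y i0\<close>. This yields
  nonzero resolvents and, in the Artin--Schreier case, the exponent \<open>j\<close>.\<close>

lemma power_sums_nonzero:
  fixes y c :: "'i \<Rightarrow> 'a::field"
  assumes I: "finite I" "i0 \<in> I" and y: "inj_on y I" and c: "c i0 \<noteq> 0"
  shows "\<exists>j. (\<Sum>i\<in>I. c i * y i ^ j) \<noteq> 0"
proof (rule ccontr)
  assume "\<not> ?thesis"
  then have z: "(\<Sum>i\<in>I. c i * y i ^ j) = 0" for j by blast
  have all: "(\<Sum>i\<in>I. c i * poly q (y i)) = 0" for q :: "'a poly"
  proof -
    have "(\<Sum>i\<in>I. c i * poly q (y i)) = (\<Sum>i\<in>I. \<Sum>j\<le>degree q. poly.coeff q j * (c i * y i ^ j))"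
      by (simp add: poly_altdef sum_distrib_left mult_ac)
    also have "\<dots> = (\<Sum>j\<le>degree q. poly.coeff q j * (\<Sum>i\<in>I. c i * y i ^ j))"
      by (subst sum.swap) (simp add: sum_distrib_left)
    finally show ?thesis by (simp add: z)
  qed
  let ?q = "\<Prod>i\<in>I - {i0}. [:- y i, 1:]"
  have "(\<Sum>i\<in>I. c i * poly ?q (y i)) = (\<Sum>i\<in>I. if i = i0 then c i0 * poly ?q (y i0) else 0)"
    by (rule sum.cong[OF refl]) (use I in \<open>auto simp: poly_prod intro!: prod_zero\<close>)
  then have "c i0 * poly ?q (y i0) = 0" using all[of ?q] I by simp
  moreover have "poly ?q (y i0) \<noteq> 0" using I y by (auto simp: poly_prod inj_on_def prod_zero_iff)
  ultimately show False using c by simp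
qed

lemma galois_group_group:
  assumes F: "subfield_of (F :: 'a::field set)" and k: "k \<subseteq> F"
  shows "group (field.galois_group \<Omega> k F)"
    and "carrier (field.galois_group \<Omega> k F) =
      {\<sigma> \<in> extensional F. hom_on F \<sigma> \<and> bij_betw \<sigma> F F \<and> (\<forall>x\<in>k. \<sigma> x = x)}"
    and "\<And>\<sigma> \<tau>. \<sigma> \<in> carrier (field.galois_group \<Omega> k F) \<Longrightarrow>
      \<tau> \<in> carrier (field.galois_group \<Omega> k F) \<Longrightarrow>
      \<sigma> \<otimes>\<^bsub>field.galois_group \<Omega> k F\<^esub> \<tau> = compose F \<sigma> \<tau>"
    and "\<one>\<^bsub>field.galois_group \<Omega> k F\<^esub> = (\<lambda>x\<in>F. x)"
proof -
  let ?R = "\<Omega> :: 'a ring"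
  note R = subfield_ring[OF F]
  let ?H = "{\<sigma> \<in> Bij F. \<sigma> \<in> Ring.ring_hom (?R\<lparr>carrier := F\<rparr>) (?R\<lparr>carrier := F\<rparr>) \<and> (\<forall>x\<in>k. \<sigma> x = x)}"
  have def': "field.galois_group ?R k F = (BijGroup F)\<lparr>carrier := ?H\<rparr>" by (rule field.galois_group_def[OF Om_field])
  have H: "?H = {\<sigma> \<in> extensional F. hom_on F \<sigma> \<and> bij_betw \<sigma> F F \<and> (\<forall>x\<in>k. \<sigma> x = x)}" (is "_ = ?H'")
  proof (intro Set.set_eqI iffI)
    fix \<sigma> assume "\<sigma> \<in> ?H" then show "\<sigma> \<in> ?H'" by (auto simp: Bij_def hom_on_def Ring.ring_hom_def)
  next
    fix \<sigma> assume s: "\<sigma> \<in> ?H'"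
    then have "\<sigma> x \<in> F" if "x \<in> F" for x using that by (auto simp: bij_betw_def)
    then have "\<sigma> \<in> Ring.ring_hom (?R\<lparr>carrier := F\<rparr>) (?R\<lparr>carrier := F\<rparr>)"
      using s by (intro ring_hom_memI) (auto simp: hom_on_def)
    then show "\<sigma> \<in> ?H" using s by (auto simp: Bij_def)
  qed
  show c: "carrier (field.galois_group ?R k F) = ?H'" unfolding def' H[symmetric] by simp
  have HB: "?H \<subseteq> Bij F" by auto
  show "\<sigma> \<otimes>\<^bsub>field.galois_group ?R k F\<^esub> \<tau> = compose F \<sigma> \<tau>"
    if "\<sigma> \<in> carrier (field.galois_group ?R k F)" "\<tau> \<in> carrier (field.galois_group ?R k F)" for \<sigma> \<tau>
    using that HB unfolding def' by (auto simp: BijGroup_def)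
  show "\<one>\<^bsub>field.galois_group ?R k F\<^esub> = (\<lambda>x\<in>F. x)" unfolding def' by (simp add: BijGroup_def)
  have "subgroup ?H (BijGroup F)"
  proof (rule group.subgroupI[OF group_BijGroup])
    show "?H \<subseteq> carrier (BijGroup F)" using HB by (simp add: BijGroup_def)
    have "(\<lambda>x\<in>F. x) \<in> ?H'" using k subring_simps[OF R] by (auto simp: hom_on_def bij_betw_def inj_on_def)
    then show "?H \<noteq> {}" unfolding H by blast
    fix \<sigma> assume "\<sigma> \<in> ?H"
    then have s: "\<sigma> \<in> ?H'" "\<sigma> \<in> Bij F" unfolding H[symmetric] by auto
    have "inv_into F \<sigma> y = the_inv_into F \<sigma> y" if "y \<in> F" for y
      using s that by (metis (no_types, lifting) bij_betw_def f_inv_into_f inv_into_into mem_Collect_eq the_inv_into_f_eq)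
    then have e: "inv\<^bsub>BijGroup F\<^esub> \<sigma> = restrict (the_inv_into F \<sigma>) F" unfolding inv_BijGroup[OF s(2)] by auto
    have bi: "bij_betw (the_inv_into F \<sigma>) F F" using s by (intro bij_betw_the_inv_into) simp
    have "hom_on F (the_inv_into F \<sigma>)" using hom_on_the_inv[OF F, of \<sigma>] s by (auto simp: bij_betw_def)
    then have "hom_on F (restrict (the_inv_into F \<sigma>) F)" using subring_simps[OF R] by (simp add: hom_on_def)
    moreover have "the_inv_into F \<sigma> x = x" if "x \<in> k" for x
      using s that k by (intro the_inv_into_f_eq) (auto simp: bij_betw_def)
    ultimately have "restrict (the_inv_into F \<sigma>) F \<in> ?H'" using bi k by (auto cong: bij_betw_cong)
    then show "inv\<^bsub>BijGroup F\<^esub> \<sigma> \<in> ?H" unfolding H e .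
    fix \<tau> assume "\<tau> \<in> ?H"
    then have t: "\<tau> \<in> ?H'" "\<tau> \<in> Bij F" unfolding H[symmetric] by auto
    have tF: "\<tau> x \<in> F" if "x \<in> F" for x using t that by (auto simp: bij_betw_def)
    have "compose F \<sigma> \<tau> \<in> ?H'"
    proof -
      have "bij_betw (compose F \<sigma> \<tau>) F F" using compose_Bij[OF s(2) t(2)] by (simp add: Bij_def)
      moreover have "hom_on F (compose F \<sigma> \<tau>)"
        using s t tF subring_simps[OF R] by (auto simp: hom_on_def compose_def)
      ultimately show ?thesis using s t k by (auto simp: compose_def)
    qed
    moreover have "\<sigma> \<otimes>\<^bsub>BijGroup F\<^esub> \<tau> = compose F \<sigma> \<tau>" using s t by (simp add: BijGroup_def)
    ultimately show "\<sigma> \<otimes>\<^bsub>BijGroup F\<^esub> \<tau> \<in> ?H" unfolding H by simp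
  qed
  then show "group (field.galois_group ?R k F)" unfolding def' by (rule subgroup.subgroup_is_group[OF _ group_BijGroup])
qed

lemma galois_group_action:
  assumes F: "subfield_of (F :: 'a::field set)" and k: "k \<subseteq> F"
    and fin: "finite (carrier (field.galois_group \<Omega> k F))"
  shows "ring_action (field.galois_group \<Omega> k F) F (\<lambda>\<sigma>. \<sigma>)"
proof -
  note G = galois_group_group[OF F k]
  interpret group "field.galois_group \<Omega> k F" by (rule G(1))
  show ?thesis
    by unfold_locales (use G fin subfield_ring[OF F] in \<open>auto simp: bij_betw_def compose_def\<close>)
qed

locale galois_data =
  fixes k F :: "'a::field set"
  assumes sp: "\<And>p. p \<in> carrier (poly_ring (\<Omega> :: 'a ring)) \<Longrightarrow> ring.splitted \<Omega> p"
    and k: "subfield_of k" and F: "subfield_of F" "k \<subseteq> F"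
    and fd: "ring.finite_dimension \<Omega> k F"
    and normal: "field.normal_extension \<Omega> k F"
    and sep: "field.separable_extension \<Omega> k F"
begin

abbreviation Gal :: "('a \<Rightarrow> 'a) monoid"
  where "Gal \<equiv> field.galois_group \<Omega> k F"

lemma sk: "subfield k \<Omega>" and sF: "subfield F \<Omega>"
  using k F Om_subfield_iff by auto

lemma ac:
  fixes q :: "'a poly" assumes "degree q > 0" shows "\<exists>z. poly q z = 0"
proof -
  have q: "q \<in> polys UNIV" by simp
  note l = rev_coeffs[OF subring_of_UNIV q]
  have c: "rev (coeffs q) \<in> carrier (poly_ring (\<Omega> :: 'a ring))" using l(1) by simp
  have "size (Om.roots (rev (coeffs q))) > 0" using sp[OF c] l(3) assms by (simp add: Om.splitted_def)
  then obtain z where "z \<in># Om.roots (rev (coeffs q))" by (metis size_empty less_irrefl multiset_nonemptyE)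
  then have "Om.is_root (rev (coeffs q)) z" using Om.roots_mem_iff_is_root[OF c] by simp
  then show ?thesis using l(2) by (auto simp: Om.is_root_def)
qed

lemma Om_alg: "x \<in> F \<Longrightarrow> (ring.algebraic \<Omega> over k) x"
  using normal by (simp add: field.normal_extension_def[OF Om_field])

lemma alg: "x \<in> F \<Longrightarrow> alg_over k x"
  using Om_alg Om_algebraic_iff[OF subfield_ring[OF k]] by blast

definition minp :: "'a \<Rightarrow> 'a poly"
  where "minp x = Poly (rev (ring.Irr \<Omega> k x))"

lemma Irr:
  assumes x: "x \<in> F"
  shows "Om.Irr k x \<in> carrier (univ_poly \<Omega> k)" "pirreducible\<^bsub>\<Omega>\<^esub> k (Om.Irr k x)"
    "Om.Irr k x \<noteq> []" "Om.is_root (Om.Irr k x) x" "hd (Om.Irr k x) = 1"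
    "Om.Irr k x \<in> carrier (univ_poly \<Omega> F)" "Om.Irr k x \<in> carrier (poly_ring (\<Omega> :: 'a ring))"
proof -
  note I = Om.IrrE[OF sk _ Om_alg[OF x], simplified]
  show 1: "Om.Irr k x \<in> carrier (univ_poly \<Omega> k)" "pirreducible\<^bsub>\<Omega>\<^esub> k (Om.Irr k x)" "hd (Om.Irr k x) = 1"
    using I by auto
  show ne: "Om.Irr k x \<noteq> []" using I(2) Om.pirreducibleE(1)[OF subfieldE(1)[OF sk] I(1,2)] by blast
  then show "Om.is_root (Om.Irr k x) x" using I(4) by (simp add: Om.is_root_def)
  show "Om.Irr k x \<in> carrier (univ_poly \<Omega> F)" "Om.Irr k x \<in> carrier (poly_ring (\<Omega> :: 'a ring))"
    using 1(1) F(2) by (auto simp: Om_univ_poly_carrier)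
qed

lemma minp:
  assumes x: "x \<in> F" shows "is_minpoly k x (minp x)" "minp x \<in> polys k" "degree (minp x) = length (Om.Irr k x) - 1"
    "poly (minp x) y = 0 \<longleftrightarrow> Om.is_root (Om.Irr k x) y"
proof -
  note I = Irr[OF x]
  show pk: "minp x \<in> polys k"
    unfolding minp_def using I(1) by (intro Poly_rev_polys[OF subfield_ring[OF k]]) (auto simp: Om_univ_poly_carrier subring_0)
  have d: "minp x \<noteq> 0" "degree (minp x) = length (Om.Irr k x) - 1" "monic (minp x)"
    using Poly_rev_degree[OF I(3)] I(5) by (auto simp: minp_def)
  then show "degree (minp x) = length (Om.Irr k x) - 1" by simp
  show r: "poly (minp x) y = 0 \<longleftrightarrow> Om.is_root (Om.Irr k x) y" for y
    using I(3) by (simp add: minp_def Om.is_root_def Om_eval)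
  \<comment> \<open>The abstract minimal polynomial divides \<open>minp x\<close>, whose degree is
    no larger by minimality of \<open>Irr\<close>; both are monic, so they agree.\<close>
  obtain f where f: "is_minpoly k x f" using minpoly_exists[OF k alg[OF x]] .
  then have f': "f \<in> polys k" "monic f" "poly f x = 0" by (auto simp: is_minpoly_def)
  then have f0: "f \<noteq> 0" by auto
  note rf = rev_coeffs[OF subfield_ring[OF k] f'(1)]
  have "Om.Irr k x pdivides\<^bsub>\<Omega>\<^esub> rev (coeffs f)"
    using Om.Irr_minimal[OF sk _ Om_alg[OF x] rf(1)] rf(2)[of x] f'(3) by simp
  then have le: "degree (minp x) \<le> degree f"
    using Om.pdivides_imp_degree_le[OF subfieldE(1)[OF sk] I(1) rf(1)] rf(3,4) f0 d(2) by simp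
  obtain q where q: "q \<in> polys k" "minp x = f * q" using f pk r[of x] I(4) unfolding is_minpoly_def by blast
  then have "q \<noteq> 0" using d(1) by auto
  then have "degree q = 0" using le q f0 by (simp add: degree_mult_eq)
  then obtain c where "q = [:c:]" by (metis degree_eq_zeroE)
  then have "c = 1" using q d(3) f' f0 \<open>q \<noteq> 0\<close> by (simp add: lead_coeff_mult)
  then have "minp x = f" using q \<open>q = [:c:]\<close> by simp
  then show "is_minpoly k x (minp x)" using f by simp
qed

text \<open>Divisibility by a power of the linear factor persists from \<open>F\<close> to the whole
  field. Normality is defined through roots counted in \<open>F\<close>, separability through roots
  counted in the whole field.\<close>

lemma alg_mult_subfield_le:
  assumes p: "p \<in> carrier (univ_poly \<Omega> F)" "p \<noteq> []" and a: "a \<in> F"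
  shows "ring.alg_mult (\<Omega>\<lparr>carrier := F\<rparr>) p a \<le> Om.alg_mult p a"
proof -
  let ?R = "\<Omega> :: 'a ring" and ?L = "\<Omega>\<lparr>carrier := F\<rparr> :: 'a ring"
  interpret L: field ?L using Om.subfield_iff(2)[OF sF] .
  have cons: "univ_poly ?L F = univ_poly ?R F" using Om.univ_poly_consistent[OF subfieldE(1)[OF sF]] by simp
  have pL: "p \<in> carrier (poly_ring ?L)" using p cons by simp
  have ai: "a_inv ?L a = - a"
    by (rule L.minus_equality) (use a subring_uminus[OF subfield_ring[OF F(1)]] in auto)
  let ?n = "L.alg_mult p a"
  have pw: "x [^]\<^bsub>univ_poly ?R F\<^esub> (n::nat) = x [^]\<^bsub>poly_ring ?R\<^esub> n" for x n
    by (induction n) (simp_all add: univ_poly_mult univ_poly_one)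
  have "([1, - a] [^]\<^bsub>poly_ring ?L\<^esub> ?n) pdivides\<^bsub>?L\<^esub> p"
    using L.alg_multE(1)[of a p] a pL p(2) ai by simp
  then obtain c where c: "c \<in> carrier (univ_poly ?R F)" "p = ([1, - a] [^]\<^bsub>univ_poly ?R F\<^esub> ?n) \<otimes>\<^bsub>univ_poly ?R F\<^esub> c"
    unfolding pdivides_def factor_def using cons by auto
  have "c \<in> carrier (poly_ring ?R)" using c(1) by (auto simp: Om_univ_poly_carrier)
  moreover have "p = ([1, - a] [^]\<^bsub>poly_ring ?R\<^esub> ?n) \<otimes>\<^bsub>poly_ring ?R\<^esub> c"
    using c(2) pw by (simp add: univ_poly_mult)
  ultimately have "([1, - a] [^]\<^bsub>poly_ring ?R\<^esub> ?n) pdivides\<^bsub>?R\<^esub> p" unfolding pdivides_def factor_def by blast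
  moreover have "p \<in> carrier (poly_ring ?R)" using p(1) by (auto simp: Om_univ_poly_carrier)
  ultimately show ?thesis using Om.alg_multE(2)[of a p ?n] p(2) by simp
qed

text \<open>The polynomial splits both in \<open>F\<close> and in the whole field, so the two
  multisets of roots have the same size; one contains the other, so they are equal.\<close>

lemma conjugate_in:
  assumes x: "x \<in> F" and y: "poly (minp x) y = 0" shows "y \<in> F"
proof -
  let ?L = "\<Omega>\<lparr>carrier := F\<rparr> :: 'a ring" and ?p = "Om.Irr k x"
  interpret L: field ?L using Om.subfield_iff(2)[OF sF] .
  note I = Irr[OF x]
  have pL: "?p \<in> carrier (poly_ring ?L)"
    using I(6) Om.univ_poly_consistent[OF subfieldE(1)[OF sF]] by simp
  have "L.splitted ?p" using normal I(1,2,4) x by (auto simp: field.normal_extension_def[OF Om_field])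
  then have s: "size (L.roots ?p) = size (Om.roots ?p)"
    using sp[OF I(7)] by (simp add: L.splitted_def Om.splitted_def)
  have le: "L.roots ?p \<subseteq># Om.roots ?p"
  proof (rule mset_subset_eqI)
    fix a
    have "count (L.roots ?p) a = L.alg_mult ?p a" using L.alg_mult_eq_count_roots[OF pL] by simp
    also have "\<dots> \<le> Om.alg_mult ?p a"
    proof (cases "a \<in> F")
      case True
      then show ?thesis using alg_mult_subfield_le[OF I(6,3)] by simp
    next
      case False
      then show ?thesis by (simp add: L.alg_mult_def)
    qed
    finally show "count (L.roots ?p) a \<le> count (Om.roots ?p) a" using Om.alg_mult_eq_count_roots[OF I(7)] by simp
  qed
  have "L.roots ?p = Om.roots ?p"
  proof (rule ccontr)
    assume "L.roots ?p \<noteq> Om.roots ?p"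
    then have "L.roots ?p \<subset># Om.roots ?p" using le by (simp add: subset_mset.less_le)
    then show False using mset_subset_size s by fastforce
  qed
  then have "y \<in># L.roots ?p" using y minp(4)[OF x] Om.roots_mem_iff_is_root[OF I(7)] by simp
  then show ?thesis using L.roots_mem_iff_is_root[OF pL] by (simp add: L.is_root_def)
qed

text \<open>Outside \<open>k\<close> the degree is at least 2, while separability makes
  \<open>x\<close> a simple root.\<close>

lemma other_conjugate:
  assumes x: "x \<in> F" "x \<notin> k" shows "\<exists>y. y \<noteq> x \<and> poly (minp x) y = 0"
proof (rule ccontr)
  assume n: "\<not> ?thesis"
  let ?p = "Om.Irr k x"
  note I = Irr[OF x(1)]
  have d: "degree (minp x) \<ge> 2"
  proof (rule ccontr)
    assume "\<not> degree (minp x) \<ge> 2"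
    then have d1: "degree (minp x) \<le> 1" by simp
    have m: "monic (minp x)" "poly (minp x) x = 0" using minp(1)[OF x(1)] by (auto simp: is_minpoly_def)
    have "degree (minp x) \<noteq> 0"
    proof
      assume "degree (minp x) = 0"
      then obtain c where "minp x = [:c:]" by (metis degree_eq_zeroE)
      then show False using m by auto
    qed
    then have "degree (minp x) = 1" using d1 by simp
    then obtain a b where ab: "minp x = [:a, b:]" by (metis One_nat_def degree_eq_zeroE degree_pCons_eq_if nat.inject pCons_cases pCons_0_0 zero_neq_one)
    then have "b = 1" using m(1) \<open>degree (minp x) = 1\<close> by simp
    then have "x = - a" using m(2) ab by (simp add: eq_neg_iff_add_eq_0 add.commute)
    moreover have "a \<in> k" using minp(2)[OF x(1)] ab polys_pCons_iff[OF subfield_ring[OF k]] by simp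
    ultimately show False using x(2) subring_uminus[OF subfield_ring[OF k]] by simp
  qed
  have cnt: "count (Om.roots ?p) y \<le> (if y = x then 1 else 0)" for y
  proof (cases "y = x")
    case True
    have "Om.alg_mult ?p x \<le> 1" using sep I(1,2,4) x by (auto simp: field.separable_extension_def[OF Om_field])
    then show ?thesis using True Om.alg_mult_eq_count_roots[OF I(7)] by simp
  next
    case False
    then have "y \<notin># Om.roots ?p" using n minp(4)[OF x(1)] Om.roots_mem_iff_is_root[OF I(7)] by auto
    then show ?thesis using False by (simp add: not_in_iff)
  qed
  have "Om.roots ?p \<subseteq># {#x#}"
  proof (rule mset_subset_eqI)
    fix a show "count (Om.roots ?p) a \<le> count {#x#} a" using cnt[of a] by (cases "a = x") auto
  qed
  then have "size (Om.roots ?p) \<le> 1" using size_mset_mono by fastforce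
  moreover have "size (Om.roots ?p) \<ge> 2" using sp[OF I(7)] d minp(3)[OF x(1)] by (simp add: Om.splitted_def)
  ultimately show False by simp
qed

text \<open>For every \<open>x\<close> in \<open>F\<close> the finitely many roots of
  \<open>minp x\<close> lie in \<open>F\<close> and are permuted by the injective
  \<open>h\<close>.\<close>

lemma embedding_image:
  assumes h: "hom_on F h" "\<And>x. x \<in> k \<Longrightarrow> h x = x" shows "bij_betw h F F"
proof -
  note R = subfield_ring[OF F(1)]
  have root: "poly (minp x) (h y) = 0" if "x \<in> F" "y \<in> F" "poly (minp x) y = 0" for x y
  proof -
    have mk: "minp x \<in> polys k" by (rule minp(2)[OF that(1)])
    have "map_poly h (minp x) = minp x"
      using mk h(2) by (intro poly_eqI) (simp add: coeff_hom_poly[OF R h(1)] polys_def)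
    then have "poly (minp x) (h y) = h (poly (minp x) y)"
      using poly_hom[OF R h(1) subsetD[OF polys_mono[OF F(2)] mk] that(2)] by simp
    then show ?thesis using that(3) hom_0[OF R h(1)] by simp
  qed
  have self: "poly (minp x) x = 0" if "x \<in> F" for x using minp(1)[OF that] by (simp add: is_minpoly_def)
  have inj: "inj_on h F" by (rule hom_inj[OF F(1) h(1)])
  have "h ` F = F"
  proof
    show "h ` F \<subseteq> F" using root[OF _ _ self] conjugate_in by blast
    show "F \<subseteq> h ` F"
    proof
      fix x assume x: "x \<in> F"
      let ?Z = "{y. poly (minp x) y = 0}"
      have "minp x \<noteq> 0" using minp(1)[OF x] by (auto simp: is_minpoly_def)
      then have fz: "finite ?Z" by (rule poly_roots_finite)
      have ZF: "?Z \<subseteq> F" using conjugate_in[OF x] by blast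
      have "h ` ?Z = ?Z"
        using root[OF x] ZF inj_on_subset[OF inj ZF] by (intro endo_inj_surj[OF fz]) auto
      then show "x \<in> h ` F" using self[OF x] ZF by blast
    qed
  qed
  then show ?thesis using inj by (simp add: bij_betw_def)
qed

lemma embedding_in_Gal:
  assumes h: "hom_on F h" "\<And>x. x \<in> k \<Longrightarrow> h x = x" shows "restrict h F \<in> carrier Gal"
  unfolding galois_group_group(2)[OF F]
  using h embedding_image[OF h] F(2) subring_simps[OF subfield_ring[OF F(1)]]
  by (auto simp: hom_on_def cong: bij_betw_cong)

text \<open>A basis of \<open>F\<close> is adjoined one vector at a time; at each stage the
  transported minimal polynomial has a root because the whole field is algebraically closed.\<close>

lemma extend_to_F:
  assumes K: "subfield_of K" "k \<subseteq> K" "K \<subseteq> F" and h: "hom_on K (h :: 'a \<Rightarrow> 'a)"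
  obtains h' where "hom_on F h'" "\<And>x. x \<in> K \<Longrightarrow> h' x = h x"
proof -
  have ext: "\<exists>K' h'. subfield_of K' \<and> K \<subseteq> K' \<and> K' \<subseteq> F \<and> set xs \<subseteq> K' \<and> hom_on K' h' \<and> (\<forall>x\<in>K. h' x = h x)"
    if "set xs \<subseteq> F" for xs
    using that
  proof (induction xs)
    case Nil
    then show ?case using K h by (intro exI[of _ K] exI[of _ h]) auto
  next
    case (Cons x xs)
    then obtain K' h' where *: "subfield_of K'" "K \<subseteq> K'" "K' \<subseteq> F" "set xs \<subseteq> K'" "hom_on K' h'" "\<forall>x\<in>K. h' x = h x" by auto
    have x: "x \<in> F" using Cons.prems by simp
    have ax: "alg_over K' x" using alg_over_mono[OF order_trans[OF K(2) *(2)] alg[OF x]] .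
    obtain f where f: "is_minpoly K' x f" using minpoly_exists[OF *(1) ax] .
    have f': "f \<in> polys K'" "monic f" "poly f x = 0" using f by (auto simp: is_minpoly_def)
    have df: "degree f > 0"
    proof (rule ccontr)
      assume "\<not> degree f > 0"
      then obtain c where "f = [:c:]" by (metis degree_eq_zeroE not_gr0)
      then show False using f' by auto
    qed
    have "degree f \<le> degree (map_poly h' f)"
      using f'(2) by (intro le_degree) (simp add: coeff_hom_poly[OF subfield_ring[OF *(1)] *(5)] hom_1[OF subfield_ring[OF *(1)] *(5)])
    then obtain z where z: "poly (map_poly h' f) z = 0" using ac[of "map_poly h' f"] df by auto
    obtain h'' where h'': "hom_on (simple_ext K' x) h''" "\<And>c. c \<in> K' \<Longrightarrow> h'' c = h' c"
      using extend_hom[OF *(1) f *(5) z] by metis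
    have b: "K' \<subseteq> simple_ext K' x" "x \<in> simple_ext K' x"
      using simple_ext_base simple_ext_gen subfield_ring[OF *(1)] by auto
    show ?case
    proof (intro exI conjI)
      show "subfield_of (simple_ext K' x)" by (rule simple_ext_subfield[OF *(1) ax])
      show "simple_ext K' x \<subseteq> F" by (rule simple_ext_subset[OF subfield_ring[OF F(1)] *(3) x])
      show "hom_on (simple_ext K' x) h''" by (rule h''(1))
      show "K \<subseteq> simple_ext K' x" "set (x # xs) \<subseteq> simple_ext K' x" using b * by auto
      show "\<forall>x\<in>K. h'' x = h x" using h''(2) * by auto
    qed
  qed
  obtain n where "Om.dimension n k F" using fd by auto
  then obtain Vs where Vs: "Om.Span k Vs = F" "Om.independent k Vs" using Om.exists_base[OF sk] by blast
  have "set Vs \<subseteq> F" using Om.Span_base_incl[OF sk, of Vs] Vs(1) by simp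
  then obtain K' h' where *: "subfield_of K'" "K \<subseteq> K'" "K' \<subseteq> F" "set Vs \<subseteq> K'" "hom_on K' h'" "\<forall>x\<in>K. h' x = h x"
    using ext by blast
  have "Om.Span k Vs' \<subseteq> K'" if "set Vs' \<subseteq> K'" for Vs'
    using that
  proof (induction Vs')
    case Nil
    then show ?case using subring_0[OF subfield_ring[OF *(1)]] by simp
  next
    case (Cons v Vs')
    have "c * v + w \<in> K'" if "c \<in> k" "w \<in> Om.Span k Vs'" for c w
    proof -
      have "c \<in> K'" "w \<in> K'" "v \<in> K'" using that Cons K(2) *(2) by auto
      then show ?thesis using subring_add[OF subfield_ring[OF *(1)]] subring_mult[OF subfield_ring[OF *(1)]] by blast
    qed
    then show ?case by (auto simp: Om.line_extension_mem_iff)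
  qed
  then have "K' = F" using Vs(1) *(3,4) by blast
  then show ?thesis using that * by blast
qed

text \<open>For \<open>x\<close> outside \<open>k\<close>, sending it to another conjugate extends
  to an automorphism of \<open>F\<close>.\<close>

lemma fixed_by_Gal:
  assumes x: "x \<in> F" "\<And>\<sigma>. \<sigma> \<in> carrier Gal \<Longrightarrow> \<sigma> x = x" shows "x \<in> k"
proof (rule ccontr)
  assume "x \<notin> k"
  then obtain y where y: "y \<noteq> x" "poly (minp x) y = 0" using other_conjugate x(1) by blast
  have idk: "hom_on k (\<lambda>x. x)" by (simp add: hom_on_def)
  have "map_poly (\<lambda>x. x) (minp x) = minp x" by (intro poly_eqI) (simp add: coeff_map_poly)
  then obtain h where h: "hom_on (simple_ext k x) h" "h x = y" "\<And>c. c \<in> k \<Longrightarrow> h c = c"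
    using extend_hom[OF k minp(1)[OF x(1)] idk, of y] y(2) by metis
  have e: "subfield_of (simple_ext k x)" "k \<subseteq> simple_ext k x" "simple_ext k x \<subseteq> F" "x \<in> simple_ext k x"
    using simple_ext_subfield[OF k alg[OF x(1)]] simple_ext_base[OF subfield_ring[OF k]] simple_ext_gen[OF subfield_ring[OF k]]
      simple_ext_subset[OF subfield_ring[OF F(1)] F(2) x(1)] by auto
  obtain h' where h': "hom_on F h'" "\<And>z. z \<in> simple_ext k x \<Longrightarrow> h' z = h z" using extend_to_F[OF e(1-3) h(1)] by blast
  have "restrict h' F \<in> carrier Gal" by (rule embedding_in_Gal[OF h'(1)]) (use h' h e in auto)
  then have "restrict h' F x = x" by (rule x(2))
  then show False using x(1) h'(2)[OF e(4)] h(2) y(1) by simp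
qed

end

section \<open>Adjoining a root of unity\<close>

lemma char_eq_prime:
  assumes "Factorial_Ring.prime (p::nat)" "(of_nat p :: 'a::field) = 0" shows "CHAR('a) = p"
proof -
  have "CHAR('a) dvd p" using assms(2) by (simp add: of_nat_eq_0_iff_char_dvd)
  then have "CHAR('a) = 1 \<or> CHAR('a) = p" using assms(1) unfolding prime_nat_iff by blast
  moreover have "CHAR('a) \<noteq> 1" by simp
  ultimately show ?thesis by blast
qed

lemma frobenius_add:
  assumes "Factorial_Ring.prime (p::nat)" "(of_nat p :: 'a::field) = 0"
  shows "(x + y :: 'a) ^ p = x ^ p + y ^ p"
  by (rule freshmans_dream) (simp_all only: char_eq_prime[OF assms] assms(1))

lemma frobenius_sum:
  assumes "Factorial_Ring.prime (p::nat)" "(of_nat p :: 'a::field) = 0"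
  shows "(sum f I :: 'a) ^ p = (\<Sum>i\<in>I. f i ^ p)"
  by (rule freshmans_dream_sum) (simp_all only: char_eq_prime[OF assms] assms(1))

lemma of_nat_power_char:
  assumes p: "Factorial_Ring.prime (p::nat)" "(of_nat p :: 'a::field) = 0"
  shows "(of_nat n :: 'a) ^ p = of_nat n"
proof (induction n)
  case 0
  show ?case using prime_gt_0_nat[OF p(1)] by (simp add: power_0_left)
next
  case (Suc n)
  then show ?case using frobenius_add[OF p, of 1 "of_nat n"] by simp
qed

lemma of_nat_inj_char:
  assumes p: "Factorial_Ring.prime (p::nat)" "(of_nat p :: 'a::field) = 0"
  shows "inj_on (\<lambda>i. of_nat i :: 'a) {..<p}"
proof (rule inj_onI)
  fix i j assume ij: "i \<in> {..<p}" "j \<in> {..<p}" "(of_nat i :: 'a) = of_nat j"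
  have "[i = j] (mod p)" using ij(3) unfolding of_nat_eq_iff_cong_CHAR char_eq_prime[OF p] .
  then show "i = j" using ij(1,2) by (simp add: cong_def)
qed

text \<open>Taking \<open>\<zeta> = 1\<close> in characteristic \<open>p\<close> makes
  \<open>M\<close> equal to \<open>F\<close>, so that one construction covers both cases.\<close>

locale galois_root = galois_data k F for k F :: "'a::field set" +
  fixes p :: nat and \<zeta> :: 'a
  assumes p: "Factorial_Ring.prime p" and \<zeta>: "\<zeta> ^ p = 1" "(of_nat p :: 'a) \<noteq> 0 \<Longrightarrow> \<zeta> \<noteq> 1" "(of_nat p :: 'a) = 0 \<Longrightarrow> \<zeta> = 1"
    and fin: "finite (carrier (field.galois_group \<Omega> k F))"
begin

lemma p_pos: "p > 0" "p > 1" "p \<ge> 2"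
  using prime_gt_0_nat[OF p] prime_gt_1_nat[OF p] by auto

text \<open>Equal powers of \<open>z\<close> make some power with exponent prime to \<open>p\<close>
  equal to 1; raising it to an inverse exponent modulo \<open>p\<close> gives
  \<open>z = 1\<close>.\<close>

lemma root_pow_inj_gen:
  assumes z: "z ^ p = 1" "z \<noteq> (1 :: 'a)" shows "inj_on (\<lambda>i. z ^ i) {..<p}"
proof -
  have z0: "z \<noteq> 0" using z(1) p_pos by (auto simp: power_0_left)
  have lt: False if "i < j" "j < p" "z ^ i = z ^ j" for i j
  proof -
    have "z ^ j = z ^ i * z ^ (j - i)" using that(1) by (simp add: power_add[symmetric])
    then have e: "z ^ (j - i) = 1" using that(3) z0 by simp
    have "\<not> p dvd (j - i)" using that by (auto dest: dvd_imp_le)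
    then have "coprime (j - i) p" using p by (metis coprime_commute prime_imp_coprime)
    then obtain u where u: "[(j - i) * u = Suc 0] (mod p)" using cong_solve_coprime_nat by blast
    define N where "N = (j - i) * u"
    have N: "N mod p = 1" using u p_pos by (simp add: cong_def N_def)
    have "z ^ N = z ^ (p * (N div p) + N mod p)" by simp
    then have "z ^ N = z" unfolding power_add power_mult z(1) N by simp
    moreover have "z ^ N = 1" unfolding N_def power_mult e by simp
    ultimately show False using z(2) by simp
  qed
  show ?thesis
  proof (rule inj_onI)
    fix i j assume "i \<in> {..<p}" "j \<in> {..<p}" "z ^ i = z ^ j"
    then show "i = j" using lt[of i j] lt[of j i] by (metis lessThan_iff nat_neq_iff)
  qed
qed

text \<open>The root \<open>z\<close> is arbitrary because conjugates of \<open>\<zeta>\<close> take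
  its place later. In characteristic \<open>p\<close> the Frobenius map leaves 1 as the only
  root.\<close>

lemma roots_of_unity:
  assumes z: "z ^ p = (1 :: 'a)" "(of_nat p :: 'a) \<noteq> 0 \<Longrightarrow> z \<noteq> 1" and y: "y ^ p = 1"
  shows "\<exists>i<p. y = z ^ i"
proof (cases "(of_nat p :: 'a) = 0")
  case True
  have "y ^ p = (y - 1) ^ p + 1" using frobenius_add[OF p True, of "y - 1" 1] by simp
  then have "y = 1" using y by simp
  then show ?thesis using p_pos by (intro exI[of _ 0]) simp
next
  case False
  let ?Z = "(\<lambda>i. z ^ i) ` {..<p}" and ?q = "Polynomial.monom 1 p - 1 :: 'a poly"
  have q: "?q \<noteq> 0" "degree ?q \<le> p" using p_pos by (auto simp: poly_eq_iff intro!: degree_diff_le exI[of _ p])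
     (simp_all add: degree_monom_eq)
  have Zq: "?Z \<subseteq> {x. poly ?q x = 0}"
  proof
    fix x assume "x \<in> ?Z"
    then obtain i where "x = z ^ i" by blast
    then have "x ^ p = 1" using z(1) power_mult[of z i p] power_mult[of z p i] by (simp add: mult.commute)
    then show "x \<in> {x. poly ?q x = 0}" by (simp add: poly_monom)
  qed
  have "card {x. poly ?q x = 0} \<le> p" using poly_roots_degree[OF q(1)] q(2) by linarith
  moreover have "card ?Z = p" using root_pow_inj_gen[OF z(1) z(2)[OF False]] by (simp add: card_image)
  ultimately have "?Z = {x. poly ?q x = 0}" using card_subset_eq[OF poly_roots_finite[OF q(1)] Zq] card_mono[OF poly_roots_finite[OF q(1)] Zq] by simp
  moreover have "y \<in> {x. poly ?q x = 0}" using y by (simp add: poly_monom)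
  ultimately show ?thesis by blast
qed

lemma finite_roots_of_unity: "finite {y :: 'a. y ^ p = 1}"
proof (rule finite_subset)
  show "{y :: 'a. y ^ p = 1} \<subseteq> (\<lambda>i. \<zeta> ^ i) ` {..<p}" using roots_of_unity[OF \<zeta>(1,2)] by auto
qed simp

definition M :: "'a set" where "M = simple_ext F \<zeta>"

lemma \<zeta>_alg: "alg_over F \<zeta>"
  unfolding alg_over_def
proof (intro bexI[of _ "Polynomial.monom 1 p - 1"] conjI)
  note R = subfield_ring[OF F(1)]
  show "Polynomial.monom 1 p - 1 \<in> polys F" by (intro polys_simps[OF R] subring_1[OF R])
  have "poly.coeff (Polynomial.monom 1 p - 1) p = (1 :: 'a)" using p_pos by simp
  then show "Polynomial.monom 1 p - 1 \<noteq> (0 :: 'a poly)" by (metis coeff_0 zero_neq_one)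
  show "poly (Polynomial.monom 1 p - 1) \<zeta> = 0" using \<zeta>(1) by (simp add: poly_monom)
qed

lemma M: "subfield_of M" "F \<subseteq> M" "\<zeta> \<in> M" "k \<subseteq> M"
  unfolding M_def using simple_ext_subfield[OF F(1) \<zeta>_alg] simple_ext_base[OF subfield_ring[OF F(1)]]
    simple_ext_gen[OF subfield_ring[OF F(1)]] F(2) by blast+

abbreviation GM :: "('a \<Rightarrow> 'a) monoid"
  where "GM \<equiv> field.galois_group \<Omega> k M"

lemma GM_carrier: "carrier GM = {\<sigma> \<in> extensional M. hom_on M \<sigma> \<and> bij_betw \<sigma> M M \<and> (\<forall>x\<in>k. \<sigma> x = x)}"
  by (rule galois_group_group(2)[OF M(1,4)])

lemma GM_hom: "\<sigma> \<in> carrier GM \<Longrightarrow> hom_on M \<sigma>" "\<sigma> \<in> carrier GM \<Longrightarrow> x \<in> k \<Longrightarrow> \<sigma> x = x"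
  "\<sigma> \<in> carrier GM \<Longrightarrow> x \<in> M \<Longrightarrow> \<sigma> x \<in> M"
  unfolding GM_carrier by (auto simp: bij_betw_def)

lemma GM_F: "\<sigma> \<in> carrier GM \<Longrightarrow> restrict \<sigma> F \<in> carrier Gal" "\<sigma> \<in> carrier GM \<Longrightarrow> x \<in> F \<Longrightarrow> \<sigma> x \<in> F"
proof -
  assume s: "\<sigma> \<in> carrier GM"
  have h: "hom_on F \<sigma>" using GM_hom(1)[OF s] M(2) hom_on_subset by blast
  show "restrict \<sigma> F \<in> carrier Gal" by (rule embedding_in_Gal[OF h GM_hom(2)[OF s]])
  show "x \<in> F \<Longrightarrow> \<sigma> x \<in> F" using embedding_image[OF h GM_hom(2)[OF s]] by (auto simp: bij_betw_def)
qed

lemma hom_M_determined: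
  assumes "hom_on M \<sigma>" "hom_on M \<tau>" "\<And>x. x \<in> F \<Longrightarrow> \<sigma> x = \<tau> x" "\<sigma> \<zeta> = (\<tau> \<zeta> :: 'a)" "x \<in> M"
  shows "\<sigma> x = \<tau> x"
proof -
  note R = subfield_ring[OF M(1)]
  obtain q where q: "q \<in> polys F" "x = poly q \<zeta>" using assms(5) by (auto simp: M_def simple_ext_def)
  have qM: "q \<in> polys M" using q(1) polys_mono[OF M(2)] by blast
  have "map_poly \<sigma> q = map_poly \<tau> q"
    using q(1) assms(3) by (intro poly_eqI) (simp add: coeff_hom_poly[OF R assms(1)] coeff_hom_poly[OF R assms(2)] polys_def)
  then show ?thesis using poly_hom[OF R assms(1) qM M(3)] poly_hom[OF R assms(2) qM M(3)] assms(4) q(2) by simp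
qed

text \<open>An embedding of \<open>M\<close> maps \<open>F\<close> onto itself and permutes the
  finitely many solutions of \<open>y ^ p = 1\<close>, all of which lie in \<open>M\<close>; so its
  image is \<open>M\<close>.\<close>

lemma extend_to_M:
  assumes h: "hom_on F h" "\<And>x. x \<in> k \<Longrightarrow> h x = x" and f: "is_minpoly F \<zeta> f" and z: "poly (map_poly h f) z = 0"
  shows "\<exists>\<sigma>\<in>carrier GM. (\<forall>x\<in>F. \<sigma> x = h x) \<and> \<sigma> \<zeta> = z"
proof -
  note R = subfield_ring[OF M(1)]
  obtain s where s: "hom_on M s" "s \<zeta> = z" "\<And>c. c \<in> F \<Longrightarrow> s c = h c"
    using extend_hom[OF F(1) f h(1) z] unfolding M_def by metis
  have inj: "inj_on s M" by (rule hom_inj[OF M(1) s(1)])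
  let ?Z = "{y :: 'a. y ^ p = 1}"
  have ZM: "?Z \<subseteq> M"
  proof
    fix y :: 'a assume "y \<in> ?Z"
    then obtain i where "y = \<zeta> ^ i" using roots_of_unity[OF \<zeta>(1,2)] by blast
    then show "y \<in> M" using subring_power[OF R M(3)] by simp
  qed
  have sZ: "s ` ?Z = ?Z"
  proof (rule endo_inj_surj[OF finite_roots_of_unity])
    show "s ` ?Z \<subseteq> ?Z"
    proof
      fix w assume "w \<in> s ` ?Z"
      then obtain y where y: "y ^ p = 1" "y \<in> M" "w = s y" using ZM by blast
      have "w ^ p = s (y ^ p)" using hom_power[OF R s(1) y(2)] y(3) by simp
      then show "w \<in> ?Z" using y(1) hom_1[OF R s(1)] by simp
    qed
    show "inj_on s ?Z" by (rule inj_on_subset[OF inj ZM])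
  qed
  have sF: "s ` F = F" using embedding_image[OF h] s(3) by (auto simp: bij_betw_def image_def)
  have sM: "subfield_of (s ` M)" by (rule hom_image_subfield[OF M(1) s(1)])
  have "F \<subseteq> s ` M" using sF M(2) by blast
  moreover have "\<zeta> \<in> s ` M" using sZ \<zeta>(1) ZM by blast
  ultimately have 1: "M \<subseteq> s ` M" by (subst M_def) (rule simple_ext_subset[OF subfield_ring[OF sM]])
  have 2: "s ` M \<subseteq> M"
  proof
    fix w assume "w \<in> s ` M"
    then obtain q where q: "q \<in> polys F" "w = s (poly q \<zeta>)" by (auto simp: M_def simple_ext_def)
    have qM: "q \<in> polys M" using q(1) polys_mono[OF M(2)] by blast
    have "z \<in> M" using s(2) sZ \<zeta>(1) ZM by blast
    moreover have "map_poly s q \<in> polys M"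
      using q(1) sF M(2) by (auto simp: polys_def coeff_hom_poly[OF R s(1)])
    ultimately show "w \<in> M" using poly_hom[OF R s(1) qM M(3)] q(2) s(2) poly_in[OF R] by simp
  qed
  have "bij_betw s M M" using inj 1 2 by (auto simp: bij_betw_def)
  then have "restrict s M \<in> carrier GM"
    unfolding GM_carrier using s h(2) F(2) M(4) subring_simps[OF R] by (auto simp: hom_on_def cong: bij_betw_cong)
  then show ?thesis using s M by (intro bexI[of _ "restrict s M"]) auto
qed

lemma extend_Gal_to_M:
  assumes "\<rho> \<in> carrier Gal" shows "\<exists>\<sigma>\<in>carrier GM. \<forall>x\<in>F. \<sigma> x = \<rho> x"
proof -
  have h: "hom_on F \<rho>" "\<And>x. x \<in> k \<Longrightarrow> \<rho> x = x" using assms unfolding galois_group_group(2)[OF F] by auto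
  obtain f where f: "is_minpoly F \<zeta> f" using minpoly_exists[OF F(1) \<zeta>_alg] .
  have f': "f \<in> polys F" "monic f" "poly f \<zeta> = 0" using f by (auto simp: is_minpoly_def)
  have df: "degree f > 0"
  proof (rule ccontr)
    assume "\<not> degree f > 0"
    then obtain c where "f = [:c:]" by (metis degree_eq_zeroE not_gr0)
    then show False using f' by auto
  qed
  note R = subfield_ring[OF F(1)]
  have "degree f \<le> degree (map_poly \<rho> f)"
    using f'(2) by (intro le_degree) (simp add: coeff_hom_poly[OF R h(1)] hom_1[OF R h(1)])
  then obtain z where "poly (map_poly \<rho> f) z = 0" using ac[of "map_poly \<rho> f"] df by auto
  then show ?thesis using extend_to_M[OF h f] by blast
qed

lemma finite_GM: "finite (carrier GM)"
proof (rule inj_on_finite[where f = "\<lambda>\<sigma>. (restrict \<sigma> F, \<sigma> \<zeta>)"])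
  show "finite (carrier Gal \<times> {y :: 'a. y ^ p = 1})" using fin finite_roots_of_unity by simp
  show "(\<lambda>\<sigma>. (restrict \<sigma> F, \<sigma> \<zeta>)) ` carrier GM \<subseteq> carrier Gal \<times> {y. y ^ p = 1}"
  proof
    fix w assume "w \<in> (\<lambda>\<sigma>. (restrict \<sigma> F, \<sigma> \<zeta>)) ` carrier GM"
    then obtain \<sigma> where s: "\<sigma> \<in> carrier GM" "w = (restrict \<sigma> F, \<sigma> \<zeta>)" by blast
    have "\<sigma> \<zeta> ^ p = \<sigma> (\<zeta> ^ p)" using hom_power[OF subfield_ring[OF M(1)] GM_hom(1)[OF s(1)] M(3)] by simp
    then show "w \<in> carrier Gal \<times> {y. y ^ p = 1}"
      using s GM_F(1)[OF s(1)] \<zeta>(1) hom_1[OF subfield_ring[OF M(1)] GM_hom(1)[OF s(1)]] by simp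
  qed
  show "inj_on (\<lambda>\<sigma>. (restrict \<sigma> F, \<sigma> \<zeta>)) (carrier GM)"
  proof (rule inj_onI)
    fix \<sigma> \<tau> assume st: "\<sigma> \<in> carrier GM" "\<tau> \<in> carrier GM" "(restrict \<sigma> F, \<sigma> \<zeta>) = (restrict \<tau> F, \<tau> \<zeta>)"
    have "\<sigma> x = \<tau> x" if "x \<in> F" for x using st(3) that by (metis Pair_inject restrict_apply')
    then have "\<sigma> x = \<tau> x" if "x \<in> M" for x
      using hom_M_determined[OF GM_hom(1)[OF st(1)] GM_hom(1)[OF st(2)] _ _ that] st(3) by simp
    moreover have "\<sigma> \<in> extensional M" "\<tau> \<in> extensional M" using st unfolding GM_carrier by auto
    ultimately show "\<sigma> = \<tau>" by (intro extensionalityI[of _ M])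
  qed
qed

text \<open>Write \<open>x\<close> as a polynomial \<open>r\<close> in \<open>\<zeta>\<close> of
  degree below that of the minimal polynomial \<open>f\<close>. Every root of \<open>f\<close> is an
  image of \<open>\<zeta>\<close> under an automorphism fixing \<open>F\<close>, so
  \<open>r - [:x:]\<close> vanishes at all of them; as \<open>f\<close> has as many roots as its
  degree, \<open>r\<close> is constant.\<close>

lemma M_fixed_F:
  assumes x: "x \<in> M" "\<And>\<sigma>. \<sigma> \<in> carrier GM \<Longrightarrow> (\<And>y. y \<in> F \<Longrightarrow> \<sigma> y = y) \<Longrightarrow> \<sigma> x = x"
  shows "x \<in> F"
proof (cases "(of_nat p :: 'a) = 0")
  case True
  then have "\<zeta> \<in> F" using \<zeta>(3) subring_1[OF subfield_ring[OF F(1)]] by simp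
  then have "M \<subseteq> F" unfolding M_def by (intro simple_ext_subset[OF subfield_ring[OF F(1)]]) auto
  then show ?thesis using x(1) by blast
next
  case False
  note R = subfield_ring[OF F(1)]
  obtain f where f: "is_minpoly F \<zeta> f" using minpoly_exists[OF F(1) \<zeta>_alg] .
  have f': "f \<in> polys F" "monic f" "poly f \<zeta> = 0" using f by (auto simp: is_minpoly_def)
  let ?q = "Polynomial.monom 1 p - 1 :: 'a poly"
  have qF: "?q \<in> polys F" by (intro polys_simps[OF R] subring_1[OF R])
  have "poly.coeff ?q p = 1" using p_pos by simp
  then have q0: "?q \<noteq> 0" by (metis coeff_0 zero_neq_one)
  have dq: "degree ?q \<le> p" by (intro degree_diff_le) (auto simp: degree_monom_eq)
  obtain g where g: "?q = f * g" using f qF \<zeta>(1) unfolding is_minpoly_def by (metis (no_types, lifting) diff_self poly_1 poly_diff poly_monom mult_1)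
  have g0: "g \<noteq> 0" "f \<noteq> 0" using g q0 by auto
  let ?Z = "{y :: 'a. poly f y = 0}"
  \<comment> \<open>The product \<open>f * g\<close>, that is \<open>X^p - 1\<close>, has
    \<open>p\<close> distinct roots, at most \<open>degree g\<close> of them from \<open>g\<close>;
    this leaves \<open>degree f\<close> distinct roots for \<open>f\<close>.\<close>
  have "card ((\<lambda>i. \<zeta> ^ i) ` {..<p}) = p" using root_pow_inj_gen[OF \<zeta>(1) \<zeta>(2)[OF False]] by (simp add: card_image)
  moreover have "(\<lambda>i. \<zeta> ^ i) ` {..<p} \<subseteq> ?Z \<union> {y. poly g y = 0}"
  proof
    fix y assume "y \<in> (\<lambda>i. \<zeta> ^ i) ` {..<p}"
    then obtain i where "y = \<zeta> ^ i" by blast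
    then have "y ^ p = 1" using \<zeta>(1) power_mult[of \<zeta> i p] power_mult[of \<zeta> p i] by (simp add: mult.commute)
    then have "poly (f * g) y = 0" unfolding g[symmetric] by (simp add: poly_monom)
    then show "y \<in> ?Z \<union> {y. poly g y = 0}" by simp
  qed
  ultimately have "p \<le> card (?Z \<union> {y. poly g y = 0})"
    using card_mono[of "?Z \<union> {y. poly g y = 0}"] poly_roots_finite g0 by (metis finite_UnI)
  also have "\<dots> \<le> card ?Z + card {y. poly g y = 0}" by (rule card_Un_le)
  also have "\<dots> \<le> card ?Z + degree g" using poly_roots_degree[OF g0(1)] by simp
  finally have "p \<le> card ?Z + degree g" .
  moreover have "degree f + degree g \<le> p" using dq g g0 by (simp add: degree_mult_eq)
  ultimately have Z: "degree f \<le> card ?Z" by linarith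
  obtain u where u: "u \<in> polys F" "x = poly u \<zeta>" using x(1) by (auto simp: M_def simple_ext_def)
  obtain w r where w: "r \<in> polys F" "u = f * w + r" "r = 0 \<or> degree r < degree f" "w \<in> polys F"
    using monic_division[OF R f'(1,2) u(1)] by blast
  have xr: "x = poly r \<zeta>" using u(2) w(2) f'(3) by simp
  have df: "degree f > 0"
  proof (rule ccontr)
    assume "\<not> degree f > 0"
    then obtain c where "f = [:c:]" by (metis degree_eq_zeroE not_gr0)
    then show False using f' by auto
  qed
  have idF: "hom_on F (\<lambda>x. x)" by (simp add: hom_on_def)
  have id: "map_poly (\<lambda>x. x) q = q" for q :: "'a poly" by (intro poly_eqI) (simp add: coeff_map_poly)
  have "poly (r - [:x:]) z = 0" if zZ: "z \<in> ?Z" for z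
  proof -
    obtain \<sigma> where s: "\<sigma> \<in> carrier GM" "\<And>y. y \<in> F \<Longrightarrow> \<sigma> y = y" "\<sigma> \<zeta> = z"
      using extend_to_M[OF idF _ f, of z] zZ id by auto
    have "\<sigma> (poly r \<zeta>) = poly (map_poly \<sigma> r) z"
      using poly_hom[OF subfield_ring[OF M(1)] GM_hom(1)[OF s(1)] subsetD[OF polys_mono[OF M(2)] w(1)] M(3)] s(3) by simp
    also have "map_poly \<sigma> r = r"
      using w(1) s(2) by (intro poly_eqI) (simp add: coeff_hom_poly[OF subfield_ring[OF M(1)] GM_hom(1)[OF s(1)]] polys_def)
    finally show ?thesis using x(2)[OF s(1,2)] xr by simp
  qed
  then have sub: "?Z \<subseteq> {z. poly (r - [:x:]) z = 0}" by blast
  have "r - [:x:] = 0"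
  proof (rule ccontr)
    assume nz: "r - [:x:] \<noteq> 0"
    have "degree (r - [:x:]) < degree f"
      using w(3) df degree_diff_le_max[of r "[:x:]"] by auto
    moreover have "card ?Z \<le> degree (r - [:x:])"
      using card_mono[OF poly_roots_finite[OF nz] sub] poly_roots_degree[OF nz] by linarith
    ultimately show False using Z by linarith
  qed
  then have "r = [:x:]" by simp
  then show ?thesis using w(1) polys_pCons_iff[OF R] by simp
qed

lemma M_action: "ring_action GM M (\<lambda>\<sigma>. \<sigma>)"
  by (rule galois_group_action[OF M(1,4) finite_GM])

lemma M_fixed: "ring_action.fixed GM M (\<lambda>\<sigma>. \<sigma>) = k"
proof
  show "ring_action.fixed GM M (\<lambda>\<sigma>. \<sigma>) \<subseteq> k"
  proof
    fix x assume "x \<in> ring_action.fixed GM M (\<lambda>\<sigma>. \<sigma>)"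
    then have x: "x \<in> M" "\<And>\<sigma>. \<sigma> \<in> carrier GM \<Longrightarrow> \<sigma> x = x" unfolding ring_action.fixed_def[OF M_action] by auto
    have xF: "x \<in> F" using M_fixed_F[OF x(1)] x(2) by blast
    have "\<rho> x = x" if "\<rho> \<in> carrier Gal" for \<rho> using extend_Gal_to_M[OF that] x(2) xF by force
    then show "x \<in> k" using fixed_by_Gal[OF xF] by blast
  qed
  show "k \<subseteq> ring_action.fixed GM M (\<lambda>\<sigma>. \<sigma>)"
    unfolding ring_action.fixed_def[OF M_action] using M(4) GM_hom(2) by auto
qed

lemma Gal_action: "ring_action Gal F (\<lambda>\<sigma>. \<sigma>)"
  by (rule galois_group_action[OF F fin])

lemma Gal_fixed: "ring_action.fixed Gal F (\<lambda>\<sigma>. \<sigma>) = k"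
proof
  show "ring_action.fixed Gal F (\<lambda>\<sigma>. \<sigma>) \<subseteq> k"
    unfolding ring_action.fixed_def[OF Gal_action] using fixed_by_Gal by blast
  show "k \<subseteq> ring_action.fixed Gal F (\<lambda>\<sigma>. \<sigma>)"
    unfolding ring_action.fixed_def[OF Gal_action] using F(2) galois_group_group(2)[OF F] by auto
qed

end

section \<open>Power series solutions of polynomial equations\<close>

lemma map_poly_fps_const_pCons: "map_poly fps_const (pCons (a :: 'a::field) q) = pCons (fps_const a) (map_poly fps_const q)"
  by (intro poly_eqI) (simp add: coeff_map_poly coeff_pCons split: nat.split)

lemma fps_compose_poly:
  fixes q :: "'a::field poly"
  assumes "g $ 0 = 0"
  shows "poly (map_poly fps_const q) b oo g = poly (map_poly fps_const q) (b oo g)"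
  by (induction q) (simp_all add: map_poly_fps_const_pCons fps_compose_add_distrib fps_compose_mult_distrib[OF assms])

lemma fps_of_poly_compose:
  fixes q :: "'a::field poly"
  assumes "g $ 0 = 0" shows "fps_of_poly q oo g = poly (map_poly fps_const q) g"
  by (induction q)
    (simp_all add: fps_of_poly_pCons map_poly_fps_const_pCons fps_compose_add_distrib fps_compose_mult_distrib[OF assms] assms)

lemma fps_to_fls_poly:
  fixes q :: "'a::field poly"
  shows "poly (map_poly fls_const q) (fps_to_fls b) = fps_to_fls (poly (map_poly fps_const q) b)"
  by (induction q) (simp_all add: map_poly_fps_const_pCons hom_poly_pCons[OF subring_of_UNIV fls_const_hom] fls_times_fps_to_fls)

lemma map_poly_fps_const_pcompose:
  fixes q :: "'a::field poly"
  shows "poly (map_poly fps_const (pcompose q [:y, 1:])) b = poly (map_poly fps_const q) (fps_const y + b)"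
proof -
  have a: "map_poly fps_const (q + r) = map_poly fps_const q + map_poly fps_const r" for q r :: "'a poly"
    by (intro poly_eqI) (simp add: coeff_map_poly)
  have s: "map_poly fps_const (Polynomial.smult c q) = Polynomial.smult (fps_const c) (map_poly fps_const q)" for c and q :: "'a poly"
    by (intro poly_eqI) (simp add: coeff_map_poly)
  show ?thesis
    by (induction q) (simp_all add: pcompose_pCons a s map_poly_fps_const_pCons algebra_simps)
qed

text \<open>The recursion for the compositional inverse divides only by powers of the linear
  coefficient.\<close>

lemma compinv_in:
  assumes K: "subfield_of (K :: 'a::field set)" and a: "\<And>n. a $ n \<in> K"
  shows "compinv a n \<in> K"
proof (induction n rule: less_induct)
  case (less n)
  note R = subfield_ring[OF K]
  have pw: "(a ^ i) $ m \<in> K" for i m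
  proof (induction i arbitrary: m)
    case 0
    show ?case using subring_simps[OF R] by simp
  next
    case (Suc i)
    show ?case unfolding power_Suc fps_mult_nth by (intro subring_sum[OF R] subring_mult[OF R] a Suc.IH)
  qed
  show ?case
  proof (cases n)
    case 0
    then show ?thesis using subring_0[OF R] by simp
  next
    case (Suc m)
    have "(\<Sum>i = 0..m. compinv a i * (a ^ i) $ Suc m) \<in> K"
      by (intro subring_sum[OF R] subring_mult[OF R] pw less) (auto simp: Suc)
    then show ?thesis unfolding Suc compinv.simps
      using subring_simps[OF R] by (intro subfield_divide[OF K] subring_diff[OF R] subring_power[OF R] a) (auto simp: fps_X_def)
  qed
qed

text \<open>Around a simple root \<open>y\<close> the shifted polynomial has no constant term and a
  nonzero linear one, so it has a compositional inverse; \<open>y\<close> plus this inverse is the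
  solution.\<close>

lemma series_root:
  assumes K: "subfield_of (K :: 'a::field set)" and f: "f \<in> polys K" "y \<in> K" "poly f y = 0" "poly (pderiv f) y \<noteq> 0"
  shows "\<exists>b. b $ 0 = y \<and> (\<forall>n. b $ n \<in> K) \<and> poly (map_poly fps_const f) b = fps_X"
proof -
  note R = subfield_ring[OF K]
  define q where "q = pcompose f [:y, 1:]"
  define a where "a = fps_of_poly q"
  have qK: "q \<in> polys K" unfolding q_def
    by (intro polys_pcompose[OF R] f) (simp add: polys_pCons_iff[OF R] polys_0[OF R] f subring_1[OF R])
  have c1: "poly.coeff r 1 = poly (pderiv r) 0" for r :: "'a poly"
    by (simp add: poly_0_coeff_0 coeff_pderiv)
  have a0: "a $ 0 = 0" using f(3) by (simp add: a_def q_def poly_0_coeff_0[symmetric] poly_pcompose)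
  have a1: "a $ 1 \<noteq> 0" unfolding a_def fps_of_poly_nth c1 q_def
    using f(4) by (simp add: pderiv_pcompose poly_pcompose pderiv_pCons)
  have i: "fps_inv a $ 0 = 0" "\<And>n. fps_inv a $ n \<in> K"
    using compinv_in[OF K, of a] qK by (auto simp: fps_inv_def a_def polys_def)
  define b where "b = fps_const y + fps_inv a"
  have "poly (map_poly fps_const f) b = poly (map_poly fps_const q) (fps_inv a)"
    unfolding b_def q_def by (rule map_poly_fps_const_pcompose[symmetric])
  also have "\<dots> = a oo fps_inv a" unfolding a_def by (rule fps_of_poly_compose[symmetric]) (rule i(1)[unfolded a_def])
  also have "\<dots> = fps_X" by (rule fps_inv_right[OF a0 a1])
  finally have "poly (map_poly fps_const f) b = fps_X" .
  moreover have "b $ 0 = y" using i(1) by (simp add: b_def)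
  moreover have "b $ n \<in> K" for n using i(2)[of n] f(2) subring_simps[OF R] by (cases n) (auto simp: b_def fps_const_def)
  ultimately show ?thesis by blast
qed

section \<open>Values of the twist on eigenvectors\<close>

context twist_family
begin

text \<open>Uniqueness of interpolation lets an explicit polynomial replace the Lagrange sum: a
  monomial for multiplicative eigenvectors, a linear polynomial for additive ones.\<close>

lemma tw_interp:
  assumes c: "c \<in> C" and x: "x \<in> M" and q: "degree q < p" "\<And>i. i < p \<Longrightarrow> poly q (pts c i) = act (el c [^] i) x"
  shows "tw c (fls_const x) = poly (map_poly fls_const q) (v c)"
proof -
  note h = subring_of_UNIV fls_const_hom
  have inj: "inj_on (\<lambda>i. fls_const (pts c i)) {..<p}" using pts(2)[OF c] by (simp add: inj_on_def fls_const_inj)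
  have "map_poly fls_const q = interp p (\<lambda>i. fls_const (pts c i)) (sact (el c)) (fls_const x)"
  proof (rule interp_unique[OF inj])
    show "degree (map_poly fls_const q) < p" using q(1) degree_map_poly_le[of fls_const q] by simp
    fix i assume i: "i < p"
    have "poly (map_poly fls_const q) (fls_const (pts c i)) = fls_const (poly q (pts c i))"
      using poly_hom[OF h, of q "pts c i"] by simp
    then show "poly (map_poly fls_const q) (fls_const (pts c i)) = (sact (el c) ^^ i) (fls_const x)"
      using q(2)[OF i] c x by (simp add: sact_pow el const_ser sact_const)
  qed
  then show ?thesis by (simp add: tw_def twist_def)
qed

text \<open>The factors \<open>y c\<close> are scalars, so later twists pull them out.\<close>

lemma Tw_prod:
  assumes x: "x \<in> ser M" and y: "\<And>c. c \<in> C \<Longrightarrow> good (y c)" "\<And>c. c \<in> C \<Longrightarrow> tw c x = y c * x"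
  shows "Tw x = (\<Prod>c\<in>C. y c) * x"
proof -
  have "fold tw ds x = (\<Prod>c\<in>set ds. y c) * x" if "set ds \<subseteq> C" "distinct ds" for ds
    using that
  proof (induction ds rule: rev_induct)
    case (snoc c ds)
    have g: "good (\<Prod>c\<in>set ds. y c)" using subring_prod[OF good_subring, of "set ds" y] y(1) snoc.prems(1) by auto
    show ?case using snoc tw_scale[OF _ g x, of c] y(2)[of c] by (simp add: ac_simps)
  qed simp
  then show ?thesis using cs by (simp add: Tw_def)
qed

lemma Tw_sum:
  assumes x: "x \<in> ser M" and y: "\<And>c. c \<in> C \<Longrightarrow> good (y c)" "\<And>c. c \<in> C \<Longrightarrow> tw c x = x + y c"
  shows "Tw x = x + (\<Sum>c\<in>C. y c)"
proof -
  have "fold tw ds x = x + (\<Sum>c\<in>set ds. y c)" if "set ds \<subseteq> C" "distinct ds" for ds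
    using that
  proof (induction ds rule: rev_induct)
    case (snoc c ds)
    have g: "good (\<Sum>c\<in>set ds. y c)" using subring_sum[OF good_subring, of "set ds" y] y(1) snoc.prems(1) by auto
    then have "(\<Sum>c\<in>set ds. y c) \<in> ser M" by (simp add: good_def)
    then show ?case using snoc tw_add[OF _ x, of c "\<Sum>c\<in>set ds. y c"] tw_good[OF _ g, of c] y(2)[of c] by (simp add: ac_simps)
  qed simp
  then show ?thesis using cs by (simp add: Tw_def)
qed

lemma polyx_subring: "subring_of (polyx k)" and polyx_X: "fls_X \<in> polyx k" and polyx_const: "x \<in> k \<Longrightarrow> fls_const x \<in> polyx k"
proof -
  note R = subfield_ring[OF k_subfield]
  show "subring_of (polyx k)" unfolding subring_of_def polyx_def
  proof (intro conjI ballI)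
    show "1 \<in> fls_of_poly ` polys k" by (rule image_eqI[where x = 1]) (simp_all add: fls_of_poly_hom polys_1[OF R])
    fix x y assume "x \<in> fls_of_poly ` polys k" "y \<in> fls_of_poly ` polys k"
    then obtain q r where *: "q \<in> polys k" "r \<in> polys k" "x = fls_of_poly q" "y = fls_of_poly r" by blast
    show "x - y \<in> fls_of_poly ` polys k" "x * y \<in> fls_of_poly ` polys k"
      unfolding *(3,4) fls_of_poly_hom(4,5)[symmetric] using polys_diff[OF R *(1,2)] polys_mult[OF R *(1,2)] by blast+
  qed
  show "fls_X \<in> polyx k" unfolding polyx_def
    by (rule image_eqI[of _ _ "[:0, 1:]"]) (simp_all add: fls_of_poly_hom polys_pCons_iff[OF R] polys_0[OF R] subring_simps[OF R])
  show "x \<in> k \<Longrightarrow> fls_const x \<in> polyx k" unfolding polyx_def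
    by (rule image_eqI[of _ _ "[:x:]"]) (simp_all add: fls_of_poly_hom polys_pCons_iff[OF R] polys_0[OF R] subring_simps[OF R])
qed

lemma const_integral:
  assumes "x \<in> M" shows "integral_over (polyx k) (fls_const x)"
proof -
  note h = subring_of_UNIV fls_const_hom
  note o = orbit_poly[OF assms]
  have "map_poly fls_const (orbit_poly x) \<in> polys (polyx k)"
    using o(1) polyx_const unfolding k by (simp add: polys_def coeff_hom_poly[OF h])
  moreover have "monic (map_poly fls_const (orbit_poly x))"
  proof -
    have "degree (map_poly fls_const (orbit_poly x)) = degree (orbit_poly x)" by (rule degree_map_poly) simp
    then show ?thesis using o(2) by (simp add: coeff_hom_poly[OF h])
  qed
  moreover have "poly (map_poly fls_const (orbit_poly x)) (fls_const x) = 0"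
    using poly_hom[OF h, of "orbit_poly x" x] o(5) by simp
  ultimately show ?thesis unfolding integral_over_def by blast
qed

lemma sact_integral:
  assumes g: "g \<in> carrier G" and x: "x \<in> ser M" "integral_over (polyx k) x"
  shows "integral_over (polyx k) (sact g x)"
proof -
  note R = subfield_ring[OF k_subfield]
  have "sact g y = y" if y: "y \<in> polyx k" for y
  proof -
    have "y $$ n \<in> k" for n using y fls_of_poly_ser[OF R] by (auto simp: polyx_def ser_def)
    then show ?thesis using k fixedD(2)[OF _ g] by (intro fls_eqI) (auto simp: ser_map_nth'[OF M hom[OF g]])
  qed
  then have "sact g ` polyx k = polyx k" by force
  moreover have "polyx k \<subseteq> ser M" using ratx_mono[OF k_sub order_refl] R0(2) polyx_ratx[OF R] by blast
  ultimately show ?thesis using integral_hom[OF ser.S ser.hom[OF g] _ x] by metis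
qed

text \<open>The Lagrange polynomials have constant coefficients, which are algebraic over
  \<open>k\<close> and so integral over $k[X]$; conjugates of \<open>x\<close> are integral as
  well.\<close>

lemma tw_integral:
  assumes c: "c \<in> C" and vc: "integral_over (polyx k) (v c)" and x: "x \<in> ser M" "integral_over (polyx k) x"
  shows "integral_over (polyx k) (tw c x)"
proof -
  note I = integral_subring[OF polyx_subring]
  have l: "lagr p (\<lambda>i. fls_const (pts c i)) i = map_poly fls_const (lagr p (pts c) i)" if "i < p" for i
    using lagr_hom[OF subring_of_UNIV fls_const_hom, of p "pts c" "\<lambda>i. fls_const (pts c i)" i] that by simp
  have "lagr p (pts c) i \<in> polys M" if "i < p" for i
    unfolding lagr_def using that pts(1)[OF c]
    by (intro polys_prod[OF S] polys_smult[OF S] subfield_inverse[OF M]) (auto simp: polys_pCons_iff[OF S] polys_0[OF S] subring_simps[OF S])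
  then have "lagr p (\<lambda>i. fls_const (pts c i)) i \<in> polys {x. integral_over (polyx k) x}" if "i < p" for i
    using that const_integral l by (simp add: polys_def coeff_hom_poly[OF subring_of_UNIV fls_const_hom])
  then have 1: "integral_over (polyx k) (poly (lagr p (\<lambda>i. fls_const (pts c i)) i) (v c))" if "i < p" for i
    using poly_in[OF I, of _ "v c"] vc that by simp
  have "integral_over (polyx k) ((sact (el c) ^^ i) x)" for i
    using sact_integral[OF nat_pow_closed[OF el[OF c]] x] by (simp add: sact_pow[OF el[OF c] x(1)])
  then have "(\<Sum>i<p. (sact (el c) ^^ i) x * poly (lagr p (\<lambda>i. fls_const (pts c i)) i) (v c)) \<in> {x. integral_over (polyx k) x}"
    using 1 by (intro subring_sum[OF I] subring_mult[OF I]) auto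
  then show ?thesis unfolding tw_def twist_altdef by simp
qed

lemma Tw_integral:
  assumes v: "\<And>c. c \<in> C \<Longrightarrow> integral_over (polyx k) (v c)" and x: "x \<in> ser M" "integral_over (polyx k) x"
  shows "integral_over (polyx k) (Tw x)"
proof -
  have "set ds \<subseteq> C \<Longrightarrow> x \<in> ser M \<Longrightarrow> integral_over (polyx k) x \<Longrightarrow> integral_over (polyx k) (fold tw ds x)" for ds x
    by (induction ds arbitrary: x) (auto simp: tw_integral tw_in v)
  then show ?thesis using x cs(1) by (simp add: Tw_def)
qed

end

lemma (in twist_descent) E_place:
  assumes v: "\<And>c. c \<in> C \<Longrightarrow> integral_over (polyx k) (v c)" and z: "z \<in> F"
  shows "\<exists>e\<in>E. integral_over (polyx k) e \<and> e $$ 0 = z"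
proof (intro bexI conjI)
  have zM: "z \<in> M" using z F(2) by blast
  then have s: "fls_const z \<in> ser M" by (simp add: const_ser)
  show "integral_over (polyx k) (Tw (fls_const z))" by (rule Tw_integral[OF v s const_integral[OF zM]])
  show "Tw (fls_const z) $$ 0 = z" using Tw_lead(2)[OF s, of 0] by simp
  show "Tw (fls_const z) \<in> E" unfolding E_def
    using ratx_const[OF subfield_ring[OF k_subfield] subfield_ring[OF F(1)] z] by blast
qed

section \<open>The twist attached to an abelian normal subgroup\<close>

text \<open>\<open>pt i = \<zeta> ^ i\<close> and \<open>s = [:0, \<zeta>:]\<close> give the Kummer case, \<open>pt i = of_nat i\<close> and \<open>s = [:1, 1:]\<close> the
  Artin--Schreier case.  The series \<open>v c\<close> solve \<open>nodal(v c) = u c * X\<close>.\<close>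

locale orbit_twist = ring_action G M act
  for G :: "('i, 'm) monoid_scheme" (structure) and M :: "'a::field set" and act +
  fixes k F :: "'a set" and A :: "'i set" and a0 :: 'i and \<theta> :: 'a and p :: nat
    and pt :: "nat \<Rightarrow> 'a" and s :: "'a poly" and u :: "'a \<Rightarrow> 'a"
  assumes M: "subfield_of M" and k: "fixed = k" and F: "subfield_of F" "F \<subseteq> M" "k \<subseteq> F"
    and F_act: "\<And>g x. g \<in> carrier G \<Longrightarrow> x \<in> F \<Longrightarrow> act g x \<in> F"
    and F_fixed: "\<And>x. x \<in> M \<Longrightarrow> (\<And>g. g \<in> carrier G \<Longrightarrow> (\<And>y. y \<in> F \<Longrightarrow> act g y = y) \<Longrightarrow> act g x = x) \<Longrightarrow> x \<in> F"
    and A: "A \<lhd> G" "a0 \<in> A" and comm: "\<And>a b. a \<in> A \<Longrightarrow> b \<in> A \<Longrightarrow> a \<otimes> b = b \<otimes> a"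
    and exponent: "\<And>a. a \<in> A \<Longrightarrow> a [^] p = \<one>" and p: "p > 0"
    and \<theta>: "\<theta> \<in> M" "\<And>g. g \<in> carrier G \<Longrightarrow> act g \<theta> = \<theta> \<longleftrightarrow> g \<in> A"
    and pt: "\<And>i. i < p \<Longrightarrow> pt i \<in> M" "inj_on pt {..<p}" "\<And>a i. a \<in> A \<Longrightarrow> i < p \<Longrightarrow> act a (pt i) = pt i" "pt 0 \<in> k"
    and s: "s \<in> polys M" "degree s = 1" "\<And>i. i < p \<Longrightarrow> poly s (pt i) = pt (Suc i mod p)" "pcompose (nodal p pt) s = nodal p pt"
    and nodal: "nodal p pt \<in> polys k" "poly (pderiv (nodal p pt)) (pt 0) \<noteq> 0"
    and u: "\<And>x. x \<in> M \<Longrightarrow> u x \<in> M" "\<And>g x. g \<in> carrier G \<Longrightarrow> x \<in> M \<Longrightarrow> act g (u x) = u (act g x)"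
begin

lemma AG: "A \<subseteq> carrier G"
  using A(1) normal_imp_subgroup subgroup.subset by blast

definition C :: "'a set"
  where "C = (\<lambda>g. act g \<theta>) ` carrier G"

definition \<tau> :: "'a \<Rightarrow> 'i"
  where "\<tau> c = (SOME g. g \<in> carrier G \<and> act g \<theta> = c)"

text \<open>The result is independent of the choice made in \<open>\<tau>\<close>: two candidates
  differ by an element of the abelian \<open>A\<close>, which commutes with
  \<open>a0\<close>.\<close>

definition el :: "'a \<Rightarrow> 'i"
  where "el c = \<tau> c \<otimes> a0 \<otimes> inv (\<tau> c)"

definition base :: "'a fps"
  where "base = (SOME b. b $ 0 = pt 0 \<and> (\<forall>n. b $ n \<in> k) \<and> poly (map_poly fps_const (nodal p pt)) b = fps_X)"

text \<open>One series over \<open>k\<close> is rescaled for all \<open>c\<close>; since its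
  coefficients are invariant, a group element moves only \<open>u c\<close>, which makes the family
  equivariant.\<close>

definition v :: "'a \<Rightarrow> 'a fls"
  where "v c = fps_to_fls (base oo (fps_const (u c) * fps_X))"

lemma CM: "C \<subseteq> M"
  unfolding C_def using act_in \<theta>(1) by auto

lemma C_act: "g \<in> carrier G \<Longrightarrow> c \<in> C \<Longrightarrow> act g c \<in> C"
proof -
  assume g: "g \<in> carrier G" and "c \<in> C"
  then obtain h where h: "h \<in> carrier G" "c = act h \<theta>" unfolding C_def by blast
  have "act g c = act (g \<otimes> h) \<theta>" using act_mult[OF g h(1) \<theta>(1)] h(2) by simp
  then show "act g c \<in> C" unfolding C_def using g h(1) by blast
qed

lemma \<theta>_C: "\<theta> \<in> C"
  unfolding C_def using act_one[OF \<theta>(1)] one_closed by force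

lemma \<tau>: "c \<in> C \<Longrightarrow> \<tau> c \<in> carrier G" "c \<in> C \<Longrightarrow> act (\<tau> c) \<theta> = c"
proof -
  assume "c \<in> C"
  then have "\<exists>g. g \<in> carrier G \<and> act g \<theta> = c" unfolding C_def by blast
  then have "\<tau> c \<in> carrier G \<and> act (\<tau> c) \<theta> = c" unfolding \<tau>_def by (rule someI_ex)
  then show "\<tau> c \<in> carrier G" "act (\<tau> c) \<theta> = c" by auto
qed

lemma \<tau>_act:
  assumes g: "g \<in> carrier G" and c: "c \<in> C"
  obtains a where "a \<in> A" "\<tau> (act g c) = g \<otimes> \<tau> c \<otimes> a"
proof -
  let ?h = "g \<otimes> \<tau> c" and ?t = "\<tau> (act g c)"
  note t = \<tau>[OF c] \<tau>[OF C_act[OF g c]]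
  have h: "?h \<in> carrier G" using g t by simp
  have "act ?h \<theta> = act ?t \<theta>" using act_mult[OF g t(1) \<theta>(1)] t by simp
  then have "act (inv ?h \<otimes> ?t) \<theta> = \<theta>" using act_mult[OF inv_closed[OF h] t(3) \<theta>(1)] act_inv[OF h \<theta>(1)] by simp
  then have "inv ?h \<otimes> ?t \<in> A" using \<theta>(2) h t(3) by simp
  moreover have "?t = ?h \<otimes> (inv ?h \<otimes> ?t)" using h t(3) by (simp add: m_assoc[symmetric])
  ultimately show ?thesis by (rule that)
qed

lemma el_A: "c \<in> C \<Longrightarrow> el c \<in> A"
  unfolding el_def using normal.inv_op_closed2[OF A(1) \<tau>(1) A(2)] .

lemma conj_comm:
  assumes "x \<in> carrier G" "a \<in> A" shows "(x \<otimes> a) \<otimes> a0 \<otimes> inv (x \<otimes> a) = x \<otimes> a0 \<otimes> inv x"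
proof -
  have c: "a \<in> carrier G" "a0 \<in> carrier G" using assms A(2) AG by auto
  have "(x \<otimes> a) \<otimes> a0 \<otimes> inv (x \<otimes> a) = x \<otimes> (a \<otimes> a0) \<otimes> inv a \<otimes> inv x"
    using assms(1) c by (simp add: inv_mult_group m_assoc)
  also have "\<dots> = x \<otimes> a0 \<otimes> inv x"
    unfolding comm[OF assms(2) A(2)] using assms(1) c by (simp add: m_assoc[symmetric]) (simp add: m_assoc)
  finally show ?thesis .
qed

lemma el_act:
  assumes g: "g \<in> carrier G" and c: "c \<in> C" shows "g \<otimes> el c = el (act g c) \<otimes> g"
proof -
  obtain a where a: "a \<in> A" "\<tau> (act g c) = g \<otimes> \<tau> c \<otimes> a" using \<tau>_act[OF g c] .
  have t: "\<tau> c \<in> carrier G" "a0 \<in> carrier G" using \<tau>(1)[OF c] A(2) AG by auto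
  have "el (act g c) = (g \<otimes> \<tau> c) \<otimes> a0 \<otimes> inv (g \<otimes> \<tau> c)"
    unfolding el_def a(2) by (rule conj_comm) (use g t a in auto)
  then show ?thesis using g t by (simp add: el_def inv_mult_group m_assoc)
qed

text \<open>By normality of \<open>A\<close>, conjugating \<open>a\<close> back to
  \<open>\<theta>\<close> gives again an element of the stabilizer of
  \<open>\<theta>\<close>.\<close>

lemma A_fixes_C:
  assumes a: "a \<in> A" and d: "d \<in> C" shows "act a d = d"
proof -
  obtain h where h: "h \<in> carrier G" "d = act h \<theta>" using d unfolding C_def by blast
  let ?b = "inv h \<otimes> a \<otimes> h"
  have aG: "a \<in> carrier G" using a AG by auto
  have b: "?b \<in> A" using normal.inv_op_closed1[OF A(1) h(1) a] .
  have "a \<otimes> h = h \<otimes> ?b" using h aG by (simp add: m_assoc[symmetric])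
  then have "act a (act h \<theta>) = act h (act ?b \<theta>)"
    using act_mult[OF aG h(1) \<theta>(1)] act_mult[OF h(1) _ \<theta>(1), of ?b] b AG by auto
  then show ?thesis using \<theta>(2)[of ?b] b AG h(2) by auto
qed

lemma k_M: "subfield_of k" "k \<subseteq> M" "\<And>g x. g \<in> carrier G \<Longrightarrow> x \<in> k \<Longrightarrow> act g x = x"
  using k fixed_subfield[OF M] fixedD by auto

lemma base: "base $ 0 = pt 0" "base $ n \<in> k" "poly (map_poly fps_const (nodal p pt)) base = fps_X"
proof -
  have "\<exists>b. b $ 0 = pt 0 \<and> (\<forall>n. b $ n \<in> k) \<and> poly (map_poly fps_const (nodal p pt)) b = fps_X"
    by (rule series_root[OF k_M(1) nodal(1) pt(4) nodal_root[OF p] nodal(2)])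
  then have "base $ 0 = pt 0 \<and> (\<forall>n. base $ n \<in> k) \<and> poly (map_poly fps_const (nodal p pt)) base = fps_X"
    unfolding base_def by (rule someI_ex)
  then show "base $ 0 = pt 0" "base $ n \<in> k" "poly (map_poly fps_const (nodal p pt)) base = fps_X" by auto
qed

lemma v_nth: "v c $$ n = (if n < 0 then 0 else u c ^ nat n * base $ nat n)"
  by (simp add: v_def)

lemma v_root: "poly (map_poly fls_const (nodal p pt)) (v c) = fls_const (u c) * fls_X"
proof -
  have "poly (map_poly fps_const (nodal p pt)) (base oo (fps_const (u c) * fps_X)) = fps_const (u c) * fps_X"
    using fps_compose_poly[of "fps_const (u c) * fps_X" "nodal p pt" base] base(3) by simp
  then show ?thesis by (simp add: v_def fps_to_fls_poly fls_times_fps_to_fls)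
qed

text \<open>Conjugation may replace the generator \<open>\<zeta>\<close> by another power, so each
  \<open>c\<close> gets its own enumeration of the nodes; \<open>nodal_pts\<close> shows that the
  nodal polynomial is unchanged.\<close>

definition pts :: "'a \<Rightarrow> nat \<Rightarrow> 'a"
  where "pts c i = act (\<tau> c) (pt i)"

lemma nodal_pts: "c \<in> C \<Longrightarrow> nodal p (pts c) = nodal p pt"
proof -
  assume c: "c \<in> C"
  note h = S hom[OF \<tau>(1)[OF c]]
  have l: "[:- pt i, 1:] \<in> polys M" if "i < p" for i
    using pt(1)[OF that] by (simp add: polys_pCons_iff[OF S] polys_0[OF S] subring_simps[OF S])
  have "map_poly (act (\<tau> c)) (nodal p pt) = (\<Prod>i<p. map_poly (act (\<tau> c)) [:- pt i, 1:])"
    unfolding nodal_def by (rule hom_poly_prod[OF h]) (use l in auto)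
  also have "\<dots> = nodal p (pts c)" unfolding nodal_def
    by (rule prod.cong) (simp_all add: hom_poly_pCons[OF h] hom_0[OF h] hom_1[OF h] hom_uminus[OF h] pt pts_def)
  finally have "nodal p (pts c) = map_poly (act (\<tau> c)) (nodal p pt)" ..
  also have "\<dots> = nodal p pt"
    using nodal(1) k_M(3)[OF \<tau>(1)[OF c]] by (intro poly_eqI) (simp add: coeff_hom_poly[OF h] polys_def)
  finally show ?thesis .
qed

sublocale twist_descent G M act k C act el pts "\<lambda>c. map_poly (act (\<tau> c)) s" v p F
proof unfold_locales
  show "subfield_of M" by (rule M)
  show "fixed = k" by (rule k)
  show "finite C" unfolding C_def using fin by simp
  show "p > 0" by (rule p)
  show "subfield_of F" "F \<subseteq> M" "k \<subseteq> F" by (rule F)+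
  show "act g x \<in> F" if "g \<in> carrier G" "x \<in> F" for g x by (rule F_act[OF that])
  show "x \<in> F" if "x \<in> M" "\<And>g. g \<in> carrier G \<Longrightarrow> (\<And>y. y \<in> F \<Longrightarrow> act g y = y) \<Longrightarrow> act g x = x" for x
    by (rule F_fixed[OF that])
  fix g assume g: "g \<in> carrier G"
  show "inj_on (act g) C" by (rule inj_on_subset[OF act_inj[OF g] CM])
  fix c assume c: "c \<in> C"
  show "act g c \<in> C" by (rule C_act[OF g c])
  show "g \<otimes> el c = el (act g c) \<otimes> g" by (rule el_act[OF g c])
  show "ser_map (act g) (v c) = v (act g c)"
  proof (rule fls_eqI)
    fix n
    have uc: "u c \<in> M" using u(1) CM c by blast
    have "act g (u c ^ m * base $ m) = u (act g c) ^ m * base $ m" for m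
      using hom_mult[OF S hom[OF g] subring_power[OF S uc] subsetD[OF k_M(2) base(2)]] hom_power[OF S hom[OF g] uc] u(2)[OF g] CM c k_M(3)[OF g base(2)] by auto
    then show "ser_map (act g) (v c) $$ n = v (act g c) $$ n"
      by (simp add: ser_map_nth'[OF M hom[OF g]] v_nth hom_0[OF S hom[OF g]])
  qed
  fix i assume i: "i < p"
  obtain a where a: "a \<in> A" "\<tau> (act g c) = g \<otimes> \<tau> c \<otimes> a" using \<tau>_act[OF g c] .
  have "a \<in> carrier G" using a AG by auto
  then show "act g (pts c i) = pts (act g c) i"
    unfolding pts_def a(2) using g \<tau>(1)[OF c] pt(3)[OF a(1) i] pt(1)[OF i] by (simp add: act_mult)
next
  fix c assume c: "c \<in> C"
  note h = S hom[OF \<tau>(1)[OF c]]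
  show "el c \<in> carrier G" using el_A[OF c] AG by auto
  show "el c [^] p = \<one>" by (rule exponent[OF el_A[OF c]])
  show "act (el c) d = d" if "d \<in> C" for d by (rule A_fixes_C[OF el_A[OF c] that])
  show "pts c i \<in> M" if "i < p" for i unfolding pts_def by (rule act_in[OF \<tau>(1)[OF c] pt(1)[OF that]])
  show "inj_on (pts c) {..<p}"
  proof (rule inj_onI)
    fix i j assume ij: "i \<in> {..<p}" "j \<in> {..<p}" "pts c i = pts c j"
    then have "pt i = pt j" using act_inj[OF \<tau>(1)[OF c]] pt(1) by (auto simp: pts_def inj_on_def)
    then show "i = j" using pt(2) ij by (simp add: inj_on_def)
  qed
  show "map_poly (act (\<tau> c)) s \<in> polys M" by (rule polys_act[OF \<tau>(1)[OF c] s(1)])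
  show "degree (map_poly (act (\<tau> c)) s) = 1"
  proof -
    have "lead_coeff s \<noteq> 0" using s(2) by (metis degree_0 leading_coeff_0_iff zero_neq_one)
    moreover have "lead_coeff s \<in> M" using s(1) by (simp add: polys_def)
    ultimately have "act (\<tau> c) (lead_coeff s) \<noteq> 0" by (intro hom_nonzero[OF h] subfield_inverse[OF M])
    then show ?thesis using s(2) degree_map_poly_le[of "act (\<tau> c)" s] le_degree[of "map_poly (act (\<tau> c)) s" 1]
      by (simp add: coeff_hom_poly[OF h])
  qed
  show "poly (map_poly (act (\<tau> c)) s) (pts c i) = pts c (Suc i mod p)" if "i < p" for i
    using poly_hom[OF h s(1) pt(1)[OF that]] s(3)[OF that] by (simp add: pts_def)
  have nM: "nodal p pt \<in> polys M" using nodal(1) polys_mono[OF k_M(2)] by blast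
  have nf: "map_poly (act (\<tau> c)) (nodal p pt) = nodal p pt"
    using nodal(1) k_M(3)[OF \<tau>(1)[OF c]] by (intro poly_eqI) (simp add: coeff_hom_poly[OF h] polys_def)
  show "pcompose (nodal p (pts c)) (map_poly (act (\<tau> c)) s) = nodal p (pts c)"
    using hom_poly_pcompose[OF h nM s(1)] s(4) nf by (simp add: nodal_pts[OF c])
  have uc: "u c \<in> M" using u(1) CM c by blast
  have "v c $$ n \<in> M" for n
    using subring_mult[OF S subring_power[OF S uc] subsetD[OF k_M(2) base(2)], of "nat n" "nat n"] subring_0[OF S]
    by (cases "n < 0") (simp_all add: v_nth)
  then show "v c \<in> ser M" by (simp add: ser_def)
  show "v c $$ n = 0" if "n < 0" for n using that by (simp add: v_nth)
  show "v c $$ 0 = pts c 0" using base(1) k_M(3)[OF \<tau>(1)[OF c] pt(4)] by (simp add: v_nth pts_def)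
  have "fls_const (u c) * fls_X \<in> ratx M k"
    by (intro subring_mult[OF ratx_subring[OF S subfield_ring[OF k_M(1)] k_M(2)]]
        ratx_const[OF subfield_ring[OF k_M(1)] S uc] ratx_X[OF subfield_ring[OF k_M(1)] S])
  then show "poly (nodal p (\<lambda>i. fls_const (pts c i))) (v c) \<in> ratx M k"
    unfolding nodal_const nodal_pts[OF c] v_root .
qed

lemma v_integral:
  assumes c: "c \<in> C" shows "integral_over (polyx k) (v c)"
proof (rule integral_if_poly_integral[OF polyx_subring])
  note I = integral_subring[OF polyx_subring]
  show "map_poly fls_const (nodal p pt) \<in> polys (polyx k)"
    using nodal(1) polyx_const by (simp add: polys_def coeff_hom_poly[OF subring_of_UNIV fls_const_hom])
  show "monic (map_poly fls_const (nodal p pt))" unfolding nodal_const[symmetric] by (rule nodal_monic)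
  show "degree (map_poly fls_const (nodal p pt)) > 0" unfolding nodal_const[symmetric] nodal_degree by (rule p)
  have "u c \<in> M" using u(1) CM c by blast
  then show "integral_over (polyx k) (poly (map_poly fls_const (nodal p pt)) (v c))"
    unfolding v_root using subring_mult[OF I, of "fls_const (u c)" fls_X] const_integral integral_base[OF polyx_subring polyx_X] by simp
qed

text \<open>The element chosen for \<open>\<theta>\<close> lies in \<open>A\<close> but is perhaps
  not \<open>\<one>\<close>; \<open>A\<close> fixes the nodes and commutes with
  \<open>a0\<close>.\<close>

lemma pts_\<theta>: "i < p \<Longrightarrow> pts \<theta> i = pt i" and el_\<theta>: "el \<theta> = a0"
proof -
  have t: "\<tau> \<theta> \<in> A" using \<tau>[OF \<theta>_C] \<theta>(2) by blast
  then show "i < p \<Longrightarrow> pts \<theta> i = pt i" by (simp add: pts_def pt(3))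
  have "\<tau> \<theta> \<in> carrier G" "a0 \<in> carrier G" using t A(2) AG by auto
  then show "el \<theta> = a0" unfolding el_def comm[OF t A(2)] by (simp add: m_assoc)
qed

end

section \<open>Two functions that are not rational\<close>

text \<open>The \<open>p\<close>-th power is a constant times the product of the factors
  \<open>(1 + c * X) ^ m c\<close>. Its order at the zero of the factor for \<open>c0\<close> is 1,
  since distinct \<open>c\<close> have distinct zeros, whereas a \<open>p\<close>-th power has order
  divisible by \<open>p\<close>.\<close>

lemma kummer_not_rational:
  fixes v :: "'a::field \<Rightarrow> 'a fls"
  assumes p: "p > 1" and C: "finite C" "c0 \<in> C" "c0 \<noteq> 0" and x: "x \<noteq> 0" and m: "m c0 = 1"
    and v: "\<And>c. c \<in> C \<Longrightarrow> v c ^ p = 1 + fls_const c * fls_X"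
  shows "(\<Prod>c\<in>C. v c ^ m c) * fls_const x \<notin> ratx UNIV UNIV"
proof
  assume "(\<Prod>c\<in>C. v c ^ m c) * fls_const x \<in> ratx UNIV UNIV"
  then obtain P Q where PQ: "Q \<noteq> 0" "(\<Prod>c\<in>C. v c ^ m c) * fls_const x = fls_of_poly P / fls_of_poly Q"
    by (auto elim: ratxE)
  let ?L = "\<lambda>c. [:1, c:] :: 'a poly"
  have L: "fls_of_poly (?L c) = 1 + fls_const c * fls_X" for c :: 'a
  proof -
    have "?L c = 1 + [:c:] * [:0, 1:]" by (simp add: one_pCons)
    then show ?thesis by (simp only: fls_of_poly_hom)
  qed
  have pr: "fls_of_poly (\<Prod>c\<in>I. g c) = (\<Prod>c\<in>I. fls_of_poly (g c))" for I :: "'a set" and g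
    by (induction I rule: infinite_finite_induct) (simp_all add: fls_of_poly_hom)
  have "fls_of_poly P = fls_of_poly Q * ((\<Prod>c\<in>C. v c ^ m c) * fls_const x)" using PQ by simp
  moreover have "(\<Prod>c\<in>C. v c ^ m c) ^ p = (\<Prod>c\<in>C. (v c ^ p) ^ m c)"
    unfolding prod_power_distrib power_mult[symmetric] by (simp add: mult.commute)
  ultimately have "fls_of_poly P ^ p = fls_of_poly Q ^ p * ((\<Prod>c\<in>C. (v c ^ p) ^ m c) * fls_const x ^ p)"
    by (simp only: power_mult_distrib)
  also have "(\<Prod>c\<in>C. (v c ^ p) ^ m c) = fls_of_poly (\<Prod>c\<in>C. ?L c ^ m c)"
    unfolding pr by (intro prod.cong) (simp_all add: v L fls_of_poly_hom)
  also have "fls_of_poly Q ^ p * (fls_of_poly (\<Prod>c\<in>C. ?L c ^ m c) * fls_const x ^ p)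
    = fls_of_poly (Q ^ p * ((\<Prod>c\<in>C. ?L c ^ m c) * [:x:] ^ p))" by (simp only: fls_of_poly_hom)
  finally have e: "P ^ p = Q ^ p * ((\<Prod>c\<in>C. ?L c ^ m c) * [:x:] ^ p)" by (simp add: fls_of_poly_hom(7)[symmetric] fls_of_poly_inj)
  let ?r = "- inverse c0"
  have nz: "(\<Prod>c\<in>C. ?L c ^ m c) \<noteq> 0" using C(1) by simp
  have x0: "[:x:] ^ p \<noteq> 0" using x by simp
  have rt: "poly (?L c) ?r = 0 \<longleftrightarrow> c = c0" for c using C(3) by (auto simp: field_simps)
  have "P ^ p \<noteq> 0" unfolding e using PQ(1) nz x0 by simp
  then have P0: "P \<noteq> 0" using p by auto
  have "poly (\<Prod>c\<in>C - {c0}. ?L c ^ m c) ?r \<noteq> 0" using C(1) rt by (simp add: poly_prod)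
  then have o1: "order ?r (\<Prod>c\<in>C - {c0}. ?L c ^ m c) = 0" by (simp add: order_0I)
  have "?L c0 = Polynomial.smult c0 [:- ?r, 1:]" using C(3) by simp
  then have o2: "order ?r (?L c0) = 1" using order_smult[OF C(3), of ?r "[:- ?r, 1:]"] order_power_n_n[of ?r 1] by simp
  have sp: "(\<Prod>c\<in>C. ?L c ^ m c) = ?L c0 * (\<Prod>c\<in>C - {c0}. ?L c ^ m c)"
    using prod.remove[OF C(1,2), of "\<lambda>c. ?L c ^ m c"] m by simp
  have o3: "order ?r (\<Prod>c\<in>C. ?L c ^ m c) = 1" using nz o1 o2 unfolding sp by (subst order_mult) auto
  have o4: "order ?r ([:x:] ^ p) = 0" using x by (intro order_0I) simp
  have op: "order ?r (q ^ n) = n * order ?r q" if "q \<noteq> 0" for q :: "'a poly" and n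
    using that by (induction n) (simp_all add: order_mult order_0I)
  have "order ?r (P ^ p) = order ?r (Q ^ p) + (1 + 0)"
    unfolding e using PQ(1) nz x0 o3 o4 by (simp add: order_mult)
  then have "p * order ?r P = p * order ?r Q + 1" using op P0 PQ(1) by simp
  then have "p dvd 1" using dvd_add_right_iff[of p "p * order ?r Q" 1] dvd_triv_left[of p "order ?r P"] by simp
  then show False using p by simp
qed

text \<open>At infinity the right side has a simple pole, while \<open>y ^ p - y\<close> has either
  no pole or one of order divisible by \<open>p\<close>. The two cases compare the degrees of
  numerator and denominator.\<close>

lemma artin_schreier_not_rational:
  fixes y :: "'a::field fls"
  assumes p: "p > 1" and s: "s \<noteq> 0" and y: "y ^ p - y = fls_const a + fls_const s * fls_X"
  shows "y \<notin> ratx UNIV UNIV"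
proof
  assume "y \<in> ratx UNIV UNIV"
  then obtain P Q where PQ: "Q \<noteq> 0" "y = fls_of_poly P / fls_of_poly Q" by (auto elim: ratxE)
  let ?L = "[:a, s:]"
  have L: "fls_of_poly ?L = fls_const a + fls_const s * fls_X"
  proof -
    have "?L = [:a:] + [:s:] * [:0, 1:]" by simp
    then show ?thesis by (simp only: fls_of_poly_hom)
  qed
  have pp: "p = Suc (p - 1)" using p by simp
  have qq: "fls_of_poly Q ^ p = fls_of_poly Q * fls_of_poly Q ^ (p - 1)"
    using power_Suc[of "fls_of_poly Q" "p - 1"] pp by simp
  have yQ: "y * fls_of_poly Q = fls_of_poly P" using PQ by simp
  have "(y ^ p - y) * fls_of_poly Q ^ p = (y * fls_of_poly Q) ^ p - (y * fls_of_poly Q) * fls_of_poly Q ^ (p - 1)"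
    by (simp only: left_diff_distrib power_mult_distrib mult.assoc qq[symmetric])
  then have "fls_of_poly (?L * Q ^ p) = fls_of_poly (P ^ p - P * Q ^ (p - 1))"
    unfolding yQ y L[symmetric] by (simp only: fls_of_poly_hom)
  then have e: "?L * Q ^ p = P ^ p - P * Q ^ (p - 1)" by (simp add: fls_of_poly_inj)
  have l: "degree (?L * Q ^ p) = 1 + p * degree Q" using s PQ(1) by (subst degree_mult_eq) (auto simp: degree_power_eq)
  show False
  proof (cases "degree P \<le> degree Q")
    case True
    have "degree (P ^ p) \<le> p * degree Q"
      unfolding mult.commute[of p] by (rule order.trans[OF degree_power_le mult_le_mono1[OF True]])
    moreover have "degree (P * Q ^ (p - 1)) \<le> p * degree Q"
    proof -
      have "degree (P * Q ^ (p - 1)) \<le> degree P + degree Q * (p - 1)"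
        using degree_mult_le[of P "Q ^ (p - 1)"] degree_power_le[of Q "p - 1"] by linarith
      also have "\<dots> \<le> degree Q + degree Q * (p - 1)" using True by simp
      also have "\<dots> = p * degree Q" using p by (cases p) (simp_all add: mult.commute)
      finally show ?thesis .
    qed
    ultimately have "degree (P ^ p - P * Q ^ (p - 1)) \<le> p * degree Q" by (rule degree_diff_le)
    then show False using l e by simp
  next
    case False
    have P0: "P \<noteq> 0" using False by auto
    have "degree (P * Q ^ (p - 1)) = degree P + (p - 1) * degree Q" using P0 PQ(1) by (simp add: degree_mult_eq degree_power_eq)
    also have "\<dots> < degree P + (p - 1) * degree P" using False p by simp
    also have "\<dots> = p * degree P" using p by (cases p) simp_all
    finally have "degree (P * Q ^ (p - 1)) < degree (P ^ p)" using P0 by (simp add: degree_power_eq mult.commute)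
    then have "degree (P ^ p - P * Q ^ (p - 1)) = p * degree P"
      using P0 degree_add_eq_left[of "- (P * Q ^ (p - 1))" "P ^ p"] by (simp add: degree_power_eq mult.commute)
    then have "p * degree P = 1 + p * degree Q" using l e by simp
    then have "p dvd 1" using dvd_add_left_iff[of p "p * degree Q" 1] dvd_triv_left[of p "degree P"] by simp
    then show False using p by simp
  qed
qed

section \<open>Stabilizers and eigenvectors\<close>

context ring_action
begin

lemma sub_action:
  assumes A: "subgroup A G" shows "ring_action (G\<lparr>carrier := A\<rparr>) S act"
proof -
  interpret A: group "G\<lparr>carrier := A\<rparr>" by (rule subgroup_imp_group[OF A])
  have "A \<subseteq> carrier G" using A subgroup.subset by blast
  then show ?thesis
    by unfold_locales (use S fin hom act_in act_mult act_one in \<open>auto simp: subset_iff intro: finite_subset\<close>)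
qed

text \<open>A primitive element of the fixed field of \<open>A\<close> will do: an element fixing
  that field sends \<open>\<eta>\<close> to a root of its \<open>A\<close>-orbit polynomial, so it
  agrees on \<open>\<eta>\<close> with an element of \<open>A\<close>.\<close>

lemma subgroup_stabilizer:
  assumes sf: "subfield_of S" and A: "subgroup A G"
    and faithful: "\<And>g. g \<in> carrier G \<Longrightarrow> (\<And>x. x \<in> S \<Longrightarrow> act g x = x) \<Longrightarrow> g = \<one>"
  obtains \<theta> where "\<theta> \<in> S" "\<theta> \<noteq> 0" "\<And>g. g \<in> carrier G \<Longrightarrow> act g \<theta> = \<theta> \<longleftrightarrow> g \<in> A"
proof -
  interpret A: ring_action "G\<lparr>carrier := A\<rparr>" S act by (rule sub_action[OF A])
  have AG: "A \<subseteq> carrier G" using A subgroup.subset by blast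
  have N: "subfield_of A.fixed" "A.fixed \<subseteq> S" "fixed \<subseteq> A.fixed"
    using A.fixed_subfield[OF sf] AG by (auto simp: A.fixed_def fixed_def)
  obtain \<theta> where \<theta>: "\<theta> \<in> A.fixed" "\<forall>g\<in>carrier G. act g \<theta> = \<theta> \<longrightarrow> (\<forall>x\<in>A.fixed. act g x = x)"
    using primitive_element[OF sf N] by blast
  have fS: "fixed \<subseteq> S" by (auto simp: fixed_def)
  obtain \<eta> where \<eta>: "\<eta> \<in> S" "\<forall>g\<in>carrier G. act g \<eta> = \<eta> \<longrightarrow> (\<forall>x\<in>S. act g x = x)"
    using primitive_element[OF sf sf order_refl fS] by blast
  have key: "g \<in> A" if g: "g \<in> carrier G" and fx: "\<forall>x\<in>A.fixed. act g x = x" for g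
  proof -
    note o = A.orbit_poly[OF \<eta>(1)]
    have oS: "A.orbit_poly \<eta> \<in> polys S" using o(1) polys_mono[OF N(2)] by blast
    have "map_poly (act g) (A.orbit_poly \<eta>) = A.orbit_poly \<eta>"
      using o(1) fx by (intro poly_eqI) (simp add: coeff_hom_poly[OF S hom[OF g]] polys_def)
    then have "poly (A.orbit_poly \<eta>) (act g \<eta>) = 0"
      using poly_hom[OF S hom[OF g] oS \<eta>(1)] o(5) hom_0[OF S hom[OF g]] by simp
    then have "\<exists>h\<in>A. act g \<eta> - act h \<eta> = 0" unfolding o(3) using A.fin by simp
    then obtain h where h: "h \<in> A" "act g \<eta> = act h \<eta>" by auto
    have hG: "h \<in> carrier G" using h AG by auto
    have "act (inv h \<otimes> g) \<eta> = \<eta>" using act_mult[OF inv_closed[OF hG] g \<eta>(1)] act_inv[OF hG \<eta>(1)] h(2) by simp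
    then have "\<forall>x\<in>S. act (inv h \<otimes> g) x = x" using \<eta>(2) hG g by simp
    then have "inv h \<otimes> g = \<one>" using faithful hG g by simp
    then have "g = h" using hG g by (metis inv_closed inv_equality inv_inv)
    then show ?thesis using h by simp
  qed
  show ?thesis
  proof (cases "\<theta> = 0")
    \<comment> \<open>If 0 is primitive then \<open>A\<close> is the whole group and 1 is a
      replacement. The Kummer case relies on a nonzero element, since for \<open>c = 0\<close> its
      equation reads \<open>v ^ p = 1\<close>.\<close>
    case True
    have "g \<in> A" if "g \<in> carrier G" for g using \<theta>(2) that key True hom_0[OF S hom[OF that]] by auto
    then have "act g 1 = 1 \<longleftrightarrow> g \<in> A" if "g \<in> carrier G" for g using that hom_1[OF S hom[OF that]] by simp
    then show ?thesis using subring_1[OF S] by (intro that[of 1]) auto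
  next
    case False
    have "act g \<theta> = \<theta> \<longleftrightarrow> g \<in> A" if g: "g \<in> carrier G" for g
    proof
      show "act g \<theta> = \<theta> \<Longrightarrow> g \<in> A" using \<theta>(2) key[OF g] g by blast
      show "g \<in> A \<Longrightarrow> act g \<theta> = \<theta>" using A.fixedD(2)[OF \<theta>(1), of g] by simp
    qed
    then show ?thesis by (rule that[OF subsetD[OF N(2) \<theta>(1)] False])
  qed
qed

lemma conjugates_inj:
  assumes sf: "subfield_of S"
    and faithful: "\<And>g. g \<in> carrier G \<Longrightarrow> (\<And>x. x \<in> S \<Longrightarrow> act g x = x) \<Longrightarrow> g = \<one>"
  obtains \<eta> where "\<eta> \<in> S" "inj_on (\<lambda>g. act g \<eta>) (carrier G)"
proof -
  have fS: "fixed \<subseteq> S" by (auto simp: fixed_def)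
  obtain \<eta> where \<eta>: "\<eta> \<in> S" "\<forall>g\<in>carrier G. act g \<eta> = \<eta> \<longrightarrow> (\<forall>x\<in>S. act g x = x)"
    using primitive_element[OF sf sf order_refl fS] by blast
  have "inj_on (\<lambda>g. act g \<eta>) (carrier G)" by (rule primitive_inj[OF \<eta>(1)]) (use \<eta>(2) faithful in blast)
  then show ?thesis using that \<eta>(1) by blast
qed

end

lemma power_mod_period:
  assumes "(z :: 'a::field) ^ p = 1" shows "z ^ (n mod p) = z ^ n"
proof -
  have "z ^ n = z ^ (p * (n div p) + n mod p)" by simp
  then show ?thesis unfolding power_add power_mult assms by simp
qed

text \<open>A Lagrange resolvent, formed with a power of \<open>\<eta>\<close> for which it is
  nonzero; such a power exists because the conjugates of \<open>\<eta>\<close> are distinct.\<close>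

lemma (in ring_action) multiplicative_eigenvector:
  assumes sf: "subfield_of S"
    and faithful: "\<And>g. g \<in> carrier G \<Longrightarrow> (\<And>x. x \<in> S \<Longrightarrow> act g x = x) \<Longrightarrow> g = \<one>"
    and z: "z \<in> S" "z ^ p = 1" "p > 0" "\<And>g. g \<in> carrier G \<Longrightarrow> act g z = z"
    and \<chi>: "\<And>g h. g \<in> carrier G \<Longrightarrow> h \<in> carrier G \<Longrightarrow> \<chi> (g \<otimes> h) mod p = (\<chi> g + \<chi> h) mod p"
  obtains x where "x \<in> S" "x \<noteq> 0" "\<And>g. g \<in> carrier G \<Longrightarrow> act g x = z ^ \<chi> g * x"
proof -
  have z0: "z \<noteq> 0" using z(2,3) by (auto simp: power_0_left)
  have zm: "z ^ \<chi> (g \<otimes> h) = z ^ \<chi> g * z ^ \<chi> h" if "g \<in> carrier G" "h \<in> carrier G" for g h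
    using power_mod_period[OF z(2), of "\<chi> (g \<otimes> h)"] power_mod_period[OF z(2), of "\<chi> g + \<chi> h"] \<chi>[OF that]
    by (simp add: power_add)
  obtain \<eta> where \<eta>: "\<eta> \<in> S" "inj_on (\<lambda>g. act g \<eta>) (carrier G)" using conjugates_inj[OF sf faithful] by blast
  let ?c = "\<lambda>g. inverse (z ^ \<chi> g)"
  obtain j where j: "(\<Sum>g\<in>carrier G. ?c g * act g \<eta> ^ j) \<noteq> 0"
    using power_sums_nonzero[OF fin one_closed \<eta>(2), of ?c] z0 by auto
  define x where "x = (\<Sum>g\<in>carrier G. ?c g * act g \<eta> ^ j)"
  have cS: "?c g \<in> S" for g by (intro subfield_inverse[OF sf] subring_power[OF S] z)
  have t: "?c g * act g \<eta> ^ j \<in> S" if "g \<in> carrier G" for g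
    by (intro subring_mult[OF S cS] subring_power[OF S] act_in that \<eta>)
  have "act g x = z ^ \<chi> g * x" if g: "g \<in> carrier G" for g
  proof -
    have "act g x = (\<Sum>h\<in>carrier G. act g (?c h * act h \<eta> ^ j))"
      unfolding x_def by (rule hom_sum[OF S hom[OF g] t])
    also have "\<dots> = (\<Sum>h\<in>carrier G. z ^ \<chi> g * (?c (g \<otimes> h) * act (g \<otimes> h) \<eta> ^ j))"
    proof (rule sum.cong[OF refl])
      fix h assume h: "h \<in> carrier G"
      have a: "act h \<eta> \<in> S" by (rule act_in[OF h \<eta>(1)])
      have zp: "z ^ n \<in> S" for n by (rule subring_power[OF S z(1)])
      have "act g (?c h) = ?c h"
        using hom_inverse[OF S hom[OF g] zp cS] hom_power[OF S hom[OF g] z(1)] z(4)[OF g] by simp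
      then have "act g (?c h * act h \<eta> ^ j) = ?c h * act (g \<otimes> h) \<eta> ^ j"
        using hom_mult[OF S hom[OF g] cS subring_power[OF S a]] hom_power[OF S hom[OF g] a] act_mult[OF g h \<eta>(1)] by simp
      then show "act g (?c h * act h \<eta> ^ j) = z ^ \<chi> g * (?c (g \<otimes> h) * act (g \<otimes> h) \<eta> ^ j)"
        using z0 by (simp add: zm[OF g h] inverse_mult_distrib)
    qed
    also have "\<dots> = z ^ \<chi> g * (\<Sum>h\<in>carrier G. ?c (g \<otimes> h) * act (g \<otimes> h) \<eta> ^ j)" by (simp add: sum_distrib_left)
    also have "(\<Sum>h\<in>carrier G. ?c (g \<otimes> h) * act (g \<otimes> h) \<eta> ^ j) = x"
      unfolding x_def by (rule sum.reindex_bij_betw[OF bij_translate[OF g]])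
    finally show ?thesis .
  qed
  moreover have "x \<in> S" unfolding x_def by (rule subring_sum[OF S t])
  ultimately show ?thesis using that[of x] j by (simp add: x_def)
qed

text \<open>Additive Hilbert 90: for \<open>t\<close> of trace 1, take the sum of the conjugates
  \<open>act g t\<close> weighted by \<open>- of_nat (\<chi> g)\<close>.\<close>

lemma (in ring_action) additive_eigenvector:
  assumes sf: "subfield_of S"
    and faithful: "\<And>g. g \<in> carrier G \<Longrightarrow> (\<And>x. x \<in> S \<Longrightarrow> act g x = x) \<Longrightarrow> g = \<one>"
    and p: "(of_nat p :: 'b) = 0"
    and \<chi>: "\<And>g h. g \<in> carrier G \<Longrightarrow> h \<in> carrier G \<Longrightarrow> \<chi> (g \<otimes> h) mod p = (\<chi> g + \<chi> h) mod p"
  obtains x where "x \<in> S" "\<And>g. g \<in> carrier G \<Longrightarrow> act g x = x + of_nat (\<chi> g)"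
proof -
  have m: "(of_nat (n mod p) :: 'b) = of_nat n" for n
  proof -
    have "(of_nat n :: 'b) = of_nat (p * (n div p) + n mod p)" by simp
    then show ?thesis unfolding of_nat_add of_nat_mult p by simp
  qed
  have zm: "(of_nat (\<chi> (g \<otimes> h)) :: 'b) = of_nat (\<chi> g) + of_nat (\<chi> h)" if "g \<in> carrier G" "h \<in> carrier G" for g h
    using m[of "\<chi> (g \<otimes> h)"] m[of "\<chi> g + \<chi> h"] \<chi>[OF that] by simp
  obtain \<eta> where \<eta>: "\<eta> \<in> S" "inj_on (\<lambda>g. act g \<eta>) (carrier G)" using conjugates_inj[OF sf faithful] by blast
  obtain t where t: "t \<in> S" "(\<Sum>g\<in>carrier G. act g t) = 1" using trace_one[OF sf \<eta>] by blast
  let ?c = "\<lambda>g. of_nat (\<chi> g) :: 'b"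
  define x where "x = - (\<Sum>g\<in>carrier G. ?c g * act g t)"
  have s: "?c h * act g t \<in> S" if "g \<in> carrier G" for g h
    by (intro subring_mult[OF S] subring_of_nat[OF S] act_in that t)
  have sS: "(\<Sum>g\<in>carrier G. ?c g * act g t) \<in> S" by (rule subring_sum[OF S s])
  have "act g x = x + ?c g" if g: "g \<in> carrier G" for g
  proof -
    have "act g (\<Sum>h\<in>carrier G. ?c h * act h t) = (\<Sum>h\<in>carrier G. act g (?c h * act h t))"
      by (rule hom_sum[OF S hom[OF g] s])
    also have "\<dots> = (\<Sum>h\<in>carrier G. ?c (g \<otimes> h) * act (g \<otimes> h) t - ?c g * act (g \<otimes> h) t)"
    proof (rule sum.cong[OF refl])
      fix h assume h: "h \<in> carrier G"
      show "act g (?c h * act h t) = ?c (g \<otimes> h) * act (g \<otimes> h) t - ?c g * act (g \<otimes> h) t"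
        using hom_mult[OF S hom[OF g] subring_of_nat[OF S] act_in[OF h t(1)]] hom_of_nat[OF S hom[OF g]] act_mult[OF g h t(1)]
        by (simp add: zm[OF g h] algebra_simps)
    qed
    also have "\<dots> = (\<Sum>h\<in>carrier G. ?c (g \<otimes> h) * act (g \<otimes> h) t) - ?c g * (\<Sum>h\<in>carrier G. act (g \<otimes> h) t)"
      by (simp add: sum_subtractf sum_distrib_left)
    also have "(\<Sum>h\<in>carrier G. ?c (g \<otimes> h) * act (g \<otimes> h) t) = (\<Sum>h\<in>carrier G. ?c h * act h t)"
      by (rule sum.reindex_bij_betw[OF bij_translate[OF g]])
    also have "(\<Sum>h\<in>carrier G. act (g \<otimes> h) t) = (\<Sum>h\<in>carrier G. act h t)"
      by (rule sum.reindex_bij_betw[OF bij_translate[OF g]])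
    finally show ?thesis unfolding x_def hom_uminus[OF S hom[OF g] sS] using t(2) by simp
  qed
  moreover have "x \<in> S" unfolding x_def by (rule subring_uminus[OF S sS])
  ultimately show ?thesis using that by blast
qed

lemma nodal_unique:
  assumes pt: "inj_on pt {..<p}" "p > 0" and q: "monic q" "degree q = p" "\<And>i. i < p \<Longrightarrow> poly q (pt i) = 0"
  shows "nodal p pt = q"
proof -
  have "degree (nodal p pt - q) < p"
  proof (rule degree_lessI)
    show "nodal p pt - q \<noteq> 0 \<or> p > 0" using pt by simp
    show "\<forall>k\<ge>p. poly.coeff (nodal p pt - q) k = 0"
    proof (intro allI impI)
      fix k assume "p \<le> k"
      then consider "k = p" | "p < k" by linarith
      then show "poly.coeff (nodal p pt - q) k = 0"
        using q nodal_monic[of p pt] nodal_degree[of p pt] by cases (auto simp: coeff_eq_0)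
    qed
  qed
  then have "nodal p pt - q = 0"
    using pt(2) q(3) nodal_root[of _ p pt] by (intro poly_eq_if_agree[OF pt(1)]) auto
  then show ?thesis by simp
qed

text \<open>The shift permutes the nodes, so the composite has the same zeros; the condition on the
  leading coefficient of \<open>s\<close> keeps it monic.\<close>

lemma nodal_shift:
  fixes pt :: "nat \<Rightarrow> 'a::field"
  assumes pt: "inj_on pt {..<p}" "p > 0" and s: "degree s = 1" "lead_coeff s ^ p = 1" "\<And>i. i < p \<Longrightarrow> poly s (pt i) = pt (Suc i mod p)"
  shows "pcompose (nodal p pt) s = nodal p pt"
proof (rule nodal_unique[OF pt, symmetric])
  show "monic (pcompose (nodal p pt) s)" using s nodal_monic[of p pt] nodal_degree[of p pt] by (subst lead_coeff_comp) auto
  show "degree (pcompose (nodal p pt) s) = p" using s by (simp add: nodal_degree)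
  show "poly (pcompose (nodal p pt) s) (pt i) = 0" if "i < p" for i
    using s(3)[OF that] nodal_root[of "Suc i mod p" p pt] pt(2) by (simp add: poly_pcompose)
qed

section \<open>The Galois group over the field with the root of unity\<close>

locale galois_step = galois_root k F p \<zeta> for k F :: "'a::field set" and p \<zeta> +
  fixes A and T :: 'a
  assumes A: "A \<lhd> Gal" "A \<noteq> {\<one>\<^bsub>Gal\<^esub>}" "\<And>a b. a \<in> A \<Longrightarrow> b \<in> A \<Longrightarrow> a \<otimes>\<^bsub>Gal\<^esub> b = b \<otimes>\<^bsub>Gal\<^esub> a"
      "\<And>a. a \<in> A \<Longrightarrow> a [^]\<^bsub>Gal\<^esub> p = \<one>\<^bsub>Gal\<^esub>"
    and T: "\<not> alg_over k T"
begin

sublocale GM: ring_action GM M "\<lambda>\<sigma>. \<sigma>"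
  by (rule M_action)

sublocale Ga: ring_action Gal F "\<lambda>\<sigma>. \<sigma>"
  by (rule Gal_action)

lemma GM_eqI:
  assumes "\<sigma> \<in> carrier GM" "\<tau> \<in> carrier GM" "\<And>x. x \<in> F \<Longrightarrow> \<sigma> x = \<tau> x" "\<sigma> \<zeta> = \<tau> \<zeta>" shows "\<sigma> = \<tau>"
proof -
  have "\<sigma> x = \<tau> x" if "x \<in> M" for x
    using hom_M_determined[OF GM_hom(1)[OF assms(1)] GM_hom(1)[OF assms(2)] assms(3,4) that] .
  moreover have "\<sigma> \<in> extensional M" "\<tau> \<in> extensional M" using assms(1,2) unfolding GM_carrier by auto
  ultimately show ?thesis by (intro extensionalityI[of _ M])
qed

lemma Gal_eqI:
  assumes "\<sigma> \<in> carrier Gal" "\<tau> \<in> carrier Gal" "\<And>x. x \<in> F \<Longrightarrow> \<sigma> x = \<tau> x" shows "\<sigma> = \<tau>"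
proof -
  have "\<sigma> \<in> extensional F" "\<tau> \<in> extensional F" using assms(1,2) unfolding galois_group_group(2)[OF F] by auto
  then show ?thesis using assms(3) by (intro extensionalityI[of _ F])
qed

lemma GM_faithful: "g \<in> carrier GM \<Longrightarrow> (\<And>x. x \<in> M \<Longrightarrow> g x = x) \<Longrightarrow> g = \<one>\<^bsub>GM\<^esub>"
  using GM_eqI[of g "\<one>\<^bsub>GM\<^esub>"] GM.act_one M(2,3) by (simp add: subset_iff)

lemma Gal_faithful: "g \<in> carrier Gal \<Longrightarrow> (\<And>x. x \<in> F \<Longrightarrow> g x = x) \<Longrightarrow> g = \<one>\<^bsub>Gal\<^esub>"
  using Gal_eqI[of g "\<one>\<^bsub>Gal\<^esub>"] Ga.act_one by simp

abbreviation res :: "('a \<Rightarrow> 'a) \<Rightarrow> 'a \<Rightarrow> 'a"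
  where "res \<sigma> \<equiv> restrict \<sigma> F"

sublocale res: group_hom GM Gal res
proof (unfold_locales, rule homI)
  show "res \<sigma> \<in> carrier Gal" if "\<sigma> \<in> carrier GM" for \<sigma> by (rule GM_F(1)[OF that])
  fix \<sigma> \<tau> assume s: "\<sigma> \<in> carrier GM" "\<tau> \<in> carrier GM"
  show "res (\<sigma> \<otimes>\<^bsub>GM\<^esub> \<tau>) = res \<sigma> \<otimes>\<^bsub>Gal\<^esub> res \<tau>"
  proof (rule Gal_eqI)
    show "res (\<sigma> \<otimes>\<^bsub>GM\<^esub> \<tau>) \<in> carrier Gal" using s by (intro GM_F(1)) simp
    show "res \<sigma> \<otimes>\<^bsub>Gal\<^esub> res \<tau> \<in> carrier Gal" using GM_F(1) s by simp
    fix x assume x: "x \<in> F"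
    then have "x \<in> M" using M(2) by blast
    then show "res (\<sigma> \<otimes>\<^bsub>GM\<^esub> \<tau>) x = (res \<sigma> \<otimes>\<^bsub>Gal\<^esub> res \<tau>) x"
      using x s GM.act_mult[OF s] Ga.act_mult[OF GM_F(1)[OF s(1)] GM_F(1)[OF s(2)] x] GM_F(2)[OF s(2) x] by simp
  qed
qed

definition At :: "('a \<Rightarrow> 'a) set"
  where "At = {\<sigma> \<in> carrier GM. res \<sigma> \<in> A \<and> \<sigma> \<zeta> = \<zeta>}"

lemma A_subgroup: "subgroup A Gal"
  using A(1) by (rule normal_imp_subgroup)

lemma conj_root: assumes s: "\<sigma> \<in> carrier GM" shows "(\<sigma> \<zeta>) ^ p = 1" "(of_nat p :: 'a) \<noteq> 0 \<Longrightarrow> \<sigma> \<zeta> \<noteq> 1" "\<exists>i<p. \<sigma> \<zeta> = \<zeta> ^ i"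
proof -
  note h = subfield_ring[OF M(1)] GM_hom(1)[OF s]
  show 1: "(\<sigma> \<zeta>) ^ p = 1" using hom_power[OF h M(3), of p] \<zeta>(1) hom_1[OF h] by simp
  show "\<exists>i<p. \<sigma> \<zeta> = \<zeta> ^ i" by (rule roots_of_unity[OF \<zeta>(1,2) 1])
  assume "(of_nat p :: 'a) \<noteq> 0"
  then have "\<zeta> \<noteq> 1" by (rule \<zeta>(2))
  then show "\<sigma> \<zeta> \<noteq> 1" using hom_inj[OF M(1) GM_hom(1)[OF s]] M(3) subring_1[OF h(1)] hom_1[OF h] by (auto simp: inj_on_def)
qed

lemma At_normal: "At \<lhd> GM"
  unfolding GM.normal_inv_iff
proof (intro conjI ballI)
  show "subgroup At GM"
  proof (rule GM.subgroupI)
    show "At \<subseteq> carrier GM" by (auto simp: At_def)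
    have "\<one>\<^bsub>GM\<^esub> \<in> At" using GM.act_one[OF M(3)] subgroup.one_closed[OF A_subgroup] by (simp add: At_def)
    then show "At \<noteq> {}" by blast
    fix a assume a: "a \<in> At"
    then have aG: "a \<in> carrier GM" by (simp add: At_def)
    have "(inv\<^bsub>GM\<^esub> a) \<zeta> = \<zeta>" using GM.act_inv[OF aG M(3)] a by (simp add: At_def)
    then show "inv\<^bsub>GM\<^esub> a \<in> At" using a aG subgroup.m_inv_closed[OF A_subgroup] by (simp add: At_def res.hom_inv)
    fix b assume b: "b \<in> At"
    then show "a \<otimes>\<^bsub>GM\<^esub> b \<in> At"
      using a subgroup.m_closed[OF A_subgroup] GM.act_mult[of a b \<zeta>] M(3) res.hom_mult[of a b] by (simp add: At_def)
  qed
  fix g a assume g: "g \<in> carrier GM" and a: "a \<in> At"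
  then have aG: "a \<in> carrier GM" "res a \<in> A" "a \<zeta> = \<zeta>" by (auto simp: At_def)
  note R = subfield_ring[OF M(1)]
  have ig: "inv\<^bsub>GM\<^esub> g \<in> carrier GM" using g by simp
  \<comment> \<open>The image of \<open>\<zeta>\<close> under the inverse of \<open>g\<close> is a
    power of \<open>\<zeta>\<close>, hence fixed by \<open>a\<close>; so the conjugate of
    \<open>a\<close> fixes \<open>\<zeta>\<close> again.\<close>
  obtain i where i: "(inv\<^bsub>GM\<^esub> g) \<zeta> = \<zeta> ^ i" using conj_root(3)[OF ig] by blast
  have "(g \<otimes>\<^bsub>GM\<^esub> a \<otimes>\<^bsub>GM\<^esub> inv\<^bsub>GM\<^esub> g) \<zeta> = g (a (\<zeta> ^ i))"
    using g aG(1) i M(3) GM.act_mult[OF _ ig M(3), of "g \<otimes>\<^bsub>GM\<^esub> a"] GM.act_mult[OF g aG(1), of "\<zeta> ^ i"] subring_power[OF R M(3)] by simp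
  also have "\<dots> = g ((inv\<^bsub>GM\<^esub> g) \<zeta>)" using hom_power[OF R GM_hom(1)[OF aG(1)] M(3)] aG(3) i by simp
  also have "\<dots> = \<zeta>" using GM.act_inv[OF ig M(3)] g by simp
  finally have 1: "(g \<otimes>\<^bsub>GM\<^esub> a \<otimes>\<^bsub>GM\<^esub> inv\<^bsub>GM\<^esub> g) \<zeta> = \<zeta>" .
  have "res (g \<otimes>\<^bsub>GM\<^esub> a \<otimes>\<^bsub>GM\<^esub> inv\<^bsub>GM\<^esub> g) = res g \<otimes>\<^bsub>Gal\<^esub> res a \<otimes>\<^bsub>Gal\<^esub> inv\<^bsub>Gal\<^esub> (res g)"
    using g aG(1) ig by (simp add: res.hom_mult res.hom_inv)
  then have "res (g \<otimes>\<^bsub>GM\<^esub> a \<otimes>\<^bsub>GM\<^esub> inv\<^bsub>GM\<^esub> g) \<in> A" using normal.inv_op_closed2[OF A(1) GM_F(1)[OF g] aG(2)] by simp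
  then show "g \<otimes>\<^bsub>GM\<^esub> a \<otimes>\<^bsub>GM\<^esub> inv\<^bsub>GM\<^esub> g \<in> At" using 1 g aG(1) ig by (simp add: At_def)
qed

lemma At_subgroup: "subgroup At GM"
  using At_normal by (rule normal_imp_subgroup)

lemma At_GM: "At \<subseteq> carrier GM"
  by (auto simp: At_def)

text \<open>Elements of \<open>At\<close> all fix \<open>\<zeta>\<close>, so only \<open>F\<close>
  can tell them apart. In this way commutativity and exponent pass from \<open>A\<close> to
  \<open>At\<close>.\<close>

lemma At_eqI: "a \<in> At \<Longrightarrow> b \<in> At \<Longrightarrow> res a = res b \<Longrightarrow> a = b"
proof (rule GM_eqI)
  assume ab: "a \<in> At" "b \<in> At" "res a = res b"
  show "a \<in> carrier GM" "b \<in> carrier GM" "a \<zeta> = b \<zeta>" using ab by (auto simp: At_def)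
  show "a x = b x" if "x \<in> F" for x using fun_cong[OF ab(3), of x] that by simp
qed

lemma At_comm: assumes "a \<in> At" "b \<in> At" shows "a \<otimes>\<^bsub>GM\<^esub> b = b \<otimes>\<^bsub>GM\<^esub> a"
proof (rule At_eqI)
  show "a \<otimes>\<^bsub>GM\<^esub> b \<in> At" "b \<otimes>\<^bsub>GM\<^esub> a \<in> At" using assms subgroup.m_closed[OF At_subgroup] by auto
  show "res (a \<otimes>\<^bsub>GM\<^esub> b) = res (b \<otimes>\<^bsub>GM\<^esub> a)" using assms A(3) by (simp add: At_def res.hom_mult)
qed

lemma At_pow: "a \<in> At \<Longrightarrow> a [^]\<^bsub>GM\<^esub> (n::nat) \<in> At"
  by (induction n) (use subgroup.one_closed[OF At_subgroup] subgroup.m_closed[OF At_subgroup] in auto)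

lemma At_exponent: assumes "a \<in> At" shows "a [^]\<^bsub>GM\<^esub> p = \<one>\<^bsub>GM\<^esub>"
proof (rule At_eqI[OF At_pow[OF assms] subgroup.one_closed[OF At_subgroup]])
  show "res (a [^]\<^bsub>GM\<^esub> p) = res \<one>\<^bsub>GM\<^esub>"
    using assms A(4) At_GM by (auto simp: At_def res.hom_nat_pow)
qed

text \<open>An extension \<open>b\<close> of a nontrivial \<open>a\<close> may move
  \<open>\<zeta>\<close>, but its power with exponent \<open>p - 1\<close> does not, by Fermat's
  little theorem, and it restricts to the inverse of \<open>a\<close>.\<close>

lemma At_nontrivial: "At \<noteq> {\<one>\<^bsub>GM\<^esub>}"
proof -
  obtain a where a: "a \<in> A" "a \<noteq> \<one>\<^bsub>Gal\<^esub>" using A(2) subgroup.one_closed[OF A_subgroup] by blast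
  have aG: "a \<in> carrier Gal" using a(1) subgroup.subset[OF A_subgroup] by blast
  obtain b where b: "b \<in> carrier GM" "\<forall>x\<in>F. b x = a x" using extend_Gal_to_M[OF aG] by blast
  have rb: "res b = a" by (rule Gal_eqI[OF GM_F(1)[OF b(1)] aG]) (use b(2) in simp)
  note R = subfield_ring[OF M(1)]
  obtain i where i: "i < p" "b \<zeta> = \<zeta> ^ i" using conj_root(3)[OF b(1)] by blast
  have bn: "(b [^]\<^bsub>GM\<^esub> n) \<zeta> = \<zeta> ^ (i ^ n)" for n :: nat
  proof (induction n)
    case (Suc n)
    have "(b [^]\<^bsub>GM\<^esub> Suc n) \<zeta> = (b [^]\<^bsub>GM\<^esub> n) (\<zeta> ^ i)" using GM.act_mult[OF _ b(1) M(3), of "b [^]\<^bsub>GM\<^esub> n"] b(1) i(2) by simp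
    also have "\<dots> = (\<zeta> ^ (i ^ n)) ^ i" using hom_power[OF R GM_hom(1) M(3), of "b [^]\<^bsub>GM\<^esub> n"] b(1) Suc by simp
    finally show ?case by (simp add: power_mult[symmetric] mult.commute)
  qed (simp add: GM.act_one[OF M(3)])
  have fx: "(b [^]\<^bsub>GM\<^esub> (p - 1)) \<zeta> = \<zeta>"
  proof (cases "\<zeta> = 1")
    case True
    then show ?thesis unfolding bn by simp
  next
    case False
    have "\<not> p dvd i"
    proof
      assume "p dvd i"
      then have "i = 0" using i(1) by (auto dest: dvd_imp_le)
      then show False using conj_root(2)[OF b(1)] i(2) \<zeta>(3) False by auto
    qed
    then have "[i ^ (p - 1) = 1] (mod p)" by (rule fermat_theorem[OF p])
    then have "i ^ (p - 1) mod p = 1" using p_pos by (simp add: cong_def)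
    then show ?thesis unfolding bn using power_mod_period[OF \<zeta>(1), of "i ^ (p - 1)"] by simp
  qed
  have rbn: "res (b [^]\<^bsub>GM\<^esub> (p - 1)) = a [^]\<^bsub>Gal\<^esub> (p - 1)" using res.hom_nat_pow[OF b(1)] rb by simp
  have Apow: "a [^]\<^bsub>Gal\<^esub> n \<in> A" for n :: nat
    by (induction n) (use a(1) subgroup.one_closed[OF A_subgroup] subgroup.m_closed[OF A_subgroup] in auto)
  have "b [^]\<^bsub>GM\<^esub> (p - 1) \<in> At" using fx rbn Apow b(1) by (simp add: At_def)
  moreover have "b [^]\<^bsub>GM\<^esub> (p - 1) \<noteq> \<one>\<^bsub>GM\<^esub>"
  proof
    assume "b [^]\<^bsub>GM\<^esub> (p - 1) = \<one>\<^bsub>GM\<^esub>"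
    then have "a [^]\<^bsub>Gal\<^esub> (p - 1) = \<one>\<^bsub>Gal\<^esub>" using rbn res.hom_one by simp
    moreover have "a [^]\<^bsub>Gal\<^esub> Suc (p - 1) = \<one>\<^bsub>Gal\<^esub>" using A(4)[OF a(1)] p_pos by simp
    ultimately show False using a(2) aG by simp
  qed
  ultimately show ?thesis by blast
qed

lemma At_finite: "finite At"
  using At_GM finite_GM finite_subset by blast

end

locale galois_twist = galois_step k F p \<zeta> A T + tw: orbit_twist GM M "\<lambda>\<sigma>. \<sigma>" k F At a0 \<theta> p pt s u
  for k F :: "'a::field set" and p \<zeta> A T a0 \<theta> pt s u
begin

text \<open>The eigenvectors are found in \<open>M\<close>, not in \<open>F\<close>. Since
  \<open>\<zeta>\<close> is a scalar for the twists and generates \<open>M\<close> over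
  \<open>F\<close>, rationality of \<open>E\<close> carries over to the twists of all constants from
  \<open>M\<close>.\<close>

lemma Tw_rational:
  assumes E: "tw.E \<subseteq> ratx UNIV UNIV" and x: "x \<in> M"
  shows "tw.Tw (fls_const x) \<in> ratx UNIV UNIV"
proof -
  note R = subfield_ring[OF M(1)] and RF = subfield_ring[OF F(1)]
  note RU = ratx_subring[OF subring_of_UNIV subring_of_UNIV subset_UNIV]
  have base: "tw.Tw (fls_const a) \<in> ratx UNIV UNIV" if "a \<in> F" for a
    using E ratx_const[OF subfield_ring[OF k] RF that] unfolding tw.E_def by blast
  have good: "tw.good (fls_const \<zeta>)"
    unfolding tw.good_def
  proof (intro conjI ballI)
    show "fls_const \<zeta> \<in> ser M" using M(3) by (simp add: tw.const_ser)
    fix c assume "c \<in> tw.C"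
    then have "tw.el c \<in> At" by (rule tw.el_A)
    then show "ser_map (tw.el c) (fls_const \<zeta>) = fls_const \<zeta>" using tw.sact_const[of "tw.el c" \<zeta>] by (simp add: At_def)
  qed
  have "poly q \<zeta> \<in> M \<and> tw.Tw (fls_const (poly q \<zeta>)) \<in> ratx UNIV UNIV" if "q \<in> polys F" for q
    using that
  proof (induction q)
    case 0
    then show ?case using base[OF subring_0[OF RF]] subring_0[OF R] by simp
  next
    case (pCons a q)
    then have a: "a \<in> F" "a \<in> M" and q: "q \<in> polys F" using polys_pCons_iff[OF RF] M(2) by auto
    note IH = pCons.IH[OF q]
    have c: "fls_const (poly (pCons a q) \<zeta>) = fls_const a + fls_const \<zeta> * fls_const (poly q \<zeta>)"
      by (simp add: fls_plus_const fls_const_mult_const)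
    have S: "fls_const a \<in> ser M" "fls_const \<zeta> \<in> ser M" "fls_const (poly q \<zeta>) \<in> ser M"
      using a IH M(3) by (simp_all add: tw.const_ser)
    have "tw.Tw (fls_const (poly (pCons a q) \<zeta>)) = tw.Tw (fls_const a) + fls_const \<zeta> * tw.Tw (fls_const (poly q \<zeta>))"
      unfolding c using tw.Tw_add[OF S(1) subring_mult[OF tw.ser.S S(2,3)]] tw.Tw_scale[OF good S(3)] by simp
    moreover have "fls_const \<zeta> \<in> ratx UNIV UNIV" by (rule ratx_const) simp_all
    ultimately have "tw.Tw (fls_const (poly (pCons a q) \<zeta>)) \<in> ratx UNIV UNIV"
      using subring_add[OF RU base[OF a(1)] subring_mult[OF RU]] IH by simp
    moreover have "poly (pCons a q) \<zeta> \<in> M" using subring_add[OF R a(2) subring_mult[OF R M(3)]] IH by simp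
    ultimately show ?case by blast
  qed
  then show ?thesis using x by (auto simp: M_def simple_ext_def)
qed

theorem extension_if_not_rational:
  assumes x: "x \<in> M" "tw.Tw (fls_const x) \<notin> ratx UNIV UNIV"
  shows "\<exists>L. field.galois_extension_of_group \<Omega> (field.adjoin \<Omega> k T) L Gal \<and>
    \<not> L \<subseteq> field.adjoin \<Omega> (field.alg_closure_in \<Omega> k) T \<and>
    field.specialization_equals \<Omega> k T L 0 F"
proof -
  \<comment> \<open>Series in \<open>E\<close> have coefficients in \<open>F\<close>, so the action
    of \<open>GM\<close> on \<open>E\<close> factors through restriction to
    \<open>F\<close>.\<close>
  have res: "ser_map (res \<sigma>) e = ser_map \<sigma> e" if s: "\<sigma> \<in> carrier GM" and e: "e \<in> tw.E" for \<sigma> e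
  proof (rule fls_eqI)
    fix n
    have "e $$ n \<in> F" using e tw.E_ser by (auto simp: ser_def)
    then show "ser_map (res \<sigma>) e $$ n = ser_map \<sigma> e $$ n"
      by (simp add: ser_map_nth'[OF M(1) GM_hom(1)[OF s]] ser_map_nth'[OF F(1) Ga.hom[OF GM_F(1)[OF s]]])
  qed
  interpret se: series_extension Gal F "\<lambda>\<sigma>. \<sigma>" k T tw.E
  proof (unfold_locales)
    show "\<exists>z. poly q z = 0" if "degree q > 0" for q :: "'a poly" by (rule ac[OF that])
    show "subfield_of F" by (rule F(1))
    show "ring_action.fixed Gal F (\<lambda>\<sigma>. \<sigma>) = k" by (rule Gal_fixed)
    show "\<not> alg_over k T" by (rule T)
    show "g = \<one>\<^bsub>Gal\<^esub>" if "g \<in> carrier Gal" "\<And>x. x \<in> F \<Longrightarrow> g x = x" for g by (rule Gal_faithful[OF that])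
    show "subring_of tw.E" "tw.E \<subseteq> ser F" "ratx k k \<subseteq> tw.E" by (rule tw.E_subring tw.E_ser tw.E_base)+
    show "\<not> tw.E \<subseteq> ratx UNIV UNIV" using Tw_rational[OF _ x(1)] x(2) by blast
    show "\<exists>e\<in>tw.E. integral_over (polyx k) e \<and> e $$ 0 = z" if "z \<in> F" for z by (rule tw.E_place[OF tw.v_integral that])
    show "ser_map g e \<in> tw.E" if g: "g \<in> carrier Gal" and e: "e \<in> tw.E" for g e
    proof -
      obtain \<sigma> where s: "\<sigma> \<in> carrier GM" "\<forall>x\<in>F. \<sigma> x = g x" using extend_Gal_to_M[OF g] by blast
      have "res \<sigma> = g" by (rule Gal_eqI[OF GM_F(1)[OF s(1)] g]) (use s(2) in simp)
      then show ?thesis using res[OF s(1) e] tw.E_act[OF s(1) e] by simp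
    qed
    show "e \<in> ratx k k" if e: "e \<in> tw.E" and fx: "\<And>g. g \<in> carrier Gal \<Longrightarrow> ser_map g e = e" for e
    proof (rule tw.E_fixed[OF e])
      show "ser_map \<sigma> e = e" if "\<sigma> \<in> carrier GM" for \<sigma> using res[OF that e] fx[OF GM_F(1)[OF that]] by simp
    qed
  qed
  show ?thesis by (rule se.extension_exists)
qed

end

section \<open>The Kummer case and the Artin--Schreier case\<close>

context galois_step
begin

lemma twist_data:
  obtains a0 \<chi> \<theta> where "a0 \<in> At" "\<chi> a0 = (1 :: nat)"
    "\<And>a b. a \<in> At \<Longrightarrow> b \<in> At \<Longrightarrow> \<chi> (a \<otimes>\<^bsub>GM\<^esub> b) mod p = (\<chi> a + \<chi> b) mod p"
    "\<theta> \<in> M" "\<theta> \<noteq> 0" "\<And>g. g \<in> carrier GM \<Longrightarrow> g \<theta> = \<theta> \<longleftrightarrow> g \<in> At"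
proof -
  obtain a0 and \<chi> :: "('a \<Rightarrow> 'a) \<Rightarrow> nat" where 1: "a0 \<in> At" "\<chi> a0 = 1"
    "\<And>a b. a \<in> At \<Longrightarrow> b \<in> At \<Longrightarrow> \<chi> (a \<otimes>\<^bsub>GM\<^esub> b) mod p = (\<chi> a + \<chi> b) mod p"
    using GM.prime_exponent_character[OF p At_subgroup At_finite At_nontrivial At_comm At_exponent] by metis
  obtain \<theta> where "\<theta> \<in> M" "\<theta> \<noteq> 0" "\<And>g. g \<in> carrier GM \<Longrightarrow> g \<theta> = \<theta> \<longleftrightarrow> g \<in> At"
    using GM.subgroup_stabilizer[OF M(1) At_subgroup GM_faithful] by metis
  with 1 show ?thesis using that by blast
qed

sublocale At: ring_action "GM\<lparr>carrier := At\<rparr>" M "\<lambda>\<sigma>. \<sigma>"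
  by (rule GM.sub_action[OF At_subgroup])

lemma At_faithful: "g \<in> carrier (GM\<lparr>carrier := At\<rparr>) \<Longrightarrow> (\<And>x. x \<in> M \<Longrightarrow> g x = x) \<Longrightarrow> g = \<one>\<^bsub>GM\<lparr>carrier := At\<rparr>\<^esub>"
  using GM_faithful[of g] At_GM by auto

lemma kummer:
  assumes p0: "(of_nat p :: 'a) \<noteq> 0"
  shows "\<exists>L. field.galois_extension_of_group \<Omega> (field.adjoin \<Omega> k T) L Gal \<and>
    \<not> L \<subseteq> field.adjoin \<Omega> (field.alg_closure_in \<Omega> k) T \<and>
    field.specialization_equals \<Omega> k T L 0 F"
proof -
  note R = subfield_ring[OF M(1)] and Rk = subfield_ring[OF k]
  obtain a0 \<chi> \<theta> where a0: "a0 \<in> At" "\<chi> a0 = (1 :: nat)"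
    and \<chi>: "\<And>a b. a \<in> At \<Longrightarrow> b \<in> At \<Longrightarrow> \<chi> (a \<otimes>\<^bsub>GM\<^esub> b) mod p = (\<chi> a + \<chi> b) mod p"
    and \<theta>: "\<theta> \<in> M" "\<theta> \<noteq> 0" "\<And>g. g \<in> carrier GM \<Longrightarrow> g \<theta> = \<theta> \<longleftrightarrow> g \<in> At"
    using twist_data by metis
  have \<zeta>0: "\<zeta> \<noteq> 0" using \<zeta>(1) p_pos by (auto simp: power_0_left)
  let ?pt = "\<lambda>i. \<zeta> ^ i" and ?s = "[:0, \<zeta>:]" and ?f = "Polynomial.monom 1 p - 1 :: 'a poly"
  have inj: "inj_on ?pt {..<p}" by (rule root_pow_inj_gen[OF \<zeta>(1) \<zeta>(2)[OF p0]])
  have sh: "poly ?s (?pt i) = ?pt (Suc i mod p)" for i using power_mod_period[OF \<zeta>(1), of "Suc i"] by simp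
  have df: "degree ?f = p"
    using p_pos degree_add_eq_left[of "- 1 :: 'a poly" "Polynomial.monom 1 p"] by (simp add: degree_monom_eq)
  have nod: "nodal p ?pt = ?f"
  proof (rule nodal_unique[OF inj p_pos(1) _ df])
    show "monic ?f" unfolding df using p_pos by simp
    show "poly ?f (\<zeta> ^ i) = 0" for i
      using \<zeta>(1) power_mult[of \<zeta> i p] power_mult[of \<zeta> p i] by (simp add: poly_monom mult.commute)
  qed
  have At_\<zeta>: "a (\<zeta> ^ i) = \<zeta> ^ i" if "a \<in> At" for a i
    using that hom_power[OF R GM_hom(1) M(3), of a i] by (simp add: At_def)
  have otw: "orbit_twist GM M (\<lambda>\<sigma>. \<sigma>) k F At a0 \<theta> p ?pt ?s (\<lambda>x. x)"
  proof (rule orbit_twist.intro[OF M_action orbit_twist_axioms.intro])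
    show "ring_action.fixed GM M (\<lambda>\<sigma>. \<sigma>) = k" by (rule M_fixed)
    show "g x \<in> F" if "g \<in> carrier GM" "x \<in> F" for g x by (rule GM_F(2)[OF that])
    show "x \<in> F" if "x \<in> M" "\<And>g. g \<in> carrier GM \<Longrightarrow> (\<And>y. y \<in> F \<Longrightarrow> g y = y) \<Longrightarrow> g x = x" for x
      using M_fixed_F[OF that(1)] that(2) by blast
    show "pcompose (nodal p ?pt) ?s = nodal p ?pt"
      by (rule nodal_shift[OF inj p_pos(1)]) (use \<zeta>0 \<zeta>(1) sh in auto)
    show "nodal p ?pt \<in> polys k" unfolding nod by (intro polys_simps[OF Rk] subring_1[OF Rk])
    show "poly (pderiv (nodal p ?pt)) (?pt 0) \<noteq> 0" unfolding nod
      using p0 by (simp add: pderiv_diff pderiv_monom poly_monom)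
    show "?s \<in> polys M" using M(3) by (simp add: polys_pCons_iff[OF R] polys_0[OF R] subring_simps[OF R])
    show "poly ?s (?pt i) = ?pt (Suc i mod p)" for i by (rule sh)
    show "a (?pt i) = ?pt i" if "a \<in> At" "i < p" for a i by (rule At_\<zeta>[OF that(1)])
  qed (use M F a0 \<theta> p_pos At_normal At_comm At_exponent \<zeta>0 inj subring_power[OF R M(3)] subring_1[OF Rk] in auto)
  interpret gt: galois_twist k F p \<zeta> A T a0 \<theta> ?pt ?s "\<lambda>x. x"
    by (rule galois_twist.intro[OF galois_step_axioms otw])
  obtain x where x: "x \<in> M" "x \<noteq> 0" "\<And>g. g \<in> At \<Longrightarrow> g x = \<zeta> ^ \<chi> g * x"
  proof (rule At.multiplicative_eigenvector[OF M(1) At_faithful M(3) \<zeta>(1) p_pos(1), of \<chi>])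
    show "g \<zeta> = \<zeta>" if "g \<in> carrier (GM\<lparr>carrier := At\<rparr>)" for g using that by (simp add: At_def)
  qed (use \<chi> in auto)
  \<comment> \<open>The eigenvalue of \<open>el c\<close> on \<open>x\<close> is a power of
    \<open>\<zeta>\<close>, but the nodes for \<open>c\<close> are the powers of the conjugate
    \<open>?z\<close>; the exponent \<open>r\<close> converts between the two roots of unity.
    Reducing modulo \<open>p\<close> keeps the degree of the interpolating monomial below
    \<open>p\<close>.\<close>
  have "\<exists>m<p. (\<forall>i<p. gt.tw.pts c i ^ m * x = (gt.tw.el c [^]\<^bsub>GM\<^esub> i) x) \<and> (c = \<theta> \<longrightarrow> m = 1)" if c: "c \<in> gt.tw.C" for c
  proof -
    let ?z = "gt.tw.\<tau> c \<zeta>" and ?e = "gt.tw.el c"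
    note t = gt.tw.\<tau>(1)[OF c] and e = gt.tw.el_A[OF c]
    note cz = conj_root[OF t]
    obtain r where r: "r < p" "\<zeta> = ?z ^ r" using roots_of_unity[OF cz(1,2) \<zeta>(1)] by blast
    have pts: "gt.tw.pts c i = ?z ^ i" for i
      unfolding gt.tw.pts_def by (rule hom_power[OF R GM_hom(1)[OF t] M(3)])
    define m where "m = r * \<chi> ?e mod p"
    have zm: "?z ^ m = \<zeta> ^ \<chi> ?e"
      unfolding m_def power_mod_period[OF cz(1)] power_mult r(2)[symmetric] ..
    have ei: "(?e [^]\<^bsub>GM\<^esub> i) x = (\<zeta> ^ \<chi> ?e) ^ i * x" for i :: nat
    proof (induction i)
      case (Suc i)
      have eG: "?e \<in> carrier GM" "?e [^]\<^bsub>GM\<^esub> i \<in> At" "?e [^]\<^bsub>GM\<^esub> i \<in> carrier GM" using e At_GM At_pow by auto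
      have "(?e [^]\<^bsub>GM\<^esub> Suc i) x = (?e [^]\<^bsub>GM\<^esub> i) (\<zeta> ^ \<chi> ?e * x)"
        using GM.act_mult[OF eG(3,1) x(1)] x(3)[OF e] by simp
      also have "\<dots> = \<zeta> ^ \<chi> ?e * (?e [^]\<^bsub>GM\<^esub> i) x"
        using hom_mult[OF R GM_hom(1)[OF eG(3)] subring_power[OF R M(3)] x(1)] At_\<zeta>[OF eG(2)] by simp
      finally show ?case using Suc by simp
    qed (simp add: GM.act_one x(1))
    have "gt.tw.pts c i ^ m * x = (?e [^]\<^bsub>GM\<^esub> i) x" for i
      unfolding pts ei zm[symmetric] by (simp add: power_mult[symmetric] mult.commute)
    \<comment> \<open>For \<open>\<theta>\<close> the two roots of unity coincide, and the character
      takes the value 1 at \<open>a0\<close>.\<close>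
    moreover have "m = 1" if ct: "c = \<theta>"
    proof -
      have "?z = \<zeta>" using gt.tw.pts_\<theta>[of 1] pts[of 1] ct p_pos by simp
      then have "\<zeta> ^ 1 = \<zeta> ^ r" using r(2) by simp
      then have "r = 1" using inj r(1) p_pos by (auto simp: inj_on_def)
      then show ?thesis unfolding m_def ct gt.tw.el_\<theta> a0(2) using p_pos by simp
    qed
    moreover have "m < p" unfolding m_def using p_pos by simp
    ultimately show ?thesis by blast
  qed
  then obtain m where m: "\<And>c. c \<in> gt.tw.C \<Longrightarrow> m c < p"
    "\<And>c i. c \<in> gt.tw.C \<Longrightarrow> i < p \<Longrightarrow> gt.tw.pts c i ^ m c * x = (gt.tw.el c [^]\<^bsub>GM\<^esub> i) x" "m \<theta> = 1"
    using gt.tw.\<theta>_C by metis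
  have tw: "gt.tw.tw c (fls_const x) = gt.tw.v c ^ m c * fls_const x" if c: "c \<in> gt.tw.C" for c
  proof -
    have "gt.tw.tw c (fls_const x) = poly (map_poly fls_const (Polynomial.monom x (m c))) (gt.tw.v c)"
    proof (rule gt.tw.tw_interp[OF c x(1)])
      show "degree (Polynomial.monom x (m c)) < p" using degree_monom_le[of x "m c"] m(1)[OF c] by linarith
      show "poly (Polynomial.monom x (m c)) (gt.tw.pts c i) = (gt.tw.el c [^]\<^bsub>GM\<^esub> i) x" if "i < p" for i
        using m(2)[OF c that] by (simp add: poly_monom mult.commute)
    qed
    then show ?thesis by (simp add: map_poly_monom poly_monom)
  qed
  have vg: "gt.tw.good (gt.tw.v c ^ m c)" if "c \<in> gt.tw.C" for c
    using subring_power[OF gt.tw.good_subring] gt.tw.v_good[OF that] by simp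
  have "gt.tw.Tw (fls_const x) = (\<Prod>c\<in>gt.tw.C. gt.tw.v c ^ m c) * fls_const x"
    by (rule gt.tw.Tw_prod[OF _ vg tw]) (simp add: gt.tw.const_ser x(1))
  also have "\<dots> \<notin> ratx UNIV UNIV"
  proof (rule kummer_not_rational[where m = m and ?c0.0 = \<theta>, OF p_pos(2) gt.tw.C gt.tw.\<theta>_C \<theta>(2) x(2) m(3)])
    fix c
    have mf: "map_poly fls_const ?f = Polynomial.monom 1 p - 1"
      using hom_poly_diff[OF subring_of_UNIV fls_const_hom, of "Polynomial.monom 1 p" 1] hom_poly_1[OF subring_of_UNIV fls_const_hom]
      by (simp add: map_poly_monom)
    show "gt.tw.v c ^ p = 1 + fls_const c * fls_X"
      using gt.tw.v_root[of c] unfolding nod mf by (simp add: poly_monom algebra_simps)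
  qed
  finally show ?thesis by (rule gt.extension_if_not_rational[OF x(1)])
qed

lemma artin_schreier:
  assumes p0: "(of_nat p :: 'a) = 0"
  shows "\<exists>L. field.galois_extension_of_group \<Omega> (field.adjoin \<Omega> k T) L Gal \<and>
    \<not> L \<subseteq> field.adjoin \<Omega> (field.alg_closure_in \<Omega> k) T \<and>
    field.specialization_equals \<Omega> k T L 0 F"
proof -
  note R = subfield_ring[OF M(1)] and Rk = subfield_ring[OF k]
  obtain a0 \<chi> \<theta> where a0: "a0 \<in> At" "\<chi> a0 = (1 :: nat)"
    and \<chi>: "\<And>a b. a \<in> At \<Longrightarrow> b \<in> At \<Longrightarrow> \<chi> (a \<otimes>\<^bsub>GM\<^esub> b) mod p = (\<chi> a + \<chi> b) mod p"
    and \<theta>: "\<theta> \<in> M" "\<theta> \<noteq> 0" "\<And>g. g \<in> carrier GM \<Longrightarrow> g \<theta> = \<theta> \<longleftrightarrow> g \<in> At"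
    using twist_data by metis
  let ?pt = "\<lambda>i. of_nat i :: 'a" and ?s = "[:1, 1:] :: 'a poly" and ?f = "Polynomial.monom 1 p - Polynomial.monom 1 1 :: 'a poly"
  have inj: "inj_on ?pt {..<p}" by (rule of_nat_inj_char[OF p p0])
  have sh: "poly ?s (?pt i) = ?pt (Suc i mod p)" if "i < p" for i
    using that p0 by (cases "Suc i = p") auto
  have df: "degree ?f = p"
    using p_pos degree_add_eq_left[of "- Polynomial.monom 1 1 :: 'a poly" "Polynomial.monom 1 p"] by (simp add: degree_monom_eq)
  have nod: "nodal p ?pt = ?f"
  proof (rule nodal_unique[OF inj p_pos(1) _ df])
    show "monic ?f" unfolding df using p_pos by simp
    show "poly ?f (of_nat i) = 0" for i
      using of_nat_power_char[OF p p0, of i] by (simp add: poly_monom)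
  qed
  have otw: "orbit_twist GM M (\<lambda>\<sigma>. \<sigma>) k F At a0 \<theta> p ?pt ?s (\<lambda>x. x ^ j)" for j
  proof (rule orbit_twist.intro[OF M_action orbit_twist_axioms.intro])
    show "ring_action.fixed GM M (\<lambda>\<sigma>. \<sigma>) = k" by (rule M_fixed)
    show "g x \<in> F" if "g \<in> carrier GM" "x \<in> F" for g x by (rule GM_F(2)[OF that])
    show "x \<in> F" if "x \<in> M" "\<And>g. g \<in> carrier GM \<Longrightarrow> (\<And>y. y \<in> F \<Longrightarrow> g y = y) \<Longrightarrow> g x = x" for x
      using M_fixed_F[OF that(1)] that(2) by blast
    show "pcompose (nodal p ?pt) ?s = nodal p ?pt"
      by (rule nodal_shift[OF inj p_pos(1)]) (use sh in auto)
    show "nodal p ?pt \<in> polys k" unfolding nod by (intro polys_simps[OF Rk] subring_1[OF Rk])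
    show "poly (pderiv (nodal p ?pt)) (?pt 0) \<noteq> 0" unfolding nod
      using p0 p_pos by (simp add: pderiv_diff pderiv_monom poly_monom)
    show "?s \<in> polys M" by (simp add: polys_pCons_iff[OF R] polys_0[OF R] subring_simps[OF R])
    show "poly ?s (?pt i) = ?pt (Suc i mod p)" if "i < p" for i by (rule sh[OF that])
    show "a (?pt i) = ?pt i" if "a \<in> At" "i < p" for a i
      using that hom_of_nat[OF R GM_hom(1), of a i] by (simp add: At_def)
    show "g (x ^ j) = g x ^ j" if "g \<in> carrier GM" "x \<in> M" for g x by (rule hom_power[OF R GM_hom(1)[OF that(1)] that(2)])
    show "x ^ j \<in> M" if "x \<in> M" for x by (rule subring_power[OF R that])
  qed (use M F a0 \<theta> p_pos At_normal At_comm At_exponent inj subring_of_nat[OF R] subring_0[OF Rk] in auto)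
  \<comment> \<open>\<open>C\<close> and \<open>el\<close> do not involve \<open>u\<close>, so they
    are available before \<open>j\<close> is chosen; any exponent serves here.\<close>
  interpret g0: orbit_twist GM M "\<lambda>\<sigma>. \<sigma>" k F At a0 \<theta> p ?pt ?s "\<lambda>x. x ^ 0" by (rule otw)
  have "of_nat (\<chi> (g0.el \<theta>)) \<noteq> (0 :: 'a)" using g0.el_\<theta> a0(2) by simp
  \<comment> \<open>with \<open>u c = c\<close> the sum of the series \<open>v c\<close>, weighted by \<open>\<chi> (el c)\<close>, might be rational\<close>
  then obtain j where j: "(\<Sum>c\<in>g0.C. of_nat (\<chi> (g0.el c)) * c ^ j) \<noteq> 0"
    using power_sums_nonzero[OF g0.C g0.\<theta>_C inj_on_id2, of "\<lambda>c. of_nat (\<chi> (g0.el c))"] by blast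
  interpret gt: galois_twist k F p \<zeta> A T a0 \<theta> ?pt ?s "\<lambda>x. x ^ j"
    by (rule galois_twist.intro[OF galois_step_axioms otw])
  obtain x where x: "x \<in> M" "\<And>g. g \<in> At \<Longrightarrow> g x = x + of_nat (\<chi> g)"
    by (rule At.additive_eigenvector[OF M(1) At_faithful p0, of \<chi>]) (use \<chi> in auto)
  let ?n = "\<lambda>c. of_nat (\<chi> (gt.tw.el c)) :: 'a"
  have tw: "gt.tw.tw c (fls_const x) = fls_const x + fls_const (?n c) * gt.tw.v c" if c: "c \<in> gt.tw.C" for c
  proof -
    let ?e = "gt.tw.el c"
    note e = gt.tw.el_A[OF c]
    have ei: "(?e [^]\<^bsub>GM\<^esub> i) x = x + of_nat i * ?n c" for i :: nat
    proof (induction i)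
      case (Suc i)
      have eG: "?e \<in> carrier GM" "?e [^]\<^bsub>GM\<^esub> i \<in> carrier GM" using e At_GM At_pow by auto
      have "(?e [^]\<^bsub>GM\<^esub> Suc i) x = (?e [^]\<^bsub>GM\<^esub> i) (x + ?n c)"
        using GM.act_mult[OF eG(2,1) x(1)] x(2)[OF e] by simp
      also have "\<dots> = (?e [^]\<^bsub>GM\<^esub> i) x + ?n c"
        using hom_add[OF R GM_hom(1)[OF eG(2)] x(1) subring_of_nat[OF R]] hom_of_nat[OF R GM_hom(1)[OF eG(2)]] by simp
      finally show ?case using Suc by (simp add: algebra_simps)
    qed (simp add: GM.act_one x(1))
    have pts: "gt.tw.pts c i = of_nat i" for i
      unfolding gt.tw.pts_def by (rule hom_of_nat[OF R GM_hom(1)[OF gt.tw.\<tau>(1)[OF c]]])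
    have "gt.tw.tw c (fls_const x) = poly (map_poly fls_const [:x, ?n c:]) (gt.tw.v c)"
    proof (rule gt.tw.tw_interp[OF c x(1)])
      show "degree [:x, ?n c:] < p" using p_pos by (auto intro: le_less_trans[OF degree_pCons_le])
      show "poly [:x, ?n c:] (gt.tw.pts c i) = (?e [^]\<^bsub>GM\<^esub> i) x" for i by (simp add: pts ei)
    qed
    then show ?thesis by (simp add: hom_poly_pCons[OF subring_of_UNIV fls_const_hom] mult.commute)
  qed
  have cg: "gt.tw.good (fls_const (?n c))" if "c \<in> gt.tw.C" for c
    unfolding gt.tw.good_def
  proof (intro conjI ballI)
    show "fls_const (?n c) \<in> ser M" using subring_of_nat[OF R] by (simp add: gt.tw.const_ser)
    fix d assume "d \<in> gt.tw.C"
    then have "gt.tw.el d \<in> carrier GM" using gt.tw.el_A At_GM by blast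
    then show "ser_map (gt.tw.el d) (fls_const (?n c)) = fls_const (?n c)"
      using gt.tw.sact_const[of "gt.tw.el d" "?n c"] hom_of_nat[OF R GM_hom(1), of "gt.tw.el d"] by simp
  qed
  have vg: "gt.tw.good (fls_const (?n c) * gt.tw.v c)" if "c \<in> gt.tw.C" for c
    using subring_mult[OF gt.tw.good_subring] gt.tw.v_good[OF that] cg[OF that] by simp
  define y where "y = gt.tw.Tw (fls_const x)"
  have y: "y = fls_const x + (\<Sum>c\<in>gt.tw.C. fls_const (?n c) * gt.tw.v c)"
    unfolding y_def by (rule gt.tw.Tw_sum[OF _ vg tw]) (simp add: gt.tw.const_ser x(1))
  have fp: "(of_nat p :: 'a fls) = 0"
    unfolding hom_of_nat[OF subring_of_UNIV fls_const_hom, of p, symmetric] p0 by simp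
  have fpow: "fls_const z ^ p = fls_const (z ^ p)" for z :: 'a
    using hom_power[OF subring_of_UNIV fls_const_hom, of z p] by simp
  have mf: "map_poly fls_const ?f = Polynomial.monom 1 p - Polynomial.monom 1 1"
    using hom_poly_diff[OF subring_of_UNIV fls_const_hom, of "Polynomial.monom 1 p" "Polynomial.monom 1 1"]
    by (simp add: map_poly_monom)
  have vp: "gt.tw.v c ^ p - gt.tw.v c = fls_const (c ^ j) * fls_X" for c
    using gt.tw.v_root[of c] unfolding nod mf by (simp add: poly_monom)
  \<comment> \<open>Frobenius is additive, and the weights lie in the prime field and are fixed by
    it, so \<open>y ^ p - y\<close> is linear in $X$.\<close>
  have "y ^ p = fls_const x ^ p + (\<Sum>c\<in>gt.tw.C. (fls_const (?n c) * gt.tw.v c) ^ p)"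
    unfolding y frobenius_add[OF p fp] frobenius_sum[OF p fp] ..
  also have "\<dots> = fls_const (x ^ p) + (\<Sum>c\<in>gt.tw.C. fls_const (?n c) * gt.tw.v c ^ p)"
    by (simp add: power_mult_distrib fpow of_nat_power_char[OF p p0])
  finally have "y ^ p - y = fls_const (x ^ p) - fls_const x + (\<Sum>c\<in>gt.tw.C. fls_const (?n c) * (gt.tw.v c ^ p - gt.tw.v c))"
    by (simp add: y right_diff_distrib sum_subtractf)
  also have "(\<Sum>c\<in>gt.tw.C. fls_const (?n c) * (gt.tw.v c ^ p - gt.tw.v c)) = fls_const (\<Sum>c\<in>gt.tw.C. ?n c * c ^ j) * fls_X"
    unfolding vp hom_sum[OF subring_of_UNIV fls_const_hom UNIV_I] sum_distrib_right
    by (simp add: fls_const_mult_const mult.assoc[symmetric])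
  finally have "y ^ p - y = fls_const (x ^ p - x) + fls_const (\<Sum>c\<in>gt.tw.C. ?n c * c ^ j) * fls_X"
    by (simp add: fls_const_diff)
  then have "y \<notin> ratx UNIV UNIV" by (rule artin_schreier_not_rational[OF p_pos(2) j])
  then show ?thesis unfolding y_def by (rule gt.extension_if_not_rational[OF x(1)])
qed

end

text \<open>A root of \<open>1 + X + ... + X^(p-1)\<close> works; at 1 this polynomial has the
  nonzero value \<open>of_nat p\<close>.\<close>

lemma (in galois_data) root_of_unity_exists:
  assumes p: "Factorial_Ring.prime p" "(of_nat p :: 'a) \<noteq> 0" obtains z :: 'a where "z ^ p = 1" "z \<noteq> 1"
proof -
  have p1: "p > 1" by (rule prime_gt_1_nat[OF p(1)])
  let ?q = "\<Sum>i<p. Polynomial.monom 1 i :: 'a poly"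
  have "poly.coeff ?q (p - 1) = (\<Sum>i<p. if i = p - 1 then 1 else 0)" by (simp add: coeff_sum)
  then have "poly.coeff ?q (p - 1) \<noteq> 0" using p1 by simp
  then have "degree ?q \<ge> p - 1" by (rule le_degree)
  then have "degree ?q > 0" using p1 by linarith
  then obtain z where z: "poly ?q z = 0" using ac by blast
  then have s: "(\<Sum>i<p. z ^ i) = 0" by (simp add: poly_sum poly_monom)
  have "z ^ p - 1 = (z - 1) * (\<Sum>i<p. z ^ i)" by (rule power_diff_1_eq)
  then have "z ^ p = 1" using s by simp
  moreover have "z \<noteq> 1" using s p(2) by auto
  ultimately show ?thesis using that by blast
qed

theorem theorem1p3:
  fixes G :: "('g, 'm) monoid_scheme"
    and k F :: "'a::field set" and T :: 'a
  assumes "group G" and "finite (carrier G)" and "solvable G" and "carrier G \<noteq> {\<one>\<^bsub>G\<^esub>}"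
    and "subfield k \<Omega>"
    and "(ring.transcendental \<Omega> over k) T"
    and "algebraic_closure \<Omega> (field.adjoin \<Omega> k T)"
    and "field.galois_extension_of_group \<Omega> k F G"
  shows "\<exists>t0\<in>k. \<exists>E.
           field.galois_extension_of_group \<Omega> (field.adjoin \<Omega> k T) E G \<and>
           \<not> E \<subseteq> field.adjoin \<Omega> (field.alg_closure_in \<Omega> k) T \<and>
           field.specialization_equals \<Omega> k T E t0 F"
proof -
  have k: "subfield_of k" using assms(5) Om_subfield_iff by blast
  have T: "\<not> alg_over k T" using assms(6) Om_transcendental_iff[OF subfield_ring[OF k]] by blast
  have gal: "field.finite_galois_extension \<Omega> k F" "field.galois_group \<Omega> k F \<cong> G"
    using assms(8) unfolding field.galois_extension_of_group_def[OF Om_field] by auto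
  interpret ac: algebraic_closure \<Omega> "field.adjoin \<Omega> k T" by (rule assms(7))
  interpret galois_data k F
  proof
    show "ring.splitted \<Omega> q" if "q \<in> carrier (poly_ring (\<Omega> :: 'a ring))" for q
      by (rule ac.roots_over_carrier[OF that])
  qed (use gal(1) k Om_subfield_iff in \<open>auto simp: field.finite_galois_extension_def[OF Om_field]\<close>)
  have grp: "group Gal" by (rule galois_group_group(1)[OF F])
  obtain h where h: "h \<in> iso G Gal" using group.iso_sym[OF grp gal(2)] by (auto simp: is_iso_def)
  then have bij: "bij_betw h (carrier G) (carrier Gal)" by (simp add: Group.iso_def)
  interpret h: group_hom G Gal h
    using h assms(1) grp by (simp add: group_hom_def group_hom_axioms_def Group.iso_def)
  have fin: "finite (carrier Gal)" using bij assms(2) bij_betw_finite by blast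
  have sol: "solvable Gal" using h.surj_hom_imp_solvable assms(3) bij by (simp add: bij_betw_def)
  have nt: "carrier Gal \<noteq> {\<one>\<^bsub>Gal\<^esub>}"
  proof
    assume "carrier Gal = {\<one>\<^bsub>Gal\<^esub>}"
    then have "h x = h \<one>\<^bsub>G\<^esub>" if "x \<in> carrier G" for x using bij that by (auto simp: bij_betw_def)
    then have "carrier G = {\<one>\<^bsub>G\<^esub>}" using bij by (auto simp: bij_betw_def inj_on_def)
    then show False using assms(4) by simp
  qed
  obtain A and p :: nat where A: "Factorial_Ring.prime p" "A \<lhd> Gal" "A \<noteq> {\<one>\<^bsub>Gal\<^esub>}"
    "\<And>a b. a \<in> A \<Longrightarrow> b \<in> A \<Longrightarrow> a \<otimes>\<^bsub>Gal\<^esub> b = b \<otimes>\<^bsub>Gal\<^esub> a" "\<And>a. a \<in> A \<Longrightarrow> a [^]\<^bsub>Gal\<^esub> p = \<one>\<^bsub>Gal\<^esub>"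
    by (rule group.elementary_abelian_normal_subgroup[OF grp sol fin nt]) (rule that, assumption+)
  obtain \<zeta> :: 'a where \<zeta>: "\<zeta> ^ p = 1" "(of_nat p :: 'a) \<noteq> 0 \<Longrightarrow> \<zeta> \<noteq> 1" "(of_nat p :: 'a) = 0 \<Longrightarrow> \<zeta> = 1"
  proof (cases "(of_nat p :: 'a) = 0")
    case True
    then show ?thesis using that[of 1] by simp
  next
    case False
    obtain z :: 'a where "z ^ p = 1" "z \<noteq> 1" using root_of_unity_exists[OF A(1) False] .
    then show ?thesis using that[of z] False by simp
  qed
  interpret galois_step k F p \<zeta> A T
    by (rule galois_step.intro[OF galois_root.intro[OF galois_data_axioms galois_root_axioms.intro[OF A(1) \<zeta> fin]]
        galois_step_axioms.intro[OF A(2-5) T]])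
  obtain L where L: "field.galois_extension_of_group \<Omega> (field.adjoin \<Omega> k T) L Gal"
    "\<not> L \<subseteq> field.adjoin \<Omega> (field.alg_closure_in \<Omega> k) T" "field.specialization_equals \<Omega> k T L 0 F"
    using kummer artin_schreier by blast
  have "field.galois_extension_of_group \<Omega> (field.adjoin \<Omega> k T) L G"
    using L(1) iso_trans[OF _ gal(2)] unfolding field.galois_extension_of_group_def[OF Om_field] by blast
  then show ?thesis using L(2,3) subring_0[OF subfield_ring[OF k]] by blast
qed

end
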